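(* Let $K$ be a field, $S=K[x_1,\dots,x_n]$, $d\ge2$, let $\mathbf t=(1,\dots,1,0,\dots,0)\in\mathbb Z_{\ge0}^{d-1}$, and let $I\subset S$ be a (proper) $\mathbf t$-spread strongly stable ideal. For $i\ge 1$, let $F_i=S\otimes_K H_i(\mathbf x;S/I)$ with its $S$-basis of elements $f(u;\sigma)$ ($u\in G(I)$, $\sigma\subseteq[\max(u)-1]\setminus\operatorname{supp}_{\mathbf t}(u)$, $|\sigma|=i-1$), let $F_0=S$, and let $d_0:F_0=S\to S/I$ be the canonical map. For $i\ge1$ and a basis element $f(u;\sigma)$ of $F_i$ define elements $g_j\in F_j\otimes_S K_{i-j}$, $j=0,\dots,i-1$, by $$g_0=(-1)^{\frac{(i-1)(i-2)}{2}}\,1\otimes\big(u'\,e_\sigma\wedge e_{\max(u)}\big),$$ and, for $j=1,\dots,i-1$, $$g_j=(-1)^{i-j}\sum_{\substack{\tau\subseteq\sigma\\|\tau|=j-1}}(-1)^{\gamma(\tau)}f(u;\tau)\otimes e_{\sigma\setminus\tau}+\sum_{\substack{\tau\subseteq\sigma\\|\tau|=j}}(-1)^{\gamma(\tau)}s_\tau\otimes e_{\sigma\setminus\tau}\wedge e_{\max(u)},$$ where $$s_\tau=\sum_{k\in\tau}(-1)^{\alpha(\tau;k)}\frac{v_k}{x_{\max(u)}}f(u_k;\tau\setminus\{k\}).$$ Define $d_i:F_i\to F_{i-1}$ by $d_i(f(u;\sigma))=\partial_1(g_{i-1})$, where $\partial_1$ denotes $\mathrm{id}_{F_{i-1}}\otimes\partial_1:F_{i-1}\otimes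 K_1\to F_{i-1}\otimes K_0=F_{i-1}$. Then, for every $i\ge 1$ and every basis element $f(u;\sigma)$ of $F_i$: (1) the elements $g_0,\dots,g_{i-1}$ satisfy $$(d_0\otimes\mathrm{id}_{K_i})(g_0)=(-1)^{\frac{(i-1)(i-2)}{2}}\,z(u;\sigma)\in (S/I)\otimes_S K_i=K_i(\mathbf x;S/I),$$ $$(d_{j+1}\otimes\mathrm{id}_{K_{i-j-1}})(g_{j+1})=(\mathrm{id}_{F_j}\otimes\partial_{i-j})(g_j)\quad\text{for } j=0,\dots,i-2;$$ (2) the maps $d_i$ are the differentials of the minimal free resolution $\cdots\to F_2\xrightarrow{d_2}F_1\xrightarrow{d_1}F_0\xrightarrow{d_0}S/I\to0$ of $S/I$, and, for $i\ge2$, $$d_i(f(u;\sigma))=\sum_{k\in\sigma}(-1)^{\alpha(\sigma;k)}\big(-x_k\,f(u;\sigma\setminus\{k\})+v_k\,f(u_k;\sigma\setminus\{k\})\big)$$ (for $i=1$, $d_1(f(u;\emptyset))=\partial_1(g_0)=u$).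
   Context: A monomial $u=x_{j_1}\cdots x_{j_\ell}\in S$ with $j_1\le\dots\le j_\ell$ and $\ell\le d$ is $\mathbf t$-spread if $j_{r+1}-j_r\ge t_r$ for all $r=1,\dots,\ell-1$. $G(I)$ denotes the minimal monomial generating set of a monomial ideal $I$. $I$ is a $\mathbf t$-spread monomial ideal if all $u\in G(I)$ are $\mathbf t$-spread; it is $\mathbf t$-spread strongly stable if moreover, for every $\mathbf t$-spread monomial $u\in I$ and all $j<i$ with $x_i\mid u$ and $x_j(u/x_i)$ $\mathbf t$-spread, one has $x_j(u/x_i)\in I$. The vector $\mathbf t=(1,\dots,1,0,\dots,0)$ is a block of $1$'s followed by a block of $0$'s (either block may be empty). For a monomial $u\ne1$: $\max(u)=\max\{i:x_i\mid u\}$ and $u'=u/x_{\max(u)}$. $[m]=\{1,\dots,m\}$. For a $\mathbf t$-spread $u=x_{j_1}\cdots x_{j_\ell}$, $j_1\le\dots\le j_\ell$, $\operatorname{supp}_{\mathbf t}(u)=\bigcup_{r=1}^{\ell-1}\{c\in\mathbb Z: j_r\le c\le j_r+t_r-1\}$. $\mathbf x=x_1,\dots,x_n$; $K_\bullet=K_\bullet(\mathbf x;S)$ is the Koszul complex with basis $e_\tau=e_{k_1}\wedge\dots\wedge e_{k_i}$ ($\tau=\{k_1<\dots<k_i\}\subseteq[n]$, $e_\emptyset$ neutral for $\wedge$) and $\partial_i(e_\tau)=\sum_{\ell=1}^i(-1)^{\ell+1}x_{k_\ell}e_{\tau\setminus\{k_\ell\}}$; $K_\bullet(\mathbf x;S/I)=K_\bullet\otimes_S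 S/I$ with homology $H_i(\mathbf x;S/I)$; $\varepsilon:S\to S/I$ is the canonical map. For this $\mathbf t$, for $u\in G(I)$ and $\sigma\subseteq[\max(u)-1]\setminus\operatorname{supp}_{\mathbf t}(u)$ with $|\sigma|=i-1$, the element $z(u;\sigma)=\varepsilon(u')\,e_\sigma\wedge e_{\max(u)}\in K_i(\mathbf x;S/I)$ is a cycle, and the homology classes $[z(u;\sigma)]$ form a $K$-basis of $H_i(\mathbf x;S/I)$, $i\ge1$. Put $f(u;\sigma)=(-1)^{(i-1)(i-2)/2}\,1\otimes[z(u;\sigma)]\in F_i$. Convention: $f(u;\sigma)=0$ if $\sigma\not\subseteq[\max(u)-1]\setminus\operatorname{supp}_{\mathbf t}(u)$. Pure lexicographic order: $x_1^{a_1}\cdots x_n^{a_n}>_{\mathrm{plex}}x_1^{b_1}\cdots x_n^{b_n}$ iff for some $s$, $a_1=b_1,\dots,a_{s-1}=b_{s-1}$ and $a_s>b_s$. For a monomial $w\in I$, $g(w)=\max_{>_{\mathrm{plex}}}\{u\in G(I):u\mid w\}$ (the $\mathbf t$-spread decomposition function). For $u\in G(I)$ and $k\in[\max(u)-1]\setminus\operatorname{supp}_{\mathbf t}(u)$, $u_k=g(x_ku)$ and $v_k=x_ku/u_k$ (here $x_{\max(u)}$ always divides $v_k$). For $\sigma\subseteq[n]$ and $k\in\sigma$, $\alpha(\sigma;k)=|\{s\in\sigma:s<k\}|$; for $\tau\subseteq\sigma$ (with $\sigma$ fixed), $\gamma(\tau)=\sum_{k\in\sigma\setminus\tau}\alpha(\sigma;k)$.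 *)

theory Defs
  imports "HOL-Algebra.Algebra" "HOL-Library.Poly_Mapping"
begin

section \<open>The polynomial ring and its monomials\<close>

text \<open>A monomial is identified with its exponent vector, so that products, quotients and the
  monomial 1 are written \<open>+\<close>, \<open>-\<close> and \<open>0\<close>. Variables are indexed by \<open>{1..n}\<close>.\<close>

type_synonym mon = "nat \<Rightarrow>\<^sub>0 nat"
type_synonym 'k mpoly = "mon \<Rightarrow>\<^sub>0 'k"

definition mons :: "nat \<Rightarrow> mon set" where
  "mons n = {u. Poly_Mapping.keys u \<subseteq> {1..n}}"

definition xvar :: "nat \<Rightarrow> mon" where
  "xvar k = Poly_Mapping.single k 1"

definition mdvd :: "mon \<Rightarrow> mon \<Rightarrow> bool" where
  "mdvd u w \<longleftrightarrow> (\<exists>v. w = u + v)"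

definition mdeg :: "mon \<Rightarrow> nat" where
  "mdeg u = (\<Sum>i\<in>Poly_Mapping.keys u. Poly_Mapping.lookup u i)"

definition maxv :: "mon \<Rightarrow> nat" where
  "maxv u = Max (Poly_Mapping.keys u)"

definition mono_poly :: "mon \<Rightarrow> 'k::field mpoly" where
  "mono_poly u = Poly_Mapping.single u 1"

definition const_poly :: "'k::field \<Rightarrow> 'k mpoly" where
  "const_poly c = Poly_Mapping.single 0 c"

text \<open>\<open>K[x\<^sub>1, \<dots>, x\<^sub>n]\<close>, as a ring and as a module over itself.\<close>

definition mpoly_ring :: "nat \<Rightarrow> ('k::field mpoly, 'k mpoly) module" where
  "mpoly_ring n = \<lparr>carrier = {p. Poly_Mapping.keys p \<subseteq> mons n}, monoid.mult = (*), monoid.one = 1, ring.zero = 0, ring.add = (+),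
     module.smult = (*)\<rparr>"

section \<open>Modules\<close>

text \<open>The ring fields \<open>mult\<close> and \<open>one\<close> of the record \<open>module\<close> play no role for modules and are
  left \<open>undefined\<close> below.\<close>

definition mod_hom ::
  "('r, 'x) ring_scheme \<Rightarrow> ('r, 'm) module \<Rightarrow> ('r, 'l) module \<Rightarrow> ('m \<Rightarrow> 'l) set" where
  "mod_hom R M N = {h. h \<in> carrier M \<rightarrow> carrier N \<and>
     (\<forall>x\<in>carrier M. \<forall>y\<in>carrier M. h (x \<oplus>\<^bsub>M\<^esub> y) = h x \<oplus>\<^bsub>N\<^esub> h y) \<and>
     (\<forall>a\<in>carrier R. \<forall>x\<in>carrier M. h (a \<odot>\<^bsub>M\<^esub> x) = a \<odot>\<^bsub>N\<^esub> h x)}"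

definition quot_module :: "('r, 'm) module \<Rightarrow> 'm set \<Rightarrow> ('r, 'm set) module" where
  "quot_module M N = \<lparr>carrier = a_rcosets\<^bsub>M\<^esub> N, monoid.mult = undefined, monoid.one = undefined, ring.zero = N,
     ring.add = set_add M, module.smult = (\<lambda>a C. \<Union>x\<in>C. N +>\<^bsub>M\<^esub> (a \<odot>\<^bsub>M\<^esub> x))\<rparr>"

definition restrict_scalars :: "('r \<Rightarrow> 's) \<Rightarrow> ('s, 'm) module \<Rightarrow> ('r, 'm) module" where
  "restrict_scalars \<phi> M = \<lparr>carrier = carrier M, monoid.mult = undefined, monoid.one = undefined,
     ring.zero = \<zero>\<^bsub>M\<^esub>, ring.add = ring.add M, module.smult = (\<lambda>a x. \<phi> a \<odot>\<^bsub>M\<^esub> x)\<rparr>"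

text \<open>The copy of a module along an injection \<open>\<phi>\<close> with left inverse \<open>\<psi>\<close>.\<close>

definition copy_module :: "('m \<Rightarrow> 'l) \<Rightarrow> ('l \<Rightarrow> 'm) \<Rightarrow> ('r, 'm) module \<Rightarrow> ('r, 'l) module" where
  "copy_module \<phi> \<psi> M = \<lparr>carrier = \<phi> ` carrier M, monoid.mult = undefined, monoid.one = undefined,
     ring.zero = \<phi> \<zero>\<^bsub>M\<^esub>, ring.add = (\<lambda>x y. \<phi> (\<psi> x \<oplus>\<^bsub>M\<^esub> \<psi> y)), module.smult = (\<lambda>a x. \<phi> (a \<odot>\<^bsub>M\<^esub> \<psi> x))\<rparr>"

text \<open>For a \<open>K\<close>-vector space \<open>V\<close>, the \<open>S\<close>-module \<open>S \<otimes>\<^sub>K V\<close>. As the monomials form a \<open>K\<close>-basis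
  of \<open>S\<close>, every element is uniquely a finite sum of tensors \<open>m \<otimes> v\<^sub>m\<close> with \<open>m\<close> a monomial; it is
  represented by the family of its coefficients \<open>v\<^sub>m\<close>.\<close>

definition ext_scalars :: "nat \<Rightarrow> ('k::field, 'v) module \<Rightarrow> ('k mpoly, mon \<Rightarrow> 'v) module" where
  "ext_scalars n V = \<lparr>
     carrier = {x. (\<forall>m. x m \<in> carrier V) \<and> finite {m. x m \<noteq> \<zero>\<^bsub>V\<^esub>} \<and> {m. x m \<noteq> \<zero>\<^bsub>V\<^esub>} \<subseteq> mons n},
     monoid.mult = undefined, monoid.one = undefined,
     ring.zero = (\<lambda>m. \<zero>\<^bsub>V\<^esub>),
     ring.add = (\<lambda>x y m. x m \<oplus>\<^bsub>V\<^esub> y m),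
     module.smult = (\<lambda>p x m. \<Oplus>\<^bsub>V\<^esub>a\<in>{a \<in> Poly_Mapping.keys p. mdvd a m}. Poly_Mapping.lookup p a \<odot>\<^bsub>V\<^esub> x (m - a))\<rparr>"

definition pure_tensor :: "('k::field, 'v) module \<Rightarrow> 'k mpoly \<Rightarrow> 'v \<Rightarrow> mon \<Rightarrow> 'v" where
  "pure_tensor V p v = (\<lambda>m. Poly_Mapping.lookup p m \<odot>\<^bsub>V\<^esub> v)"

definition finite_basis :: "('r, 'x) ring_scheme \<Rightarrow> ('r, 'm) module \<Rightarrow> 'm set \<Rightarrow> bool" where
  "finite_basis R M B \<longleftrightarrow> finite B \<and> B \<subseteq> carrier M \<and>
     (\<forall>x\<in>carrier M. \<exists>!c. c \<in> B \<rightarrow>\<^sub>E carrier R \<and> x = (\<Oplus>\<^bsub>M\<^esub>b\<in>B. c b \<odot>\<^bsub>M\<^esub> b))"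

definition ideal_module :: "('r, 'x) ring_scheme \<Rightarrow> 'r set \<Rightarrow> ('r, 'm) module \<Rightarrow> 'm set" where
  "ideal_module R A M =
     \<Inter>{N. submodule N R M \<and> (\<forall>a\<in>A. \<forall>x\<in>carrier M. a \<odot>\<^bsub>M\<^esub> x \<in> N)}"

section \<open>Minimal free resolutions\<close>

text \<open>Over the standard graded ring \<open>S = K[x\<^sub>1, \<dots>, x\<^sub>n]\<close> minimality refers to the irrelevant
  ideal \<open>(x\<^sub>1, \<dots>, x\<^sub>n)\<close> and to graded resolutions. If \<open>\<delta>\<close> gives the degrees of the elements of a
  basis \<open>B\<close> of \<open>M\<close>, then \<open>free_component n M B \<delta> e\<close> is the component of degree \<open>e\<close> of \<open>M\<close>.
  In \<open>minimal_free_resolution n F d \<epsilon> M Mg\<close>, \<open>Mg e\<close> is the component of degree \<open>e\<close> of \<open>M\<close>, and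
  \<open>d i\<close> is the differential from \<open>F i\<close> to \<open>F (i - 1)\<close> for \<open>i \<ge> 1\<close> (the value \<open>d 0\<close> is not used).\<close>

definition irrelevant_ideal :: "nat \<Rightarrow> 'k::field mpoly set" where
  "irrelevant_ideal n = genideal (mpoly_ring n) ((\<lambda>k. mono_poly (xvar k)) ` {1..n})"

definition free_component ::
  "nat \<Rightarrow> ('k::field mpoly, 'm) module \<Rightarrow> 'm set \<Rightarrow> ('m \<Rightarrow> nat) \<Rightarrow> nat \<Rightarrow> 'm set" where
  "free_component n M B \<delta> e = {\<Oplus>\<^bsub>M\<^esub>b\<in>B. p b \<odot>\<^bsub>M\<^esub> b | p.
     \<forall>b\<in>B. p b \<in> carrier (mpoly_ring n) \<and> (\<forall>m\<in>Poly_Mapping.keys (p b). mdeg m + \<delta> b = e)}"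

definition minimal_free_resolution ::
  "nat \<Rightarrow> (nat \<Rightarrow> ('k::field mpoly, 'f) module) \<Rightarrow> (nat \<Rightarrow> 'f \<Rightarrow> 'f) \<Rightarrow>
   ('f \<Rightarrow> 'm) \<Rightarrow> ('k mpoly, 'm) module \<Rightarrow> (nat \<Rightarrow> 'm set) \<Rightarrow> bool" where
  "minimal_free_resolution n F d \<epsilon> M Mg \<longleftrightarrow>
     module (mpoly_ring n) M \<and> (\<forall>i. module (mpoly_ring n) (F i)) \<and>
     \<epsilon> \<in> mod_hom (mpoly_ring n) (F 0) M \<and>
     (\<forall>i\<ge>1. d i \<in> mod_hom (mpoly_ring n) (F i) (F (i - 1))) \<and>
     (\<exists>B \<delta>. (\<forall>i. finite_basis (mpoly_ring n) (F i) (B i)) \<and>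
        (\<forall>b\<in>B 0. \<epsilon> b \<in> Mg (\<delta> 0 b)) \<and>
        (\<forall>i\<ge>1. \<forall>b\<in>B i. d i b \<in> free_component n (F (i - 1)) (B (i - 1)) (\<delta> (i - 1)) (\<delta> i b))) \<and>
     \<epsilon> ` carrier (F 0) = carrier M \<and>
     a_kernel (F 0) M \<epsilon> = d 1 ` carrier (F 1) \<and>
     (\<forall>i\<ge>1. a_kernel (F i) (F (i - 1)) (d i) = d (i + 1) ` carrier (F (i + 1))) \<and>
     (\<forall>i\<ge>1. d i ` carrier (F i) \<subseteq> ideal_module (mpoly_ring n) (irrelevant_ideal n) (F (i - 1)))"

section \<open>Koszul complexes\<close>

definition alpha :: "nat set \<Rightarrow> nat \<Rightarrow> nat" where
  "alpha \<sigma> k = card {s \<in> \<sigma>. s < k}"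

text \<open>For an \<open>S\<close>-module \<open>M\<close>, the module \<open>M \<otimes>\<^sub>S K\<^sub>i\<close>: since \<open>K\<^sub>i\<close> is free on the \<open>e\<^sub>\<tau>\<close>, every
  element is uniquely a sum of tensors \<open>c\<^sub>\<tau> \<otimes> e\<^sub>\<tau>\<close>; it is represented by the family
  of its coefficients \<open>c\<^sub>\<tau>\<close>. Accordingly, for \<open>h : M \<rightarrow> N\<close> the map \<open>h \<otimes> id\<close> is \<open>c \<mapsto> h \<circ> c\<close>, and
  the identification of \<open>M \<otimes>\<^sub>S K\<^sub>0\<close> with \<open>M\<close> is \<open>c \<mapsto> c {}\<close>.\<close>

definition koszul :: "nat \<Rightarrow> ('k::field mpoly, 'm) module \<Rightarrow> nat \<Rightarrow> ('k mpoly, nat set \<Rightarrow> 'm) module" where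
  "koszul n M i = \<lparr>
     carrier = {c. (\<forall>\<tau>. c \<tau> \<in> carrier M) \<and> (\<forall>\<tau>. c \<tau> \<noteq> \<zero>\<^bsub>M\<^esub> \<longrightarrow> \<tau> \<subseteq> {1..n} \<and> card \<tau> = i)},
     monoid.mult = undefined, monoid.one = undefined,
     ring.zero = (\<lambda>\<tau>. \<zero>\<^bsub>M\<^esub>),
     ring.add = (\<lambda>c c' \<tau>. c \<tau> \<oplus>\<^bsub>M\<^esub> c' \<tau>),
     module.smult = (\<lambda>p c \<tau>. p \<odot>\<^bsub>M\<^esub> c \<tau>)\<rparr>"

definition tensor_e :: "('k::field mpoly, 'm) module \<Rightarrow> 'm \<Rightarrow> nat set \<Rightarrow> nat set \<Rightarrow> 'm" where
  "tensor_e M x \<tau> = (\<lambda>\<rho>. if \<rho> = \<tau> then x else \<zero>\<^bsub>M\<^esub>)"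

text \<open>\<open>id\<^sub>M \<otimes> \<partial>\<close> in every homological degree. The basis element \<open>e\<^sub>\<rho>\<close> occurs in \<open>\<partial> e\<^sub>\<tau>\<close> iff
  \<open>\<tau> = \<rho> \<union> {k}\<close> for some \<open>k \<notin> \<rho>\<close>, and if \<open>k\<close> is the \<open>l\<close>-th element of \<open>\<tau>\<close>, then
  \<open>l = alpha \<tau> k + 1\<close>, so that its coefficient is \<open>(-1) ^ alpha \<tau> k * x\<^sub>k\<close>.\<close>

definition koszul_d ::
  "nat \<Rightarrow> ('k::field mpoly, 'm) module \<Rightarrow> (nat set \<Rightarrow> 'm) \<Rightarrow> nat set \<Rightarrow> 'm" where
  "koszul_d n M c = (\<lambda>\<rho>. \<Oplus>\<^bsub>M\<^esub>k\<in>{1..n} - \<rho>.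
     ((-1) ^ alpha (insert k \<rho>) k * mono_poly (xvar k)) \<odot>\<^bsub>M\<^esub> c (insert k \<rho>))"

definition koszul_cycles :: "nat \<Rightarrow> ('k::field mpoly, 'm) module \<Rightarrow> nat \<Rightarrow> (nat set \<Rightarrow> 'm) set" where
  "koszul_cycles n M i = {c \<in> carrier (koszul n M i). koszul_d n M c = (\<lambda>\<rho>. \<zero>\<^bsub>M\<^esub>)}"

definition koszul_boundaries :: "nat \<Rightarrow> ('k::field mpoly, 'm) module \<Rightarrow> nat \<Rightarrow> (nat set \<Rightarrow> 'm) set" where
  "koszul_boundaries n M i = koszul_d n M ` carrier (koszul n M (i + 1))"

definition koszul_homology ::
  "nat \<Rightarrow> ('k::field mpoly, 'm) module \<Rightarrow> nat \<Rightarrow> ('k mpoly, (nat set \<Rightarrow> 'm) set) module" where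
  "koszul_homology n M i =
     quot_module ((koszul n M i)\<lparr>carrier := koszul_cycles n M i\<rparr>) (koszul_boundaries n M i)"

definition koszul_class ::
  "nat \<Rightarrow> ('k::field mpoly, 'm) module \<Rightarrow> nat \<Rightarrow> (nat set \<Rightarrow> 'm) \<Rightarrow> (nat set \<Rightarrow> 'm) set" where
  "koszul_class n M i z = koszul_boundaries n M i +>\<^bsub>koszul n M i\<^esub> z"

section \<open>Strongly stable ideals of spread monomials\<close>

definition monomial_ideal :: "nat \<Rightarrow> 'k::field mpoly set \<Rightarrow> bool" where
  "monomial_ideal n I \<longleftrightarrow> (\<exists>A\<subseteq>mons n. I = genideal (mpoly_ring n) (mono_poly ` A))"

definition min_gens :: "nat \<Rightarrow> 'k::field mpoly set \<Rightarrow> mon set" where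
  "min_gens n I = (THE G. G \<subseteq> mons n \<and> I = genideal (mpoly_ring n) (mono_poly ` G) \<and>
     (\<forall>G'. G' \<subset> G \<longrightarrow> I \<noteq> genideal (mpoly_ring n) (mono_poly ` G')))"

text \<open>The list \<open>[j\<^sub>1, \<dots>, j\<^sub>l]\<close> with \<open>u = x\<^bsub>j\<^sub>1\<^esub> \<cdots> x\<^bsub>j\<^sub>l\<^esub>\<close> and \<open>j\<^sub>1 \<le> \<dots> \<le> j\<^sub>l\<close>. List positions
  start at 0, so \<open>j\<^bsub>r+1\<^esub>\<close> and \<open>t\<^bsub>r+1\<^esub>\<close> are \<open>var_list u ! r\<close> and \<open>t ! r\<close>. The vector \<open>t\<close> has
  \<open>d - 1\<close> entries, so the length bound \<open>l \<le> d\<close> is \<open>l \<le> length t + 1\<close>.\<close>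

definition var_list :: "mon \<Rightarrow> nat list" where
  "var_list u = concat (map (\<lambda>i. replicate (Poly_Mapping.lookup u i) i) (sorted_list_of_set (Poly_Mapping.keys u)))"

definition spread :: "nat list \<Rightarrow> mon \<Rightarrow> bool" where
  "spread t u \<longleftrightarrow> length (var_list u) \<le> length t + 1 \<and>
     (\<forall>r. r + 1 < length (var_list u) \<longrightarrow> var_list u ! r + t ! r \<le> var_list u ! (r + 1))"

definition spread_strongly_stable :: "nat \<Rightarrow> nat list \<Rightarrow> 'k::field mpoly set \<Rightarrow> bool" where
  "spread_strongly_stable n t I \<longleftrightarrow> monomial_ideal n I \<and> (\<forall>u\<in>min_gens n I. spread t u) \<and>
     (\<forall>u\<in>mons n. spread t u \<and> mono_poly u \<in> I \<longrightarrow>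
        (\<forall>i\<in>Poly_Mapping.keys u. \<forall>j\<in>{1..<i}. spread t (xvar j + (u - xvar i)) \<longrightarrow>
           mono_poly (xvar j + (u - xvar i)) \<in> I))"

definition spread_supp :: "nat list \<Rightarrow> mon \<Rightarrow> nat set" where
  "spread_supp t u = (\<Union>r\<in>{r. r + 1 < length (var_list u)}.
     {var_list u ! r ..< var_list u ! r + t ! r})"

definition admissible :: "nat list \<Rightarrow> mon \<Rightarrow> nat set" where
  "admissible t u = {1..maxv u - 1} - spread_supp t u"

text \<open>The order on \<open>mon\<close> is the one of \<open>HOL-Library.Poly_Mapping\<close>: the monomials are compared by
  the exponents at the smallest index where they differ, i.e. it is the pure lexicographic order.\<close>

definition decomp :: "nat \<Rightarrow> 'k::field mpoly set \<Rightarrow> mon \<Rightarrow> mon" where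
  "decomp n I w = Max {u \<in> min_gens n I. mdvd u w}"

section \<open>The modules and maps of the resolution\<close>

definition quot :: "nat \<Rightarrow> 'k::field mpoly set \<Rightarrow> ('k mpoly, 'k mpoly set) module" where
  "quot n I = quot_module (mpoly_ring n) I"

definition quot_component :: "nat \<Rightarrow> 'k::field mpoly set \<Rightarrow> nat \<Rightarrow> 'k mpoly set set" where
  "quot_component n I e = {I +>\<^bsub>mpoly_ring n\<^esub> p | p.
     p \<in> carrier (mpoly_ring n) \<and> (\<forall>m\<in>Poly_Mapping.keys p. mdeg m = e)}"

text \<open>The homology of \<open>K\<^sub>\<bullet>(x; S/I)\<close> as a vector space over \<open>K\<close>.\<close>

definition homol :: "nat \<Rightarrow> 'k::field mpoly set \<Rightarrow> nat \<Rightarrow> ('k, (nat set \<Rightarrow> 'k mpoly set) set) module" where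
  "homol n I i = restrict_scalars const_poly (koszul_homology n (quot n I) i)"

text \<open>\<open>F\<^sub>0 = S\<close> and \<open>F\<^sub>i = S \<otimes>\<^sub>K H\<^sub>i(x; S/I)\<close> for \<open>i \<ge> 1\<close>, tagged by \<open>Inl\<close> and \<open>Inr\<close> so that
  all of them live on the same type.\<close>

type_synonym 'k fres = "'k mpoly + (mon \<Rightarrow> (nat set \<Rightarrow> 'k mpoly set) set)"

definition Fres :: "nat \<Rightarrow> 'k::field mpoly set \<Rightarrow> nat \<Rightarrow> ('k mpoly, 'k fres) module" where
  "Fres n I i = (if i = 0 then copy_module Inl projl (mpoly_ring n)
     else copy_module Inr projr (ext_scalars n (homol n I i)))"

definition aug :: "nat \<Rightarrow> 'k::field mpoly set \<Rightarrow> 'k fres \<Rightarrow> 'k mpoly set" where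
  "aug n I x = I +>\<^bsub>mpoly_ring n\<^esub> projl x"

text \<open>The wedge \<open>e\<^sub>\<rho> \<and> e\<^bsub>max(u)\<^esub>\<close> is only used for \<open>\<rho> \<subseteq> {1..max(u)-1}\<close>, where it is the basis
  element of \<open>\<rho> \<union> {max(u)}\<close> with sign \<open>+1\<close>.\<close>

definition zcyc :: "nat \<Rightarrow> 'k::field mpoly set \<Rightarrow> mon \<Rightarrow> nat set \<Rightarrow> nat set \<Rightarrow> 'k mpoly set" where
  "zcyc n I u \<sigma> =
     tensor_e (quot n I) (I +>\<^bsub>mpoly_ring n\<^esub> mono_poly (u - xvar (maxv u))) (insert (maxv u) \<sigma>)"

text \<open>The exponent \<open>(i - 1)(i - 2)/2\<close>; it is 0 for \<open>i = 1\<close>, also with truncated subtraction.\<close>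

definition sgn_exp :: "nat \<Rightarrow> nat" where
  "sgn_exp i = (i - 1) * (i - 2) div 2"

definition fbas :: "nat \<Rightarrow> nat list \<Rightarrow> 'k::field mpoly set \<Rightarrow> mon \<Rightarrow> nat set \<Rightarrow> 'k fres" where
  "fbas n t I u \<sigma> = (let i = card \<sigma> + 1 in
     if \<sigma> \<subseteq> admissible t u
     then (-1) ^ sgn_exp i \<odot>\<^bsub>Fres n I i\<^esub>
       Inr (pure_tensor (homol n I i) 1 (koszul_class n (quot n I) i (zcyc n I u \<sigma>)))
     else \<zero>\<^bsub>Fres n I i\<^esub>)"

definition uk :: "nat \<Rightarrow> 'k::field mpoly set \<Rightarrow> mon \<Rightarrow> nat \<Rightarrow> mon" where
  "uk n I u k = decomp n I (xvar k + u)"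

definition vk :: "nat \<Rightarrow> 'k::field mpoly set \<Rightarrow> mon \<Rightarrow> nat \<Rightarrow> mon" where
  "vk n I u k = xvar k + u - uk n I u k"

definition gam :: "nat set \<Rightarrow> nat set \<Rightarrow> nat" where
  "gam \<sigma> \<tau> = (\<Sum>k\<in>\<sigma> - \<tau>. alpha \<sigma> k)"

text \<open>The exponent vector \<open>vk n I u k - xvar (maxv u)\<close> stands for \<open>v\<^sub>k / x\<^bsub>max(u)\<^esub>\<close>; the division
  is exact.\<close>

definition selt :: "nat \<Rightarrow> nat list \<Rightarrow> 'k::field mpoly set \<Rightarrow> mon \<Rightarrow> nat set \<Rightarrow> 'k fres" where
  "selt n t I u \<tau> = (\<Oplus>\<^bsub>Fres n I (card \<tau>)\<^esub>k\<in>\<tau>.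
     ((-1) ^ alpha \<tau> k * mono_poly (vk n I u k - xvar (maxv u)))
       \<odot>\<^bsub>Fres n I (card \<tau>)\<^esub> fbas n t I (uk n I u k) (\<tau> - {k}))"

text \<open>The element \<open>g\<^sub>j\<close> of \<open>F\<^sub>j \<otimes>\<^sub>S K\<^bsub>i-j\<^esub>\<close> attached to \<open>f(u;\<sigma>)\<close>, where \<open>i = |\<sigma>| + 1\<close>.\<close>

definition gelt ::
  "nat \<Rightarrow> nat list \<Rightarrow> 'k::field mpoly set \<Rightarrow> mon \<Rightarrow> nat set \<Rightarrow> nat \<Rightarrow> nat set \<Rightarrow> 'k fres" where
  "gelt n t I u \<sigma> j = (let i = card \<sigma> + 1; F = Fres n I j; FK = koszul n F (i - j) in
     if j = 0
     then (-1) ^ sgn_exp i \<odot>\<^bsub>FK\<^esub>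
       tensor_e F (Inl (mono_poly (u - xvar (maxv u)))) (insert (maxv u) \<sigma>)
     else
       ((-1) ^ (i - j) \<odot>\<^bsub>FK\<^esub> (\<Oplus>\<^bsub>FK\<^esub>\<tau>\<in>{\<tau>. \<tau> \<subseteq> \<sigma> \<and> card \<tau> = j - 1}.
          (-1) ^ gam \<sigma> \<tau> \<odot>\<^bsub>FK\<^esub> tensor_e F (fbas n t I u \<tau>) (\<sigma> - \<tau>)))
       \<oplus>\<^bsub>FK\<^esub> (\<Oplus>\<^bsub>FK\<^esub>\<tau>\<in>{\<tau>. \<tau> \<subseteq> \<sigma> \<and> card \<tau> = j}.
          (-1) ^ gam \<sigma> \<tau> \<odot>\<^bsub>FK\<^esub> tensor_e F (selt n t I u \<tau>) (insert (maxv u) (\<sigma> - \<tau>))))"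

definition basis_index :: "nat \<Rightarrow> nat list \<Rightarrow> 'k::field mpoly set \<Rightarrow> nat \<Rightarrow> (mon \<times> nat set) set" where
  "basis_index n t I i =
     {(u, \<sigma>). u \<in> min_gens n I \<and> \<sigma> \<subseteq> admissible t u \<and> card \<sigma> = i - 1}"

text \<open>\<open>d i : F\<^sub>i \<rightarrow> F\<^bsub>i-1\<^esub>\<close> is the \<open>S\<close>-linear map with \<open>d i (f(u;\<sigma>)) = \<partial>\<^sub>1 (g\<^bsub>i-1\<^esub>)\<close>.\<close>

definition res_maps :: "nat \<Rightarrow> nat list \<Rightarrow> 'k::field mpoly set \<Rightarrow> (nat \<Rightarrow> 'k fres \<Rightarrow> 'k fres) \<Rightarrow> bool" where
  "res_maps n t I d \<longleftrightarrow> (\<forall>i\<ge>1.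
     d i \<in> mod_hom (mpoly_ring n) (Fres n I i) (Fres n I (i - 1)) \<and>
     (\<forall>(u, \<sigma>)\<in>basis_index n t I i.
        d i (fbas n t I u \<sigma>) = koszul_d n (Fres n I (i - 1)) (gelt n t I u \<sigma> (i - 1)) {}))"

end

theory Submission imports Defs
begin

text \<open>Every monomial \<open>w\<close> of the ideal is \<open>w = g(w) m\<close>,
  where all variables of \<open>m\<close> lie outside \<open>[max(g(w)) - 1] - supp\<^sub>t(g(w))\<close>. Hence the
  multiples \<open>m f(u; \<sigma>)\<close> can be matched by moving a variable between \<open>m\<close> and \<open>\<sigma>\<close>, and since
  \<open>u\<^sub>k\<close> is lexicographically larger than \<open>u\<close>, the differential given by the explicit formula is triangular with
  respect to this matching. A triangular matching computes homology as in discrete Morse theory, which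
  makes the complex a resolution of \<open>S/I\<close>. A similar matching of the monomials \<open>w e\<^sub>\<tau>\<close> of
  the Koszul complex of \<open>S/I\<close> leaves exactly the cycles \<open>z(u; \<sigma>)\<close>, which therefore represent
  a basis of the Koszul homology. The lifting equations for the \<open>g\<^sub>j\<close> reduce to \<open>d\<^sup>2 = 0\<close>, because
  \<open>x\<^bsub>max(u)\<^esub> s\<^sub>\<tau>\<close> differs from \<open>d(f(u; \<tau>))\<close> by the terms \<open>x\<^sub>k f(u; \<tau> - {k})\<close> alone.\<close>

text \<open>The shape (1,...,1,0,...,0) of t enters through one fact: whether a variable may be
  repeated depends only on the number of distinct variables before it. This number does not grow on
  passing to a divisor, and it is kept by prefixes of a monomial. Strong stability then makes g(w) a
  prefix of w for t-spread w, and from this come the rules for \<open>u\<^sub>k\<close> and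
  \<open>v\<^sub>k\<close>. On the algebraic side F_i is built from the Koszul homology, so its
  freeness on the f(u;\<sigma>) has to be established as well. In general the critical cells of a
  matching only give an upper bound for the homology; here they give a basis because every one of
  them is a cycle. Computations take place on finitely supported functions, with type class
  arithmetic, and \<open>Psi\<close> and \<open>Phi\<close> carry the results to cosets, homology
  classes and tensors. The sign in f(u;\<sigma>) is (-1)^\<gamma>(\<emptyset>), which makes g_0 the
  case j = 0 of the second sum in g_j.\<close>

abbreviation (input) lookup where "lookup \<equiv> Poly_Mapping.lookup"
abbreviation (input) keys where "keys \<equiv> Poly_Mapping.keys"
abbreviation (input) single where "single \<equiv> Poly_Mapping.single"

section \<open>Monomials\<close>

lemma lookup_xvar: "lookup (xvar k) i = (if i = k then 1 else 0)"
  by (simp add: xvar_def lookup_single when_def)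

lemma keys_xvar [simp]: "keys (xvar k) = {k}"
  by (simp add: xvar_def)

lemma mdvd_iff: "mdvd u w \<longleftrightarrow> (\<forall>i. lookup u i \<le> lookup w i)"
proof
  assume "\<forall>i. lookup u i \<le> lookup w i"
  then have "w = u + (w - u)"
    by (intro poly_mapping_eqI) (simp add: lookup_add lookup_minus)
  then show "mdvd u w" unfolding mdvd_def by blast
qed (auto simp: mdvd_def lookup_add)

lemma mdvd_add_diff: "mdvd u w \<Longrightarrow> u + (w - u) = w"
  by (intro poly_mapping_eqI) (simp add: lookup_add lookup_minus mdvd_iff)

lemma mdvd_refl [simp]: "mdvd u u" by (simp add: mdvd_iff)

lemma mdvd_trans [trans]: "mdvd u v \<Longrightarrow> mdvd v w \<Longrightarrow> mdvd u w"
  by (meson mdvd_iff order_trans)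

lemma mdvd_add_left [simp]: "mdvd u (u + v)" "mdvd u (v + u)"
  by (auto simp: mdvd_iff lookup_add)

lemma keys_add_mon: "keys (u + v :: mon) = keys u \<union> keys v"
  by (auto simp: in_keys_iff lookup_add)

lemma mdvd_keys: "mdvd u w \<Longrightarrow> keys u \<subseteq> keys w"
  by (metis Un_upper1 keys_add_mon mdvd_def)

lemma mdeg_eq_sum: "finite A \<Longrightarrow> keys u \<subseteq> A \<Longrightarrow> mdeg u = (\<Sum>i\<in>A. lookup u i)"
  unfolding mdeg_def by (rule sum.mono_neutral_left) (auto simp: in_keys_iff)

lemma mdeg_add: "mdeg (u + v) = mdeg u + mdeg v"
  by (subst (1 2 3) mdeg_eq_sum[of "keys u \<union> keys v"])
    (auto simp: keys_add_mon lookup_add sum.distrib)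

lemma mdeg_xvar [simp]: "mdeg (xvar k) = 1"
  by (simp add: mdeg_def lookup_xvar)

lemma mdeg_zero [simp]: "mdeg 0 = 0" by (simp add: mdeg_def)

lemma mdeg_eq_0_iff: "mdeg u = 0 \<longleftrightarrow> u = 0"
  by (auto simp: mdeg_def in_keys_iff intro!: poly_mapping_eqI)

lemma mdvd_mdeg_less: "mdvd u w \<Longrightarrow> u \<noteq> w \<Longrightarrow> mdeg u < mdeg w"
  by (metis add_cancel_left_right mdeg_add mdeg_eq_0_iff mdvd_def add.right_neutral less_add_same_cancel1 gr_zeroI)

lemma mdvd_xvar_iff: "mdvd (xvar k) w \<longleftrightarrow> k \<in> keys w"
  by (auto simp: mdvd_iff lookup_xvar in_keys_iff Suc_le_eq)

lemma xvar_add_diff: "k \<in> keys w \<Longrightarrow> xvar k + (w - xvar k) = w"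
  by (simp add: mdvd_add_diff mdvd_xvar_iff)

lemma mdvd_diff [simp]: "mdvd (u - v) u"
  by (simp add: mdvd_iff lookup_minus)

lemma mons_add: "u + v \<in> mons n \<longleftrightarrow> u \<in> mons n \<and> v \<in> mons n"
  by (auto simp: mons_def keys_add_mon)

lemma mons_mdvd: "w \<in> mons n \<Longrightarrow> mdvd u w \<Longrightarrow> u \<in> mons n"
  by (metis mdvd_def mons_add)

lemma zero_in_mons [simp]: "0 \<in> mons n" by (simp add: mons_def)

lemma xvar_in_mons [simp]: "xvar k \<in> mons n \<longleftrightarrow> 1 \<le> k \<and> k \<le> n" by (simp add: mons_def)

lemma diff_in_mons: "u \<in> mons n \<Longrightarrow> u - v \<in> mons n"
  using mdvd_diff mons_mdvd by blast

text \<open>Makes the generating set finite later on: spread generators have degree at most d, and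
  monomials of bounded degree inject into the functions between two finite sets.\<close>

lemma finite_mons_mdeg: "finite {u \<in> mons n. mdeg u \<le> d}"
proof (rule inj_on_finite)
  show "inj_on (\<lambda>u. restrict (lookup u) {1..n}) {u \<in> mons n. mdeg u \<le> d}"
  proof (rule inj_onI, rule poly_mapping_eqI)
    fix u v i assume *: "u \<in> {u \<in> mons n. mdeg u \<le> d}" "v \<in> {u \<in> mons n. mdeg u \<le> d}"
      "restrict (lookup u) {1..n} = restrict (lookup v) {1..n}"
    show "lookup u i = lookup v i"
    proof (cases "i \<in> {1..n}")
      case True then show ?thesis using *(3) by (metis restrict_apply')
    next
      case False
      then have "i \<notin> keys u" "i \<notin> keys v" using * by (auto simp: mons_def)
      then show ?thesis by (simp add: in_keys_iff)
    qed
  qed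
  show "(\<lambda>u. restrict (lookup u) {1..n}) ` {u \<in> mons n. mdeg u \<le> d} \<subseteq> {1..n} \<rightarrow>\<^sub>E {..d}"
  proof (rule image_subsetI)
    fix u assume u: "u \<in> {u \<in> mons n. mdeg u \<le> d}"
    have "lookup u i \<le> d" if "i \<in> {1..n}" for i
    proof -
      have "mdeg u = (\<Sum>i\<in>{1..n}. lookup u i)" using u by (intro mdeg_eq_sum) (auto simp: mons_def)
      also have "\<dots> \<ge> lookup u i" using that by (meson finite_atLeastAtMost member_le_sum zero_le)
      finally show ?thesis using u by auto
    qed
    then show "restrict (lookup u) {1..n} \<in> {1..n} \<rightarrow>\<^sub>E {..d}" by (simp add: PiE_iff)
  qed
qed (simp add: finite_PiE)

lemma maxv_in_keys: "u \<noteq> 0 \<Longrightarrow> maxv u \<in> keys u"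
  unfolding maxv_def by (rule Max_in) auto

lemma maxv_ge: "i \<in> keys u \<Longrightarrow> i \<le> maxv u"
  unfolding maxv_def by simp

lemma maxv_mono: "mdvd u w \<Longrightarrow> u \<noteq> 0 \<Longrightarrow> maxv u \<le> maxv w"
  by (meson maxv_ge maxv_in_keys mdvd_keys subsetD)

lemma lookup_gt_maxv: "maxv u < i \<Longrightarrow> lookup u i = 0"
  by (meson in_keys_iff leD maxv_ge)

lemma maxv_eqI: "i \<in> keys u \<Longrightarrow> (\<And>j. j \<in> keys u \<Longrightarrow> j \<le> i) \<Longrightarrow> maxv u = i"
  unfolding maxv_def by (rule Max_eqI) auto

lemma plex_less_iff: "(u::mon) < w \<longleftrightarrow> (\<exists>s. lookup u s < lookup w s \<and> (\<forall>l<s. lookup u l = lookup w l))"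
  by (simp add: less_poly_mapping.rep_eq less_fun_def)

section \<open>Spread monomials\<close>

definition rnk :: "mon \<Rightarrow> nat \<Rightarrow> nat" where
  "rnk w i = card {j \<in> keys w. j < i}"

text \<open>For a vector \<open>t\<close> consisting of \<open>a\<close> ones followed by zeros, a monomial of degree at most
  \<open>length t + 1\<close> is \<open>t\<close>-spread if and only if every variable dividing it more than once is preceded by
  at least \<open>a\<close> other variables dividing it, and \<open>adm a u\<close> is \<open>[max(u) - 1] - supp\<^sub>t(u)\<close>.\<close>

definition qspread :: "nat \<Rightarrow> mon \<Rightarrow> bool" where
  "qspread a w \<longleftrightarrow> (\<forall>i. 2 \<le> lookup w i \<longrightarrow> a \<le> rnk w i)"

definition adm :: "nat \<Rightarrow> mon \<Rightarrow> nat set" where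
  "adm a u = {k. 1 \<le> k \<and> k < maxv u \<and> (k \<in> keys u \<longrightarrow> a \<le> rnk u k)}"

text \<open>The largest \<open>qspread\<close> divisor of \<open>w\<close>: a variable preceded by
  fewer than \<open>a\<close> others is cut down to exponent 1. The supports of \<open>w\<close> and
  \<open>reduce a w\<close> agree, so the ranks may be taken in \<open>w\<close>.\<close>

definition reduce :: "nat \<Rightarrow> mon \<Rightarrow> mon" where
  "reduce a w = Poly_Mapping.mapp (\<lambda>i c. if rnk w i < a then min 1 c else c) w"

lemma rnk_mono: "keys u \<subseteq> keys w \<Longrightarrow> rnk u i \<le> rnk w i"
  unfolding rnk_def by (rule card_mono) auto

lemma rnk_cong: "(\<And>l. l < i \<Longrightarrow> l \<in> keys u \<longleftrightarrow> l \<in> keys w) \<Longrightarrow> rnk u i = rnk w i"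
  unfolding rnk_def by (rule arg_cong[where f=card]) auto

lemma lookup_reduce: "lookup (reduce a w) i = (if rnk w i < a then min 1 (lookup w i) else lookup w i)"
  by (auto simp: reduce_def lookup_mapp in_keys_iff when_def)

lemma mdvd_reduce [simp]: "mdvd (reduce a w) w"
  by (simp add: mdvd_iff lookup_reduce)

lemma reduce_qspread: "qspread a w \<Longrightarrow> reduce a w = w"
proof (rule poly_mapping_eqI)
  fix i assume "qspread a w"
  then have "2 \<le> lookup w i \<longrightarrow> a \<le> rnk w i" by (simp add: qspread_def)
  then show "lookup (reduce a w) i = lookup w i" by (auto simp: lookup_reduce min_def)
qed

text \<open>Ranks can only drop from \<open>w\<close> to its divisor \<open>v\<close>. Where
  \<open>reduce\<close> cuts an exponent to 1, the rank in \<open>v\<close> is below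
  \<open>a\<close> as well, so a \<open>qspread\<close> monomial \<open>v\<close> has exponent at
  most 1 there.\<close>

lemma mdvd_reduce_iff: "qspread a v \<Longrightarrow> mdvd v (reduce a w) \<longleftrightarrow> mdvd v w"
proof
  assume v: "qspread a v" "mdvd v w"
  show "mdvd v (reduce a w)" unfolding mdvd_iff
  proof
    fix i
    have "rnk v i \<le> rnk w i" using v(2) by (simp add: mdvd_keys rnk_mono)
    moreover have "lookup v i \<le> lookup w i" using v(2) by (simp add: mdvd_iff)
    moreover have "2 \<le> lookup v i \<longrightarrow> a \<le> rnk v i" using v(1) by (simp add: qspread_def)
    ultimately show "lookup v i \<le> lookup (reduce a w) i" by (auto simp: lookup_reduce)
  qed
qed (metis mdvd_trans mdvd_reduce)

lemma adm_subset: "adm a u \<subseteq> {1..<maxv u}"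
  by (auto simp: adm_def)

text \<open>Each admissible variable is added once, so a new repetition can only concern an
  admissible variable that already divides \<open>u\<close>, and \<open>adm\<close> demands rank at
  least \<open>a\<close> for these.\<close>

lemma qspread_add_adm:
  assumes "qspread a u" "A \<subseteq> adm a u" "finite A"
  shows "qspread a (sum xvar A + u)"
proof -
  have l: "lookup (sum xvar A) i = (if i \<in> A then 1 else 0)" for i
    using assms(3) by (simp add: lookup_sum lookup_xvar)
  have *: "rnk u i \<le> rnk (sum xvar A + u) i" for i by (rule rnk_mono) (simp add: keys_add_mon)
  show ?thesis unfolding qspread_def
  proof (intro allI impI)
    fix i assume i: "2 \<le> lookup (sum xvar A + u) i"
    then have "2 \<le> lookup u i \<or> (i \<in> adm a u \<and> i \<in> keys u)"
      using assms(2) by (auto simp: lookup_add l in_keys_iff split: if_splits)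
    then have "a \<le> rnk u i" using assms(1) by (auto simp: qspread_def adm_def)
    then show "a \<le> rnk (sum xvar A + u) i" using * order_trans by blast
  qed
qed

text \<open>Ranks only look at smaller indices, so those of \<open>p\<close> and \<open>w\<close>
  agree at all indices up to \<open>maxv p\<close>.\<close>

lemma qspread_prefix:
  assumes "qspread a w" "mdvd p w" "\<And>l. l < maxv p \<Longrightarrow> lookup p l = lookup w l"
  shows "qspread a p"
  unfolding qspread_def
proof (intro allI impI)
  fix i assume i: "2 \<le> lookup p i"
  then have "i \<le> maxv p" by (metis lookup_gt_maxv not_less not_numeral_le_zero)
  then have "rnk p i = rnk w i" by (intro rnk_cong) (simp add: assms(3) in_keys_iff)
  moreover have "2 \<le> lookup w i" using i assms(2) by (meson mdvd_iff order_trans)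
  ultimately show "a \<le> rnk p i" using assms(1) by (simp add: qspread_def)
qed

text \<open>Here \<open>M\<close> stands for the monomials of the ideal, \<open>a\<close> for the
  number of ones in t and \<open>dd\<close> for d. The field is absent: the decomposition function
  is a matter of monomials alone.\<close>

locale spread_ideal =
  fixes n a dd :: nat and M :: "mon set"
  assumes M_sub: "M \<subseteq> mons n"
    and M_add: "u \<in> M \<Longrightarrow> v \<in> mons n \<Longrightarrow> u + v \<in> M"
    and zero_notin_M: "0 \<notin> M"
    and gens_spread: "u \<in> M \<Longrightarrow> (\<And>v. v \<in> M \<Longrightarrow> mdvd v u \<Longrightarrow> v = u) \<Longrightarrow> qspread a u \<and> mdeg u \<le> dd"
    and stable: "u \<in> M \<Longrightarrow> qspread a u \<Longrightarrow> mdeg u \<le> dd \<Longrightarrow> i \<in> keys u \<Longrightarrow> 1 \<le> j \<Longrightarrow> j < i \<Longrightarrow>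
      qspread a (xvar j + (u - xvar i)) \<Longrightarrow> xvar j + (u - xvar i) \<in> M"
begin

definition G where "G = {u \<in> M. \<forall>v\<in>M. mdvd v u \<longrightarrow> v = u}"

definition gg where "gg w = Max {u \<in> G. mdvd u w}"

lemma G_sub: "G \<subseteq> M" by (auto simp: G_def)

lemma G_mons: "u \<in> G \<Longrightarrow> u \<in> mons n" using G_sub M_sub by auto

lemma G_minimal: "u \<in> G \<Longrightarrow> v \<in> M \<Longrightarrow> mdvd v u \<Longrightarrow> v = u" by (auto simp: G_def)

lemma G_nz: "u \<in> G \<Longrightarrow> u \<noteq> 0" using G_sub zero_notin_M by auto

lemma G_qspread: "u \<in> G \<Longrightarrow> qspread a u" and G_mdeg: "u \<in> G \<Longrightarrow> mdeg u \<le> dd"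
  using gens_spread by (auto simp: G_def)

lemma finite_G: "finite G"
  by (rule finite_subset[OF _ finite_mons_mdeg[of n dd]]) (use G_mons G_mdeg in auto)

lemma M_mdvd: "u \<in> M \<Longrightarrow> mdvd u w \<Longrightarrow> w \<in> mons n \<Longrightarrow> w \<in> M"
  by (metis M_add mdvd_def mons_add)

lemma G_divides: "w \<in> M \<Longrightarrow> \<exists>u\<in>G. mdvd u w"
proof (induction "mdeg w" arbitrary: w rule: less_induct)
  case less
  show ?case
  proof (cases "w \<in> G")
    case False
    then obtain v where v: "v \<in> M" "mdvd v w" "v \<noteq> w" using less.prems by (auto simp: G_def)
    then show ?thesis using less.hyps[of v] mdvd_mdeg_less mdvd_trans by blast
  qed (use mdvd_refl in blast)
qed

lemma gg_props:
  assumes "w \<in> M" shows "gg w \<in> G" "mdvd (gg w) w"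
proof -
  have "gg w \<in> {u \<in> G. mdvd u w}"
    unfolding gg_def by (rule Max_in) (use finite_G G_divides[OF assms] in auto)
  then show "gg w \<in> G" "mdvd (gg w) w" by auto
qed

lemma gg_ge: "u \<in> G \<Longrightarrow> mdvd u w \<Longrightarrow> u \<le> gg w"
  unfolding gg_def by (rule Max_ge) (use finite_G in auto)

text \<open>Generators are spread, so they divide \<open>w\<close> exactly when they divide its
  reduction.\<close>

lemma reduce_M_iff: "reduce a w \<in> M \<longleftrightarrow> w \<in> M" if "w \<in> mons n"
proof
  assume "w \<in> M"
  then obtain u where "u \<in> G" "mdvd u w" using G_divides by blast
  then have "mdvd u (reduce a w)" by (simp add: G_qspread mdvd_reduce_iff)
  then show "reduce a w \<in> M" using \<open>u \<in> G\<close> G_sub M_mdvd that by (meson mdvd_reduce mons_mdvd subsetD)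
qed (use M_mdvd mdvd_reduce that in blast)

text \<open>Below \<open>maxv p\<close> a spread divisor \<open>v\<close> of \<open>w\<close> cannot
  exceed \<open>p\<close>, which has the full exponents of \<open>reduce a w\<close> there. A
  lexicographically larger \<open>v\<close> therefore first differs from \<open>p\<close> at an
  index at or beyond \<open>maxv p\<close>, so \<open>p\<close> divides \<open>v\<close>, against
  the minimality of \<open>v\<close>.\<close>

lemma gg_eqI:
  assumes p: "p \<in> G" "mdvd p w" "\<And>l. l < maxv p \<Longrightarrow> lookup p l = lookup (reduce a w) l"
  shows "gg w = p"
  unfolding gg_def
proof (rule Max_eqI)
  fix v assume "v \<in> {u \<in> G. mdvd u w}"
  then have v: "v \<in> G" "mdvd v (reduce a w)" by (auto simp: G_qspread mdvd_reduce_iff)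
  show "v \<le> p"
  proof (rule ccontr)
    assume "\<not> v \<le> p"
    then obtain s where s: "lookup p s < lookup v s" "\<And>l. l < s \<Longrightarrow> lookup p l = lookup v l"
      unfolding not_le plex_less_iff by blast
    have "\<not> s < maxv p" using s(1) p(3)[of s] v(2) by (metis leD mdvd_iff)
    then have "lookup p i \<le> lookup v i" for i
      using s by (metis less_le_not_le linorder_neqE_nat lookup_gt_maxv nat_le_linear order_le_less_trans zero_le order_refl)
    then have "mdvd p v" by (simp add: mdvd_iff)
    then have "p = v" using G_minimal v(1) p(1) G_sub by blast
    then show False using s(1) by simp
  qed
qed (use finite_G p in auto)

text \<open>The exchange \<open>x\<^sub>i(v/x\<^sub>N)\<close> at the smallest index \<open>i\<close> where \<open>v\<close> and \<open>p\<close> differ contradicts the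
  minimality of the prefix \<open>p\<close>.\<close>

lemma prefix_exists:
  assumes "w \<in> M" "qspread a w"
  obtains p where "p \<in> G" "mdvd p w" "\<And>l. l < maxv p \<Longrightarrow> lookup p l = lookup w l"
proof -
  define P where "P = (\<lambda>p. p \<in> M \<and> mdvd p w \<and> (\<forall>l<maxv p. lookup p l = lookup w l))"
  have "P w" using assms by (simp add: P_def)
  \<comment> \<open>\<open>w\<close> itself is a prefix, so a prefix in \<open>M\<close> of least
    degree exists; it turns out to be a generator.\<close>
  then obtain p where p: "P p" "\<And>q. P q \<Longrightarrow> mdeg p \<le> mdeg q"
    using ex_has_least_nat[of P w mdeg] by blast
  define N where "N = maxv p"
  have pM: "p \<in> M" and pw: "mdvd p w" and agree: "\<And>l. l < N \<Longrightarrow> lookup p l = lookup w l"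
    using p(1) by (auto simp: P_def N_def)
  have "p \<noteq> 0" using pM zero_notin_M by auto
  then have N: "N \<in> keys p" by (simp add: N_def maxv_in_keys)
  define p' where "p' = p - xvar N"
  have p'p: "mdvd p' p" by (simp add: p'_def)
  have "p = xvar N + p'" by (simp add: p'_def xvar_add_diff N)
  then have "mdeg p' < mdeg p" by (simp add: mdeg_add)
  have p'l: "lookup p' l = lookup p l - (if l = N then 1 else 0)" for l
    by (simp add: p'_def lookup_minus lookup_xvar)
  have "p' \<notin> M"
  proof
    assume "p' \<in> M"
    then have "p' \<noteq> 0" using zero_notin_M by auto
    then have "maxv p' \<le> N" unfolding N_def using p'p by (rule maxv_mono[rotated])
    then have "P p'" using \<open>p' \<in> M\<close> pw p'p agree p'l by (auto simp: P_def intro: mdvd_trans)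
    then show False using p(2) \<open>mdeg p' < mdeg p\<close> by fastforce
  qed
  have qp: "qspread a p" using assms(2) pw agree by (auto simp: N_def intro: qspread_prefix)
  have "v = p" if v: "v \<in> G" "mdvd v p" for v
  proof (rule ccontr)
    assume "v \<noteq> p"
    have vM: "v \<in> M" using v G_sub by auto
    \<comment> \<open>\<open>v\<close> divides \<open>p\<close> but not \<open>p'\<close>, and
      \<open>p'\<close> lacks only one factor with index \<open>N\<close>: hence \<open>v\<close>
      contains the full power of this variable in \<open>p\<close>.\<close>
    have "\<not> mdvd v p'" using vM \<open>p' \<notin> M\<close> M_mdvd p'p pM M_sub mons_mdvd by blast
    then obtain l where l: "lookup v l > lookup p' l" by (auto simp: mdvd_iff not_le)
    have le: "lookup v l \<le> lookup p l" for l using v(2) by (simp add: mdvd_iff)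
    have "l = N"
    proof (rule ccontr)
      assume "l \<noteq> N"
      then have "lookup p' l = lookup p l" using p'l[of l] by simp
      then show False using l le[of l] by linarith
    qed
    moreover have "lookup p' N = lookup p N - 1" using p'l[of N] by simp
    ultimately have vN: "lookup v N = lookup p N" using l le[of N] by simp
    then have "N \<in> keys v" using N by (simp add: in_keys_iff)
    have "\<exists>i. lookup v i \<noteq> lookup p i" using \<open>v \<noteq> p\<close> poly_mapping_eqI[of v p] by auto
    then obtain i where i: "lookup v i \<noteq> lookup p i" "\<And>l. l < i \<Longrightarrow> lookup v l = lookup p l"
      using exists_least_iff[of "\<lambda>i. lookup v i \<noteq> lookup p i"] by auto
    have vi: "lookup v i < lookup p i" using i(1) le[of i] by simp
    then have "i \<in> keys p" by (simp add: in_keys_iff)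
    then have iN: "i < N" using maxv_ge[of i p] vN i(1) unfolding N_def by (metis le_neq_implies_less)
    have "1 \<le> i" using \<open>i \<in> keys p\<close> pM M_sub by (fastforce simp: mons_def)
    define v' where "v' = xvar i + (v - xvar N)"
    have v'l: "lookup v' l = (if l = i then lookup v l + 1 else if l = N then lookup v l - 1 else lookup v l)" for l
      using iN by (auto simp: v'_def lookup_add lookup_minus lookup_xvar)
    have "qspread a v'" unfolding qspread_def
    proof (intro allI impI)
      fix l assume l: "2 \<le> lookup v' l"
      show "a \<le> rnk v' l"
      proof (cases "l = i")
        case True
        have "rnk v' i = rnk p i" using i(2) iN by (intro rnk_cong) (auto simp: v'l in_keys_iff)
        moreover have "2 \<le> lookup p i" using l vi True by (simp add: v'l)
        ultimately show ?thesis using True qp by (simp add: qspread_def)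
      next
        case False
        then have "2 \<le> lookup v l" using l by (auto simp: v'l split: if_splits)
        then have "a \<le> rnk v l" using G_qspread[OF v(1)] by (simp add: qspread_def)
        \<comment> \<open>The exchange can only lose the variable with index \<open>N\<close>, which
          is not below \<open>l\<close>; so the rank at \<open>l\<close> does not drop.\<close>
        moreover have "l \<le> N"
          using \<open>2 \<le> lookup v l\<close> le[of l] maxv_ge[of l p] by (simp add: N_def in_keys_iff)
        then have "{j \<in> keys v. j < l} \<subseteq> {j \<in> keys v'. j < l}"
          by (auto simp: v'l in_keys_iff)
        then have "rnk v l \<le> rnk v' l" unfolding rnk_def by (intro card_mono) auto
        ultimately show ?thesis by simp
      qed
    qed
    then have "v' \<in> M" unfolding v'_def
      using stable[OF vM G_qspread[OF v(1)] G_mdeg[OF v(1)] \<open>N \<in> keys v\<close> \<open>1 \<le> i\<close> iN] by simp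
    moreover have "mdvd v' p'" unfolding mdvd_iff
      using le vi iN vN by (auto simp: v'l p'l Suc_le_eq)
    ultimately show False using \<open>p' \<notin> M\<close> M_mdvd p'p pM M_sub mons_mdvd by blast
  qed
  then have "p \<in> G" using G_divides[OF pM] by blast
  then show ?thesis using that pw agree by (auto simp: N_def)
qed

text \<open>A generator that is a prefix is automatically the lexicographic maximum, so the
  existence of one determines \<open>gg w\<close>.\<close>

lemma gg_prefix:
  assumes "w \<in> M" "qspread a w" "l < maxv (gg w)"
  shows "lookup (gg w) l = lookup w l"
proof -
  obtain p where p: "p \<in> G" "mdvd p w" "\<And>l. l < maxv p \<Longrightarrow> lookup p l = lookup w l"
    using prefix_exists[OF assms(1,2)] by blast
  then have "gg w = p" by (intro gg_eqI) (auto simp: reduce_qspread assms(2))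
  then show ?thesis using p(3)[of l] assms(3) by metis
qed

lemma gg_eqI_qspread:
  assumes "qspread a w" "p \<in> G" "mdvd p w" "\<And>l. l < maxv p \<Longrightarrow> lookup p l = lookup w l"
  shows "gg w = p"
proof (rule gg_eqI[OF assms(2,3)])
  show "lookup p l = lookup (reduce a w) l" if "l < maxv p" for l
    using assms(4)[OF that] reduce_qspread[OF assms(1)] by simp
qed

lemma adm_le_n: "u \<in> G \<Longrightarrow> k \<in> adm a u \<Longrightarrow> 1 \<le> k \<and> k < maxv u \<and> k \<le> n"
  using G_mons maxv_in_keys[OF G_nz] by (fastforce simp: adm_def mons_def)

lemma maxv_le_n: "u \<in> G \<Longrightarrow> 1 \<le> maxv u \<and> maxv u \<le> n"
  using G_mons maxv_in_keys[OF G_nz] by (fastforce simp: mons_def)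

lemma xk_in_M: "u \<in> G \<Longrightarrow> 1 \<le> k \<Longrightarrow> k \<le> n \<Longrightarrow> xvar k + u \<in> M"
  by (subst add.commute) (rule M_add, use G_sub in auto)

lemma qspread_xk: "u \<in> G \<Longrightarrow> k \<in> adm a u \<Longrightarrow> qspread a (xvar k + u)"
  using qspread_add_adm[of a u "{k}"] G_qspread by simp

text \<open>If the decomposition were \<open>u\<close>, the prefix property at the index
  \<open>k\<close>, which lies below \<open>maxv u\<close>, would give the variable the same
  exponent in \<open>u\<close> and in \<open>xvar k + u\<close>. The direction of the inequality is
  the maximality of \<open>gg\<close>.\<close>

lemma gg_xk_ne: 
  assumes "u \<in> G" "k \<in> adm a u"
  shows "u < gg (xvar k + u)"
proof -
  have kn: "1 \<le> k" "k \<le> n" "k < maxv u" using adm_le_n assms by auto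
  have "gg (xvar k + u) \<noteq> u"
    using gg_prefix[OF xk_in_M[OF assms(1) kn(1,2)] qspread_xk[OF assms], of k] kn
    by (auto simp: lookup_add lookup_xvar)
  moreover have "u \<le> gg (xvar k + u)" using assms by (intro gg_ge) auto
  ultimately show ?thesis by simp
qed

text \<open>If an admissible \<open>k\<close> divides \<open>m\<close>, the larger generator
  \<open>gg (xvar k + u)\<close> competes for \<open>u + m\<close> as well. Conversely, all
  variables of \<open>m\<close> below \<open>maxv u\<close> divide \<open>u\<close> with rank below
  \<open>a\<close>, so \<open>reduce\<close> removes their extra powers. The product need not be
  spread, hence the comparison with \<open>reduce a (u + m)\<close>. Both matchings rest on this
  lemma.\<close>

lemma gg_eq_iff:
  assumes "u \<in> G" "m \<in> mons n"
  shows "gg (u + m) = u \<longleftrightarrow> keys m \<inter> adm a u = {}"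
proof
  assume *: "gg (u + m) = u"
  show "keys m \<inter> adm a u = {}"
  proof (rule ccontr)
    assume "keys m \<inter> adm a u \<noteq> {}"
    then obtain k where k: "k \<in> keys m" "k \<in> adm a u" by auto
    have "u < gg (xvar k + u)" using gg_xk_ne assms(1) k(2) by auto
    have kn: "1 \<le> k" "k \<le> n" using adm_le_n[OF assms(1) k(2)] by auto
    have "mdvd (xvar k + u) (u + m)"
      using k(1) by (auto simp: mdvd_iff lookup_add lookup_xvar in_keys_iff)
    then have "gg (xvar k + u) \<le> gg (u + m)"
      using gg_props[OF xk_in_M[OF assms(1) kn]] mdvd_trans gg_ge by blast
    then show False using * \<open>u < gg (xvar k + u)\<close> by simp
  qed
next
  assume *: "keys m \<inter> adm a u = {}"
  have m1: "i \<in> keys u \<and> rnk u i < a" if "i \<in> keys m" "i < maxv u" for i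
    using * that assms(2) by (fastforce simp: adm_def mons_def)
  show "gg (u + m) = u"
  proof (rule gg_eqI)
    fix l assume l: "l < maxv u"
    have r: "rnk (u + m) l = rnk u l" using l m1 by (intro rnk_cong) (auto simp: keys_add_mon)
    have q: "2 \<le> lookup u l \<Longrightarrow> a \<le> rnk u l" using G_qspread[OF assms(1)] by (simp add: qspread_def)
    show "lookup u l = lookup (reduce a (u + m)) l"
    proof (cases "l \<in> keys m")
      case True
      then have "l \<in> keys u" "rnk u l < a" using m1 l by auto
      then have "lookup u l = 1" using q by (fastforce simp: in_keys_iff)
      then show ?thesis using \<open>rnk u l < a\<close> by (simp add: lookup_reduce r lookup_add)
    next
      case False
      then have "lookup m l = 0" by (simp add: in_keys_iff)
      then show ?thesis using q by (cases "2 \<le> lookup u l") (auto simp: lookup_reduce r lookup_add min_def)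
    qed
  qed (use assms in auto)
qed

lemma gg_xk_notadm: "u \<in> G \<Longrightarrow> 1 \<le> k \<Longrightarrow> k \<le> n \<Longrightarrow> k \<notin> adm a u \<Longrightarrow> gg (xvar k + u) = u"
  using gg_eq_iff[of u "xvar k"] by (simp add: add.commute)

lemma maxv_gg_xk:
  assumes "u \<in> G" "1 \<le> k" "k \<le> n"
  shows "maxv (gg (xvar k + u)) \<le> maxv u"
proof (cases "k \<in> adm a u")
  case True
  have "maxv (gg (xvar k + u)) \<le> maxv (xvar k + u)"
    using gg_props[OF xk_in_M[OF assms]] G_nz by (intro maxv_mono) auto
  also have "maxv (xvar k + u) = maxv u"
    using True maxv_in_keys[OF G_nz[OF assms(1)]]
    by (intro maxv_eqI) (auto simp: keys_add_mon maxv_ge adm_def)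
  finally show ?thesis .
qed (use gg_xk_notadm assms in auto)

text \<open>Otherwise \<open>gg (xvar k + u)\<close> would contain the full power of the last
  variable of \<open>u\<close> and, being a prefix, everything of \<open>u\<close> before it; it
  would be a multiple of \<open>u\<close> and hence \<open>u\<close> itself. This is what makes the
  division of \<open>v\<^sub>k\<close> by the last variable exact.\<close>

lemma maxv_in_vk:
  assumes "u \<in> G" "k \<in> adm a u"
  shows "maxv u \<in> keys (xvar k + u - gg (xvar k + u))"
proof (rule ccontr)
  define N where "N = maxv u"
  define p where "p = gg (xvar k + u)"
  assume "maxv u \<notin> keys (xvar k + u - gg (xvar k + u))"
  then have "lookup (xvar k + u) N \<le> lookup p N"
    by (simp add: in_keys_iff lookup_minus N_def p_def)
  have kn: "1 \<le> k" "k \<le> n" "k < N" using adm_le_n assms by (auto simp: N_def)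
  have w: "xvar k + u \<in> M" "qspread a (xvar k + u)" using xk_in_M qspread_xk assms kn by auto
  have p: "p \<in> G" "mdvd p (xvar k + u)" using gg_props[OF w(1)] by (auto simp: p_def)
  have pN: "lookup p N = lookup (xvar k + u) N"
    using \<open>lookup (xvar k + u) N \<le> lookup p N\<close> p(2) by (simp add: mdvd_iff order_antisym)
  have "N \<in> keys u" using maxv_in_keys[OF G_nz[OF assms(1)]] by (simp add: N_def)
  then have "N \<in> keys p" using pN by (auto simp: in_keys_iff lookup_add)
  then have "N \<le> maxv p" by (rule maxv_ge)
  then have "lookup u i \<le> lookup p i" for i
    using gg_prefix[OF w, of i] pN lookup_gt_maxv[of u i]
    by (cases "i < N"; cases "i = N") (auto simp: p_def lookup_add N_def)
  then have "mdvd u p" by (simp add: mdvd_iff)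
  then have "u = p" using G_minimal[OF p(1)] assms(1) G_sub by blast
  then show False using gg_xk_ne[OF assms] by (simp add: p_def)
qed

text \<open>An inadmissible \<open>j\<close> below the last variable of \<open>u\<^sub>k\<close> has
  rank below \<open>a\<close> in \<open>u\<^sub>k\<close> and divides \<open>u\<close>, where its
  rank is at least \<open>a\<close>. As \<open>u\<^sub>k\<close> is a prefix of
  \<open>xvar k + u\<close>, the two ranks contradict each other.\<close>

lemma notadm_gg_xk:
  assumes "u \<in> G" "k \<in> adm a u" "j \<in> adm a u" "j \<noteq> k" "j \<notin> adm a (gg (xvar k + u))"
  shows "maxv (gg (xvar k + u)) \<le> j"
proof (rule ccontr)
  define p where "p = gg (xvar k + u)"
  assume "\<not> maxv (gg (xvar k + u)) \<le> j"
  then have j: "j < maxv p" by (simp add: p_def)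
  have kn: "1 \<le> k" "k \<le> n" using adm_le_n assms by auto
  note pre = gg_prefix[OF xk_in_M[OF assms(1) kn] qspread_xk[OF assms(1,2)], folded p_def]
  have "j \<in> keys p" "rnk p j < a" using assms(5,3) j by (auto simp: p_def adm_def)
  then have "j \<in> keys u" using pre[OF j] assms(4) by (simp add: in_keys_iff lookup_add lookup_xvar)
  then have "a \<le> rnk u j" using assms(3) by (simp add: adm_def)
  also have "\<dots> \<le> rnk p j" unfolding rnk_def using pre j
    by (intro card_mono) (auto simp: in_keys_iff lookup_add)
  finally show False using \<open>rnk p j < a\<close> by simp
qed

text \<open>The right-hand side is symmetric in \<open>j\<close> and \<open>k\<close>, which is the
  purpose. If \<open>j\<close> lies below the last variable of \<open>u\<^sub>k\<close>, then the
  product of x_j and \<open>u\<^sub>k\<close> is a prefix of the full product, and its decomposition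
  is a prefix of both; otherwise \<open>u\<^sub>k\<close> itself is already a prefix of the full
  product.\<close>

lemma gg_xj_xk:
  assumes "u \<in> G" "k \<in> adm a u" "j \<in> adm a u" "j \<noteq> k"
  shows "gg (xvar j + gg (xvar k + u)) = gg (xvar j + (xvar k + u))"
proof -
  define p where "p = gg (xvar k + u)"
  define w where "w = xvar j + (xvar k + u)"
  have kn: "1 \<le> k" "k \<le> n" "1 \<le> j" "j \<le> n" using adm_le_n assms by auto
  have xM: "xvar k + u \<in> M" using xk_in_M assms(1) kn by auto
  note pre = gg_prefix[OF xM qspread_xk[OF assms(1,2)], folded p_def]
  have p: "p \<in> G" "mdvd p (xvar k + u)" using gg_props[OF xM] by (auto simp: p_def)
  have qw: "qspread a w"
    using qspread_add_adm[of a u "{j,k}"] assms G_qspread by (simp add: w_def add.assoc)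
  have pw: "mdvd (xvar j + p) w" using p(2) by (auto simp: mdvd_iff w_def lookup_add)
  show ?thesis
  proof (cases "j < maxv p")
    case True
    have mx: "maxv (xvar j + p) = maxv p"
      by (rule maxv_eqI) (use True maxv_in_keys[OF G_nz[OF p(1)]] maxv_ge[of _ p] in \<open>auto simp: keys_add_mon\<close>)
    have ag: "lookup (xvar j + p) l = lookup w l" if "l < maxv p" for l
      using pre[OF that] by (simp add: w_def lookup_add)
    have q: "qspread a (xvar j + p)" by (rule qspread_prefix[OF qw pw]) (simp add: ag mx)
    have M': "xvar j + p \<in> M" using xk_in_M[OF p(1)] kn by simp
    have "gg w = gg (xvar j + p)"
    proof (rule gg_eqI_qspread[OF qw])
      show "mdvd (gg (xvar j + p)) w" using gg_props[OF M'] pw mdvd_trans by blast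
      fix l assume l: "l < maxv (gg (xvar j + p))"
      also have "\<dots> \<le> maxv p" using maxv_gg_xk[OF p(1)] kn by simp
      finally show "lookup (gg (xvar j + p)) l = lookup w l" using gg_prefix[OF M' q l] ag[of l] by metis
    qed (use gg_props[OF M'] in auto)
    then show ?thesis by (simp add: w_def p_def)
  next
    case False
    then have "j \<notin> adm a p" by (auto simp: adm_def)
    then have "gg (xvar j + p) = p" using gg_xk_notadm[OF p(1)] kn by simp
    moreover have "gg w = p"
    proof (rule gg_eqI_qspread[OF qw p(1)])
      show "mdvd p w" using pw by (meson mdvd_add_left(2) mdvd_trans)
      fix l assume "l < maxv p"
      then show "lookup p l = lookup w l" using pre[of l] False by (simp add: w_def lookup_add lookup_xvar)
    qed
    ultimately show ?thesis by (simp add: w_def p_def)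
  qed
qed

end

section \<open>Spread monomials and their supports through lists of variables\<close>

lemma sorted_var_list: "sorted (var_list u)"
proof -
  have "sorted (concat (map (\<lambda>i. replicate (f i) i) xs))" if "sorted xs" for f :: "nat \<Rightarrow> nat" and xs
    using that by (induction xs) (auto simp: sorted_append sorted_replicate)
  then show ?thesis by (simp add: var_list_def)
qed

lemma set_var_list: "set (var_list u) = keys u"
  by (auto simp: var_list_def in_keys_iff)

lemma length_var_list: "length (var_list u) = mdeg u"
  by (simp add: var_list_def length_concat mdeg_def comp_def sum_list_distinct_conv_sum_set)

lemma count_var_list: "count_list (var_list u) i = lookup u i"
proof -
  have "count_list (replicate m j) i = (if i = j then m else 0)" for m j
    by (induction m) auto
  then have "count_list (concat (map (\<lambda>i. replicate (f i) i) xs)) i = (if i \<in> set xs then f i else 0)"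
    if "distinct xs" for f :: "nat \<Rightarrow> nat" and xs
    using that by (induction xs) (auto simp: count_list_append)
  then show ?thesis by (simp add: var_list_def in_keys_iff)
qed

text \<open>Equal entries of a sorted list are adjacent; this turns a condition on neighbours into
  one on exponents.\<close>

lemma lookup_ge_2_iff:
  "2 \<le> lookup u i \<longleftrightarrow> (\<exists>r. r + 1 < length (var_list u) \<and> var_list u ! r = i \<and> var_list u ! (r + 1) = i)"
proof -
  define xs where "xs = var_list u"
  define R where "R = {r. r < length xs \<and> xs ! r = i}"
  have fin: "finite R" by (simp add: R_def)
  have "lookup u i = card R"
    unfolding count_var_list[symmetric] xs_def[symmetric] R_def count_list_eq_length_filter length_filter_conv_card
    by (rule arg_cong[where f=card]) auto
  moreover have "2 \<le> card R \<longleftrightarrow> (\<exists>r. r + 1 < length xs \<and> xs ! r = i \<and> xs ! (r + 1) = i)"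
  proof
    assume "2 \<le> card R"
    then obtain p q where "p \<in> R" "q \<in> R" "p \<noteq> q" using card_le_Suc0_iff_eq[OF fin] by force
    then obtain r s where rs: "r \<in> R" "s \<in> R" "r < s" by (metis linorder_neqE_nat)
    then have "r + 1 < length xs" "r + 1 \<le> s" "s < length xs" by (auto simp: R_def)
    then have "xs ! r \<le> xs ! (r + 1)" "xs ! (r + 1) \<le> xs ! s"
      unfolding xs_def by (auto intro!: sorted_nth_mono[OF sorted_var_list] simp del: One_nat_def)
    moreover have "xs ! r = i" "xs ! s = i" using rs by (auto simp: R_def)
    ultimately have "xs ! (r + 1) = i" by linarith
    then show "\<exists>r. r + 1 < length xs \<and> xs ! r = i \<and> xs ! (r + 1) = i"
      using \<open>xs ! r = i\<close> \<open>r + 1 < length xs\<close> by blast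
  next
    assume "\<exists>r. r + 1 < length xs \<and> xs ! r = i \<and> xs ! (r + 1) = i"
    then obtain r where "r + 1 < length xs" "xs ! r = i" "xs ! (r + 1) = i" by blast
    then have "{r, r + 1} \<subseteq> R" by (auto simp: R_def)
    then have "card {r, r + 1} \<le> card R" using fin card_mono by blast
    then show "2 \<le> card R" by simp
  qed
  ultimately show ?thesis by (simp add: xs_def)
qed

text \<open>Variables below the entry at position \<open>r\<close> all occur at positions before
  \<open>r\<close>.\<close>

lemma rnk_var_list_le:
  assumes "r < length (var_list u)"
  shows "rnk u (var_list u ! r) \<le> r"
proof -
  have "{j \<in> keys u. j < var_list u ! r} \<subseteq> (!) (var_list u) ` {..<r}"
  proof
    fix j assume j: "j \<in> {j \<in> keys u. j < var_list u ! r}"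
    then obtain p where p: "p < length (var_list u)" "var_list u ! p = j"
      by (metis (mono_tags) in_set_conv_nth mem_Collect_eq set_var_list)
    have "p < r"
      using sorted_nth_mono[OF sorted_var_list, of r p u] p j by (metis (mono_tags) leI leD mem_Collect_eq)
    then show "j \<in> (!) (var_list u) ` {..<r}" using p by auto
  qed
  then have "rnk u (var_list u ! r) \<le> card ((!) (var_list u) ` {..<r})"
    unfolding rnk_def by (intro card_mono) auto
  also have "\<dots> \<le> card {..<r}" by (rule card_image_le) simp
  finally show ?thesis by simp
qed

text \<open>The first \<open>a\<close> entries are pairwise distinct variables below
  \<open>i\<close>.\<close>

lemma rnk_ge:
  assumes "a < length (var_list u)" "\<And>r. r < a \<Longrightarrow> var_list u ! r < var_list u ! (r + 1)"
    and "var_list u ! a \<le> i"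
  shows "a \<le> rnk u i"
proof -
  define xs where "xs = var_list u"
  have mono: "xs ! p < xs ! q" if "p < q" "q \<le> a" for p q
    using that
  proof (induction q)
    case (Suc q)
    then show ?case using assms(2)[of q] by (cases "p = q") (auto simp: xs_def)
  qed simp
  have "inj_on ((!) xs) {..<a}"
    by (rule linorder_inj_onI) (use mono in fastforce)+
  then have "a = card ((!) xs ` {..<a})" by (simp add: card_image)
  also have "\<dots> \<le> rnk u i" unfolding rnk_def
  proof (rule card_mono)
    show "(!) xs ` {..<a} \<subseteq> {j \<in> keys u. j < i}"
    proof (rule image_subsetI)
      fix p assume "p \<in> {..<a}"
      then have "xs ! p < xs ! a" "p < length xs" using mono assms(1) by (auto simp: xs_def)
      then show "xs ! p \<in> {j \<in> keys u. j < i}" using assms(3) nth_mem by (force simp: xs_def set_var_list[symmetric])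
    qed
  qed simp
  finally show ?thesis .
qed

lemma block_nth: "r < a + b \<Longrightarrow> (replicate a 1 @ replicate b 0) ! r = (if r < a then 1 else (0::nat))"
  by (simp add: nth_append)

text \<open>The list is sorted anyway, so an entry 0 of \<open>t\<close> demands nothing and an
  entry 1 only forbids equal neighbours. Equal neighbours thus occur only at positions from
  \<open>a\<close> on, and the first \<open>a\<close> entries are distinct predecessors. The degree
  bound keeps the relevant positions inside \<open>t\<close>.\<close>

lemma spread_iff:
  assumes "t = replicate a 1 @ replicate b 0"
  shows "spread t u \<longleftrightarrow> mdeg u \<le> a + b + 1 \<and> qspread a u"
proof (cases "mdeg u \<le> a + b + 1")
  case True
  define xs where "xs = var_list u"
  have tr: "t ! r = (if r < a then 1 else 0)" if "r + 1 < length xs" for r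
    unfolding assms by (rule block_nth) (use that True in \<open>simp add: xs_def length_var_list\<close>)
  have so: "xs ! r \<le> xs ! (r + 1)" if "r + 1 < length xs" for r
    using that sorted_nth_mono[OF sorted_var_list] by (simp add: xs_def)
  have "(\<forall>r. r + 1 < length xs \<longrightarrow> xs ! r + t ! r \<le> xs ! (r + 1)) \<longleftrightarrow>
      (\<forall>r. r + 1 < length xs \<longrightarrow> r < a \<longrightarrow> xs ! r < xs ! (r + 1))"
    using tr so by auto
  also have "\<dots> \<longleftrightarrow> qspread a u"
  proof
    assume *: "\<forall>r. r + 1 < length xs \<longrightarrow> r < a \<longrightarrow> xs ! r < xs ! (r + 1)"
    show "qspread a u" unfolding qspread_def
    proof (intro allI impI)
      fix i assume "2 \<le> lookup u i"
      then obtain r where r: "r + 1 < length xs" "xs ! r = i" "xs ! (r + 1) = i"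
        unfolding lookup_ge_2_iff xs_def[symmetric] by blast
      then have "a \<le> r" using * by (metis leI less_irrefl)
      show "a \<le> rnk u i"
      proof (rule rnk_ge)
        show "a < length (var_list u)" using \<open>a \<le> r\<close> r by (simp add: xs_def)
        show "var_list u ! p < var_list u ! (p + 1)" if "p < a" for p
          using * that \<open>a \<le> r\<close> r by (simp add: xs_def)
        show "var_list u ! a \<le> i"
          using \<open>a \<le> r\<close> r sorted_nth_mono[OF sorted_var_list, of a r u] by (simp add: xs_def)
      qed
    qed
  next
    assume q: "qspread a u"
    show "\<forall>r. r + 1 < length xs \<longrightarrow> r < a \<longrightarrow> xs ! r < xs ! (r + 1)"
    proof (intro allI impI, rule ccontr)
      fix r assume r: "r + 1 < length xs" "r < a" "\<not> xs ! r < xs ! (r + 1)"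
      then have "2 \<le> lookup u (xs ! r)" unfolding lookup_ge_2_iff xs_def[symmetric]
        using so[of r] by (intro exI[of _ r]) auto
      then have "a \<le> rnk u (xs ! r)" using q by (simp add: qspread_def)
      then show False using r rnk_var_list_le[of r u] by (simp add: xs_def)
    qed
  qed
  finally show ?thesis using True assms unfolding spread_def
    by (simp add: xs_def length_var_list)
next
  case False
  then show ?thesis using assms by (simp add: spread_def length_var_list)
qed

text \<open>With entries 0 and 1 the support consists of the list entries at positions below
  \<open>a\<close>, the last position of the list excluded. For a variable below
  \<open>maxv u\<close>, having such a position amounts to rank less than \<open>a\<close>.\<close>

lemma admissible_eq_adm:
  assumes t: "t = replicate a 1 @ replicate b 0" and u: "spread t u"
  shows "admissible t u = adm a u"
proof -
  define xs where "xs = var_list u"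
  have deg: "mdeg u \<le> a + b + 1" using u spread_iff[OF t] by auto
  have tr: "t ! r = (if r < a then 1 else 0)" if "r + 1 < length xs" for r
    unfolding t by (rule block_nth) (use that deg in \<open>simp add: xs_def length_var_list\<close>)
  have strict: "xs ! r < xs ! (r + 1)" if "r + 1 < length xs" "r < a" for r
    using u tr[OF that(1)] that unfolding spread_def xs_def by fastforce
  have "k \<in> spread_supp t u \<longleftrightarrow> k \<in> keys u \<and> rnk u k < a" if k: "k < maxv u" for k
  proof
    assume "k \<in> spread_supp t u"
    then obtain r where r: "r + 1 < length xs" "k = xs ! r" "r < a"
      using tr by (fastforce simp: spread_supp_def xs_def split: if_splits)
    then show "k \<in> keys u \<and> rnk u k < a"
      using rnk_var_list_le[of r u] nth_mem[of r xs] by (auto simp: xs_def set_var_list)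
  next
    assume *: "k \<in> keys u \<and> rnk u k < a"
    then obtain r where r: "r < length xs" "k = xs ! r"
      by (metis in_set_conv_nth set_var_list xs_def)
    have "maxv u \<in> keys u" using * by (intro maxv_in_keys) auto
    then obtain s where s: "s < length xs" "maxv u = xs ! s"
      by (metis in_set_conv_nth set_var_list xs_def)
    \<comment> \<open>The support ignores the last position; \<open>k\<close> is below
      \<open>maxv u\<close>, so its position is not the last.\<close>
    have "r < s" using sorted_nth_mono[OF sorted_var_list, of s r u] r s k
      by (metis leI leD xs_def)
    have "r < a"
    proof (rule ccontr)
      assume "\<not> r < a"
      then have "a \<le> rnk u k"
        using r \<open>r < s\<close> s strict sorted_nth_mono[OF sorted_var_list, of a r u]
        by (intro rnk_ge) (auto simp: xs_def)
      then show False using * by simp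
    qed
    then show "k \<in> spread_supp t u"
      using r \<open>r < s\<close> s tr[of r] unfolding spread_supp_def xs_def[symmetric]
      by (intro UN_I[of r]) auto
  qed
  then show ?thesis by (auto simp: admissible_def adm_def)
qed

section \<open>Monomial ideals\<close>

lemma mpoly_ring_simps [simp]:
  "p \<in> carrier (mpoly_ring n) \<longleftrightarrow> keys p \<subseteq> mons n"
  "x \<otimes>\<^bsub>mpoly_ring n\<^esub> y = x * y" "\<one>\<^bsub>mpoly_ring n\<^esub> = 1"
  "\<zero>\<^bsub>mpoly_ring n\<^esub> = 0" "x \<oplus>\<^bsub>mpoly_ring n\<^esub> y = x + y" "x \<odot>\<^bsub>mpoly_ring n\<^esub> y = x * y"
  by (simp_all add: mpoly_ring_def)

lemma keys_add_mons: "keys p \<subseteq> A \<Longrightarrow> keys q \<subseteq> A \<Longrightarrow> keys (p + q) \<subseteq> A"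
  using keys_add[of p q] by auto

lemma keys_mult_mons: "keys p \<subseteq> mons n \<Longrightarrow> keys q \<subseteq> mons n \<Longrightarrow> keys (p * q) \<subseteq> mons n"
  using keys_mult[of p q] by (fastforce simp: mons_add)

lemma keys_uminus [simp]: "keys (- p) = keys (p :: 'a \<Rightarrow>\<^sub>0 'b::ab_group_add)"
  by (auto simp: in_keys_iff)

lemma keys_minus_mons: "keys p \<subseteq> A \<Longrightarrow> keys q \<subseteq> A \<Longrightarrow> keys (p - q :: 'a \<Rightarrow>\<^sub>0 'b::ab_group_add) \<subseteq> A"
  using keys_add_mons[of p A "- q"] by simp

lemma keys_sum_mons: "(\<And>x. x \<in> A \<Longrightarrow> keys (f x) \<subseteq> B) \<Longrightarrow> keys (sum f A) \<subseteq> B"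
  by (induction A rule: infinite_finite_induct) (simp_all add: keys_add_mons)

lemma poly_expand: "p = (\<Sum>m\<in>keys p. single m (lookup p m))"
  by (intro poly_mapping_eqI) (simp add: lookup_sum lookup_single when_def in_keys_iff)

lemma mpoly_cring: "cring (mpoly_ring n :: ('k::field mpoly, 'k mpoly) module)"
proof (rule cringI)
  show "abelian_group (mpoly_ring n :: ('k mpoly, 'k mpoly) module)"
  proof (rule abelian_groupI)
    fix x assume "x \<in> carrier (mpoly_ring n :: ('k mpoly, 'k mpoly) module)"
    then show "\<exists>y\<in>carrier (mpoly_ring n). y \<oplus>\<^bsub>mpoly_ring n\<^esub> x = \<zero>\<^bsub>mpoly_ring n\<^esub>"
      by (intro bexI[of _ "- x"]) auto
  qed (auto simp: keys_add_mons add_ac intro: set_mp[OF keys_add_mons])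
  show "Group.comm_monoid (mpoly_ring n :: ('k mpoly, 'k mpoly) module)"
    by (rule comm_monoidI) (auto simp: mult_ac intro: set_mp[OF keys_mult_mons])
qed (auto simp: distrib_right)

interpretation mpoly: cring "mpoly_ring n :: ('k::field mpoly, 'k mpoly) module" for n
  by (rule mpoly_cring)

lemma mpoly_uminus: "keys p \<subseteq> mons n \<Longrightarrow> \<ominus>\<^bsub>mpoly_ring n\<^esub> p = - p"
  by (rule mpoly.minus_equality) auto

lemma genideal_monomials:
  assumes "A \<subseteq> mons n"
  shows "genideal (mpoly_ring n) (mono_poly ` A :: 'k::field mpoly set) =
    {p. keys p \<subseteq> {w \<in> mons n. \<exists>u\<in>A. mdvd u w}}" (is "_ = ?J")
proof
  have "ideal ?J (mpoly_ring n)"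
  proof (rule idealI)
    show "subgroup ?J (add_monoid (mpoly_ring n))"
    proof (rule mpoly.add.subgroupI)
      show "\<ominus>\<^bsub>mpoly_ring n\<^esub> p \<in> ?J" if "p \<in> ?J" for p
        using that by (subst mpoly_uminus) auto
      show "p \<oplus>\<^bsub>mpoly_ring n\<^esub> q \<in> ?J" if "p \<in> ?J" "q \<in> ?J" for p q
        using that keys_add_mons[of p _ q] by simp
    qed (auto intro!: exI[of _ 0])
    fix p x :: "'k mpoly" assume p: "p \<in> ?J" and x: "x \<in> carrier (mpoly_ring n)"
    have "keys (x * p) \<subseteq> {w \<in> mons n. \<exists>u\<in>A. mdvd u w}"
      using keys_mult[of x p] p x by (fastforce simp: mons_add intro: mdvd_trans[of _ _ "_ + _"])
    then show "x \<otimes>\<^bsub>mpoly_ring n\<^esub> p \<in> ?J" "p \<otimes>\<^bsub>mpoly_ring n\<^esub> x \<in> ?J" by (auto simp: mult.commute)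
  qed (rule mpoly.ring_axioms)
  moreover have "mono_poly ` A \<subseteq> ?J" using assms mdvd_refl by (fastforce simp: mono_poly_def)
  ultimately show "genideal (mpoly_ring n) (mono_poly ` A) \<subseteq> ?J" by (rule mpoly.genideal_minimal)
next
  have sub: "(mono_poly ` A :: 'k mpoly set) \<subseteq> carrier (mpoly_ring n)"
    using assms by (auto simp: mono_poly_def)
  interpret J: ideal "genideal (mpoly_ring n) (mono_poly ` A :: 'k mpoly set)" "mpoly_ring n"
    by (rule mpoly.genideal_ideal[OF sub])
  show "?J \<subseteq> genideal (mpoly_ring n) (mono_poly ` A)"
  proof
    fix p assume p: "p \<in> ?J"
    have "(\<Sum>m\<in>B. single m (lookup p m)) \<in> genideal (mpoly_ring n) (mono_poly ` A)"
      if "B \<subseteq> keys p" for B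
      using finite_subset[OF that finite_keys] that
    proof (induction B rule: finite_induct)
      case empty then show ?case using J.a_subgroup additive_subgroup.zero_closed J.is_additive_subgroup by force
    next
      case (insert m B)
      then obtain u where u: "u \<in> A" "mdvd u m" "m \<in> mons n" using p by auto
      have "single m (lookup p m) = single (m - u) (lookup p m) * mono_poly u"
        using mdvd_add_diff[OF u(2)] by (simp add: mono_poly_def mult_single add.commute)
      moreover have "mono_poly u \<in> genideal (mpoly_ring n) (mono_poly ` A :: 'k mpoly set)"
        using mpoly.genideal_self[OF sub] u by auto
      ultimately have "single m (lookup p m) \<in> genideal (mpoly_ring n) (mono_poly ` A)"
        using J.I_l_closed[of "mono_poly u" "single (m - u) (lookup p m)"] u by (auto simp: diff_in_mons)
      moreover have "(\<Sum>m\<in>B. single m (lookup p m)) \<in> genideal (mpoly_ring n) (mono_poly ` A)"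
        using insert by simp
      ultimately show ?case
        using insert additive_subgroup.a_closed[OF J.is_additive_subgroup] by force
    qed
    then show "p \<in> genideal (mpoly_ring n) (mono_poly ` A)" by (subst poly_expand) auto
  qed
qed

definition ideal_mons :: "nat \<Rightarrow> 'k::field mpoly set \<Rightarrow> mon set" where
  "ideal_mons n I = {w \<in> mons n. mono_poly w \<in> I}"

lemma monomial_ideal_char:
  assumes "monomial_ideal n (I :: 'k::field mpoly set)"
  shows "I = {p. keys p \<subseteq> ideal_mons n I}"
    and "u \<in> ideal_mons n I \<Longrightarrow> v \<in> mons n \<Longrightarrow> u + v \<in> ideal_mons n I"
proof -
  obtain A where A: "A \<subseteq> mons n" "I = genideal (mpoly_ring n) (mono_poly ` A)"
    using assms by (auto simp: monomial_ideal_def)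
  have I: "I = {p. keys p \<subseteq> {w \<in> mons n. \<exists>u\<in>A. mdvd u w}}" using genideal_monomials[OF A(1)] A(2) by simp
  have M: "ideal_mons n I = {w \<in> mons n. \<exists>u\<in>A. mdvd u w}"
    by (auto simp: ideal_mons_def I mono_poly_def)
  show "I = {p. keys p \<subseteq> ideal_mons n I}" using I M by simp
  show "u \<in> ideal_mons n I \<Longrightarrow> v \<in> mons n \<Longrightarrow> u + v \<in> ideal_mons n I"
    unfolding M mons_add mem_Collect_eq using mdvd_trans mdvd_add_left(1) by blast
qed

lemma ex_minimal_divisor: "w \<in> M \<Longrightarrow> \<exists>u\<in>M. mdvd u w \<and> (\<forall>v\<in>M. mdvd v u \<longrightarrow> v = u)"
proof (induction "mdeg w" arbitrary: w rule: less_induct)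
  case less
  show ?case
  proof (cases "\<forall>v\<in>M. mdvd v w \<longrightarrow> v = w")
    case False
    then obtain v where v: "v \<in> M" "mdvd v w" "v \<noteq> w" by auto
    then show ?thesis using less.hyps[of v] mdvd_mdeg_less mdvd_trans by blast
  qed (use less.prems mdvd_refl in blast)
qed

text \<open>A divisibility-minimal element can only be generated by itself, so it lies in every
  generating set of monomials. Irredundance therefore leaves exactly one candidate for the
  \<open>THE\<close>.\<close>

lemma min_gens_eq:
  assumes "monomial_ideal n (I :: 'k::field mpoly set)"
  shows "min_gens n I = {u \<in> ideal_mons n I. \<forall>v\<in>ideal_mons n I. mdvd v u \<longrightarrow> v = u}" (is "_ = ?G")
proof -
  define M where "M = ideal_mons n I"
  have Mm: "M \<subseteq> mons n" by (auto simp: M_def ideal_mons_def)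
  have I: "I = {p. keys p \<subseteq> M}" and add: "\<And>u v. u \<in> M \<Longrightarrow> v \<in> mons n \<Longrightarrow> u + v \<in> M"
    using monomial_ideal_char[OF assms] by (auto simp: M_def)
  have gen: "I = genideal (mpoly_ring n) (mono_poly ` H) \<longleftrightarrow> M = {w \<in> mons n. \<exists>u\<in>H. mdvd u w}"
    if "H \<subseteq> mons n" for H
  proof -
    have "{p :: 'k mpoly. keys p \<subseteq> A} = {p. keys p \<subseteq> B} \<longleftrightarrow> A = B" for A B :: "mon set"
    proof
      assume *: "{p :: 'k mpoly. keys p \<subseteq> A} = {p. keys p \<subseteq> B}"
      have "x \<in> A \<longleftrightarrow> x \<in> B" for x
        using eqset_imp_iff[OF *, of "single x 1"] by simp
      then show "A = B" by blast
    qed simp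
    then show ?thesis using genideal_monomials[OF that, where 'k='k] I by simp
  qed
  show ?thesis unfolding min_gens_def M_def[symmetric]
  proof (rule the_equality)
    let ?G = "{u \<in> M. \<forall>v\<in>M. mdvd v u \<longrightarrow> v = u}"
    have G: "M = {w \<in> mons n. \<exists>u\<in>?G. mdvd u w}"
    proof -
      have "w \<in> M" if "w \<in> mons n" "u \<in> M" "mdvd u w" for u w
        using that add[of u "w - u"] mdvd_add_diff[OF that(3)] diff_in_mons[OF that(1)] by simp
      then show ?thesis using ex_minimal_divisor[of _ M] Mm by blast
    qed
    have "I \<noteq> genideal (mpoly_ring n) (mono_poly ` H)" if HG: "H \<subset> ?G" for H
    proof
      assume "I = genideal (mpoly_ring n) (mono_poly ` H)"
      then have M: "M = {w \<in> mons n. \<exists>u\<in>H. mdvd u w}" using gen[of H] that Mm by blast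
      obtain w where w: "w \<in> ?G" "w \<notin> H" using psubset_imp_ex_mem[OF HG] by blast
      then obtain u where "u \<in> H" "mdvd u w" using M by blast
      then show False using w that by blast
    qed
    then show "?G \<subseteq> mons n \<and> I = genideal (mpoly_ring n) (mono_poly ` ?G) \<and>
        (\<forall>G'. G' \<subset> ?G \<longrightarrow> I \<noteq> genideal (mpoly_ring n) (mono_poly ` G'))"
      using gen[of ?G] G Mm by blast
    fix H assume H: "H \<subseteq> mons n \<and> I = genideal (mpoly_ring n) (mono_poly ` H) \<and>
        (\<forall>G'. G' \<subset> H \<longrightarrow> I \<noteq> genideal (mpoly_ring n) (mono_poly ` G'))"
    then have M: "M = {w \<in> mons n. \<exists>u\<in>H. mdvd u w}" using gen[of H] by blast
    have "?G \<subseteq> H"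
    proof
      fix w assume w: "w \<in> ?G"
      then obtain u where u: "u \<in> H" "mdvd u w" using M by blast
      then have "u \<in> M" using M H mdvd_refl by blast
      then show "w \<in> H" using w u by blast
    qed
    moreover have "I = genideal (mpoly_ring n) (mono_poly ` ?G)" using gen[of ?G] G Mm by blast
    ultimately show "H = ?G" using H by blast
  qed
qed

text \<open>The bound \<open>a + b + 1\<close> is d, as \<open>t\<close> has d - 1 entries.
  Properness becomes the absence of the exponent vector 0, which is the monomial 1.\<close>

lemma spread_ideal_ideal_mons:
  assumes t: "t = replicate a 1 @ replicate b 0"
    and sss: "spread_strongly_stable n t (I :: 'k::field mpoly set)"
    and proper: "I \<noteq> carrier (mpoly_ring n)"
  shows "spread_ideal n a (a + b + 1) (ideal_mons n I)"
proof
  have mi: "monomial_ideal n I" using sss by (simp add: spread_strongly_stable_def)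
  show "ideal_mons n I \<subseteq> mons n" by (auto simp: ideal_mons_def)
  show add: "\<And>u v. u \<in> ideal_mons n I \<Longrightarrow> v \<in> mons n \<Longrightarrow> u + v \<in> ideal_mons n I"
    by (rule monomial_ideal_char(2)[OF mi])
  show "0 \<notin> ideal_mons n I"
  proof
    assume "0 \<in> ideal_mons n I"
    then have "mons n = ideal_mons n I" using add[of 0] by (auto simp: ideal_mons_def)
    then have "I = carrier (mpoly_ring n)" using monomial_ideal_char(1)[OF mi] by auto
    then show False using proper by simp
  qed
  show "qspread a u \<and> mdeg u \<le> a + b + 1"
    if "u \<in> ideal_mons n I" "\<And>v. v \<in> ideal_mons n I \<Longrightarrow> mdvd v u \<Longrightarrow> v = u" for u
    using that sss min_gens_eq[OF mi] spread_iff[OF t] by (auto simp: spread_strongly_stable_def)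
  fix u i j assume *: "u \<in> ideal_mons n I" "qspread a u" "mdeg u \<le> a + b + 1" "i \<in> keys u" "1 \<le> j" "j < i"
     "qspread a (xvar j + (u - xvar i))"
  define w where "w = xvar j + (u - xvar i)"
  have u: "u \<in> mons n" "mono_poly u \<in> I" using * by (auto simp: ideal_mons_def)
  have "i \<le> n" using *(4) u by (auto simp: mons_def)
  then have w: "w \<in> mons n" using u * by (auto simp: w_def mons_add diff_in_mons)
  have "mdeg u = mdeg (xvar i + (u - xvar i))" using *(4) by (simp add: xvar_add_diff)
  then have "mdeg w = mdeg u" by (simp add: w_def mdeg_add)
  then have "spread t w" using * by (simp add: spread_iff[OF t] w_def)
  then have "mono_poly w \<in> I" unfolding w_def
    using sss u * spread_iff[OF t] unfolding spread_strongly_stable_def by auto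
  then show "xvar j + (u - xvar i) \<in> ideal_mons n I" using w by (simp add: ideal_mons_def w_def)
qed

section \<open>Complexes with a triangular matching\<close>

text \<open>The algebraic form of discrete Morse theory: if every cell of \<open>U\<close> is matched with a cell of
  \<open>L\<close> one degree lower and the matrix of the differential from \<open>U\<close> to \<open>L\<close> is triangular, then the
  homology is spanned freely by the remaining cells \<open>C\<close>, provided that these are cycles.\<close>

locale matched_complex =
  fixes coef :: "'c::ab_group_add \<Rightarrow> 's \<Rightarrow> 'k::field" and elt :: "'k \<Rightarrow> 's \<Rightarrow> 'c" and d :: "'c \<Rightarrow> 'c"
    and Cell :: "nat \<Rightarrow> 's set" and U L C :: "'s set" and mate :: "'s \<Rightarrow> 's" and rk :: "'s \<Rightarrow> nat"
  assumes coef_add: "coef (c + c') s = coef c s + coef c' s"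
    and fin_coef: "finite {s. coef c s \<noteq> 0}"
    and coef_inj: "(\<And>s. coef c s = coef c' s) \<Longrightarrow> c = c'"
    and coef_elt: "coef (elt \<kappa> s) s' = (if s' = s then \<kappa> else 0)"
    and d_add: "d (c + c') = d c + d c'"
    and d_elt: "coef (d (elt \<kappa> s)) s' = \<kappa> * coef (d (elt 1 s)) s'"
    and d_deg: "s \<in> Cell (Suc i) \<Longrightarrow> y \<notin> Cell i \<Longrightarrow> coef (d (elt 1 s)) y = 0"
    and d_d: "(\<And>s. coef c s \<noteq> 0 \<Longrightarrow> s \<in> Cell i) \<Longrightarrow> d (d c) = 0"
    and cells: "s \<in> Cell i \<Longrightarrow> s \<in> U \<or> s \<in> L \<or> s \<in> C" "U \<inter> Cell 0 = {}" "U \<inter> L = {}" "L \<inter> C = {}"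
    and mate: "s \<in> U \<Longrightarrow> s \<in> Cell (Suc i) \<Longrightarrow> mate s \<in> L \<inter> Cell i"
    and mate_onto: "y \<in> L \<Longrightarrow> y \<in> Cell i \<Longrightarrow> \<exists>s\<in>U \<inter> Cell (Suc i). mate s = y"
    and mate_inj: "s \<in> U \<Longrightarrow> s \<in> Cell (Suc i) \<Longrightarrow> s' \<in> U \<Longrightarrow> s' \<in> Cell (Suc i) \<Longrightarrow> mate s = mate s' \<Longrightarrow> s = s'"
    and mate_coef: "s \<in> U \<Longrightarrow> s \<in> Cell (Suc i) \<Longrightarrow> coef (d (elt 1 s)) (mate s) \<noteq> 0"
    and triangular: "s \<in> U \<Longrightarrow> s \<in> Cell (Suc i) \<Longrightarrow> coef (d (elt 1 s)) y \<noteq> 0 \<Longrightarrow> y \<in> L \<Longrightarrow> y \<noteq> mate s \<Longrightarrow>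
        rk y < rk (mate s)"
    and critical: "s \<in> C \<Longrightarrow> s \<in> Cell i \<Longrightarrow> d (elt 1 s) = 0"
begin

definition chain where "chain i = {c. \<forall>s. coef c s \<noteq> 0 \<longrightarrow> s \<in> Cell i}"

lemma coef_0 [simp]: "coef 0 s = 0"
  using coef_add[of 0 0 s] by (simp only: add_0_right add_cancel_right_right)

lemma coef_minus: "coef (x - y) s = coef x s - coef y s"
  using coef_add[of "x - y" y s] by simp

lemma coef_sum: "coef (sum f A) s = (\<Sum>a\<in>A. coef (f a) s)"
  by (induction A rule: infinite_finite_induct) (auto simp: coef_add)

lemma d_0 [simp]: "d 0 = 0" using d_add[of 0 0] by simp

lemma d_minus: "d (x - y) = d x - d y"
  using d_add[of "x - y" y] by (simp add: algebra_simps)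

lemma d_sum: "d (sum f A) = (\<Sum>a\<in>A. d (f a))"
  by (induction A rule: infinite_finite_induct) (auto simp: d_add)

lemma expand: "c = (\<Sum>s\<in>{s. coef c s \<noteq> 0}. elt (coef c s) s)"
  by (rule coef_inj) (use fin_coef in \<open>simp add: coef_sum coef_elt\<close>)

lemma coef_d: "coef (d c) y = (\<Sum>s\<in>{s. coef c s \<noteq> 0}. coef c s * coef (d (elt 1 s)) y)"
  by (subst expand[of c]) (simp add: d_sum coef_sum, metis (no_types) d_elt)

lemma chain_0 [simp]: "0 \<in> chain i" by (simp add: chain_def)

lemma chain_add: "x \<in> chain i \<Longrightarrow> y \<in> chain i \<Longrightarrow> x + y \<in> chain i"
  by (auto simp: chain_def coef_add) force

lemma chain_minus: "x \<in> chain i \<Longrightarrow> y \<in> chain i \<Longrightarrow> x - y \<in> chain i"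
  by (auto simp: chain_def coef_minus) force

lemma chain_sum: "(\<And>a. a \<in> A \<Longrightarrow> f a \<in> chain i) \<Longrightarrow> sum f A \<in> chain i"
  by (induction A rule: infinite_finite_induct) (auto intro: chain_add)

lemma chain_elt: "s \<in> Cell i \<Longrightarrow> elt \<kappa> s \<in> chain i"
  by (simp add: chain_def coef_elt)

lemma chain_d:
  assumes "c \<in> chain (Suc i)"
  shows "d c \<in> chain i"
proof -
  have "coef (d c) y = 0" if y: "y \<notin> Cell i" for y
  proof (subst coef_d, rule sum.neutral, rule ballI)
    fix s assume "s \<in> {s. coef c s \<noteq> 0}"
    then have "s \<in> Cell (Suc i)" using assms by (simp add: chain_def)
    then have "coef (d (elt 1 s)) y = 0" using y by (rule d_deg)
    then show "coef c s * coef (d (elt 1 s)) y = 0" by simp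
  qed
  then show ?thesis by (auto simp: chain_def)
qed

text \<open>Gaussian elimination from the highest rank downwards: the coefficients of
  \<open>c\<close> at the cells of \<open>L\<close> of rank \<open>N\<close> are cancelled by
  boundaries of their partners, and by triangularity this changes other cells of \<open>L\<close>
  only at ranks below \<open>N\<close>.\<close>

lemma reduction:
  assumes "c \<in> chain i"
  shows "\<exists>b\<in>chain (Suc i). \<forall>y\<in>L. coef (c - d b) y = 0"
proof -
  have "\<exists>b\<in>chain (Suc i). \<forall>y\<in>L. coef (c - d b) y = 0"
    if "c \<in> chain i" "\<And>y. y \<in> L \<Longrightarrow> coef c y \<noteq> 0 \<Longrightarrow> rk y < N" for N c
    using that
  proof (induction N arbitrary: c)
    case 0
    then show ?case by (intro bexI[of _ 0]) auto
  next
    case (Suc N)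
    define T where "T = {y \<in> L. coef c y \<noteq> 0 \<and> rk y = N}"
    have fT: "finite T" by (rule finite_subset[OF _ fin_coef[of c]]) (auto simp: T_def)
    have "\<forall>y\<in>T. \<exists>s. s \<in> U \<and> s \<in> Cell (Suc i) \<and> mate s = y"
      using mate_onto Suc.prems(1) by (force simp: T_def chain_def)
    then obtain \<phi> where \<phi>: "\<And>y. y \<in> T \<Longrightarrow> \<phi> y \<in> U \<and> \<phi> y \<in> Cell (Suc i) \<and> mate (\<phi> y) = y" by metis
    \<comment> \<open>Dividing by the matching coefficient makes the partner of \<open>y\<close>
      cancel \<open>y\<close> exactly; the partners of other cells of \<open>T\<close> miss
      \<open>y\<close>, since it has the same rank.\<close>
    define \<kappa> where "\<kappa> = (\<lambda>y. coef c y / coef (d (elt 1 (\<phi> y))) y)"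
    define b where "b = (\<Sum>y\<in>T. elt (\<kappa> y) (\<phi> y))"
    have b: "b \<in> chain (Suc i)" unfolding b_def using \<phi> by (intro chain_sum chain_elt) auto
    have db: "coef (d b) y = (\<Sum>z\<in>T. \<kappa> z * coef (d (elt 1 (\<phi> z))) y)" for y
      unfolding b_def d_sum coef_sum by (intro sum.cong refl) (rule d_elt)
    have low: "rk y < N" if "z \<in> T" "coef (d (elt 1 (\<phi> z))) y \<noteq> 0" "y \<in> L" "y \<noteq> z" for y z
      using triangular[of "\<phi> z" i y] \<phi>[OF that(1)] that by (auto simp: T_def)
    have c'T: "coef (c - d b) y = 0" if y: "y \<in> T" for y
    proof -
      have "coef (d b) y = (\<Sum>z\<in>{y}. \<kappa> z * coef (d (elt 1 (\<phi> z))) y)"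
        unfolding db by (rule sum.mono_neutral_right) (use y fT low in \<open>force simp: T_def\<close>)+
      moreover have "coef (d (elt 1 (\<phi> y))) y \<noteq> 0" using mate_coef \<phi>[OF y] by metis
      ultimately show ?thesis by (simp add: coef_minus \<kappa>_def)
    qed
    have "rk y < N" if y: "y \<in> L" "coef (c - d b) y \<noteq> 0" for y
    proof (rule ccontr)
      assume N: "\<not> rk y < N"
      have "y \<notin> T" using y c'T by auto
      have "coef (d b) y = 0" unfolding db
        by (rule sum.neutral) (use low y N \<open>y \<notin> T\<close> in fastforce)
      then have "coef c y \<noteq> 0" using y by (simp add: coef_minus)
      then have "rk y < Suc N" using Suc.prems(2) y by auto
      then show False using N \<open>y \<notin> T\<close> \<open>coef c y \<noteq> 0\<close> y by (auto simp: T_def)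
    qed
    then obtain b' where b': "b' \<in> chain (Suc i)" "\<forall>y\<in>L. coef (c - d b - d b') y = 0"
      using Suc.IH[of "c - d b"] chain_minus[OF Suc.prems(1) chain_d[OF b]] by blast
    then show ?case by (intro bexI[of _ "b + b'"]) (auto simp: d_add chain_add b diff_diff_eq)
  qed
  moreover have "\<exists>N. \<forall>y\<in>{s. coef c s \<noteq> 0}. rk y < N"
    using finite_nat_set_iff_bounded[of "rk ` {s. coef c s \<noteq> 0}"] fin_coef by auto
  ultimately show ?thesis using assms by blast
qed

text \<open>If some cell of \<open>e\<close> were in \<open>U\<close>, take one whose mate has the
  highest rank: no other cell of \<open>e\<close> reaches that mate, so \<open>d e\<close> would be
  nonzero on \<open>L\<close>.\<close>

lemma only_critical:
  assumes "e \<in> chain i" "\<And>y. y \<in> L \<Longrightarrow> coef e y = 0" "\<And>y. y \<in> L \<Longrightarrow> coef (d e) y = 0" "coef e s \<noteq> 0"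
  shows "s \<in> C"
proof (rule ccontr)
  assume "s \<notin> C"
  define T where "T = {s \<in> U. coef e s \<noteq> 0}"
  have fT: "finite T" by (rule finite_subset[OF _ fin_coef[of e]]) (auto simp: T_def)
  have "s \<in> T" using assms \<open>s \<notin> C\<close> cells(1)[of s i] by (auto simp: T_def chain_def)
  have "Max ((rk \<circ> mate) ` T) \<in> (rk \<circ> mate) ` T" using fT \<open>s \<in> T\<close> by (intro Max_in) auto
  then obtain s0 where s0: "s0 \<in> T" "Max ((rk \<circ> mate) ` T) = rk (mate s0)" by auto
  have s0_max: "rk (mate s) \<le> rk (mate s0)" if "s \<in> T" for s
    unfolding s0(2)[symmetric] using fT that by (intro Max_ge) auto
  have "s0 \<in> Cell i" using s0 assms(1) by (auto simp: T_def chain_def)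
  \<comment> \<open>\<open>U\<close> has no cells in degree 0, so the degree is a successor.\<close>
  then obtain j where j: "i = Suc j" using cells(2) s0 by (cases i) (auto simp: T_def)
  have s0': "s0 \<in> U" "s0 \<in> Cell (Suc j)" using s0 \<open>s0 \<in> Cell i\<close> j by (auto simp: T_def)
  have "coef (d e) (mate s0) = (\<Sum>s\<in>{s0}. coef e s * coef (d (elt 1 s)) (mate s0))"
  proof (subst coef_d, rule sum.mono_neutral_right)
    show "\<forall>s\<in>{s. coef e s \<noteq> 0} - {s0}. coef e s * coef (d (elt 1 s)) (mate s0) = 0"
    proof
      fix s assume s: "s \<in> {s. coef e s \<noteq> 0} - {s0}"
      have sX: "s \<in> Cell (Suc j)" using s assms(1) j by (auto simp: chain_def)
      show "coef e s * coef (d (elt 1 s)) (mate s0) = 0"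
      proof (cases "s \<in> C")
        case True then show ?thesis using critical sX by simp
      next
        case False
        then have sU: "s \<in> U" using cells(1)[OF sX] assms(2) s by auto
        show ?thesis
        proof (rule ccontr)
          assume "coef e s * coef (d (elt 1 s)) (mate s0) \<noteq> 0"
          then have "rk (mate s0) < rk (mate s)"
            using triangular[OF sU sX, of "mate s0"] mate[OF s0'] mate_inj[OF s0' sU sX] s by auto
          then show False using s0_max[of s] sU s by (auto simp: T_def)
        qed
      qed
    qed
  qed (use fin_coef s0 in \<open>auto simp: T_def\<close>)
  then have "coef (d e) (mate s0) \<noteq> 0" using mate_coef[OF s0'] s0 by (simp add: T_def)
  then show False using assms(3) mate[OF s0'] by auto
qed

text \<open>The critical cells span the homology: \<open>reduction\<close> clears \<open>L\<close>,
  and \<open>only_critical\<close> then excludes \<open>U\<close>.\<close>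

theorem cycle_critical:
  assumes "c \<in> chain i" "d c = 0"
  shows "\<exists>b\<in>chain (Suc i). \<forall>s. coef (c - d b) s \<noteq> 0 \<longrightarrow> s \<in> C \<inter> Cell i"
proof -
  obtain b where b: "b \<in> chain (Suc i)" "\<forall>y\<in>L. coef (c - d b) y = 0" using reduction[OF assms(1)] by blast
  have e: "c - d b \<in> chain i" using chain_minus chain_d b assms by blast
  have "d (d b) = 0" using d_d[of b "Suc i"] b(1) by (auto simp: chain_def)
  then have "d (c - d b) = 0" using assms by (simp add: d_minus)
  then have "s \<in> C" if "coef (c - d b) s \<noteq> 0" for s
    using only_critical[OF e, of s] b(2) that by simp
  then show ?thesis using b e by (auto simp: chain_def)
qed

text \<open>Independence of the critical cells: modulo boundaries, which leave \<open>d b\<close>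
  unchanged, \<open>b\<close> has no cells in \<open>L\<close>; it then consists of critical cells
  only, and these are cycles.\<close>

theorem boundary_critical:
  assumes "b \<in> chain (Suc i)" "\<And>s. coef (d b) s \<noteq> 0 \<Longrightarrow> s \<in> C"
  shows "d b = 0"
proof -
  obtain b' where b': "b' \<in> chain (Suc (Suc i))" "\<forall>y\<in>L. coef (b - d b') y = 0"
    using reduction[OF assms(1)] by blast
  define e where "e = b - d b'"
  have e: "e \<in> chain (Suc i)" using chain_minus chain_d b' assms by (auto simp: e_def)
  have "d (d b') = 0" using d_d[of b' "Suc (Suc i)"] b'(1) by (auto simp: chain_def)
  then have de: "d e = d b" by (simp add: e_def d_minus)
  have "coef (d e) y = 0" if "y \<in> L" for y using that assms(2)[of y] cells(4) de by auto
  then have "s \<in> C" if "coef e s \<noteq> 0" for s using only_critical[OF e, of s] b'(2) that by (auto simp: e_def)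
  moreover have "s \<in> Cell (Suc i)" if "coef e s \<noteq> 0" for s using that e by (auto simp: chain_def)
  ultimately have sC: "s \<in> C \<and> s \<in> Cell (Suc i)" if "coef e s \<noteq> 0" for s using that by blast
  have "coef (d e) y = 0" for y
    by (subst coef_d, rule sum.neutral) (use sC critical[of _ "Suc i"] in simp)
  then have "d e = 0" by (intro coef_inj) simp
  then show ?thesis using de by simp
qed

end

section \<open>Chains with polynomial coefficients\<close>

type_synonym ('b, 'k) chains = "'b \<Rightarrow>\<^sub>0 'k mpoly"

definition act :: "'k::field mpoly \<Rightarrow> ('b, 'k) chains \<Rightarrow> ('b, 'k) chains" where
  "act p c = Poly_Mapping.map ((*) p) c"

lemma lookup_act [simp]: "lookup (act p c) b = p * lookup c b"
  by (simp add: act_def Poly_Mapping.map.rep_eq when_def)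

lemma act_add_left: "act (p + q) c = act p c + act q c"
  and act_add: "act p (c + c') = act p c + act p c'"
  and act_minus: "act p (c - c') = act p c - act p c'"
  and act_uminus_left: "act (- p) c = - act p c"
  and act_uminus: "act p (- c) = - act p c"
  and act_act: "act p (act q c) = act (p * q) c"
  and act_1 [simp]: "act 1 c = c"
  and act_0 [simp]: "act p 0 = 0"
  and act_0_left [simp]: "act 0 c = 0"
  by (rule poly_mapping_eqI, simp add: lookup_add lookup_minus algebra_simps)+

lemma act_sum: "act p (sum f A) = (\<Sum>x\<in>A. act p (f x))"
  by (induction A rule: infinite_finite_induct) (auto simp: act_add)

lemma act_single [simp]: "act p (single b q) = single b (p * q)"
  by (rule poly_mapping_eqI) (simp add: lookup_single when_def)

lemma chains_expand: "c = (\<Sum>b\<in>keys c. single b (lookup c b))"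
  by (intro poly_mapping_eqI) (simp add: lookup_sum lookup_single when_def in_keys_iff)

definition lin :: "('b \<Rightarrow> ('c, 'k::field) chains) \<Rightarrow> ('b, 'k) chains \<Rightarrow> ('c, 'k) chains" where
  "lin \<delta> c = (\<Sum>b\<in>keys c. act (lookup c b) (\<delta> b))"

lemma lin_superset: "finite B \<Longrightarrow> keys c \<subseteq> B \<Longrightarrow> lin \<delta> c = (\<Sum>b\<in>B. act (lookup c b) (\<delta> b))"
  unfolding lin_def by (rule sum.mono_neutral_left) (auto simp: in_keys_iff)

lemma lin_add: "lin \<delta> (c + c') = lin \<delta> c + lin \<delta> c'"
proof -
  let ?B = "keys c \<union> keys c'"
  have "keys (c + c') \<subseteq> ?B" by (rule keys_add)
  then show ?thesis
    by (simp add: lin_superset[of ?B] lookup_add act_add_left sum.distrib)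
qed

lemma lin_act: "lin \<delta> (act p c) = act p (lin \<delta> c)"
proof -
  have "keys (act p c) \<subseteq> keys c" by (auto simp: in_keys_iff)
  then show ?thesis by (simp add: lin_superset[of "keys c"] act_sum act_act)
qed

lemma lin_0 [simp]: "lin \<delta> 0 = 0" by (simp add: lin_def)

lemma lin_sum: "lin \<delta> (sum f A) = (\<Sum>x\<in>A. lin \<delta> (f x))"
  by (induction A rule: infinite_finite_induct) (auto simp: lin_add)

lemma lin_single [simp]: "lin \<delta> (single b p) = act p (\<delta> b)"
  by (simp add: lin_superset[of "{b}"] lookup_single)

lemma lin_lin_eq_0: "(\<And>b. b \<in> keys c \<Longrightarrow> lin \<epsilon> (\<delta> b) = 0) \<Longrightarrow> lin \<epsilon> (lin \<delta> c) = 0"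
  unfolding lin_def[of \<delta>] lin_sum lin_act by (simp add: sum.neutral)

lemma sign_mult: "(-1) ^ k * p = (if even k then p else - p :: 'a::ring_1)"
  by (simp add: minus_one_power_iff)

text \<open>The K-coordinates of a chain: the cell \<open>(m, b)\<close> is the multiple of the
  basis element \<open>b\<close> by the monomial \<open>m\<close>. The matchings pair such cells,
  not basis elements.\<close>

definition ccoef :: "('b, 'k::field) chains \<Rightarrow> mon \<times> 'b \<Rightarrow> 'k" where
  "ccoef c s = lookup (lookup c (snd s)) (fst s)"

definition celt :: "'k::field \<Rightarrow> mon \<times> 'b \<Rightarrow> ('b, 'k) chains" where
  "celt \<kappa> s = single (snd s) (single (fst s) \<kappa>)"

lemma ccoef_add: "ccoef (c + c') s = ccoef c s + ccoef c' s"
  by (simp add: ccoef_def lookup_add)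

lemma ccoef_minus: "ccoef (c - c') s = ccoef c s - ccoef c' s"
  by (simp add: ccoef_def lookup_minus)

lemma ccoef_inj: "(\<And>s. ccoef c s = ccoef c' s) \<Longrightarrow> c = c'"
  by (intro poly_mapping_eqI) (auto simp: ccoef_def)

lemma finite_ccoef: "finite {s. ccoef c s \<noteq> 0}"
proof (rule finite_subset)
  show "{s. ccoef c s \<noteq> 0} \<subseteq> (\<Union>b\<in>keys c. keys (lookup c b) \<times> {b})"
    by (auto simp: ccoef_def in_keys_iff)
qed simp

lemma ccoef_celt: "ccoef (celt \<kappa> s) s' = (if s' = s then \<kappa> else 0)"
  by (cases s, cases s') (auto simp: ccoef_def celt_def lookup_single when_def)

lemma lookup_single_mult: "lookup (single m \<kappa> * p :: 'k::field mpoly) w = (if mdvd m w then \<kappa> * lookup p (w - m) else 0)"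
proof -
  have "lookup (single m \<kappa> * p) w = (\<Sum>v\<in>keys p. lookup (single (m + v) (\<kappa> * lookup p v)) w)"
    by (subst (1) poly_expand[of p]) (simp add: sum_distrib_left mult_single lookup_sum)
  also have "\<dots> = (\<Sum>v\<in>keys p. if v = w - m \<and> mdvd m w then \<kappa> * lookup p v else 0)"
  proof (rule sum.cong[OF refl])
    fix v assume "v \<in> keys p"
    have "m + v = w \<longleftrightarrow> v = w - m \<and> mdvd m w" using mdvd_add_diff[of m w] by auto
    then show "lookup (single (m + v) (\<kappa> * lookup p v)) w = (if v = w - m \<and> mdvd m w then \<kappa> * lookup p v else 0)"
      by (simp add: lookup_single when_def)
  qed
  also have "\<dots> = (if mdvd m w then \<kappa> * lookup p (w - m) else 0)"
    by (simp add: in_keys_iff)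
  finally show ?thesis .
qed

lemma ccoef_scale: "ccoef (act (single m \<kappa>) c) s = \<kappa> * ccoef (act (single m 1) c) s"
  by (simp add: ccoef_def lookup_single_mult)

text \<open>The contributions of (j,k) and (k,j) are cancelled directly. That the sum equals its own
  negative would not suffice in characteristic 2.\<close>

lemma sum_antisymmetric:
  fixes h :: "'a \<Rightarrow> 'a \<Rightarrow> 'b::ab_group_add"
  assumes "finite A" "\<And>j k. j \<in> A \<Longrightarrow> k \<in> A \<Longrightarrow> j \<noteq> k \<Longrightarrow> h j k = - h k j"
  shows "(\<Sum>k\<in>A. \<Sum>j\<in>A - {k}. h k j) = 0"
  using assms
proof (induction A rule: finite_induct)
  case (insert x A)
  have "(\<Sum>j\<in>insert x A - {k}. h k j) = h k x + (\<Sum>j\<in>A - {k}. h k j)" if "k \<in> A" for k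
  proof -
    have "insert x A - {k} = insert x (A - {k})" using that insert.hyps by auto
    then show ?thesis using insert.hyps by simp
  qed
  then have "(\<Sum>k\<in>insert x A. \<Sum>j\<in>insert x A - {k}. h k j) =
      (\<Sum>j\<in>A. h x j + h j x) + (\<Sum>k\<in>A. \<Sum>j\<in>A - {k}. h k j)"
    using insert.hyps by (simp add: sum.distrib insert_Diff_if)
  also have "(\<Sum>j\<in>A. h x j + h j x) = 0"
  proof (rule sum.neutral, rule ballI)
    fix j assume "j \<in> A"
    then have "h x j = - h j x" using insert.prems[of x j] insert.hyps(2) by blast
    then show "h x j + h j x = 0" by simp
  qed
  also have "(\<Sum>k\<in>A. \<Sum>j\<in>A - {k}. h k j) = 0"
    by (rule insert.IH) (rule insert.prems, simp_all)
  finally show ?case by simp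
qed simp

lemma alpha_diff: "finite \<sigma> \<Longrightarrow> k \<in> \<sigma> \<Longrightarrow> alpha \<sigma> j = alpha (\<sigma> - {k}) j + (if k < j then 1 else 0)"
proof -
  assume *: "finite \<sigma>" "k \<in> \<sigma>"
  have "{s \<in> \<sigma>. s < j} = (if k < j then insert k {s \<in> \<sigma> - {k}. s < j} else {s \<in> \<sigma> - {k}. s < j})"
    using * by auto
  then show ?thesis using * by (auto simp: alpha_def)
qed

text \<open>Exactly one of the two counts changes: deleting the smaller index lowers that of the
  larger by one.\<close>

lemma sign_swap:
  assumes "finite \<sigma>" "k \<in> \<sigma>" "j \<in> \<sigma>" "j \<noteq> k"
  shows "(-1) ^ alpha \<sigma> k * (-1) ^ alpha (\<sigma> - {k}) j = - ((-1) ^ alpha \<sigma> j * (-1) ^ alpha (\<sigma> - {j}) k :: 'a::comm_ring_1)"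
  using alpha_diff[OF assms(1,2), of j] alpha_diff[OF assms(1,3), of k] assms(4)
  by (cases "k < j") (auto simp: mult_ac)

section \<open>The resolution in coordinates\<close>

context spread_ideal
begin

definition uu where "uu u k = gg (xvar k + u)"
definition vv where "vv u k = xvar k + u - gg (xvar k + u)"

definition fh :: "mon \<Rightarrow> nat set \<Rightarrow> (mon \<times> nat set, 'k::field) chains" where
  "fh u \<sigma> = (if \<sigma> \<subseteq> adm a u then single (u, \<sigma>) 1 else 0)"

definition dterm :: "mon \<Rightarrow> nat set \<Rightarrow> nat \<Rightarrow> (mon \<times> nat set, 'k::field) chains" where
  "dterm u \<sigma> k = act ((-1) ^ alpha \<sigma> k)
     (act (- mono_poly (xvar k)) (fh u (\<sigma> - {k})) + act (mono_poly (vv u k)) (fh (uu u k) (\<sigma> - {k})))"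

text \<open>The symbol \<open>(0, {})\<close> stands for the basis element \<open>1\<close> of \<open>F\<^sub>0 = S\<close>.\<close>

definition dbas :: "mon \<times> nat set \<Rightarrow> (mon \<times> nat set, 'k::field) chains" where
  "dbas b = (if fst b = 0 then 0 else if snd b = {} then single (0, {}) (mono_poly (fst b))
     else \<Sum>k\<in>snd b. dterm (fst b) (snd b) k)"

definition Bas :: "nat \<Rightarrow> (mon \<times> nat set) set" where
  "Bas i = (if i = 0 then {(0, {})} else {(u, \<sigma>). u \<in> G \<and> \<sigma> \<subseteq> adm a u \<and> card \<sigma> = i - 1})"

lemma finite_adm: "finite (adm a u)"
  using adm_subset finite_subset by blast

lemma finite_subset_adm: "\<sigma> \<subseteq> adm a u \<Longrightarrow> finite \<sigma>"
  using finite_adm finite_subset by blast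

lemma uu_G: "u \<in> G \<Longrightarrow> k \<in> adm a u \<Longrightarrow> uu u k \<in> G"
  using gg_props xk_in_M adm_le_n by (simp add: uu_def)

lemma uu_gt: "u \<in> G \<Longrightarrow> k \<in> adm a u \<Longrightarrow> u < uu u k"
  using gg_xk_ne by (simp add: uu_def)

lemma vv_mons: "u \<in> G \<Longrightarrow> k \<in> adm a u \<Longrightarrow> vv u k \<in> mons n"
  using adm_le_n[of u k] G_mons[of u] by (simp add: vv_def diff_in_mons mons_add)

lemma uu_add_vv: "u \<in> G \<Longrightarrow> k \<in> adm a u \<Longrightarrow> vv u k + uu u k = xvar k + u"
  using gg_props(2) xk_in_M adm_le_n by (simp add: uu_def vv_def add.commute mdvd_add_diff)

lemma maxv_keys_vv: "u \<in> G \<Longrightarrow> k \<in> adm a u \<Longrightarrow> maxv u \<in> keys (vv u k)"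
  using maxv_in_vk by (simp add: vv_def)

lemma finite_Bas: "finite (Bas i)"
proof (cases "i = 0")
  case False
  have "Bas i \<subseteq> (SIGMA u : G. Pow (adm a u))" using False by (auto simp: Bas_def)
  moreover have "finite (SIGMA u : G. Pow (adm a u))" using finite_G finite_adm by auto
  ultimately show ?thesis by (rule finite_subset)
qed (simp add: Bas_def)

lemma lin_dbas_fh: "u \<in> G \<Longrightarrow> \<sigma> \<subseteq> adm a u \<Longrightarrow> \<sigma> \<noteq> {} \<Longrightarrow> lin dbas (fh u \<sigma>) = (\<Sum>k\<in>\<sigma>. dterm u \<sigma> k)"
  by (auto simp: fh_def dbas_def G_nz)

text \<open>If \<open>\<sigma> - {k}\<close> is not admissible for \<open>u\<^sub>k\<close>, then it has an element \<open>j \<ge> max(u\<^sub>k)\<close>, for which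
  \<open>(u\<^sub>k)\<^sub>j = u\<^sub>k\<close>, and the summands of the formula vanish or cancel.\<close>

lemma lin_dbas_fh_uu:
  assumes u: "u \<in> G" "\<sigma> \<subseteq> adm a u" "k \<in> \<sigma>" "\<sigma> - {k} \<noteq> {}"
  shows "lin dbas (fh (uu u k) (\<sigma> - {k})) =
    ((\<Sum>j\<in>\<sigma> - {k}. dterm (uu u k) (\<sigma> - {k}) j) :: (mon \<times> nat set, 'k::field) chains)"
proof (cases "\<sigma> - {k} \<subseteq> adm a (uu u k)")
  case True
  then show ?thesis using lin_dbas_fh uu_G u by blast
next
  case False
  have k: "k \<in> adm a u" using u by auto
  obtain j0 where j0: "j0 \<in> \<sigma>" "j0 \<noteq> k" "j0 \<notin> adm a (uu u k)" using False by auto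
  have mj0: "maxv (uu u k) \<le> j0" using notadm_gg_xk[of u k j0] u j0 by (auto simp: uu_def)
  have "dterm (uu u k) (\<sigma> - {k}) j = (0 :: (mon \<times> nat set, 'k) chains)" if j: "j \<in> \<sigma> - {k}" for j
  proof -
    have jn: "1 \<le> j" "j \<le> n" using adm_le_n[OF u(1)] j u(2) by auto
    show ?thesis
    proof (cases "j = j0")
      case True
      have "gg (xvar j + uu u k) = uu u k"
        using gg_xk_notadm[OF uu_G[OF u(1) k] jn] j0 True by simp
      then have "uu (uu u k) j = uu u k" "vv (uu u k) j = xvar j" by (simp_all add: uu_def vv_def)
      then show ?thesis by (simp add: dterm_def act_uminus_left)
    next
      case False
      have "maxv (uu (uu u k) j) \<le> j0"
        using maxv_gg_xk[OF uu_G[OF u(1) k] jn] mj0 by (simp add: uu_def[of "uu u k"])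
      then have "j0 \<notin> adm a (uu (uu u k) j)" by (auto simp: adm_def)
      then have "fh (uu u k) (\<sigma> - {k} - {j}) = (0 :: (mon \<times> nat set, 'k) chains)"
         "fh (uu (uu u k) j) (\<sigma> - {k} - {j}) = (0 :: (mon \<times> nat set, 'k) chains)"
        using j0 False by (auto simp: fh_def)
      then show ?thesis by (simp add: dterm_def)
    qed
  qed
  then have "(\<Sum>j\<in>\<sigma> - {k}. dterm (uu u k) (\<sigma> - {k}) j) = (0 :: (mon \<times> nat set, 'k) chains)"
    by (intro sum.neutral) blast
  then show ?thesis using False by (simp add: fh_def)
qed

lemma uu_uu: "u \<in> G \<Longrightarrow> k \<in> adm a u \<Longrightarrow> j \<in> adm a u \<Longrightarrow> j \<noteq> k \<Longrightarrow> uu (uu u k) j = uu (uu u j) k"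
  using gg_xj_xk[of u k j] gg_xj_xk[of u j k] by (simp add: uu_def add_ac)

text \<open>Both sides are the quotient of the same monomial \<open>xvar j + (xvar k + u)\<close> by
  the same generator \<open>uu (uu u k) j\<close>.\<close>

lemma vv_vv:
  assumes "u \<in> G" "k \<in> adm a u" "j \<in> adm a u" "j \<noteq> k"
  shows "vv u k + vv (uu u k) j = vv u j + vv (uu u j) k"
proof -
  have *: "vv u k + vv (uu u k) j + uu (uu u k) j = xvar j + (xvar k + u)"
    if "k \<in> adm a u" "j \<in> adm a u" "j \<noteq> k" for j k
  proof -
    have "1 \<le> j" "j \<le> n" using adm_le_n assms(1) that by auto
    then have "xvar j + uu u k \<in> M" using xk_in_M uu_G assms(1) that by auto
    \<comment> \<open>\<open>uu_add_vv\<close> does not apply here, as \<open>j\<close> may be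
      inadmissible for \<open>uu u k\<close>.\<close>
    then have "vv (uu u k) j + uu (uu u k) j = xvar j + uu u k"
      using gg_props(2)[of "xvar j + uu u k"] by (simp add: uu_def vv_def add.commute mdvd_add_diff)
    then show ?thesis using uu_add_vv[OF assms(1) that(1)] by (metis add.assoc add.left_commute)
  qed
  have "vv u k + vv (uu u k) j + uu (uu u k) j = vv u j + vv (uu u j) k + uu (uu u k) j"
    using *[of k j] *[of j k] uu_uu[OF assms] assms by (simp add: add.left_commute)
  then show ?thesis by simp
qed

lemma mono_poly_mult: "mono_poly u * mono_poly v = mono_poly (u + v)"
  by (simp add: mono_poly_def mult_single)

text \<open>The signs are antisymmetric in the two removed indices, and the remaining factors are
  symmetric by \<open>uu_uu\<close> and \<open>vv_vv\<close>. A singleton \<sigma> is separate,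
  because the second map is then d_1 with values in S, and the claim is that x_k u is the product of
  \<open>v\<^sub>k\<close> and \<open>u\<^sub>k\<close>.\<close>

lemma lin_dbas_dbas:
  assumes "b \<in> Bas i"
  shows "lin dbas (dbas b :: (mon \<times> nat set, 'k::field) chains) = 0"
proof (cases "i = 0 \<or> snd b = {}")
  case True
  then show ?thesis using assms by (auto simp: Bas_def dbas_def)
next
  case False
  obtain u \<sigma> where b: "b = (u, \<sigma>)" by (cases b)
  have u: "u \<in> G" "\<sigma> \<subseteq> adm a u" "\<sigma> \<noteq> {}" "u \<noteq> 0" and fin: "finite \<sigma>"
    using False assms G_nz finite_subset_adm by (auto simp: Bas_def b)
  define fc where "fc = (fh :: _ \<Rightarrow> _ \<Rightarrow> (mon \<times> nat set, 'k) chains)"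
  have db: "dbas b = (\<Sum>k\<in>\<sigma>. dterm u \<sigma> k)" using u by (simp add: dbas_def b)
  show ?thesis
  proof (cases "\<exists>k. \<sigma> = {k}")
    case True
    then obtain k where k: "\<sigma> = {k}" by blast
    then have ka: "k \<in> adm a u" using u by auto
    have nz: "uu u k \<noteq> 0" using uu_G[OF u(1) ka] G_nz by auto
    show ?thesis unfolding db k
      by (simp add: dterm_def lin_act lin_add act_add fh_def dbas_def u(4) nz mono_poly_mult mult.assoc
          uu_add_vv[OF u(1) ka] single_uminus[symmetric] flip: single_add)
  next
    case False
    \<comment> \<open>Products of the coefficients -x and v of two successive steps. Exchanging the
      indices swaps the two middle terms and fixes the outer ones.\<close>
    define T where "T = (\<lambda>k j. act (mono_poly (xvar k + xvar j)) (fc u (\<sigma> - {k} - {j}))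
      - act (mono_poly (xvar k + vv u j)) (fc (uu u j) (\<sigma> - {k} - {j}))
      - act (mono_poly (vv u k + xvar j)) (fc (uu u k) (\<sigma> - {k} - {j}))
      + act (mono_poly (vv u k + vv (uu u k) j)) (fc (uu (uu u k) j) (\<sigma> - {k} - {j})))"
    define h where "h = (\<lambda>k j. act ((-1) ^ alpha \<sigma> k * (-1) ^ alpha (\<sigma> - {k}) j) (T k j))"
    have sub: "\<sigma> - {k} \<noteq> {}" if "k \<in> \<sigma>" for k using False that by auto
    have "lin dbas (dterm u \<sigma> k) = (\<Sum>j\<in>\<sigma> - {k}. h k j)" if k: "k \<in> \<sigma>" for k
    proof -
      have 1: "lin dbas (fc u (\<sigma> - {k})) = (\<Sum>j\<in>\<sigma> - {k}. dterm u (\<sigma> - {k}) j)"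
        unfolding fc_def using u sub[OF k] by (intro lin_dbas_fh) auto
      have 2: "lin dbas (fc (uu u k) (\<sigma> - {k})) = (\<Sum>j\<in>\<sigma> - {k}. dterm (uu u k) (\<sigma> - {k}) j)"
        unfolding fc_def using u sub[OF k] k by (intro lin_dbas_fh_uu) auto
      have "act ((-1) ^ alpha \<sigma> k) (act (- mono_poly (xvar k)) (dterm u (\<sigma> - {k}) j)
          + act (mono_poly (vv u k)) (dterm (uu u k) (\<sigma> - {k}) j)) = h k j" for j
        unfolding h_def T_def dterm_def fc_def[symmetric]
        by (simp add: act_add act_act act_minus act_uminus_left act_uminus mono_poly_mult[symmetric] mult_ac)
      then show ?thesis
        unfolding dterm_def[of u \<sigma> k] fc_def[symmetric] lin_act lin_add 1 2
        by (simp add: act_sum sum.distrib[symmetric])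
    qed
    then have "lin dbas (dbas b) = (\<Sum>k\<in>\<sigma>. \<Sum>j\<in>\<sigma> - {k}. h k j)"
      unfolding db lin_sum by simp
    also have "\<dots> = 0"
    proof (rule sum_antisymmetric[OF fin])
      fix j k assume jk: "j \<in> \<sigma>" "k \<in> \<sigma>" "j \<noteq> k"
      then have adm: "j \<in> adm a u" "k \<in> adm a u" using u by auto
      have "\<sigma> - {j} - {k} = \<sigma> - {k} - {j}" by auto
      moreover have "uu (uu u j) k = uu (uu u k) j" using uu_uu[OF u(1)] adm jk by auto
      moreover have "vv u j + vv (uu u j) k = vv u k + vv (uu u k) j" using vv_vv[OF u(1)] adm jk by auto
      ultimately have "T j k = T k j" unfolding T_def by (simp add: add.commute)
      then show "h j k = - h k j"
        unfolding h_def using sign_swap[OF fin jk(1,2), where 'a="'k mpoly"] jk(3) by (simp add: act_uminus_left)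
    qed
    finally show ?thesis .
  qed
qed

text \<open>The cell \<open>(m, u, \<sigma>)\<close> is the multiple \<open>m f(u; \<sigma>)\<close>. It is matched by moving the largest possible
  variable from \<open>\<sigma>\<close> to \<open>m\<close>, or, if \<open>u\<close> is the decomposition of \<open>m u\<close> and \<open>\<sigma> = {}\<close>, by applying \<open>d\<^sub>1\<close>.\<close>

definition toggle :: "mon \<times> mon \<times> nat set \<Rightarrow> nat set" where
  "toggle s = (case s of (m, u, \<sigma>) \<Rightarrow> (keys m \<inter> adm a u) \<union> \<sigma>)"

definition EU where "EU = {(m, u, \<sigma>). u \<noteq> 0 \<and> (toggle (m, u, \<sigma>) = {} \<or> Max (toggle (m, u, \<sigma>)) \<in> \<sigma>)}"
definition EL where "EL = {(m, u, \<sigma>). (u = 0 \<and> m \<in> M) \<or>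
   (u \<noteq> 0 \<and> toggle (m, u, \<sigma>) \<noteq> {} \<and> Max (toggle (m, u, \<sigma>)) \<notin> \<sigma>)}"
text \<open>The monomials outside the ideal, a K-basis of S/I. Among the cells of the complex they
  occur only in degree 0, which is where exactness comes from.\<close>

definition EC :: "(mon \<times> mon \<times> nat set) set" where "EC = {(m, u, \<sigma>). u = 0 \<and> m \<notin> M}"
definition Emate :: "mon \<times> mon \<times> nat set \<Rightarrow> mon \<times> mon \<times> nat set" where
  "Emate s = (case s of (m, u, \<sigma>) \<Rightarrow> if toggle s = {} then (m + u, 0, {})
     else (m + xvar (Max (toggle s)), u, \<sigma> - {Max (toggle s)}))"
text \<open>Counts the lexicographically larger generators, hence drops from u to
  \<open>u\<^sub>k\<close>.\<close>

definition Erk :: "mon \<times> mon \<times> nat set \<Rightarrow> nat" where "Erk s = card {v \<in> G. fst (snd s) < v}"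

lemma finite_toggle: "\<sigma> \<subseteq> adm a u \<Longrightarrow> finite (toggle (m, u, \<sigma>))"
  by (simp add: toggle_def finite_subset_adm)

text \<open>The toggle set does not see on which side a variable lies, so its maximum can be
  recovered from either member of a matched pair.\<close>

lemma toggle_move: "q \<in> \<sigma> \<Longrightarrow> \<sigma> \<subseteq> adm a u \<Longrightarrow> toggle (m + xvar q, u, \<sigma> - {q}) = toggle (m, u, \<sigma>)"
  by (auto simp: toggle_def keys_add_mon)

lemma lookup_fh: "lookup (fh u \<sigma>) b = (if b = (u, \<sigma>) \<and> \<sigma> \<subseteq> adm a u then 1 else 0)"
  by (auto simp: fh_def lookup_single when_def)

lemma lookup_sign_mult: "lookup ((-1) ^ j * p :: 'k::field mpoly) w = (-1) ^ j * lookup p w"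
  by (simp add: sign_mult)

lemma ccoef_dterm:
  assumes "u \<in> G" "\<sigma> \<subseteq> adm a u"
  shows "ccoef (act (single m 1) (dterm u \<sigma> k)) (m', b) = (-1) ^ alpha \<sigma> k *
    ((if m' = m + vv u k \<and> b = (uu u k, \<sigma> - {k}) \<and> \<sigma> - {k} \<subseteq> adm a (uu u k) then 1 else 0)
     - (if m' = m + xvar k \<and> b = (u, \<sigma> - {k}) then 1 else (0 :: 'k::field)))"
proof -
  define A where "A = (if b = (uu u k, \<sigma> - {k}) \<and> \<sigma> - {k} \<subseteq> adm a (uu u k) then single (m + vv u k) (1::'k) else 0)"
  define B where "B = (if b = (u, \<sigma> - {k}) then single (m + xvar k) (1::'k) else 0)"
  have "\<sigma> - {k} \<subseteq> adm a u" using assms by auto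
  then have "lookup (act (single m 1) (dterm u \<sigma> k)) b = (-1) ^ alpha \<sigma> k * (A - B)"
    by (auto simp: dterm_def lookup_add lookup_fh A_def B_def sign_mult mono_poly_def mult_single
        distrib_left right_diff_distrib)
  then have "ccoef (act (single m 1) (dterm u \<sigma> k)) (m', b) = (-1) ^ alpha \<sigma> k * lookup (A - B) m'"
    by (simp add: ccoef_def lookup_sign_mult)
  also have "lookup (A - B) m' =
     (if m' = m + vv u k \<and> b = (uu u k, \<sigma> - {k}) \<and> \<sigma> - {k} \<subseteq> adm a (uu u k) then 1 else 0)
     - (if m' = m + xvar k \<and> b = (u, \<sigma> - {k}) then 1 else 0)"
    by (simp add: A_def B_def lookup_minus lookup_single when_def)
  finally show ?thesis .
qed

lemma toggle_dterm_cases: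
  assumes "u \<in> G" "\<sigma> \<subseteq> adm a u" "\<sigma> \<noteq> {}" "ccoef (act (single m 1) (dbas (u, \<sigma>)) :: (_, 'k::field) chains) (m', b) \<noteq> 0"
  obtains k where "k \<in> \<sigma>" "m' = m + xvar k" "b = (u, \<sigma> - {k})"
    | k where "k \<in> \<sigma>" "m' = m + vv u k" "b = (uu u k, \<sigma> - {k})" "\<sigma> - {k} \<subseteq> adm a (uu u k)"
proof -
  have "ccoef (sum f A) s = (\<Sum>x\<in>A. ccoef (f x) s)" for f :: "nat \<Rightarrow> (mon \<times> nat set, 'k) chains" and A s
    by (simp add: ccoef_def lookup_sum)
  then have "(\<Sum>k\<in>\<sigma>. ccoef (act (single m 1) (dterm u \<sigma> k) :: (_, 'k) chains) (m', b)) \<noteq> 0"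
    using assms G_nz by (simp add: dbas_def act_sum)
  then obtain k where "k \<in> \<sigma>" "ccoef (act (single m 1) (dterm u \<sigma> k) :: (_, 'k) chains) (m', b) \<noteq> 0"
    by (meson sum.neutral)
  then show thesis using that unfolding ccoef_dterm[OF assms(1,2)] by (auto split: if_splits)
qed

text \<open>Since \<open>u\<^sub>k\<close> differs from \<open>u\<close>, only the summand with -x_q
  and the old generator reaches this cell, and its coefficient is a sign.\<close>

lemma Emate_coef:
  assumes "u \<in> G" "\<sigma> \<subseteq> adm a u" "q \<in> \<sigma>"
  shows "ccoef (act (single m 1) (dbas (u, \<sigma>)) :: (_, 'k::field) chains) (m + xvar q, u, \<sigma> - {q}) \<noteq> 0"
proof -
  have "ccoef (sum f A) s = (\<Sum>x\<in>A. ccoef (f x) s)" for f :: "nat \<Rightarrow> (mon \<times> nat set, 'k) chains" and A s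
    by (simp add: ccoef_def lookup_sum)
  then have "ccoef (act (single m 1) (dbas (u, \<sigma>)) :: (_, 'k) chains) (m + xvar q, u, \<sigma> - {q}) =
      (\<Sum>k\<in>\<sigma>. ccoef (act (single m 1) (dterm u \<sigma> k) :: (_, 'k) chains) (m + xvar q, u, \<sigma> - {q}))"
    using assms G_nz by (auto simp: dbas_def act_sum)
  also have "\<dots> = (\<Sum>k\<in>\<sigma>. if k = q then - ((-1) ^ alpha \<sigma> q) else 0)"
  proof (rule sum.cong[OF refl])
    fix k assume k: "k \<in> \<sigma>"
    then have "u \<noteq> uu u k" using uu_gt[of u k] assms by auto
    moreover have "\<sigma> - {q} = \<sigma> - {k} \<longleftrightarrow> k = q" using k assms(3) by auto
    ultimately show "ccoef (act (single m 1) (dterm u \<sigma> k) :: (_, 'k) chains) (m + xvar q, u, \<sigma> - {q}) =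
        (if k = q then - ((-1) ^ alpha \<sigma> q) else 0)"
      unfolding ccoef_dterm[OF assms(1,2)] by auto
  qed
  also have "\<dots> \<noteq> 0" using assms finite_subset_adm by simp
  finally show ?thesis .
qed

lemma E_matched: "matched_complex (ccoef :: (mon \<times> nat set, 'k::field) chains \<Rightarrow> _) celt (lin dbas)
   (\<lambda>i. mons n \<times> Bas i) EU EL EC Emate Erk"
proof
  have d_celt: "lin dbas (celt \<kappa> (m, u, \<sigma>)) = act (single m \<kappa>) (dbas (u, \<sigma>) :: (_, 'k) chains)" for \<kappa> m u \<sigma>
    by (simp add: celt_def)
  show "ccoef (c + c') s = ccoef c s + ccoef c' s" for c c' :: "(mon \<times> nat set, 'k) chains" and s
    by (rule ccoef_add)
  show "finite {s. ccoef c s \<noteq> 0}" for c :: "(mon \<times> nat set, 'k) chains" by (rule finite_ccoef)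
  show "(\<And>s. ccoef c s = ccoef c' s) \<Longrightarrow> c = c'" for c c' :: "(mon \<times> nat set, 'k) chains" by (rule ccoef_inj)
  show "ccoef (celt \<kappa> s) s' = (if s' = s then \<kappa> else 0)" for \<kappa> :: 'k and s s' :: "mon \<times> mon \<times> nat set" by (rule ccoef_celt)
  show "lin dbas (c + c') = lin dbas c + (lin dbas c' :: (mon \<times> nat set, 'k) chains)" for c c' by (rule lin_add)
  show "ccoef (lin dbas (celt \<kappa> s)) s' = \<kappa> * ccoef (lin dbas (celt 1 s)) s'" for \<kappa> :: 'k and s s'
    by (cases s) (metis d_celt ccoef_scale)
  show "ccoef (lin dbas (celt (1 :: 'k) s)) y = 0" if "s \<in> mons n \<times> Bas (Suc i)" "y \<notin> mons n \<times> Bas i" for s i y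
  proof (rule ccontr)
    obtain m u \<sigma> where s: "s = (m, u, \<sigma>)" by (cases s)
    obtain m' b where y: "y = (m', b)" by (cases y)
    assume "ccoef (lin dbas (celt (1 :: 'k) s)) y \<noteq> 0"
    then have *: "ccoef (act (single m 1) (dbas (u, \<sigma>)) :: (_, 'k) chains) (m', b) \<noteq> 0" by (simp add: s y d_celt)
    have u: "u \<in> G" "\<sigma> \<subseteq> adm a u" "card \<sigma> = i" "m \<in> mons n" "finite \<sigma>"
      using that(1) finite_subset_adm by (auto simp: s Bas_def)
    show False
    proof (cases "\<sigma> = {}")
      case True
      then have "ccoef (single (0, {}) (single (m + u) 1) :: (_, 'k) chains) (m', b) \<noteq> 0"
        using * G_nz[OF u(1)] by (simp add: dbas_def mono_poly_def mult_single)
      then have "m' = m + u \<and> b = (0, {})" by (auto simp: ccoef_def lookup_single when_def split: if_splits)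
      then have "y \<in> mons n \<times> Bas i" using u True G_mons by (auto simp: y Bas_def mons_add)
      then show False using that by simp
    next
      case False
      have i: "i \<noteq> 0" using False u by auto
      have c: "card (\<sigma> - {k}) = i - 1" if "k \<in> \<sigma>" for k using that u by simp
      have kn: "1 \<le> k" "k \<le> n" "k \<in> adm a u" if "k \<in> \<sigma>" for k using adm_le_n u that by auto
      show False using that(2)
        by (cases rule: toggle_dterm_cases[OF u(1,2) False *])
          (use u i c kn uu_G vv_mons in \<open>auto simp: y Bas_def mons_add\<close>)
    qed
  qed
  show "lin dbas (lin dbas c) = (0 :: (_, 'k) chains)" if "\<And>s. ccoef c s \<noteq> 0 \<Longrightarrow> s \<in> mons n \<times> Bas i"
    for c :: "(mon \<times> nat set, 'k) chains" and i
  proof (rule lin_lin_eq_0)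
    fix b assume "b \<in> keys c"
    then obtain m where "ccoef c (m, b) \<noteq> 0"
      by (metis ccoef_def fst_conv in_keys_iff lookup_zero poly_mapping_eqI snd_conv)
    then have "b \<in> Bas i" using that[of "(m, b)"] by simp
    then show "lin dbas (dbas b) = (0 :: (_, 'k) chains)" by (rule lin_dbas_dbas)
  qed
  show "s \<in> EU \<or> s \<in> EL \<or> s \<in> EC" for s by (cases s) (auto simp: EU_def EL_def EC_def)
  show "EU \<inter> mons n \<times> Bas 0 = {}" by (auto simp: EU_def Bas_def)
  show "EU \<inter> EL = {}" "EL \<inter> EC = {}" by (auto simp: EU_def EL_def EC_def)
  show "Emate s \<in> EL \<inter> mons n \<times> Bas i" if "s \<in> EU" "s \<in> mons n \<times> Bas (Suc i)" for s i
  proof -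
    obtain m u \<sigma> where s: "s = (m, u, \<sigma>)" by (cases s)
    have u: "u \<in> G" "\<sigma> \<subseteq> adm a u" "card \<sigma> = i" "m \<in> mons n" "finite \<sigma>" "u \<noteq> 0"
      using that(2) finite_subset_adm G_nz by (auto simp: s Bas_def)
    show ?thesis
    proof (cases "toggle s = {}")
      case True
      then have "i = 0" using u by (auto simp: s toggle_def)
      have "m + u \<in> M" using M_add[of u m] u G_sub by (auto simp: add.commute)
      then show ?thesis using True \<open>i = 0\<close> M_sub by (auto simp: s Emate_def EL_def Bas_def)
    next
      case False
      define q where "q = Max (toggle s)"
      have q: "q \<in> \<sigma>" using that(1) False by (auto simp: EU_def s q_def)
      have "1 \<le> q" "q \<le> n" using adm_le_n u q by auto
      then have "m + xvar q \<in> mons n" using u by (simp add: mons_add)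
      moreover have "i \<noteq> 0" "card (\<sigma> - {q}) = i - 1" using q u card_gt_0_iff[of \<sigma>] by auto
      moreover have "\<sigma> - {q} \<subseteq> adm a u" using u by auto
      moreover have "Emate s = (m + xvar q, u, \<sigma> - {q})" using False by (simp add: s Emate_def q_def)
      moreover have "toggle (m + xvar q, u, \<sigma> - {q}) = toggle s" using toggle_move[OF q u(2), of m] by (simp add: s)
      then have "(m + xvar q, u, \<sigma> - {q}) \<in> EL"
        using False u(6) unfolding EL_def by (simp add: q_def[symmetric])
      ultimately show ?thesis using u(1) by (simp add: Bas_def)
    qed
  qed
  show "\<exists>s\<in>EU \<inter> mons n \<times> Bas (Suc i). Emate s = y" if "y \<in> EL" "y \<in> mons n \<times> Bas i" for y i
  proof -
    obtain m u \<sigma> where y: "y = (m, u, \<sigma>)" by (cases y)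
    show ?thesis
    proof (cases "u = 0")
      case True
      then have y': "y = (m, 0, {})" "i = 0" using that(2) G_nz by (auto simp: y Bas_def split: if_splits)
      have m: "m \<in> M" using that(1) True by (auto simp: y EL_def)
      \<comment> \<open>A monomial of the ideal is matched with its decomposition: by
        \<open>gg_eq_iff\<close> the cofactor has no admissible variable, so the toggle set is
        empty.\<close>
      define v where "v = gg m"
      have v: "v \<in> G" "v + (m - v) = m" using gg_props[OF m] by (auto simp: v_def mdvd_add_diff)
      have m': "m - v \<in> mons n" using m M_sub diff_in_mons by auto
      have "toggle (m - v, v, {}) = {}"
        using gg_eq_iff[OF v(1) m'] v by (simp add: toggle_def v_def)
      then show ?thesis using v m' G_nz y'
        by (intro bexI[of _ "(m - v, v, {})"]) (auto simp: Emate_def EU_def Bas_def add.commute)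
    next
      case False
      then have u: "u \<in> G" "\<sigma> \<subseteq> adm a u" "card \<sigma> = i - 1" "i \<noteq> 0" "m \<in> mons n" "finite \<sigma>"
        using that(2) finite_subset_adm by (auto simp: y Bas_def split: if_splits)
      define q where "q = Max (toggle y)"
      have ne: "toggle y \<noteq> {}" "q \<notin> \<sigma>" using that(1) False by (auto simp: y EL_def q_def)
      have "q \<in> toggle y" unfolding q_def using ne(1) finite_toggle[OF u(2)] by (simp add: y)
      then have q: "q \<in> keys m" "q \<in> adm a u" using ne(2) by (auto simp: y toggle_def)
      define s where "s = (m - xvar q, u, insert q \<sigma>)"
      have my: "(m - xvar q + xvar q) = m" using xvar_add_diff[OF q(1)] by (simp add: add.commute)
      have ts: "toggle s = toggle y"
        using toggle_move[of q "insert q \<sigma>" u "m - xvar q"] q u ne(2) my by (simp add: s_def y)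
      have "Emate s = y" using ts ne my by (auto simp: s_def y Emate_def q_def)
      moreover have "s \<in> EU" using ts False ne by (auto simp: s_def EU_def q_def)
      moreover have "s \<in> mons n \<times> Bas (Suc i)"
        using u q ne by (auto simp: s_def Bas_def diff_in_mons)
      ultimately show ?thesis by blast
    qed
  qed
  show "s = s'" if s: "s \<in> EU" "s \<in> mons n \<times> Bas (Suc i)" and s': "s' \<in> EU" "s' \<in> mons n \<times> Bas (Suc i)"
    and eq: "Emate s = Emate s'" for s s' i
  proof -
    obtain m u \<sigma> where 1: "s = (m, u, \<sigma>)" by (cases s)
    obtain m' u' \<sigma>' where 2: "s' = (m', u', \<sigma>')" by (cases s')
    have u: "u \<in> G" "\<sigma> \<subseteq> adm a u" "m \<in> mons n" "u \<noteq> 0" using s(2) G_nz by (auto simp: 1 Bas_def)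
    have u': "u' \<in> G" "\<sigma>' \<subseteq> adm a u'" "m' \<in> mons n" "u' \<noteq> 0" using s'(2) G_nz by (auto simp: 2 Bas_def)
    show ?thesis
    proof (cases "toggle s = {}")
      case True
      then have t': "toggle s' = {}" using eq u' by (auto simp: 1 2 Emate_def split: if_splits)
      then have "m + u = m' + u'" using eq True by (auto simp: 1 2 Emate_def)
      \<comment> \<open>With empty toggle sets the generators are recovered from the products as
        their decompositions.\<close>
      moreover have "gg (m + u) = u" "gg (m' + u') = u'"
        using gg_eq_iff[OF u(1,3)] gg_eq_iff[OF u'(1,3)] True t'
        by (simp_all add: 1 2 toggle_def add.commute[of m] add.commute[of m'])
      ultimately have "u = u'" "m = m'" by auto
      then show ?thesis using True t' by (auto simp: 1 2 toggle_def)
    next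
      case False
      then have t': "toggle s' \<noteq> {}" using eq u by (auto simp: 1 2 Emate_def split: if_splits)
      define q where "q = Max (toggle s)"
      define q' where "q' = Max (toggle s')"
      have q: "q \<in> \<sigma>" "q' \<in> \<sigma>'" using s(1) s'(1) False t' by (auto simp: 1 2 EU_def q_def q'_def)
      have eq': "m + xvar q = m' + xvar q'" "u = u'" "\<sigma> - {q} = \<sigma>' - {q'}"
        using eq False t' by (auto simp: 1 2 Emate_def q_def q'_def)
      have "toggle s = toggle (m + xvar q, u, \<sigma> - {q})" unfolding 1 by (rule toggle_move[OF q(1) u(2), symmetric])
      also have "\<dots> = toggle (m' + xvar q', u', \<sigma>' - {q'})" using eq' by simp
      also have "\<dots> = toggle s'" unfolding 2 by (rule toggle_move[OF q(2) u'(2)])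
      finally have "q = q'" by (simp add: q_def q'_def)
      then show ?thesis using eq' q by (auto simp: 1 2)
    qed
  qed
  show "ccoef (lin dbas (celt (1 :: 'k) s)) (Emate s) \<noteq> 0" if "s \<in> EU" "s \<in> mons n \<times> Bas (Suc i)" for s i
  proof -
    obtain m u \<sigma> where s: "s = (m, u, \<sigma>)" by (cases s)
    have u: "u \<in> G" "\<sigma> \<subseteq> adm a u" "u \<noteq> 0" using that(2) G_nz by (auto simp: s Bas_def)
    show ?thesis
    proof (cases "toggle s = {}")
      case True
      then have "\<sigma> = {}" by (auto simp: s toggle_def)
      then show ?thesis using True u
        by (simp add: s d_celt Emate_def dbas_def ccoef_def mono_poly_def mult_single)
    next
      case False
      then have "Max (toggle s) \<in> \<sigma>" using that(1) by (auto simp: EU_def s)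
      then show ?thesis using False Emate_coef[OF u(1,2), where m=m and 'k='k] by (simp add: s d_celt Emate_def)
    qed
  qed
  show "Erk y < Erk (Emate s)" if s: "s \<in> EU" "s \<in> mons n \<times> Bas (Suc i)" and y: "ccoef (lin dbas (celt (1 :: 'k) s)) y \<noteq> 0"
      "y \<in> EL" "y \<noteq> Emate s" for s y i
  proof -
    obtain m u \<sigma> where s': "s = (m, u, \<sigma>)" by (cases s)
    obtain m' b where y': "y = (m', b)" by (cases y)
    have u: "u \<in> G" "\<sigma> \<subseteq> adm a u" "u \<noteq> 0" using s(2) G_nz by (auto simp: s' Bas_def)
    have *: "ccoef (act (single m 1) (dbas (u, \<sigma>)) :: (_, 'k) chains) (m', b) \<noteq> 0" using y(1) by (simp add: s' y' d_celt)
    show ?thesis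
    proof (cases "toggle s = {}")
      case True
      then have "\<sigma> = {}" by (auto simp: s' toggle_def)
      then have "ccoef (single (0, {}) (single (m + u) 1) :: (_, 'k) chains) (m', b) \<noteq> 0"
        using * u by (simp add: dbas_def mono_poly_def mult_single)
      then have "y = Emate s" using True
        by (auto simp: ccoef_def lookup_single when_def s' y' Emate_def split: if_splits)
      then show ?thesis using y by simp
    next
      case False
      define q where "q = Max (toggle s)"
      have q: "q \<in> \<sigma>" using s(1) False by (auto simp: EU_def s' q_def)
      then have "\<sigma> \<noteq> {}" by auto
      have mate: "Emate s = (m + xvar q, u, \<sigma> - {q})" using False by (simp add: s' Emate_def q_def)
      show ?thesis
      proof (cases rule: toggle_dterm_cases[OF u(1,2) \<open>\<sigma> \<noteq> {}\<close> *])
        \<comment> \<open>Moving a variable other than \<open>q\<close> keeps the toggle set, and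
          its maximum \<open>q\<close> stays in the index set, so the cell is not in
          \<open>EL\<close>.\<close>
        case (1 k)
        then have "k \<noteq> q" using y(3) mate by (auto simp: y')
        have "toggle y = toggle s" using toggle_move[OF 1(1) u(2), of m] 1 by (simp add: y' s')
        then have "y \<notin> EL" using 1 \<open>k \<noteq> q\<close> q u by (simp add: EL_def y' q_def s')
        then show ?thesis using y by simp
      next
        \<comment> \<open>The generator grows to \<open>uu u k\<close>, which itself no longer
          counts as a larger one.\<close>
        case (2 k)
        then have "k \<in> adm a u" using u by auto
        then have "{v \<in> G. uu u k < v} \<subset> {v \<in> G. u < v}" using uu_gt[OF u(1)] uu_G[OF u(1)]
          by (auto dest: less_trans)
        then have "card {v \<in> G. uu u k < v} < card {v \<in> G. u < v}" using finite_G by (intro psubset_card_mono) auto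
        then show ?thesis using 2 mate by (simp add: Erk_def y')
      qed
    qed
  qed
  show "lin dbas (celt (1 :: 'k) s) = 0" if "s \<in> EC" for s
    using that by (cases s) (auto simp: EC_def d_celt dbas_def)
qed

end

section \<open>The Koszul complex of the quotient in coordinates\<close>

lemma alpha_insert: "k \<notin> \<rho> \<Longrightarrow> alpha (insert k \<rho>) j = alpha \<rho> j + (if k < j then 1 else 0)"
proof -
  assume "k \<notin> \<rho>"
  moreover have "{s \<in> insert k \<rho>. s < j} = (if k < j then insert k {s \<in> \<rho>. s < j} else {s \<in> \<rho>. s < j})"
    by auto
  ultimately show ?thesis by (simp add: alpha_def)
qed

lemma sign_swap_insert:
  assumes "k \<notin> \<rho>" "j \<notin> \<rho>" "j \<noteq> k"
  shows "(-1) ^ alpha (insert k \<rho>) k * (-1) ^ alpha (insert j (insert k \<rho>)) j =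
    - ((-1) ^ alpha (insert j \<rho>) j * (-1) ^ alpha (insert k (insert j \<rho>)) k :: 'a::comm_ring_1)"
  using assms by (cases "k < j") (auto simp: alpha_insert mult_ac)

context spread_ideal
begin

text \<open>Elements of the quotient \<open>S/I\<close> are represented by the polynomials without monomials in \<open>I\<close>.\<close>

definition nf :: "'k::field mpoly \<Rightarrow> 'k mpoly" where
  "nf p = Poly_Mapping.mapp (\<lambda>m c. if m \<in> M then 0 else c) p"

lemma lookup_nf: "lookup (nf p) m = (if m \<in> M then 0 else lookup p m)"
  by (simp add: nf_def lookup_mapp in_keys_iff when_def)

definition dK :: "(nat set, 'k::field) chains \<Rightarrow> (nat set, 'k) chains" where
  "dK c = Abs_poly_mapping (\<lambda>\<rho>. nf (\<Sum>k\<in>{1..n} - \<rho>.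
     (-1) ^ alpha (insert k \<rho>) k * mono_poly (xvar k) * lookup c (insert k \<rho>)))"

lemma lookup_dK: "lookup (dK c) \<rho> = nf (\<Sum>k\<in>{1..n} - \<rho>.
     (-1) ^ alpha (insert k \<rho>) k * mono_poly (xvar k) * lookup c (insert k \<rho>))"
proof -
  let ?f = "\<lambda>\<rho>. nf (\<Sum>k\<in>{1..n} - \<rho>. (-1) ^ alpha (insert k \<rho>) k * mono_poly (xvar k) * lookup c (insert k \<rho>))"
  \<comment> \<open>An index set with nonzero value arises from one in the support of
    \<open>c\<close> by deleting a single element; this finiteness justifies
    \<open>Abs_poly_mapping\<close>.\<close>
  have "{\<rho>. ?f \<rho> \<noteq> 0} \<subseteq> (\<Union>k\<in>{1..n}. (\<lambda>\<tau>. \<tau> - {k}) ` keys c)"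
  proof
    fix \<rho> assume "\<rho> \<in> {\<rho>. ?f \<rho> \<noteq> 0}"
    then have "(\<Sum>k\<in>{1..n} - \<rho>. (-1) ^ alpha (insert k \<rho>) k * mono_poly (xvar k) * lookup c (insert k \<rho>)) \<noteq> 0"
      by (metis (mono_tags, lifting) lookup_nf lookup_zero mem_Collect_eq poly_mapping_eqI)
    then obtain k where "k \<in> {1..n} - \<rho>" "lookup c (insert k \<rho>) \<noteq> 0"
      by (metis (no_types, lifting) mult_zero_right sum.neutral)
    then show "\<rho> \<in> (\<Union>k\<in>{1..n}. (\<lambda>\<tau>. \<tau> - {k}) ` keys c)"
      by (intro UN_I[of k] image_eqI[of _ _ "insert k \<rho>"]) (auto simp: in_keys_iff)
  qed
  then have "finite {\<rho>. ?f \<rho> \<noteq> 0}" by (rule finite_subset) auto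
  then show ?thesis by (simp add: dK_def)
qed

lemma ccoef_dK: "ccoef (dK c) (w, \<rho>) = (if w \<in> M then 0 else \<Sum>k\<in>{1..n} - \<rho>.
   (-1) ^ alpha (insert k \<rho>) k * (if k \<in> keys w then ccoef c (w - xvar k, insert k \<rho>) else 0))"
  by (auto simp: ccoef_def lookup_dK lookup_nf lookup_sum mult.assoc lookup_sign_mult
      lookup_single_mult mono_poly_def mdvd_xvar_iff intro!: sum.cong)

definition KCell :: "nat \<Rightarrow> (mon \<times> nat set) set" where
  "KCell i = {(w, \<tau>). w \<in> mons n \<and> w \<notin> M \<and> \<tau> \<subseteq> {1..n} \<and> card \<tau> = i}"

text \<open>Reads \<open>dK\<close> from the side of the source index set \<tau> instead of the
  target \<rho>.\<close>

lemma ccoef_dK_celt: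
  assumes "\<tau> \<subseteq> {1..n}"
  shows "ccoef (dK (celt \<kappa> (w, \<tau>))) (w', \<rho>) =
    (\<Sum>k\<in>\<tau>. if \<rho> = \<tau> - {k} \<and> w' = w + xvar k \<and> w' \<notin> M then (-1) ^ alpha \<tau> k * \<kappa> else 0)"
proof (cases "w' \<in> M")
  case False
  have "finite \<tau>" using assms finite_subset by blast
  have "ccoef (dK (celt \<kappa> (w, \<tau>))) (w', \<rho>) =
     (\<Sum>k\<in>{1..n} - \<rho>. if k \<in> \<tau> \<and> \<rho> = \<tau> - {k} \<and> w' = w + xvar k then (-1) ^ alpha \<tau> k * \<kappa> else 0)"
  proof -
    have "ccoef (dK (celt \<kappa> (w, \<tau>))) (w', \<rho>) = (\<Sum>k\<in>{1..n} - \<rho>. (-1) ^ alpha (insert k \<rho>) k *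
        (if k \<in> keys w' then if (w' - xvar k, insert k \<rho>) = (w, \<tau>) then \<kappa> else 0 else 0))"
      using False by (simp only: ccoef_dK ccoef_celt if_False)
    also have "\<dots> = (\<Sum>k\<in>{1..n} - \<rho>. if k \<in> \<tau> \<and> \<rho> = \<tau> - {k} \<and> w' = w + xvar k then (-1) ^ alpha \<tau> k * \<kappa> else 0)"
    proof (rule sum.cong[OF refl])
      fix k assume k: "k \<in> {1..n} - \<rho>"
      have 1: "insert k \<rho> = \<tau> \<longleftrightarrow> k \<in> \<tau> \<and> \<rho> = \<tau> - {k}" using k by auto
      have 2: "k \<in> keys w' \<and> w' - xvar k = w \<longleftrightarrow> w' = w + xvar k"
        using xvar_add_diff[of k w'] by (auto simp: keys_add_mon add.commute)
      show "(-1) ^ alpha (insert k \<rho>) k * (if k \<in> keys w' then if (w' - xvar k, insert k \<rho>) = (w, \<tau>) then \<kappa> else 0 else 0) =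
         (if k \<in> \<tau> \<and> \<rho> = \<tau> - {k} \<and> w' = w + xvar k then (-1) ^ alpha \<tau> k * \<kappa> else 0)"
        using 1 2 by (cases "insert k \<rho> = \<tau>") auto
    qed
    finally show ?thesis .
  qed
  also have "\<dots> = (\<Sum>k\<in>\<tau>. if k \<in> \<tau> \<and> \<rho> = \<tau> - {k} \<and> w' = w + xvar k then (-1) ^ alpha \<tau> k * \<kappa> else 0)"
    by (rule sum.mono_neutral_cong) (use assms \<open>finite \<tau>\<close> in auto)
  finally show ?thesis using False by (simp cong: sum.cong)
next
  case True
  then show ?thesis by (auto simp: ccoef_dK intro!: sum.neutral[symmetric])
qed

lemma ccoef_dK_celt_nz:
  assumes "\<tau> \<subseteq> {1..n}" "ccoef (dK (celt (1::'k::field) (w, \<tau>))) y \<noteq> 0"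
  obtains k where "k \<in> \<tau>" "y = (w + xvar k, \<tau> - {k})" "w + xvar k \<notin> M"
proof -
  obtain w' \<rho> where y: "y = (w', \<rho>)" by (cases y)
  have "(\<Sum>k\<in>\<tau>. if \<rho> = \<tau> - {k} \<and> w' = w + xvar k \<and> w' \<notin> M then (-1) ^ alpha \<tau> k * (1::'k) else 0) \<noteq> 0"
    using assms(2) unfolding y ccoef_dK_celt[OF assms(1)] .
  then obtain k where "k \<in> \<tau>" "(if \<rho> = \<tau> - {k} \<and> w' = w + xvar k \<and> w' \<notin> M then (-1) ^ alpha \<tau> k * (1::'k) else 0) \<noteq> 0"
    by (rule sum.not_neutral_contains_not_neutral)
  then show thesis using that by (auto simp: y split: if_splits)
qed

lemma ccoef_dK_celt_mate:
  assumes "\<tau> \<subseteq> {1..n}" "k \<in> \<tau>" "w + xvar k \<notin> M"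
  shows "ccoef (dK (celt (1::'k::field) (w, \<tau>))) (w + xvar k, \<tau> - {k}) \<noteq> 0"
proof -
  have "finite \<tau>" using assms finite_subset by blast
  have "(\<Sum>j\<in>\<tau>. if \<tau> - {k} = \<tau> - {j} \<and> w + xvar k = w + xvar j \<and> w + xvar k \<notin> M then (-1) ^ alpha \<tau> j * (1::'k) else 0)
     = (\<Sum>j\<in>\<tau>. if j = k then (-1) ^ alpha \<tau> k else 0)"
    by (rule sum.cong) (use assms in auto)
  then show ?thesis unfolding ccoef_dK_celt[OF assms(1)] using \<open>finite \<tau>\<close> assms by simp
qed

lemma dK_dK: "dK (dK c) = (0 :: (nat set, 'k::field) chains)"
proof (rule ccoef_inj)
  fix s :: "mon \<times> nat set"
  obtain w \<rho> where s: "s = (w, \<rho>)" by (cases s)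
  have "ccoef (dK (dK c)) (w, \<rho>) = 0"
  proof (cases "w \<in> M")
    case False
    define h where "h = (\<lambda>k j. (-1) ^ alpha (insert k \<rho>) k * (-1) ^ alpha (insert j (insert k \<rho>)) j *
      (if k \<in> keys w \<and> j \<in> keys w then ccoef c (w - xvar k - xvar j, insert j (insert k \<rho>)) else 0))"
    have "ccoef (dK (dK c)) (w, \<rho>) = (\<Sum>k\<in>{1..n} - \<rho>. (-1) ^ alpha (insert k \<rho>) k *
        (if k \<in> keys w then ccoef (dK c) (w - xvar k, insert k \<rho>) else 0))"
      using False by (simp only: ccoef_dK[of "dK c"] if_False)
    also have "\<dots> = (\<Sum>k\<in>{1..n} - \<rho>. \<Sum>j\<in>({1..n} - \<rho>) - {k}. h k j)"
    proof (rule sum.cong[OF refl])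
      fix k assume k: "k \<in> {1..n} - \<rho>"
      have eq: "{1..n} - insert k \<rho> = {1..n} - \<rho> - {k}" by auto
      show "(-1) ^ alpha (insert k \<rho>) k * (if k \<in> keys w then ccoef (dK c) (w - xvar k, insert k \<rho>) else 0) =
         (\<Sum>j\<in>{1..n} - \<rho> - {k}. h k j)"
      proof (cases "k \<in> keys w")
        case True
        \<comment> \<open>A divisor of a monomial outside \<open>M\<close> is outside
          \<open>M\<close>, so the inner passage to normal forms changes nothing.\<close>
        have nM: "w - xvar k \<notin> M"
          using M_add[of "w - xvar k" "xvar k"] False xvar_add_diff[OF True] k by (auto simp: add.commute)
        have kj: "j \<in> keys (w - xvar k) \<longleftrightarrow> j \<in> keys w" if "j \<noteq> k" for j
          using that by (simp add: in_keys_iff lookup_minus lookup_xvar)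
        have "(-1) ^ alpha (insert k \<rho>) k * ccoef (dK c) (w - xvar k, insert k \<rho>) =
          (\<Sum>j\<in>{1..n} - \<rho> - {k}. (-1) ^ alpha (insert k \<rho>) k * ((-1) ^ alpha (insert j (insert k \<rho>)) j *
            (if j \<in> keys (w - xvar k) then ccoef c (w - xvar k - xvar j, insert j (insert k \<rho>)) else 0)))"
          using nM by (simp only: ccoef_dK if_False eq sum_distrib_left)
        also have "\<dots> = (\<Sum>j\<in>{1..n} - \<rho> - {k}. h k j)"
          by (rule sum.cong[OF refl]) (use True kj in \<open>simp add: h_def mult.assoc\<close>)
        finally show ?thesis using True by simp
      qed (simp add: h_def)
    qed
    also have "\<dots> = 0"
    proof (rule sum_antisymmetric)
      fix j k assume jk: "j \<in> {1..n} - \<rho>" "k \<in> {1..n} - \<rho>" "j \<noteq> k"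
      have "w - xvar j - xvar k = w - xvar k - xvar j"
        by (intro poly_mapping_eqI) (simp add: lookup_minus)
      moreover have "insert k (insert j \<rho>) = insert j (insert k \<rho>)" by auto
      ultimately show "h j k = - h k j"
        unfolding h_def using sign_swap_insert[of j \<rho> k, where 'a='k] jk by auto
    qed simp
    finally show ?thesis .
  qed (simp add: ccoef_dK)
  then show "ccoef (dK (dK c)) s = ccoef 0 s" by (simp add: s ccoef_def)
qed

text \<open>Modelled on the cycle z(u;\<sigma>), whose largest index is max(u) and whose coefficient
  u' becomes u on multiplication by that variable. For a cell with coefficient w and largest index
  N, the product of x_N and w, if in the ideal, takes the role of a multiple of u:
  \<open>gen\<close> is its decomposition and \<open>rest\<close> the cofactor.\<close>

definition topv :: "mon \<times> nat set \<Rightarrow> nat" where "topv s = Max (keys (fst s) \<union> snd s)"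
definition gen :: "mon \<times> nat set \<Rightarrow> mon" where "gen s = gg (fst s + xvar (topv s))"
definition rest :: "mon \<times> nat set \<Rightarrow> mon" where "rest s = fst s + xvar (topv s) - gen s"
text \<open>What separates a cell from a cycle z(u;\<sigma>): the variables of the cofactor and the
  inadmissible indices.\<close>

definition inadm :: "mon \<times> nat set \<Rightarrow> nat set" where
  "inadm s = keys (rest s) \<union> (snd s - {topv s} - adm a (gen s))"

definition nonzero :: "mon \<times> nat set \<Rightarrow> bool" where "nonzero s \<longleftrightarrow> keys (fst s) \<union> snd s \<noteq> {}"
definition kind2 :: "mon \<times> nat set \<Rightarrow> bool" where
  "kind2 s \<longleftrightarrow> nonzero s \<and> topv s \<in> snd s \<and> fst s + xvar (topv s) \<in> M"

text \<open>The matching has two stages: the variable \<open>x\<^bsub>topv\<^esub>\<close> is toggled whenever this is possible, and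
  on the remaining cells (\<open>kind2\<close>) the largest inadmissible variable is toggled.\<close>

definition KU where "KU = {s. (nonzero s \<and> topv s \<in> snd s \<and> fst s + xvar (topv s) \<notin> M) \<or>
   (kind2 s \<and> inadm s \<noteq> {} \<and> Max (inadm s) \<in> snd s)}"
definition KL where "KL = {s. (nonzero s \<and> topv s \<notin> snd s) \<or>
   (kind2 s \<and> inadm s \<noteq> {} \<and> Max (inadm s) \<notin> snd s)}"
definition KC where "KC = {s. \<not> nonzero s \<or> (kind2 s \<and> inadm s = {})}"
definition Kpiv :: "mon \<times> nat set \<Rightarrow> nat" where "Kpiv s = (if kind2 s then Max (inadm s) else topv s)"
definition Kmate :: "mon \<times> nat set \<Rightarrow> mon \<times> nat set" where
  "Kmate s = (fst s + xvar (Kpiv s), snd s - {Kpiv s})"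
text \<open>Cells outside \<open>kind2\<close> rank above all others, because boundaries of
  first-stage cells may contain second-stage ones. Inside \<open>kind2\<close> the rank counts the
  larger generators, at most \<open>card G\<close> many.\<close>

definition Krk :: "mon \<times> nat set \<Rightarrow> nat" where
  "Krk s = (if kind2 s then card {v \<in> G. gen s < v} else Suc (card G))"

text \<open>Coordinates for the cells of \<open>kind2\<close>: the coefficient is u'm and the index
  set is \<sigma> together with max(u). The variables of \<open>m\<close> and the inadmissible
  indices of \<sigma> are what the second stage toggles; m = 1 with admissible \<sigma> is
  z(u;\<sigma>).\<close>

definition par :: "mon \<times> nat set \<Rightarrow> mon \<Rightarrow> mon \<Rightarrow> nat set \<Rightarrow> bool" where
  "par s u m \<sigma> \<longleftrightarrow> s = (u - xvar (maxv u) + m, insert (maxv u) \<sigma>) \<and> u \<in> G \<and> m \<in> mons n \<and>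
     keys m \<subseteq> {..<maxv u} - adm a u \<and> \<sigma> \<subseteq> {1..<maxv u}"

text \<open>The essential point is that u'm stays outside the ideal: each variable of
  \<open>m\<close> divides \<open>u\<close> before its last variable and with rank below
  \<open>a\<close>, so the reduction of u'm divides u', which is outside the ideal by minimality of
  \<open>u\<close>.\<close>

lemma par_E:
  assumes "par s u m \<sigma>"
  shows "s \<in> KCell (card \<sigma> + 1)" "kind2 s" "topv s = maxv u" "gen s = u" "rest s = m" "snd s = insert (maxv u) \<sigma>"
    "fst s = u - xvar (maxv u) + m" "maxv u \<notin> \<sigma>" "inadm s = keys m \<union> (\<sigma> - adm a u)" "finite \<sigma>"
proof -
  define N where "N = maxv u"
  have s: "s = (u - xvar N + m, insert N \<sigma>)" and u: "u \<in> G" and m: "m \<in> mons n" "keys m \<subseteq> {..<N} - adm a u"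
    and \<sigma>: "\<sigma> \<subseteq> {1..<N}" using assms by (auto simp: par_def N_def)
  show fs: "finite \<sigma>" using \<sigma> finite_subset by blast
  have N: "N \<in> keys u" "1 \<le> N" "N \<le> n" using maxv_in_keys[OF G_nz[OF u]] maxv_le_n[OF u] by (auto simp: N_def)
  have w: "u - xvar N + m + xvar N = u + m"
    using xvar_add_diff[OF N(1)] by (metis add.assoc add.commute)
  have "keys (u - xvar N) \<subseteq> {..N}" using maxv_ge[of _ u] by (auto simp: N_def in_keys_iff lookup_minus)
  then have k: "keys (u - xvar N + m) \<union> insert N \<sigma> \<subseteq> {..N}" using m \<sigma> by (auto simp: keys_add_mon)
  have ts: "topv s = N" unfolding topv_def
    by (rule Max_eqI) (use k fs in \<open>auto simp: s\<close>)
  then show "topv s = maxv u" by (simp add: N_def)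
  have fs_add: "fst s + xvar N = u + m" using w by (simp add: s)
  have "keys m \<inter> adm a u = {}" using m by auto
  then have "gg (u + m) = u" using gg_eq_iff u m by blast
  then show gen: "gen s = u" by (simp only: gen_def ts fs_add)
  show rest: "rest s = m" by (simp add: rest_def gen ts fs_add)
  show "maxv u \<notin> \<sigma>" using \<sigma> by (auto simp: N_def)
  then show "inadm s = keys m \<union> (\<sigma> - adm a u)"
    using adm_subset[of a u] unfolding inadm_def rest gen ts by (auto simp: s N_def)
  show "snd s = insert (maxv u) \<sigma>" "fst s = u - xvar (maxv u) + m" by (auto simp: s N_def)
  have "u + m \<in> M" using M_add u m G_sub by auto
  then show "kind2 s" unfolding kind2_def ts fs_add by (simp add: nonzero_def s)
  have um: "u - xvar N \<in> mons n" using u G_mons diff_in_mons by auto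
  have wn: "u - xvar N + m \<in> mons n" using um m by (simp add: mons_add)
  have mu: "i \<in> keys u \<and> rnk u i < a" if "i \<in> keys m" for i
    using that m by (fastforce simp: adm_def N_def mons_def)
  have "u - xvar N + m \<notin> M"
  proof
    assume "u - xvar N + m \<in> M"
    then have r: "reduce a (u - xvar N + m) \<in> M" using reduce_M_iff[OF wn] by simp
    have "mdvd (reduce a (u - xvar N + m)) (u - xvar N)" unfolding mdvd_iff
    proof
      fix l
      show "lookup (reduce a (u - xvar N + m)) l \<le> lookup (u - xvar N) l"
      proof (cases "l \<in> keys m")
        case True
        then have l: "l < N" "l \<in> keys u" "rnk u l < a" using m mu by auto
        have "rnk (u - xvar N + m) l = rnk u l"
          using l mu by (intro rnk_cong) (auto simp: keys_add_mon in_keys_iff lookup_minus lookup_xvar)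
        then show ?thesis using l by (simp add: lookup_reduce lookup_minus lookup_xvar in_keys_iff)
      next
        case False
        then show ?thesis using mdvd_reduce[of a "u - xvar N + m"]
          by (simp add: mdvd_iff lookup_add in_keys_iff) (metis add.right_neutral)
      qed
    qed
    then have "u - xvar N \<in> M" using r M_mdvd um by blast
    then have "u - xvar N = u" using G_minimal[OF u] by simp
    then show False using N by (metis in_keys_iff lookup_minus lookup_xvar diff_less not_gr_zero zero_less_one less_irrefl)
  qed
  then show "s \<in> KCell (card \<sigma> + 1)"
    using wn N \<sigma> fs \<open>maxv u \<notin> \<sigma>\<close> by (auto simp: KCell_def s N_def)
qed

text \<open>With N the largest index and w the coefficient: w is outside the ideal, so the
  decomposition u of the product of x_N and w does not divide w. Hence u uses up the full power of
  x_N, which gives max(u) = N and keeps x_N out of the cofactor.\<close>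

lemma kind2_par:
  assumes s: "s \<in> KCell i" "kind2 s"
  shows "par s (gen s) (rest s) (snd s - {topv s})"
proof -
  obtain w \<tau> where sw: "s = (w, \<tau>)" by (cases s)
  define N where "N = topv s"
  have w: "w \<in> mons n" "w \<notin> M" "\<tau> \<subseteq> {1..n}" "finite \<tau>" using s(1) finite_subset by (auto simp: sw KCell_def)
  have N: "N \<in> \<tau>" "w + xvar N \<in> M" using s(2) by (auto simp: kind2_def N_def sw)
  have le: "k \<le> N" if "k \<in> keys w \<union> \<tau>" for k
    unfolding N_def topv_def by (rule Max_ge) (use w that in \<open>auto simp: sw\<close>)
  define u where "u = gg (w + xvar N)"
  define m where "m = w + xvar N - u"
  have u: "u \<in> G" "mdvd u (w + xvar N)" using gg_props[OF N(2)] by (auto simp: u_def)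
  have um: "u + m = w + xvar N" using u by (simp add: m_def mdvd_add_diff)
  have nd: "\<not> mdvd u w" using w u(1) M_mdvd G_sub by blast
  have Nu: "N \<in> keys u"
  proof (rule ccontr)
    assume "N \<notin> keys u"
    then have "lookup u i \<le> lookup w i" for i
      using u(2) by (cases "i = N") (auto simp: mdvd_iff lookup_add lookup_xvar in_keys_iff dest: spec[of _ i])
    then have "mdvd u w" by (simp add: mdvd_iff)
    then show False using nd by simp
  qed
  have ku: "keys u \<subseteq> keys w \<union> {N}" "keys m \<subseteq> keys w \<union> {N}"
    using um by (metis Un_upper1 keys_add_mon keys_xvar) (metis Un_upper2 um keys_add_mon keys_xvar)
  have mx: "maxv u = N" using Nu ku le N by (intro maxv_eqI) auto
  have Nm: "N \<notin> keys m"
  proof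
    assume "N \<in> keys m"
    then have "w + xvar N = u + (m - xvar N) + xvar N" using um xvar_add_diff[of N m] by (metis add.assoc add.commute)
    then have "w = u + (m - xvar N)" by simp
    then show False using nd by (simp add: mdvd_def)
  qed
  have "m \<in> mons n" using w N um by (metis M_sub mons_add subsetD)
  moreover have "keys m \<inter> adm a u = {}" using gg_eq_iff[OF u(1) \<open>m \<in> mons n\<close>] um by (simp add: u_def)
  moreover have "keys m \<subseteq> {..<N}" using ku Nm le by (auto simp: less_le)
  moreover have "w = u - xvar N + m"
    using um xvar_add_diff[OF Nu] by (metis add.assoc add.commute add_right_cancel)
  moreover have "\<tau> = insert N (\<tau> - {N})" using N by auto
  moreover have "\<tau> - {N} \<subseteq> {1..<N}" using w le by (fastforce simp: less_le)
  moreover have "gen s = u" "rest s = m" by (auto simp: gen_def rest_def u_def m_def sw N_def)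
  ultimately have "par (w, \<tau>) u m (\<tau> - {N})" "gen s = u" "rest s = m"
    using u mx unfolding par_def by auto
  then show ?thesis by (simp add: sw N_def)
qed

text \<open>Neither the generator nor \<open>inadm\<close> changes, so the maximum of
  \<open>inadm\<close> identifies the partner from both sides.\<close>

lemma par_toggle:
  assumes "par s u m \<sigma>" "k \<in> \<sigma>" "k \<notin> adm a u"
  shows "par (fst s + xvar k, snd s - {k}) u (m + xvar k) (\<sigma> - {k})"
    "inadm (fst s + xvar k, snd s - {k}) = inadm s"
proof -
  have k: "1 \<le> k" "k < maxv u" using assms by (auto simp: par_def)
  moreover have "k \<le> n" using k maxv_le_n[of u] assms by (auto simp: par_def)
  ultimately show *: "par (fst s + xvar k, snd s - {k}) u (m + xvar k) (\<sigma> - {k})"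
    using assms by (auto simp: par_def add.assoc keys_add_mon mons_add)
  show "inadm (fst s + xvar k, snd s - {k}) = inadm s"
    using par_E(9)[OF *] par_E(9)[OF assms(1)] assms by (auto simp: keys_add_mon)
qed

lemma par_untoggle:
  assumes "par s u m \<sigma>" "k \<in> keys m" "k \<notin> \<sigma>"
  shows "par (fst s - xvar k, insert k (snd s)) u (m - xvar k) (insert k \<sigma>)"
proof -
  have k: "k < maxv u" "k \<notin> adm a u" "1 \<le> k" using assms by (auto simp: par_def mons_def)
  have "u - xvar (maxv u) + m - xvar k = u - xvar (maxv u) + (m - xvar k)"
    using assms(2) by (intro poly_mapping_eqI) (auto simp: lookup_add lookup_minus lookup_xvar in_keys_iff)
  moreover have "keys (m - xvar k) \<subseteq> keys m" by (rule mdvd_keys) simp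
  ultimately show ?thesis using assms k by (auto simp: par_def diff_in_mons insert_commute)
qed

lemma KCell_finite: "s \<in> KCell i \<Longrightarrow> finite (snd s)"
  using finite_subset[of "snd s" "{1..n}"] by (auto simp: KCell_def)

lemma top_ge: "s \<in> KCell i \<Longrightarrow> k \<in> keys (fst s) \<union> snd s \<Longrightarrow> k \<le> topv s"
  unfolding topv_def by (rule Max_ge) (use KCell_finite in auto)

lemma top_in: "s \<in> KCell i \<Longrightarrow> nonzero s \<Longrightarrow> topv s \<in> keys (fst s) \<union> snd s"
  unfolding topv_def nonzero_def by (rule Max_in) (use KCell_finite in auto)

lemma top_eqI: "s \<in> KCell i \<Longrightarrow> k \<in> keys (fst s) \<union> snd s \<Longrightarrow> (\<And>j. j \<in> keys (fst s) \<union> snd s \<Longrightarrow> j \<le> k) \<Longrightarrow> topv s = k"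
  unfolding topv_def by (rule Max_eqI) (use KCell_finite in auto)

lemma KCell_move:
  assumes "s \<in> KCell (Suc i)" "k \<in> snd s" "fst s + xvar k \<notin> M"
  shows "(fst s + xvar k, snd s - {k}) \<in> KCell i"
proof -
  have "finite (snd s)" using assms KCell_finite by blast
  then show ?thesis using assms by (auto simp: KCell_def mons_add)
qed

lemma top_move:
  assumes "s \<in> KCell (Suc i)" "k \<in> snd s" "fst s + xvar k \<notin> M"
  shows "topv (fst s + xvar k, snd s - {k}) = topv s" "nonzero (fst s + xvar k, snd s - {k})"
proof -
  have "nonzero s" using assms by (auto simp: nonzero_def)
  then show "topv (fst s + xvar k, snd s - {k}) = topv s"
    using top_in[OF assms(1)] top_ge[OF assms(1)] assms(2)
    by (intro top_eqI[OF KCell_move[OF assms]]) (auto simp: keys_add_mon)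
qed (auto simp: nonzero_def keys_add_mon)

text \<open>First-stage pairs stay outside \<open>kind2\<close>, and second-stage pairs will stay
  inside it, so the two stages can be matched independently.\<close>

lemma KU_kind1:
  assumes "s \<in> KU" "s \<in> KCell (Suc i)" "\<not> kind2 s"
  shows "topv s \<in> snd s" "fst s + xvar (topv s) \<notin> M" "Kmate s = (fst s + xvar (topv s), snd s - {topv s})"
    "topv (Kmate s) = topv s" "Kmate s \<in> KCell i" "Kmate s \<in> KL" "\<not> kind2 (Kmate s)"
proof -
  show t: "topv s \<in> snd s" "fst s + xvar (topv s) \<notin> M" using assms by (auto simp: KU_def)
  show m: "Kmate s = (fst s + xvar (topv s), snd s - {topv s})" using assms by (simp add: Kmate_def Kpiv_def)
  show "Kmate s \<in> KCell i" unfolding m by (rule KCell_move[OF assms(2) t])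
  show tm: "topv (Kmate s) = topv s" unfolding m by (rule top_move[OF assms(2) t])
  have "nonzero (Kmate s)" unfolding m by (rule top_move[OF assms(2) t])
  then show "Kmate s \<in> KL" "\<not> kind2 (Kmate s)" using tm by (auto simp: KL_def kind2_def m)
qed

lemma KU_kind2:
  assumes "s \<in> KU" "s \<in> KCell (Suc i)" "kind2 s"
  shows "par s (gen s) (rest s) (snd s - {topv s})" "Kpiv s \<in> snd s - {topv s}" "Kpiv s = Max (inadm s)"
    "par (Kmate s) (gen s) (rest s + xvar (Kpiv s)) (snd s - {topv s} - {Kpiv s})" "inadm (Kmate s) = inadm s"
    "Kmate s \<in> KCell i" "Kmate s \<in> KL"
proof -
  define u where "u = gen s"
  define m where "m = rest s"
  define \<sigma> where "\<sigma> = snd s - {topv s}"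
  define r where "r = Max (inadm s)"
  have p: "par s u m \<sigma>" unfolding u_def m_def \<sigma>_def by (rule kind2_par[OF assms(2,3)])
  note pE = par_E[OF p]
  have ne: "inadm s \<noteq> {}" "r \<in> snd s" using assms by (auto simp: KU_def kind2_def r_def)
  have "finite (inadm s)" using pE by simp
  then have "r \<in> inadm s" using ne by (simp add: r_def)
  then have "r \<noteq> maxv u" using pE(9) p by (auto simp: par_def)
  then have r: "r \<in> \<sigma>" using ne pE(6) by auto
  have ra: "r \<notin> adm a u" using \<open>r \<in> inadm s\<close> pE(9) p by (auto simp: par_def)
  have m': "Kmate s = (fst s + xvar r, snd s - {r})" using assms(3) by (simp add: Kmate_def Kpiv_def r_def)
  have p': "par (Kmate s) u (m + xvar r) (\<sigma> - {r})" unfolding m' by (rule par_toggle(1)[OF p r ra])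
  have i': "inadm (Kmate s) = inadm s" unfolding m' by (rule par_toggle(2)[OF p r ra])
  have "card (snd s) = Suc i" using assms(2) by (auto simp: KCell_def)
  then have "card (\<sigma> - {r}) + 1 = i" using pE(6,8,10) r card_Suc_Diff1[of \<sigma> r] by auto
  then have c: "Kmate s \<in> KCell i" using par_E(1)[OF p'] by simp
  have "Max (inadm s) \<notin> snd (Kmate s)" by (simp add: m' r_def)
  then have "Kmate s \<in> KL" using par_E(2)[OF p'] i' ne by (simp add: KL_def)
  have "Kpiv s = r" using assms(3) by (simp add: Kpiv_def r_def)
  then show "par s (gen s) (rest s) (snd s - {topv s})" "Kpiv s \<in> snd s - {topv s}" "Kpiv s = Max (inadm s)"
    "par (Kmate s) (gen s) (rest s + xvar (Kpiv s)) (snd s - {topv s} - {Kpiv s})" "inadm (Kmate s) = inadm s"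
    "Kmate s \<in> KCell i" "Kmate s \<in> KL"
    using p p' r i' c \<open>Kmate s \<in> KL\<close> unfolding u_def m_def \<sigma>_def r_def by simp_all
qed

lemma K_matched: "matched_complex (ccoef :: (nat set, 'k::field) chains \<Rightarrow> _) celt dK KCell KU KL KC Kmate Krk"
proof
  show "ccoef (c + c') s = ccoef c s + ccoef c' s" for c c' :: "(nat set, 'k) chains" and s by (rule ccoef_add)
  show "finite {s. ccoef c s \<noteq> 0}" for c :: "(nat set, 'k) chains" by (rule finite_ccoef)
  show "(\<And>s. ccoef c s = ccoef c' s) \<Longrightarrow> c = c'" for c c' :: "(nat set, 'k) chains" by (rule ccoef_inj)
  show "ccoef (celt \<kappa> s) s' = (if s' = s then \<kappa> else 0)" for \<kappa> :: 'k and s s' :: "mon \<times> nat set" by (rule ccoef_celt)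
  show "dK (c + c') = dK c + (dK c' :: (nat set, 'k) chains)" for c c'
  proof (rule ccoef_inj)
    show "ccoef (dK (c + c')) s = ccoef (dK c + dK c') s" for s
      by (cases s) (auto simp: ccoef_dK ccoef_add sum.distrib[symmetric] distrib_left intro!: sum.cong)
  qed
  show "ccoef (dK (celt \<kappa> s)) s' = \<kappa> * ccoef (dK (celt 1 s)) s'" for \<kappa> :: 'k and s s'
    by (cases s'; cases s) (auto simp: ccoef_dK ccoef_celt sum_distrib_left intro!: sum.cong)
  show "ccoef (dK (celt (1 :: 'k) s)) y = 0" if "s \<in> KCell (Suc i)" "y \<notin> KCell i" for s i y
  proof (rule ccontr)
    assume nz: "ccoef (dK (celt (1 :: 'k) s)) y \<noteq> 0"
    have "snd s \<subseteq> {1..n}" using that(1) by (auto simp: KCell_def)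
    then obtain k where "k \<in> snd s" "y = (fst s + xvar k, snd s - {k})" "fst s + xvar k \<notin> M"
      using ccoef_dK_celt_nz[of "snd s" "fst s" y, where 'k='k] nz by auto
    then show False using KCell_move[OF that(1)] that(2) by simp
  qed
  show "dK (dK c) = (0 :: (nat set, 'k) chains)" for c by (rule dK_dK)
  show "s \<in> KU \<or> s \<in> KL \<or> s \<in> KC" for s by (auto simp: KU_def KL_def KC_def kind2_def)
  show "KU \<inter> KCell 0 = {}"
  proof -
    have "snd s = {}" if "s \<in> KCell 0" for s using KCell_finite[OF that] that by (auto simp: KCell_def)
    then show ?thesis by (auto simp: KU_def kind2_def)
  qed
  show "KU \<inter> KL = {}" by (auto simp: KU_def KL_def kind2_def)
  show "KL \<inter> KC = {}" by (auto simp: KL_def KC_def kind2_def)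
  show "Kmate s \<in> KL \<inter> KCell i" if "s \<in> KU" "s \<in> KCell (Suc i)" for s i
  proof (cases "kind2 s")
    case True
    then show ?thesis using KU_kind2[OF that True] by blast
  next
    case False
    then show ?thesis using KU_kind1[OF that False] by blast
  qed
  show "\<exists>s\<in>KU \<inter> KCell (Suc i). Kmate s = y" if y: "y \<in> KL" "y \<in> KCell i" for y i
  proof (cases "kind2 y")
    case True
    define r where "r = Max (inadm y)"
    note p = kind2_par[OF y(2) True]
    let ?\<sigma> = "snd y - {topv y}"
    have ne: "inadm y \<noteq> {}" "r \<notin> snd y" using y True by (auto simp: KL_def kind2_def r_def)
    have "finite (inadm y)" using par_E(9,10)[OF p] by simp
    then have "r \<in> inadm y" using ne by (simp add: r_def)
    then have r: "r \<in> keys (rest y)" using ne by (auto simp: inadm_def)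
    define s where "s = (fst y - xvar r, insert r (snd y))"
    have ps: "par s (gen y) (rest y - xvar r) (insert r ?\<sigma>)"
      unfolding s_def using par_untoggle[OF p r] ne by simp
    have ra: "r \<notin> adm a (gen y)" using r p by (auto simp: par_def)
    have rw: "r \<in> keys (fst y)" using par_E(7)[OF p] r by (simp add: keys_add_mon)
    have y': "(fst s + xvar r, snd s - {r}) = y"
      using xvar_add_diff[OF rw] ne by (simp add: s_def add.commute prod_eq_iff)
    have ia: "inadm s = inadm y" using par_toggle(2)[OF ps _ ra] y' by simp
    have k2: "kind2 s" by (rule par_E(2)[OF ps])
    have "Kmate s = y" using k2 ia y' by (simp add: Kmate_def Kpiv_def r_def)
    moreover have "s \<in> KU" using k2 ia ne by (simp add: KU_def r_def s_def)
    moreover have "card (insert r ?\<sigma>) + 1 = Suc i"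
    proof -
      have "topv y \<in> snd y" "finite (snd y)" using True y(2) KCell_finite by (auto simp: kind2_def)
      moreover have "card (snd y) = i" using y(2) by (auto simp: KCell_def)
      ultimately show ?thesis using ne card_Suc_Diff1[of "snd y" "topv y"] by simp
    qed
    ultimately show ?thesis using par_E(1)[OF ps] by (intro bexI[of _ s]) auto
  next
    case False
    then have y1: "nonzero y" "topv y \<notin> snd y" using y by (auto simp: KL_def)
    then have t: "topv y \<in> keys (fst y)" using top_in[OF y(2)] by auto
    define s where "s = (fst y - xvar (topv y), insert (topv y) (snd y))"
    have fy: "fst y - xvar (topv y) + xvar (topv y) = fst y" using xvar_add_diff[OF t] by (simp add: add.commute)
    have yc: "fst y \<in> mons n" "fst y \<notin> M" "snd y \<subseteq> {1..n}" "card (snd y) = i" "finite (snd y)"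
      using y(2) KCell_finite[OF y(2)] by (auto simp: KCell_def)
    have tn: "1 \<le> topv y" "topv y \<le> n" using t yc by (auto simp: mons_def)
    have "fst y - xvar (topv y) \<notin> M" using M_add[of "fst y - xvar (topv y)" "xvar (topv y)"] fy yc tn by auto
    then have sc: "s \<in> KCell (Suc i)" using yc tn y1 by (auto simp: s_def KCell_def diff_in_mons)
    have "keys (fst y - xvar (topv y)) \<subseteq> keys (fst y)" by (rule mdvd_keys) simp
    then have ts: "topv s = topv y" using top_ge[OF y(2)]
      by (intro top_eqI[OF sc]) (auto simp: s_def)
    have "\<not> kind2 s" using ts fy yc by (simp add: kind2_def s_def)
    moreover have "s \<in> KU" using ts fy yc by (auto simp: KU_def s_def nonzero_def)
    moreover have "(fst s + xvar (topv y), snd s - {topv y}) = y" using fy y1 by (simp add: s_def prod_eq_iff)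
    ultimately show ?thesis using sc ts by (intro bexI[of _ s]) (auto simp: Kmate_def Kpiv_def)
  qed
  show "s = s'" if s: "s \<in> KU" "s \<in> KCell (Suc i)" and s': "s' \<in> KU" "s' \<in> KCell (Suc i)"
    and eq: "Kmate s = Kmate s'" for s s' i
  proof (cases "kind2 s")
    case False
    note 1 = KU_kind1[OF s False]
    have "\<not> kind2 s'" using KU_kind2[OF s'] 1(7) eq par_E(2) by metis
    note 2 = KU_kind1[OF s' this]
    have "topv s = topv s'" using 1(4) 2(4) eq by simp
    then show ?thesis using 1(1,3) 2(1,3) eq by (metis add_right_cancel insert_Diff prod.inject prod.collapse)
  next
    case True
    note 1 = KU_kind2[OF s True]
    have k: "kind2 s'" using KU_kind1(7)[OF s'] par_E(2)[OF 1(4)] eq by metis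
    note 2 = KU_kind2[OF s' k]
    have "Kpiv s = Kpiv s'" using 1(3,5) 2(3,5) eq by simp
    moreover have "Kpiv s \<in> snd s" "Kpiv s' \<in> snd s'" using 1(2) 2(2) by auto
    ultimately show ?thesis using eq unfolding Kmate_def by (metis add_right_cancel insert_Diff prod.inject prod.collapse)
  qed
  show "ccoef (dK (celt (1 :: 'k) s)) (Kmate s) \<noteq> 0" if "s \<in> KU" "s \<in> KCell (Suc i)" for s i
  proof -
    have "Kpiv s \<in> snd s \<and> fst s + xvar (Kpiv s) \<notin> M"
    proof (cases "kind2 s")
      case True
      show ?thesis using KU_kind2(2,6)[OF that True] by (auto simp: Kmate_def KCell_def)
    next
      case False
      then show ?thesis using KU_kind1[OF that False] by (simp add: Kpiv_def)
    qed
    moreover have "snd s \<subseteq> {1..n}" using that by (auto simp: KCell_def)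
    ultimately show ?thesis using ccoef_dK_celt_mate[of "snd s" "Kpiv s" "fst s", where 'k='k] by (simp add: Kmate_def)
  qed
  show "Krk y < Krk (Kmate s)" if s: "s \<in> KU" "s \<in> KCell (Suc i)" and y: "ccoef (dK (celt (1 :: 'k) s)) y \<noteq> 0"
      "y \<in> KL" "y \<noteq> Kmate s" for s y i
  proof -
    have "snd s \<subseteq> {1..n}" using s by (auto simp: KCell_def)
    then obtain k where k: "k \<in> snd s" "y = (fst s + xvar k, snd s - {k})" "fst s + xvar k \<notin> M"
      using ccoef_dK_celt_nz[of "snd s" "fst s" y, where 'k='k] y(1) by auto
    have ty: "topv y = topv s" unfolding k(2) by (rule top_move[OF s(2) k(1,3)])
    have kp: "k \<noteq> Kpiv s" using y(3) k(2) by (auto simp: Kmate_def)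
    show ?thesis
    proof (cases "kind2 s")
      case False
      note 1 = KU_kind1[OF s False]
      have "topv y \<in> snd y" using 1(1) kp False ty k by (auto simp: Kpiv_def)
      \<comment> \<open>The top index is still in the index set, so a cell of \<open>KL\<close> of
        this form belongs to the second stage, where ranks are smaller.\<close>
      then have "kind2 y" using y(2) by (auto simp: KL_def)
      moreover have "card {v \<in> G. gen y < v} \<le> card G" using finite_G by (intro card_mono) auto
      ultimately show ?thesis using 1(7) by (simp add: Krk_def)
    next
      case True
      define u where "u = gen s"
      define m where "m = rest s"
      define \<sigma> where "\<sigma> = snd s - {topv s}"
      define r where "r = Kpiv s"
      note 1 = KU_kind2[OF s True, folded u_def m_def \<sigma>_def r_def]
      note pE = par_E[OF 1(1)]
      have rk: "Krk (Kmate s) = card {v \<in> G. u < v}" using par_E(2,4)[OF 1(4)] by (simp add: Krk_def)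
      have uG: "u \<in> G" using 1(1) by (simp add: par_def)
      have w: "fst s + xvar (topv s) = u + m"
        unfolding pE(3,7) using xvar_add_diff[OF maxv_in_keys[OF G_nz[OF uG]]] by (metis add.assoc add.commute)
      have "k \<noteq> topv s" using k(3) True by (auto simp: kind2_def)
      then have k\<sigma>: "k \<in> \<sigma>" using k(1) pE(3,6) by auto
      have kr: "k \<noteq> r" using kp by (simp add: r_def)
      show ?thesis
      proof (cases "k \<in> adm a u")
        case False
        \<comment> \<open>The moved variable differs from the pivot, which therefore remains in the
          index set; so the cell is not in \<open>KL\<close>.\<close>
        have "inadm y = inadm s" unfolding k(2) by (rule par_toggle(2)[OF 1(1) k\<sigma> False])
        moreover have "r \<in> snd y" using 1(2) kr pE(6) k(2) by auto
        moreover have "topv y \<in> snd y" using ty \<open>k \<noteq> topv s\<close> k pE(3,6) by auto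
        ultimately have "y \<notin> KL" using 1(3) by (simp add: KL_def)
        then show ?thesis using y(2) by simp
      next
        case True
        have m: "m \<in> mons n" using 1(1) by (simp add: par_def)
        have kn: "xvar k \<in> mons n" using adm_le_n[OF uG True] by simp
        \<comment> \<open>An admissible variable enters the cofactor, and by
          \<open>gg_eq_iff\<close> the decomposition becomes strictly larger.\<close>
        have "fst y = fst s + xvar k" by (simp add: k(2))
        then have "fst y + xvar (topv y) = (fst s + xvar (topv s)) + xvar k"
          unfolding ty by (simp only: add_ac)
        then have wy: "fst y + xvar (topv y) = u + (m + xvar k)"
          by (simp only: w add.assoc)
        have mem: "u + (m + xvar k) \<in> M" using M_add uG G_sub m kn by (auto simp: mons_add)
        have "nonzero y" unfolding k(2) by (rule top_move[OF s(2) k(1,3)])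
        moreover have "topv y \<in> snd y" using ty \<open>k \<noteq> topv s\<close> k pE(3,6) by auto
        ultimately have "kind2 y" using wy mem by (simp add: kind2_def)
        have g: "gen y = gg (u + (m + xvar k))" by (simp add: gen_def wy)
        have "u \<le> gen y" unfolding g by (rule gg_ge[OF uG]) simp
        moreover have "gen y \<noteq> u"
          unfolding g using gg_eq_iff[OF uG, of "m + xvar k"] True m kn by (auto simp: mons_add keys_add_mon)
        ultimately have "u < gen y" by simp
        moreover have "gen y \<in> G" unfolding g by (rule gg_props(1)[OF mem])
        ultimately have "{v \<in> G. gen y < v} \<subset> {v \<in> G. u < v}" by (auto dest: less_trans)
        then have "card {v \<in> G. gen y < v} < card {v \<in> G. u < v}" using finite_G by (intro psubset_card_mono) auto
        then show ?thesis using rk \<open>kind2 y\<close> by (simp add: Krk_def)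
      qed
    qed
  qed
  \<comment> \<open>The boundary of z(u;\<sigma>) vanishes term by term: moving max(u) gives u, and
    moving an admissible k gives the product of \<open>u\<^sub>k\<close> and the quotient of
    \<open>v\<^sub>k\<close> by the last variable of u. Both lie in the ideal.\<close>
  show "dK (celt (1 :: 'k) s) = 0" if s: "s \<in> KC" "s \<in> KCell i" for s i
  proof (rule ccoef_inj, rule ccontr)
    fix y assume "ccoef (dK (celt (1 :: 'k) s)) y \<noteq> ccoef 0 y"
    then have nz: "ccoef (dK (celt (1 :: 'k) s)) y \<noteq> 0" by (simp add: ccoef_def)
    have "snd s \<subseteq> {1..n}" using s by (auto simp: KCell_def)
    then obtain k where k: "k \<in> snd s" "y = (fst s + xvar k, snd s - {k})" "fst s + xvar k \<notin> M"
      using ccoef_dK_celt_nz[of "snd s" "fst s" y, where 'k='k] nz by auto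
    then have "kind2 s" "inadm s = {}" using s by (auto simp: KC_def nonzero_def)
    note p = kind2_par[OF s(2) \<open>kind2 s\<close>]
    define u where "u = gen s"
    have uG: "u \<in> G" using p by (simp add: par_def u_def)
    have "rest s = 0" using \<open>inadm s = {}\<close> by (simp add: inadm_def)
    then have w: "fst s = u - xvar (maxv u)" using par_E(7)[OF p] by (simp add: u_def)
    have Nu: "maxv u \<in> keys u" using maxv_in_keys[OF G_nz[OF uG]] .
    have wN: "fst s + xvar (maxv u) = u" unfolding w using xvar_add_diff[OF Nu] by (simp add: add.commute)
    then have "k \<noteq> maxv u" using k uG G_sub by auto
    moreover have "snd s - {maxv u} \<subseteq> adm a u"
      using \<open>inadm s = {}\<close> par_E(3)[OF p] by (auto simp: inadm_def u_def)
    ultimately have ka: "k \<in> adm a u" using k by auto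
    have "mdvd (uu u k) (fst s + xvar k)"
    proof -
      have "vv u k + uu u k = xvar k + u" by (rule uu_add_vv[OF uG ka])
      moreover have "xvar (maxv u) + (vv u k - xvar (maxv u)) = vv u k"
        by (rule xvar_add_diff[OF maxv_keys_vv[OF uG ka]])
      ultimately have "xvar (maxv u) + (vv u k - xvar (maxv u) + uu u k) = xvar (maxv u) + (fst s + xvar k)"
        using wN by (metis add.assoc add.commute)
      then have "fst s + xvar k = vv u k - xvar (maxv u) + uu u k" by simp
      then show ?thesis by simp
    qed
    moreover have "fst s + xvar k \<in> mons n" using s(2) adm_le_n[OF uG ka] by (auto simp: KCell_def mons_add)
    ultimately show False using k uu_G[OF uG ka] G_sub M_mdvd by blast
  qed
qed

text \<open>Empty \<open>inadm\<close> means cofactor 1 and admissible \<sigma>, so the critical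
  cells of positive degree are the symbols of the cycles z(u;\<sigma>).\<close>

lemma KC_cell: "KC \<inter> KCell (Suc i) = (\<lambda>(u, \<sigma>). (u - xvar (maxv u), insert (maxv u) \<sigma>)) ` Bas (Suc i)"
proof (intro equalityI subsetI)
  fix s assume s: "s \<in> KC \<inter> KCell (Suc i)"
  have "nonzero s" using s by (auto simp: nonzero_def KCell_def)
  then have k: "kind2 s" "inadm s = {}" "s \<in> KCell (Suc i)" using s by (auto simp: KC_def)
  note p = kind2_par[OF k(3,1)]
  note pE = par_E[OF p]
  have "rest s = 0" "snd s - {topv s} \<subseteq> adm a (gen s)" using k(2) by (auto simp: inadm_def)
  moreover have "topv s \<in> snd s" "card (snd s) = Suc i" using k by (auto simp: kind2_def KCell_def)
  then have "card (snd s - {topv s}) = i" using KCell_finite[OF k(3)] by simp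
  ultimately have "(gen s, snd s - {topv s}) \<in> Bas (Suc i)" using p by (auto simp: Bas_def par_def)
  moreover have "s = (gen s - xvar (maxv (gen s)), insert (maxv (gen s)) (snd s - {topv s}))"
    using p \<open>rest s = 0\<close> by (simp add: par_def)
  ultimately show "s \<in> (\<lambda>(u, \<sigma>). (u - xvar (maxv u), insert (maxv u) \<sigma>)) ` Bas (Suc i)" by force
next
  fix s assume "s \<in> (\<lambda>(u, \<sigma>). (u - xvar (maxv u), insert (maxv u) \<sigma>)) ` Bas (Suc i)"
  then obtain u \<sigma> where u: "s = (u - xvar (maxv u), insert (maxv u) \<sigma>)" "u \<in> G" "\<sigma> \<subseteq> adm a u" "card \<sigma> = i"
    by (auto simp: Bas_def)
  have p: "par s u 0 \<sigma>" using u adm_subset by (auto simp: par_def)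
  note pE = par_E[OF p]
  have "inadm s = {}" using pE(9) u by auto
  then show "s \<in> KC \<inter> KCell (Suc i)" using pE(1,2) u by (auto simp: KC_def)
qed

text \<open>The generator can be read off from the cell as \<open>gen\<close>.\<close>

lemma inj_zsym: "inj_on (\<lambda>(u, \<sigma>). (u - xvar (maxv u), insert (maxv u) \<sigma>)) (Bas (Suc i))"
proof (rule inj_onI)
  fix b b' assume b: "b \<in> Bas (Suc i)" "b' \<in> Bas (Suc i)"
    and eq: "(\<lambda>(u, \<sigma>). (u - xvar (maxv u), insert (maxv u) \<sigma>)) b = (\<lambda>(u, \<sigma>). (u - xvar (maxv u), insert (maxv u) \<sigma>)) b'"
  obtain u \<sigma> where 1: "b = (u, \<sigma>)" "par (u - xvar (maxv u), insert (maxv u) \<sigma>) u 0 \<sigma>"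
    using b(1) adm_subset[of a "fst b"] by (cases b) (auto simp: Bas_def par_def)
  obtain u' \<sigma>' where 2: "b' = (u', \<sigma>')" "par (u' - xvar (maxv u'), insert (maxv u') \<sigma>') u' 0 \<sigma>'"
    using b(2) adm_subset[of a "fst b'"] by (cases b') (auto simp: Bas_def par_def)
  have eq': "(u - xvar (maxv u), insert (maxv u) \<sigma>) = (u' - xvar (maxv u'), insert (maxv u') \<sigma>')"
    using eq unfolding 1(1) 2(1) by simp
  have "u = u'" using par_E(4)[OF 1(2)] par_E(4)[OF 2(2)] eq' by metis
  moreover have "insert (maxv u) \<sigma> = insert (maxv u) \<sigma>'" using eq' calculation by simp
  then have "\<sigma> = \<sigma>'" using par_E(8)[OF 1(2)] par_E(8)[OF 2(2)] calculation by (metis insert_ident)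
  ultimately show "b = b'" using 1 2 by simp
qed

end

section \<open>Transport of module structures\<close>

lemma moduleI_surj:
  assumes "module R M" "h ` carrier M = carrier N" "h \<zero>\<^bsub>M\<^esub> = \<zero>\<^bsub>N\<^esub>"
    and h_add: "\<And>x y. x \<in> carrier M \<Longrightarrow> y \<in> carrier M \<Longrightarrow> h (x \<oplus>\<^bsub>M\<^esub> y) = h x \<oplus>\<^bsub>N\<^esub> h y"
    and h_smult: "\<And>r x. r \<in> carrier R \<Longrightarrow> x \<in> carrier M \<Longrightarrow> h (r \<odot>\<^bsub>M\<^esub> x) = r \<odot>\<^bsub>N\<^esub> h x"
  shows "module R N"
proof -
  interpret M: module R M by fact
  have closed: "h x \<in> carrier N" if "x \<in> carrier M" for x using that assms(2) by blast
  have cases: P if "y \<in> carrier N" "\<And>x. x \<in> carrier M \<Longrightarrow> y = h x \<Longrightarrow> P" for y P using that assms(2) by blast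
  note h_zero = assms(3)
  show ?thesis
  proof (rule moduleI)
    show "cring R" by (rule M.R.cring_axioms)
    show "abelian_group N"
    proof (rule abelian_groupI)
      show "\<And>x y. x \<in> carrier N \<Longrightarrow> y \<in> carrier N \<Longrightarrow> x \<oplus>\<^bsub>N\<^esub> y \<in> carrier N"
        by (elim cases) (simp add: h_add[symmetric] closed)
      show "\<zero>\<^bsub>N\<^esub> \<in> carrier N" using closed[of "\<zero>\<^bsub>M\<^esub>"] by (simp add: h_zero)
      show "\<And>x y z. x \<in> carrier N \<Longrightarrow> y \<in> carrier N \<Longrightarrow> z \<in> carrier N \<Longrightarrow> x \<oplus>\<^bsub>N\<^esub> y \<oplus>\<^bsub>N\<^esub> z = x \<oplus>\<^bsub>N\<^esub> (y \<oplus>\<^bsub>N\<^esub> z)"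
        by (elim cases) (simp add: h_add[symmetric] M.M.a_assoc)
      show "\<And>x y. x \<in> carrier N \<Longrightarrow> y \<in> carrier N \<Longrightarrow> x \<oplus>\<^bsub>N\<^esub> y = y \<oplus>\<^bsub>N\<^esub> x"
        by (elim cases) (simp add: h_add[symmetric] M.M.a_comm)
      show "\<And>x. x \<in> carrier N \<Longrightarrow> \<zero>\<^bsub>N\<^esub> \<oplus>\<^bsub>N\<^esub> x = x"
        by (elim cases) (simp add: h_add[symmetric] h_zero[symmetric])
      fix x assume "x \<in> carrier N"
      then obtain x' where x: "x' \<in> carrier M" "x = h x'" by (rule cases)
      then have "h (\<ominus>\<^bsub>M\<^esub> x') \<oplus>\<^bsub>N\<^esub> x = \<zero>\<^bsub>N\<^esub>" by (simp add: h_add[symmetric] M.M.l_neg h_zero)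
      then show "\<exists>y\<in>carrier N. y \<oplus>\<^bsub>N\<^esub> x = \<zero>\<^bsub>N\<^esub>" using closed[of "\<ominus>\<^bsub>M\<^esub> x'"] x(1) by auto
    qed
    show "\<And>a x. a \<in> carrier R \<Longrightarrow> x \<in> carrier N \<Longrightarrow> a \<odot>\<^bsub>N\<^esub> x \<in> carrier N"
      by (elim cases) (simp add: h_smult[symmetric] closed)
    show "\<And>a b x. a \<in> carrier R \<Longrightarrow> b \<in> carrier R \<Longrightarrow> x \<in> carrier N \<Longrightarrow> (a \<oplus>\<^bsub>R\<^esub> b) \<odot>\<^bsub>N\<^esub> x = a \<odot>\<^bsub>N\<^esub> x \<oplus>\<^bsub>N\<^esub> b \<odot>\<^bsub>N\<^esub> x"
      by (elim cases) (simp add: h_smult[symmetric] h_add[symmetric] M.smult_l_distr)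
    show "\<And>a x y. a \<in> carrier R \<Longrightarrow> x \<in> carrier N \<Longrightarrow> y \<in> carrier N \<Longrightarrow> a \<odot>\<^bsub>N\<^esub> (x \<oplus>\<^bsub>N\<^esub> y) = a \<odot>\<^bsub>N\<^esub> x \<oplus>\<^bsub>N\<^esub> a \<odot>\<^bsub>N\<^esub> y"
      by (elim cases) (simp add: h_smult[symmetric] h_add[symmetric] M.smult_r_distr)
    show "\<And>a b x. a \<in> carrier R \<Longrightarrow> b \<in> carrier R \<Longrightarrow> x \<in> carrier N \<Longrightarrow> (a \<otimes>\<^bsub>R\<^esub> b) \<odot>\<^bsub>N\<^esub> x = a \<odot>\<^bsub>N\<^esub> (b \<odot>\<^bsub>N\<^esub> x)"
      by (elim cases) (simp add: h_smult[symmetric] M.smult_assoc1)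
    show "\<And>x. x \<in> carrier N \<Longrightarrow> \<one>\<^bsub>R\<^esub> \<odot>\<^bsub>N\<^esub> x = x"
      by (elim cases) (simp add: h_smult[symmetric])
  qed
qed

text \<open>Module axioms and finite sums are transported along a surjection \<open>q\<close> from a subgroup of a
  type class group, where computations are simple.\<close>

locale module_cover = R: cring R for R (structure) +
  fixes A :: "'x::ab_group_add set" and s :: "'a \<Rightarrow> 'x \<Rightarrow> 'x" and q :: "'x \<Rightarrow> 'm" and N :: "('a, 'm) module"
  assumes A_0: "0 \<in> A" and A_add: "x \<in> A \<Longrightarrow> y \<in> A \<Longrightarrow> x + y \<in> A" and A_uminus: "x \<in> A \<Longrightarrow> - x \<in> A"
    and s_closed: "r \<in> carrier R \<Longrightarrow> x \<in> A \<Longrightarrow> s r x \<in> A"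
    and s_add: "r \<in> carrier R \<Longrightarrow> x \<in> A \<Longrightarrow> y \<in> A \<Longrightarrow> s r (x + y) = s r x + s r y"
    and s_add_left: "r \<in> carrier R \<Longrightarrow> r' \<in> carrier R \<Longrightarrow> x \<in> A \<Longrightarrow> s (r \<oplus> r') x = s r x + s r' x"
    and s_mult: "r \<in> carrier R \<Longrightarrow> r' \<in> carrier R \<Longrightarrow> x \<in> A \<Longrightarrow> s (r \<otimes> r') x = s r (s r' x)"
    and s_one: "x \<in> A \<Longrightarrow> s \<one> x = x"
    and q_surj: "q ` A = carrier N"
    and q_0: "q 0 = \<zero>\<^bsub>N\<^esub>"
    and q_add: "x \<in> A \<Longrightarrow> y \<in> A \<Longrightarrow> q (x + y) = q x \<oplus>\<^bsub>N\<^esub> q y"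
    and q_smult: "r \<in> carrier R \<Longrightarrow> x \<in> A \<Longrightarrow> q (s r x) = r \<odot>\<^bsub>N\<^esub> q x"
begin

lemma q_closed: "x \<in> A \<Longrightarrow> q x \<in> carrier N"
  using q_surj by blast

lemma cover_module: "module R N"
proof -
  define B :: "('a, 'x) module" where "B = \<lparr>carrier = A, monoid.mult = undefined, monoid.one = undefined, ring.zero = 0,
    ring.add = (+), module.smult = s\<rparr>"
  have "module R B"
  proof (rule moduleI[OF R.cring_axioms])
    show "abelian_group B"
      by (rule abelian_groupI) (auto simp: B_def A_0 A_add add_ac intro: bexI[OF _ A_uminus])
  qed (auto simp: B_def s_closed s_add s_add_left s_mult s_one)
  then show ?thesis
    by (rule moduleI_surj[where h=q]) (auto simp: B_def q_surj q_0 q_add q_smult)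
qed

lemma A_sum: "(\<And>b. b \<in> B \<Longrightarrow> f b \<in> A) \<Longrightarrow> sum f B \<in> A"
  by (induction B rule: infinite_finite_induct) (auto simp: A_0 A_add)

lemma q_sum: "finite B \<Longrightarrow> (\<And>b. b \<in> B \<Longrightarrow> f b \<in> A) \<Longrightarrow> q (sum f B) = (\<Oplus>\<^bsub>N\<^esub>b\<in>B. q (f b))"
proof (induction B rule: finite_induct)
  interpret N: module R N by (rule cover_module)
  case empty then show ?case by (simp add: q_0)
next
  interpret N: module R N by (rule cover_module)
  case (insert b B)
  then have "q (sum f (insert b B)) = q (f b) \<oplus>\<^bsub>N\<^esub> q (sum f B)" by (simp add: q_add A_sum)
  then show ?case using insert by (simp add: N.finsum_insert Pi_def q_closed)
qed

end

definition field_ring :: "'k::field ring" where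
  "field_ring = \<lparr>carrier = UNIV, monoid.mult = (*), monoid.one = 1, ring.zero = 0, ring.add = (+)\<rparr>"

lemma field_ring_simps [simp]:
  "carrier field_ring = UNIV" "x \<otimes>\<^bsub>field_ring\<^esub> y = x * y" "\<one>\<^bsub>field_ring\<^esub> = 1"
  "\<zero>\<^bsub>field_ring\<^esub> = 0" "x \<oplus>\<^bsub>field_ring\<^esub> y = x + y"
  by (simp_all add: field_ring_def)

lemma field_ring_cring: "cring (field_ring :: 'k::field ring)"
proof (rule cringI)
  show "abelian_group (field_ring :: 'k ring)"
    by (rule abelian_groupI) (auto simp: add_ac intro: exI[of _ "- _"])
  show "Group.comm_monoid (field_ring :: 'k ring)"
    by (rule comm_monoidI) (auto simp: mult_ac)
qed (auto simp: distrib_right)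

section \<open>Quotient modules\<close>

lemma quot_module_simps [simp]:
  "carrier (quot_module M N) = a_rcosets\<^bsub>M\<^esub> N" "\<zero>\<^bsub>quot_module M N\<^esub> = N"
  "x \<oplus>\<^bsub>quot_module M N\<^esub> y = x <+>\<^bsub>M\<^esub> y" "r \<odot>\<^bsub>quot_module M N\<^esub> C = (\<Union>x\<in>C. N +>\<^bsub>M\<^esub> (r \<odot>\<^bsub>M\<^esub> x))"
  by (simp_all add: quot_module_def)

locale quotient_module = module R M for R :: "('a, 'r) ring_scheme" (structure) and M :: "('a, 'b) module" (structure) +
  fixes N :: "'b set"
  assumes submod: "submodule N R M"
begin

lemma N_subset: "N \<subseteq> carrier M"
  using submoduleE(1)[OF submod] .

lemma N_abelian: "abelian_subgroup N M"
  by (rule abelian_subgroupI3)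
    (use submod in \<open>auto simp: submodule_def additive_subgroup_def M.abelian_group_axioms\<close>)

lemma quot_image: "(\<lambda>x. N +>\<^bsub>M\<^esub> x) ` carrier M = carrier (quot_module M N)"
  by (auto simp: A_RCOSETS_def')

lemma quot_add:
  "x \<in> carrier M \<Longrightarrow> y \<in> carrier M \<Longrightarrow>
    N +>\<^bsub>M\<^esub> (x \<oplus>\<^bsub>M\<^esub> y) = (N +>\<^bsub>M\<^esub> x) \<oplus>\<^bsub>quot_module M N\<^esub> (N +>\<^bsub>M\<^esub> y)"
  using abelian_subgroup.a_rcos_sum[OF N_abelian] by simp

lemma quot_zero: "N +>\<^bsub>M\<^esub> \<zero>\<^bsub>M\<^esub> = \<zero>\<^bsub>quot_module M N\<^esub>"
  using N_subset by simp

lemma coset_eq_iff: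
  assumes "x \<in> carrier M" "y \<in> carrier M"
  shows "N +>\<^bsub>M\<^esub> x = N +>\<^bsub>M\<^esub> y \<longleftrightarrow> x \<ominus>\<^bsub>M\<^esub> y \<in> N"
proof -
  interpret N: abelian_subgroup N M by (rule N_abelian)
  have *: "x \<in> N +>\<^bsub>M\<^esub> y \<longleftrightarrow> x \<ominus>\<^bsub>M\<^esub> y \<in> N"
  proof
    assume "x \<in> N +>\<^bsub>M\<^esub> y"
    then obtain h where h: "h \<in> N" "x = h \<oplus>\<^bsub>M\<^esub> y" by (auto simp: a_r_coset_def')
    then have "h \<in> carrier M" using N_subset by auto
    then show "x \<ominus>\<^bsub>M\<^esub> y \<in> N" using h assms by (simp add: a_minus_def M.a_assoc M.r_neg)
  next
    assume h: "x \<ominus>\<^bsub>M\<^esub> y \<in> N"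
    have "x = (x \<ominus>\<^bsub>M\<^esub> y) \<oplus>\<^bsub>M\<^esub> y" using assms by (simp add: a_minus_def M.a_assoc M.l_neg)
    then show "x \<in> N +>\<^bsub>M\<^esub> y" using h by (auto simp: a_r_coset_def')
  qed
  show ?thesis
  proof
    assume "N +>\<^bsub>M\<^esub> x = N +>\<^bsub>M\<^esub> y"
    then show "x \<ominus>\<^bsub>M\<^esub> y \<in> N" using N.a_rcos_self[OF assms(1)] * by simp
  next
    assume "x \<ominus>\<^bsub>M\<^esub> y \<in> N"
    then have "x \<in> N +>\<^bsub>M\<^esub> y" using * by simp
    then show "N +>\<^bsub>M\<^esub> x = N +>\<^bsub>M\<^esub> y" using N.a_repr_independence'[OF _ assms(2)] by simp
  qed
qed

text \<open>The union in \<open>quot_module\<close> runs over all representatives; they all give the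
  same coset, and there is at least one.\<close>

lemma quot_smult:
  assumes "r \<in> carrier R" "x \<in> carrier M"
  shows "N +>\<^bsub>M\<^esub> (r \<odot>\<^bsub>M\<^esub> x) = r \<odot>\<^bsub>quot_module M N\<^esub> (N +>\<^bsub>M\<^esub> x)"
proof -
  interpret N: abelian_subgroup N M by (rule N_abelian)
  have "N +>\<^bsub>M\<^esub> (r \<odot>\<^bsub>M\<^esub> y) = N +>\<^bsub>M\<^esub> (r \<odot>\<^bsub>M\<^esub> x)" if y: "y \<in> N +>\<^bsub>M\<^esub> x" for y
  proof -
    obtain h where h: "h \<in> N" "y = h \<oplus>\<^bsub>M\<^esub> x" using y by (auto simp: a_r_coset_def')
    have hc: "h \<in> carrier M" using h N_subset by auto
    have "r \<odot>\<^bsub>M\<^esub> y \<ominus>\<^bsub>M\<^esub> r \<odot>\<^bsub>M\<^esub> x = r \<odot>\<^bsub>M\<^esub> h"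
      using h hc assms by (simp add: smult_r_distr a_minus_def M.a_assoc M.r_neg)
    also have "\<dots> \<in> N" using submoduleE(4)[OF submod assms(1) h(1)] .
    finally show ?thesis using coset_eq_iff h hc assms by simp
  qed
  then have "(\<Union>y\<in>N +>\<^bsub>M\<^esub> x. N +>\<^bsub>M\<^esub> (r \<odot>\<^bsub>M\<^esub> y)) = (\<Union>y\<in>N +>\<^bsub>M\<^esub> x. N +>\<^bsub>M\<^esub> (r \<odot>\<^bsub>M\<^esub> x))"
    by (intro SUP_cong refl)
  moreover have "N +>\<^bsub>M\<^esub> x \<noteq> {}" using N.a_rcos_self[OF assms(2)] by (metis empty_iff)
  ultimately show ?thesis by (simp only: quot_module_simps UN_constant if_False)
qed

lemma quot_module_module: "module R (quot_module M N)"
  by (rule moduleI_surj[OF module_axioms quot_image quot_zero quot_add quot_smult])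

end

lemma mpoly_module: "module (mpoly_ring n) (mpoly_ring n :: ('k::field mpoly, 'k mpoly) module)"
  by (rule moduleI[OF mpoly_cring mpoly.abelian_group_axioms])
    (auto simp: algebra_simps intro: set_mp[OF keys_mult_mons])

section \<open>Koszul modules\<close>

lemma koszul_simps [simp]:
  "c \<in> carrier (koszul n M i) \<longleftrightarrow>
    (\<forall>\<tau>. c \<tau> \<in> carrier M) \<and> (\<forall>\<tau>. c \<tau> \<noteq> \<zero>\<^bsub>M\<^esub> \<longrightarrow> \<tau> \<subseteq> {1..n} \<and> card \<tau> = i)"
  "\<zero>\<^bsub>koszul n M i\<^esub> = (\<lambda>\<tau>. \<zero>\<^bsub>M\<^esub>)" "c \<oplus>\<^bsub>koszul n M i\<^esub> c' = (\<lambda>\<tau>. c \<tau> \<oplus>\<^bsub>M\<^esub> c' \<tau>)"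
  "p \<odot>\<^bsub>koszul n M i\<^esub> c = (\<lambda>\<tau>. p \<odot>\<^bsub>M\<^esub> c \<tau>)"
  by (simp_all add: koszul_def)

lemma koszul_module:
  assumes "module (mpoly_ring n) M"
  shows "module (mpoly_ring n) (koszul n (M :: ('k::field mpoly, 'm) module) i)"
proof -
  interpret M: module "mpoly_ring n" M by fact
  have nz: "x \<oplus>\<^bsub>M\<^esub> y \<noteq> \<zero>\<^bsub>M\<^esub> \<Longrightarrow> x \<in> carrier M \<Longrightarrow> y \<in> carrier M \<Longrightarrow> x \<noteq> \<zero>\<^bsub>M\<^esub> \<or> y \<noteq> \<zero>\<^bsub>M\<^esub>" for x y by auto
  show ?thesis
  proof (rule moduleI[OF mpoly_cring])
    show "abelian_group (koszul n M i)"
    proof (rule abelian_groupI)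
      fix x y assume "x \<in> carrier (koszul n M i)" "y \<in> carrier (koszul n M i)"
      then show "x \<oplus>\<^bsub>koszul n M i\<^esub> y \<in> carrier (koszul n M i)" using nz by simp blast
    next
      fix x assume x: "x \<in> carrier (koszul n M i)"
      show "\<exists>y\<in>carrier (koszul n M i). y \<oplus>\<^bsub>koszul n M i\<^esub> x = \<zero>\<^bsub>koszul n M i\<^esub>"
        by (rule bexI[of _ "\<lambda>\<tau>. \<ominus>\<^bsub>M\<^esub> x \<tau>"]) (use x in \<open>auto simp: M.M.l_neg\<close>)
    qed (auto simp: M.M.a_ac fun_eq_iff)
    fix a :: "'k mpoly" and x assume a: "a \<in> carrier (mpoly_ring n)" "x \<in> carrier (koszul n M i)"
    have "x \<tau> \<noteq> \<zero>\<^bsub>M\<^esub>" if "a \<odot>\<^bsub>M\<^esub> x \<tau> \<noteq> \<zero>\<^bsub>M\<^esub>" for \<tau> using that M.smult_r_null[OF a(1)] by auto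
    then show "a \<odot>\<^bsub>koszul n M i\<^esub> x \<in> carrier (koszul n M i)"
      using a by (simp del: mpoly_ring_simps(1))
  next
    fix x assume x: "x \<in> carrier (koszul n M i)"
    then have "1 \<odot>\<^bsub>M\<^esub> x \<tau> = x \<tau>" for \<tau> using M.smult_one[of "x \<tau>"] by simp
    then show "\<one>\<^bsub>mpoly_ring n\<^esub> \<odot>\<^bsub>koszul n M i\<^esub> x = x" by simp
  next
    fix a b :: "'k mpoly" and x assume "a \<in> carrier (mpoly_ring n)" "b \<in> carrier (mpoly_ring n)" "x \<in> carrier (koszul n M i)"
    then have "(a + b) \<odot>\<^bsub>M\<^esub> x \<tau> = a \<odot>\<^bsub>M\<^esub> x \<tau> \<oplus>\<^bsub>M\<^esub> b \<odot>\<^bsub>M\<^esub> x \<tau>" "(a * b) \<odot>\<^bsub>M\<^esub> x \<tau> = a \<odot>\<^bsub>M\<^esub> (b \<odot>\<^bsub>M\<^esub> x \<tau>)" for \<tau>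
      using M.smult_l_distr[of a b "x \<tau>"] M.smult_assoc1[of a b "x \<tau>"] by simp_all
    then show "(a \<oplus>\<^bsub>mpoly_ring n\<^esub> b) \<odot>\<^bsub>koszul n M i\<^esub> x = a \<odot>\<^bsub>koszul n M i\<^esub> x \<oplus>\<^bsub>koszul n M i\<^esub> b \<odot>\<^bsub>koszul n M i\<^esub> x"
      "(a \<otimes>\<^bsub>mpoly_ring n\<^esub> b) \<odot>\<^bsub>koszul n M i\<^esub> x = a \<odot>\<^bsub>koszul n M i\<^esub> (b \<odot>\<^bsub>koszul n M i\<^esub> x)" by simp_all
  qed (simp add: M.smult_r_distr)
qed

lemma koszul_finsum:
  assumes "module (mpoly_ring n) (M :: ('k::field mpoly, 'm) module)" "finite B"
    "\<And>b. b \<in> B \<Longrightarrow> f b \<in> carrier (koszul n M i)"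
  shows "(\<Oplus>\<^bsub>koszul n M i\<^esub>b\<in>B. f b) = (\<lambda>\<rho>. \<Oplus>\<^bsub>M\<^esub>b\<in>B. f b \<rho>)"
proof -
  interpret M: module "mpoly_ring n" M by fact
  interpret K: module "mpoly_ring n" "koszul n M i" by (rule koszul_module) fact
  show ?thesis using assms(2,3)
  proof (induction B rule: finite_induct)
    case (insert b B)
    have IH: "finsum (koszul n M i) f B = (\<lambda>\<rho>. \<Oplus>\<^bsub>M\<^esub>b\<in>B. f b \<rho>)"
      by (rule insert.IH) (use insert.prems in blast)
    have c: "f x \<in> carrier (koszul n M i)" if "x \<in> insert b B" for x using insert.prems that by blast
    then have cM: "f x \<rho> \<in> carrier M" if "x \<in> insert b B" for x \<rho> using that by simp
    have "finsum (koszul n M i) f (insert b B) = f b \<oplus>\<^bsub>koszul n M i\<^esub> finsum (koszul n M i) f B"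
      by (rule K.finsum_insert[OF insert.hyps Pi_I]) (rule c, simp)+
    moreover have "(\<Oplus>\<^bsub>M\<^esub>x\<in>insert b B. f x \<rho>) = f b \<rho> \<oplus>\<^bsub>M\<^esub> (\<Oplus>\<^bsub>M\<^esub>x\<in>B. f x \<rho>)" for \<rho>
      by (rule M.finsum_insert[OF insert.hyps Pi_I]) (rule cM, simp)+
    ultimately show ?case by (simp add: IH)
  qed (simp add: fun_eq_iff)
qed

lemma sign_in_mons: "keys ((-1) ^ k * p :: 'k::field mpoly) \<subseteq> mons n \<longleftrightarrow> keys p \<subseteq> mons n"
  by (simp add: sign_mult)

lemma keys_mono_poly [simp]: "keys (mono_poly u :: 'k::field mpoly) = {u}"
  by (simp add: mono_poly_def)

text \<open>The operations of \<open>koszul n M i\<close> are the same for every \<open>i\<close>,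
  so the right-hand sides may carry \<open>i\<close> although the images have degree i - 1.\<close>

lemma koszul_d_linear:
  assumes "module (mpoly_ring n) (M :: ('k::field mpoly, 'm) module)"
    and c: "c \<in> carrier (koszul n M i)" "c' \<in> carrier (koszul n M i)" "p \<in> carrier (mpoly_ring n)"
  shows "koszul_d n M (c \<oplus>\<^bsub>koszul n M i\<^esub> c') = koszul_d n M c \<oplus>\<^bsub>koszul n M i\<^esub> koszul_d n M c'"
    and "koszul_d n M (p \<odot>\<^bsub>koszul n M i\<^esub> c) = p \<odot>\<^bsub>koszul n M i\<^esub> koszul_d n M c"
proof -
  interpret M: module "mpoly_ring n" M by fact
  have cl: "\<And>\<tau>. c \<tau> \<in> carrier M" "\<And>\<tau>. c' \<tau> \<in> carrier M" using c by auto
  have s: "(-1) ^ alpha (insert k \<rho>) k * mono_poly (xvar k) \<in> carrier (mpoly_ring n)" if "k \<in> {1..n} - \<rho>" for k \<rho>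
    using that by (auto simp: sign_in_mons)
  show "koszul_d n M (c \<oplus>\<^bsub>koszul n M i\<^esub> c') = koszul_d n M c \<oplus>\<^bsub>koszul n M i\<^esub> koszul_d n M c'"
  proof
    fix \<rho>
    have "(\<Oplus>\<^bsub>M\<^esub>k\<in>{1..n} - \<rho>. ((-1) ^ alpha (insert k \<rho>) k * mono_poly (xvar k)) \<odot>\<^bsub>M\<^esub> (c (insert k \<rho>) \<oplus>\<^bsub>M\<^esub> c' (insert k \<rho>)))
      = (\<Oplus>\<^bsub>M\<^esub>k\<in>{1..n} - \<rho>. ((-1) ^ alpha (insert k \<rho>) k * mono_poly (xvar k)) \<odot>\<^bsub>M\<^esub> c (insert k \<rho>) \<oplus>\<^bsub>M\<^esub>
           ((-1) ^ alpha (insert k \<rho>) k * mono_poly (xvar k)) \<odot>\<^bsub>M\<^esub> c' (insert k \<rho>))"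
      using s cl by (intro M.finsum_cong' refl M.smult_r_distr) (auto simp del: mpoly_ring_simps(1))
    also have "\<dots> = koszul_d n M c \<rho> \<oplus>\<^bsub>M\<^esub> koszul_d n M c' \<rho>"
      unfolding koszul_d_def using s cl by (intro M.finsum_addf) (auto intro!: M.smult_closed[OF s] simp del: mpoly_ring_simps(1))
    finally show "koszul_d n M (c \<oplus>\<^bsub>koszul n M i\<^esub> c') \<rho> = (koszul_d n M c \<oplus>\<^bsub>koszul n M i\<^esub> koszul_d n M c') \<rho>"
      by (simp add: koszul_d_def)
  qed
  show "koszul_d n M (p \<odot>\<^bsub>koszul n M i\<^esub> c) = p \<odot>\<^bsub>koszul n M i\<^esub> koszul_d n M c"
  proof
    fix \<rho>
    have "(\<Oplus>\<^bsub>M\<^esub>k\<in>{1..n} - \<rho>. ((-1) ^ alpha (insert k \<rho>) k * mono_poly (xvar k)) \<odot>\<^bsub>M\<^esub> (p \<odot>\<^bsub>M\<^esub> c (insert k \<rho>)))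
      = (\<Oplus>\<^bsub>M\<^esub>k\<in>{1..n} - \<rho>. p \<odot>\<^bsub>M\<^esub> (((-1) ^ alpha (insert k \<rho>) k * mono_poly (xvar k)) \<odot>\<^bsub>M\<^esub> c (insert k \<rho>)))"
    proof (intro M.finsum_cong' refl)
      fix k assume k: "k \<in> {1..n} - \<rho>"
      show "((-1) ^ alpha (insert k \<rho>) k * mono_poly (xvar k)) \<odot>\<^bsub>M\<^esub> (p \<odot>\<^bsub>M\<^esub> c (insert k \<rho>)) =
         p \<odot>\<^bsub>M\<^esub> (((-1) ^ alpha (insert k \<rho>) k * mono_poly (xvar k)) \<odot>\<^bsub>M\<^esub> c (insert k \<rho>))"
        using M.smult_assoc1[OF s[OF k] c(3) cl(1)] M.smult_assoc1[OF c(3) s[OF k] cl(1)] by (simp add: mult.commute)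
    qed (use cl c(3) in \<open>auto intro!: M.smult_closed[OF c(3)] M.smult_closed[OF s] simp del: mpoly_ring_simps(1)\<close>)
    also have "\<dots> = p \<odot>\<^bsub>M\<^esub> koszul_d n M c \<rho>"
      unfolding koszul_d_def using s cl c(3)
      by (intro M.finsum_smult_ldistr[symmetric]) (auto intro!: M.smult_closed[OF s] simp del: mpoly_ring_simps(1))
    finally show "koszul_d n M (p \<odot>\<^bsub>koszul n M i\<^esub> c) \<rho> = (p \<odot>\<^bsub>koszul n M i\<^esub> koszul_d n M c) \<rho>"
      by (simp add: koszul_d_def)
  qed
qed

lemma lookup_mult_sum:
  "lookup (p * r :: 'k::field mpoly) m = (\<Sum>x\<in>{x \<in> keys p. mdvd x m}. lookup p x * lookup r (m - x))"
proof -
  have "lookup (p * r) m = (\<Sum>x\<in>keys p. lookup (single x (lookup p x) * r) m)"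
    by (subst (1) poly_expand[of p]) (simp add: sum_distrib_right lookup_sum)
  also have "\<dots> = (\<Sum>x\<in>{x \<in> keys p. mdvd x m}. lookup p x * lookup r (m - x))"
    by (simp add: lookup_single_mult sum.If_cases Int_def)
  finally show ?thesis .
qed

section \<open>The free modules in coordinates\<close>

locale spread_resolution = spread_ideal n a dd M for n a dd and M :: "mon set" +
  fixes I :: "'k::field mpoly set" and t :: "nat list"
  assumes I_eq: "I = {p. keys p \<subseteq> M}"
    and min_gens_G: "min_gens n I = G"
    and admissible_adm: "u \<in> G \<Longrightarrow> admissible t u = adm a u"
begin

definition Q where "Q = quot n I"
definition cs :: "'k mpoly \<Rightarrow> 'k mpoly set" where "cs p = I +>\<^bsub>mpoly_ring n\<^esub> p"

lemma I_submodule: "submodule I (mpoly_ring n) (mpoly_ring n)"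
proof -
  interpret S: module "mpoly_ring n" "mpoly_ring n :: ('k mpoly, 'k mpoly) module" by (rule mpoly_module)
  show ?thesis
  proof (rule S.submoduleI)
    show "I \<subseteq> carrier (mpoly_ring n)" using M_sub by (auto simp: I_eq)
    show "\<ominus>\<^bsub>mpoly_ring n\<^esub> p \<in> I" if "p \<in> I" for p
      using that M_sub by (subst mpoly_uminus) (auto simp: I_eq)
    show "p \<oplus>\<^bsub>mpoly_ring n\<^esub> q \<in> I" if "p \<in> I" "q \<in> I" for p q
      using that keys_add_mons by (simp add: I_eq)
    show "p \<odot>\<^bsub>mpoly_ring n\<^esub> q \<in> I" if p: "p \<in> carrier (mpoly_ring n)" and q: "q \<in> I" for p q
    proof -
      have "keys (p * q) \<subseteq> {x + y |x y. x \<in> keys p \<and> y \<in> keys q}" by (rule keys_mult)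
      also have "\<dots> \<subseteq> M" using p q M_add by (fastforce simp: I_eq add.commute)
      finally show ?thesis by (simp add: I_eq)
    qed
  qed (simp add: I_eq)
qed

sublocale Iq: quotient_module "mpoly_ring n" "mpoly_ring n :: ('k mpoly, 'k mpoly) module" I
  by (intro quotient_module.intro mpoly_module quotient_module_axioms.intro I_submodule)

lemma Q_module: "module (mpoly_ring n) Q"
  unfolding Q_def quot_def by (rule Iq.quot_module_module)

sublocale Qm: module "mpoly_ring n" Q by (rule Q_module)

lemma cs_image: "cs ` {p. keys p \<subseteq> mons n} = carrier Q"
  using Iq.quot_image by (simp add: cs_def Q_def quot_def mpoly_ring_def)

lemma cs_closed: "keys p \<subseteq> mons n \<Longrightarrow> cs p \<in> carrier Q"
  using cs_image by blast

lemma cs_add: "keys p \<subseteq> mons n \<Longrightarrow> keys q \<subseteq> mons n \<Longrightarrow> cs (p + q) = cs p \<oplus>\<^bsub>Q\<^esub> cs q"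
  using Iq.quot_add[of p q] by (simp add: cs_def Q_def quot_def)

lemma cs_0: "cs 0 = \<zero>\<^bsub>Q\<^esub>"
  using Iq.quot_zero by (simp add: cs_def Q_def quot_def)

lemma cs_mult: "keys r \<subseteq> mons n \<Longrightarrow> keys p \<subseteq> mons n \<Longrightarrow> cs (r * p) = r \<odot>\<^bsub>Q\<^esub> cs p"
  using Iq.quot_smult[of r p] by (simp add: cs_def Q_def quot_def)

lemma cs_eq_iff: "keys p \<subseteq> mons n \<Longrightarrow> keys q \<subseteq> mons n \<Longrightarrow> cs p = cs q \<longleftrightarrow> keys (p - q) \<subseteq> M"
  using Iq.coset_eq_iff[of p q] eqset_imp_iff[OF I_eq, of "p - q"] by (simp add: cs_def a_minus_def mpoly_uminus)

lemma cs_sum: "finite B \<Longrightarrow> (\<And>b. b \<in> B \<Longrightarrow> keys (f b) \<subseteq> mons n) \<Longrightarrow> cs (sum f B) = (\<Oplus>\<^bsub>Q\<^esub>b\<in>B. cs (f b))"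
proof (induction B rule: finite_induct)
  case (insert b B)
  then have "cs (sum f (insert b B)) = cs (f b) \<oplus>\<^bsub>Q\<^esub> cs (sum f B)"
    by (simp add: cs_add keys_sum_mons)
  then show ?case using insert by (simp add: Qm.finsum_insert Pi_def cs_closed)
qed (simp add: cs_0)

lemma keys_nf: "keys (nf p) = keys p - M"
  by (auto simp: in_keys_iff lookup_nf split: if_splits)

lemma cs_nf: "keys p \<subseteq> mons n \<Longrightarrow> cs (nf p) = cs p"
proof (subst cs_eq_iff)
  show "keys (nf p - p) \<subseteq> M" by (auto simp: in_keys_iff lookup_minus lookup_nf split: if_splits)
qed (auto simp: keys_nf)

lemma cs_inj: "keys p \<subseteq> mons n - M \<Longrightarrow> keys q \<subseteq> mons n - M \<Longrightarrow> cs p = cs q \<Longrightarrow> p = q"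
proof -
  assume *: "keys p \<subseteq> mons n - M" "keys q \<subseteq> mons n - M" "cs p = cs q"
  have "keys (p - q) \<subseteq> M" using cs_eq_iff[of p q] * by blast
  moreover have "keys (p - q) \<subseteq> mons n - M" using * by (intro keys_minus_mons)
  ultimately have "keys (p - q) = {}" by blast
  then show "p = q" by simp
qed

section \<open>Koszul chains of S/I through normal forms, and their homology\<close>

definition Kch where "Kch i = {k :: (nat set, 'k) chains. \<forall>s. ccoef k s \<noteq> 0 \<longrightarrow> s \<in> KCell i}"
definition Zc where "Zc i = {k \<in> Kch i. dK k = 0}"
definition Psi :: "(nat set, 'k) chains \<Rightarrow> nat set \<Rightarrow> 'k mpoly set" where "Psi k = (\<lambda>\<tau>. cs (lookup k \<tau>))"

sublocale Km: matched_complex "ccoef :: (nat set, 'k) chains \<Rightarrow> _" celt dK KCell KU KL KC Kmate Krk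
  by (rule K_matched)

sublocale Em: matched_complex "ccoef :: (mon \<times> nat set, 'k) chains \<Rightarrow> _" celt "lin dbas"
   "\<lambda>i. mons n \<times> Bas i" EU EL EC Emate Erk
  by (rule E_matched)

lemma Kch_chain: "Kch i = Km.chain i"
  by (simp add: Kch_def Km.chain_def)

lemma Kch_iff: "k \<in> Kch i \<longleftrightarrow> (\<forall>\<tau>. keys (lookup k \<tau>) \<subseteq> mons n - M \<and> (lookup k \<tau> \<noteq> 0 \<longrightarrow> \<tau> \<subseteq> {1..n} \<and> card \<tau> = i))"
proof
  assume k: "k \<in> Kch i"
  have *: "m \<in> mons n \<and> m \<notin> M \<and> \<tau> \<subseteq> {1..n} \<and> card \<tau> = i" if "m \<in> keys (lookup k \<tau>)" for m \<tau>
    using k that by (force simp: Kch_def ccoef_def in_keys_iff KCell_def)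
  show "\<forall>\<tau>. keys (lookup k \<tau>) \<subseteq> mons n - M \<and> (lookup k \<tau> \<noteq> 0 \<longrightarrow> \<tau> \<subseteq> {1..n} \<and> card \<tau> = i)"
  proof (intro allI conjI impI)
    fix \<tau>
    show "keys (lookup k \<tau>) \<subseteq> mons n - M" using * by blast
    assume "lookup k \<tau> \<noteq> 0"
    then obtain m where "m \<in> keys (lookup k \<tau>)" by (metis equals0I keys_eq_empty)
    then show "\<tau> \<subseteq> {1..n}" "card \<tau> = i" using * by blast+
  qed
next
  assume *: "\<forall>\<tau>. keys (lookup k \<tau>) \<subseteq> mons n - M \<and> (lookup k \<tau> \<noteq> 0 \<longrightarrow> \<tau> \<subseteq> {1..n} \<and> card \<tau> = i)"
  show "k \<in> Kch i" unfolding Kch_def mem_Collect_eq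
  proof (intro allI impI)
    fix s assume s: "ccoef k s \<noteq> 0"
    then have "fst s \<in> keys (lookup k (snd s))" by (simp add: ccoef_def in_keys_iff)
    then have "fst s \<in> mons n - M" "lookup k (snd s) \<noteq> 0" using * by (blast, auto)
    then show "s \<in> KCell i" using * by (auto simp: KCell_def split: prod.splits)
  qed
qed

lemma Psi_carrier: "k \<in> Kch i \<Longrightarrow> Psi k \<in> carrier (koszul n Q i)"
proof -
  assume k: "k \<in> Kch i"
  have "cs (lookup k \<tau>) \<in> carrier Q" for \<tau> using k by (intro cs_closed) (auto simp: Kch_iff)
  moreover have "\<tau> \<subseteq> {1..n} \<and> card \<tau> = i" if "cs (lookup k \<tau>) \<noteq> \<zero>\<^bsub>Q\<^esub>" for \<tau>
  proof -
    have "lookup k \<tau> \<noteq> 0" using that cs_0 by metis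
    then show ?thesis using k unfolding Kch_iff by blast
  qed
  ultimately show ?thesis by (simp add: Psi_def)
qed

lemma Psi_inj: "k \<in> Kch i \<Longrightarrow> k' \<in> Kch i \<Longrightarrow> Psi k = Psi k' \<Longrightarrow> k = k'"
  unfolding Kch_iff by (intro poly_mapping_eqI cs_inj) (auto simp: Psi_def fun_eq_iff)

lemma Psi_surj:
  assumes c: "c \<in> carrier (koszul n Q i)"
  obtains k where "k \<in> Kch i" "c = Psi k"
proof -
  have "\<exists>p. keys p \<subseteq> mons n - M \<and> c \<tau> = cs p" for \<tau>
  proof -
    obtain p where "keys p \<subseteq> mons n" "c \<tau> = cs p" using c cs_image by (metis (no_types, lifting) imageE koszul_simps(1) mem_Collect_eq)
    then show ?thesis using cs_nf[of p] keys_nf[of p] by (intro exI[of _ "nf p"]) auto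
  qed
  then obtain p where p: "\<And>\<tau>. keys (p \<tau>) \<subseteq> mons n - M" "\<And>\<tau>. c \<tau> = cs (p \<tau>)" by metis
  have p0: "\<tau> \<subseteq> {1..n} \<and> card \<tau> = i" if "p \<tau> \<noteq> 0" for \<tau>
  proof -
    have "c \<tau> \<noteq> cs 0" using cs_inj[of "p \<tau>" 0] p that by auto
    then show ?thesis using c cs_0 by auto
  qed
  define k where "k = Abs_poly_mapping p"
  have "finite {\<tau>. p \<tau> \<noteq> 0}" by (rule finite_subset[of _ "Pow {1..n}"]) (use p0 in auto)
  then have l: "lookup k = p" by (simp add: k_def)
  have "k \<in> Kch i" unfolding Kch_iff l using p(1) p0 by blast
  moreover have "c = Psi k" using p(2) by (simp add: Psi_def l fun_eq_iff)
  ultimately show thesis using that by blast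
qed

lemma Kch_keys: "k \<in> Kch i \<Longrightarrow> keys (lookup k \<tau>) \<subseteq> mons n"
  by (auto simp: Kch_iff)

lemma Psi_add: "k \<in> Kch i \<Longrightarrow> k' \<in> Kch i \<Longrightarrow> Psi (k + k') = Psi k \<oplus>\<^bsub>koszul n Q i\<^esub> Psi k'"
  by (simp add: Psi_def lookup_add cs_add Kch_keys)

lemma Psi_0: "Psi 0 = \<zero>\<^bsub>koszul n Q i\<^esub>"
  by (simp add: Psi_def cs_0)

lemma Psi_const: "k \<in> Kch i \<Longrightarrow> Psi (act (const_poly \<kappa>) k) = const_poly \<kappa> \<odot>\<^bsub>koszul n Q i\<^esub> Psi k"
  by (simp add: Psi_def const_poly_def cs_mult Kch_keys)

text \<open>Multiplication by a variable may lead into the ideal; \<open>nf\<close> deletes such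
  monomials in \<open>dK\<close>, and \<open>cs\<close> does not notice this.\<close>

lemma Psi_d: "k \<in> Kch i \<Longrightarrow> koszul_d n Q (Psi k) = Psi (dK k)"
proof
  fix \<rho> assume k: "k \<in> Kch i"
  have s: "keys ((-1) ^ alpha (insert j \<rho>) j * mono_poly (xvar j) :: 'k mpoly) \<subseteq> mons n" if "j \<in> {1..n} - \<rho>" for j
    using that by (auto simp: sign_in_mons)
  let ?f = "\<lambda>j. (-1) ^ alpha (insert j \<rho>) j * mono_poly (xvar j) * lookup k (insert j \<rho>)"
  have f: "keys (?f j) \<subseteq> mons n" if "j \<in> {1..n} - \<rho>" for j
    by (rule keys_mult_mons[OF s[OF that] Kch_keys[OF k]])
  have "koszul_d n Q (Psi k) \<rho> = (\<Oplus>\<^bsub>Q\<^esub>j\<in>{1..n} - \<rho>. cs (?f j))"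
    unfolding koszul_d_def Psi_def
    by (rule Qm.finsum_cong') (use f s k Kch_keys in \<open>simp_all add: cs_mult cs_closed Pi_def\<close>)
  also have "\<dots> = cs (\<Sum>j\<in>{1..n} - \<rho>. ?f j)" using f by (intro cs_sum[symmetric]) auto
  also have "\<dots> = cs (lookup (dK k) \<rho>)" unfolding lookup_dK using f by (intro cs_nf[symmetric] keys_sum_mons) auto
  finally show "koszul_d n Q (Psi k) \<rho> = Psi (dK k) \<rho>" by (simp add: Psi_def)
qed

lemma dK_0: "dK 0 = (0 :: (nat set, 'k) chains)"
  by (rule Km.d_0)

lemma cycles_eq: "koszul_cycles n Q i = Psi ` Zc i"
proof
  show "koszul_cycles n Q i \<subseteq> Psi ` Zc i"
  proof
    fix c assume c: "c \<in> koszul_cycles n Q i"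
    then obtain k where k: "k \<in> Kch i" "c = Psi k" unfolding koszul_cycles_def by (metis (no_types, lifting) Psi_surj mem_Collect_eq)
    have "Psi (dK k) = Psi 0" using c k Psi_d[OF k(1)] Psi_0[of i] by (simp add: koszul_cycles_def)
    moreover have "dK k \<in> Kch (i - 1)"
    proof (cases i)
      \<comment> \<open>With truncated subtraction \<open>i - 1\<close> is 0 here; the claim holds
        because the boundary of a chain of degree 0 vanishes.\<close>
      case 0
      have "dK k = 0"
      proof (rule ccoef_inj)
        fix s
        have "ccoef (dK k) s = 0"
        proof (subst Km.coef_d, rule sum.neutral, rule ballI)
          fix s' assume "s' \<in> {s. ccoef k s \<noteq> 0}"
          then have "s' \<in> KCell 0" using k 0 unfolding Kch_def by blast
          then have "snd s' = {}" using KCell_finite[of s' 0] by (auto simp: KCell_def)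
          then have "ccoef (dK (celt (1 :: 'k) s')) s = 0" using ccoef_dK_celt_nz[of "{}" "fst s'" s] by (metis empty_iff empty_subsetI prod.collapse)
          then show "ccoef k s' * ccoef (dK (celt 1 s')) s = 0" by simp
        qed
        then show "ccoef (dK k) s = ccoef 0 s" by (simp add: ccoef_def)
      qed
      then show ?thesis by (simp add: Kch_iff)
    next
      case (Suc j)
      then show ?thesis using Km.chain_d[of k j] k by (simp add: Kch_chain)
    qed
    ultimately have "dK k = 0" by (rule Psi_inj[rotated 2]) (simp add: Kch_iff)
    then show "c \<in> Psi ` Zc i" using k by (auto simp: Zc_def)
  qed
  show "Psi ` Zc i \<subseteq> koszul_cycles n Q i"
  proof (rule image_subsetI)
    fix k assume k: "k \<in> Zc i"
    then have "koszul_d n Q (Psi k) = (\<lambda>\<rho>. \<zero>\<^bsub>Q\<^esub>)" using Psi_d[of k i] Psi_0[of i] by (simp add: Zc_def)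
    then show "Psi k \<in> koszul_cycles n Q i"
      using Psi_carrier[of k i] k by (simp add: koszul_cycles_def Zc_def del: koszul_simps)
  qed
qed

lemma boundaries_eq: "koszul_boundaries n Q i = Psi ` dK ` Kch (i + 1)"
proof -
  have "carrier (koszul n Q (i + 1)) = Psi ` Kch (i + 1)" using Psi_surj Psi_carrier by blast
  moreover have "koszul_d n Q ` Psi ` Kch (i + 1) = Psi ` dK ` Kch (i + 1)"
    unfolding image_image by (rule image_cong[OF refl]) (rule Psi_d)
  ultimately show ?thesis by (simp add: koszul_boundaries_def)
qed

definition CM where "CM i = (koszul n Q i)\<lparr>carrier := koszul_cycles n Q i\<rparr>"

lemma CM_simps [simp]: "carrier (CM i) = koszul_cycles n Q i" "\<zero>\<^bsub>CM i\<^esub> = \<zero>\<^bsub>koszul n Q i\<^esub>"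
   "x \<oplus>\<^bsub>CM i\<^esub> y = x \<oplus>\<^bsub>koszul n Q i\<^esub> y" "p \<odot>\<^bsub>CM i\<^esub> x = p \<odot>\<^bsub>koszul n Q i\<^esub> x"
  by (simp_all add: CM_def)

lemma CM_quotient: "quotient_module (mpoly_ring n) (CM i) (koszul_boundaries n Q i)"
proof -
  interpret K: module "mpoly_ring n" "koszul n Q i" by (rule koszul_module[OF Q_module])
  interpret K1: module "mpoly_ring n" "koszul n Q (i + 1)" by (rule koszul_module[OF Q_module])
  have cyc: "c \<in> carrier (koszul n Q i) \<and> koszul_d n Q c = \<zero>\<^bsub>koszul n Q i\<^esub>" if "c \<in> koszul_cycles n Q i" for c
    using that by (simp add: koszul_cycles_def)
  have cycI: "c \<in> koszul_cycles n Q i" if "c \<in> carrier (koszul n Q i)" "koszul_d n Q c = \<zero>\<^bsub>koszul n Q i\<^esub>" for c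
    using that by (simp add: koszul_cycles_def)
  have sm: "p \<odot>\<^bsub>koszul n Q i\<^esub> c \<in> koszul_cycles n Q i" if "p \<in> carrier (mpoly_ring n)" "c \<in> koszul_cycles n Q i" for p c
    using that cyc[OF that(2)] koszul_d_linear(2)[OF Q_module _ _ that(1), of c i c]
    by (intro cycI K.smult_closed) (auto simp del: mpoly_ring_simps koszul_simps)
  \<comment> \<open>Negation is multiplication by the scalar -1, so closure under negatives follows
    from closure under scalars.\<close>
  have neg: "\<ominus>\<^bsub>koszul n Q i\<^esub> c = (\<ominus>\<^bsub>mpoly_ring n\<^esub> \<one>\<^bsub>mpoly_ring n\<^esub>) \<odot>\<^bsub>koszul n Q i\<^esub> c" if "c \<in> carrier (koszul n Q i)" for c
    using that K.smult_l_minus[of "\<one>\<^bsub>mpoly_ring n\<^esub>" c] by (simp del: mpoly_ring_simps koszul_simps)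
  have m1: "\<ominus>\<^bsub>mpoly_ring n\<^esub> \<one>\<^bsub>mpoly_ring n\<^esub> \<in> carrier (mpoly_ring n :: ('k mpoly, 'k mpoly) module)"
    by (intro mpoly.a_inv_closed mpoly.one_closed)
  have sub: "submodule (koszul_cycles n Q i) (mpoly_ring n) (koszul n Q i)"
  proof (rule K.submoduleI)
    show "koszul_cycles n Q i \<subseteq> carrier (koszul n Q i)" using cyc by blast
    show "\<zero>\<^bsub>koszul n Q i\<^esub> \<in> koszul_cycles n Q i" unfolding cycles_eq using Psi_0[of i]
      by (intro image_eqI[of _ _ 0]) (auto simp: Zc_def Kch_iff dK_0)
    show "\<ominus>\<^bsub>koszul n Q i\<^esub> c \<in> koszul_cycles n Q i" if "c \<in> koszul_cycles n Q i" for c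
      using sm[OF m1 that] neg cyc[OF that] by (simp del: mpoly_ring_simps koszul_simps)
    show "c \<oplus>\<^bsub>koszul n Q i\<^esub> c' \<in> koszul_cycles n Q i" if "c \<in> koszul_cycles n Q i" "c' \<in> koszul_cycles n Q i" for c c'
      using cyc[OF that(1)] cyc[OF that(2)] koszul_d_linear(1)[OF Q_module _ _ m1, of c i c']
      by (intro cycI K.M.a_closed) (auto simp del: mpoly_ring_simps koszul_simps)
  qed (rule sm)
  interpret C: module "mpoly_ring n" "CM i"
    unfolding CM_def by (rule submodule.submodule_is_module[OF sub K.module_axioms])
  have bd: "koszul_d n Q c \<in> koszul_boundaries n Q i" if "c \<in> carrier (koszul n Q (i + 1))" for c
    using that by (simp add: koszul_boundaries_def del: koszul_simps)
  have bE: "\<exists>b\<in>carrier (koszul n Q (i + 1)). c = koszul_d n Q b" if "c \<in> koszul_boundaries n Q i" for c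
    using that by (auto simp: koszul_boundaries_def simp del: koszul_simps)
  have plus: "x \<oplus>\<^bsub>koszul n Q (i + 1)\<^esub> y = x \<oplus>\<^bsub>koszul n Q i\<^esub> y" "p \<odot>\<^bsub>koszul n Q (i + 1)\<^esub> x = p \<odot>\<^bsub>koszul n Q i\<^esub> x"
    for x y and p :: "'k mpoly" by simp_all
  have bsm: "p \<odot>\<^bsub>koszul n Q i\<^esub> c \<in> koszul_boundaries n Q i"
    if p: "p \<in> carrier (mpoly_ring n)" and c: "c \<in> koszul_boundaries n Q i" for p c
  proof -
    obtain b where b: "b \<in> carrier (koszul n Q (i + 1))" "c = koszul_d n Q b" using bE[OF c] by blast
    have "p \<odot>\<^bsub>koszul n Q i\<^esub> c = koszul_d n Q (p \<odot>\<^bsub>koszul n Q (i + 1)\<^esub> b)"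
      unfolding b(2) plus(2)[symmetric] by (rule koszul_d_linear(2)[OF Q_module b(1) b(1) p, symmetric])
    then show ?thesis using bd[OF K1.smult_closed[OF p b(1)]] by simp
  qed
  have bsub: "koszul_boundaries n Q i \<subseteq> koszul_cycles n Q i"
  proof
    fix c assume "c \<in> koszul_boundaries n Q i"
    then obtain k where k: "k \<in> Kch (i + 1)" "c = Psi (dK k)" by (auto simp: boundaries_eq)
    have "dK k \<in> Kch i" using k Km.chain_d[of k i] by (simp add: Kch_chain)
    then show "c \<in> koszul_cycles n Q i" unfolding cycles_eq using k by (auto simp: Zc_def dK_dK)
  qed
  have "submodule (koszul_boundaries n Q i) (mpoly_ring n) (CM i)"
  proof (rule C.submoduleI)
    show "koszul_boundaries n Q i \<subseteq> carrier (CM i)" using bsub by simp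
    show "\<zero>\<^bsub>CM i\<^esub> \<in> koszul_boundaries n Q i" unfolding boundaries_eq CM_simps Psi_0[symmetric] image_image
      by (rule image_eqI[of _ _ 0]) (auto simp: dK_0 Kch_iff)
    show "\<ominus>\<^bsub>CM i\<^esub> c \<in> koszul_boundaries n Q i" if c: "c \<in> koszul_boundaries n Q i" for c
    proof -
      have cc: "c \<in> carrier (CM i)" using c bsub by auto
      have "\<ominus>\<^bsub>CM i\<^esub> c = (\<ominus>\<^bsub>mpoly_ring n\<^esub> \<one>\<^bsub>mpoly_ring n\<^esub>) \<odot>\<^bsub>CM i\<^esub> c"
        using C.smult_l_minus[OF mpoly.one_closed cc] C.smult_one[OF cc] by (simp del: mpoly_ring_simps CM_simps)
      then show ?thesis using bsm[OF m1 c] by (simp del: koszul_simps)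
    qed
    show "c \<oplus>\<^bsub>CM i\<^esub> c' \<in> koszul_boundaries n Q i" if c: "c \<in> koszul_boundaries n Q i" "c' \<in> koszul_boundaries n Q i" for c c'
    proof -
      obtain b b' where b: "b \<in> carrier (koszul n Q (i + 1))" "c = koszul_d n Q b"
        "b' \<in> carrier (koszul n Q (i + 1))" "c' = koszul_d n Q b'" using bE c by metis
      have "c \<oplus>\<^bsub>CM i\<^esub> c' = koszul_d n Q (b \<oplus>\<^bsub>koszul n Q (i + 1)\<^esub> b')"
        unfolding b(2,4) CM_simps plus(1)[symmetric]
        by (rule koszul_d_linear(1)[OF Q_module b(1,3) m1, symmetric])
      then show ?thesis using bd[OF K1.M.a_closed[OF b(1,3)]] by simp
    qed
    show "p \<odot>\<^bsub>CM i\<^esub> c \<in> koszul_boundaries n Q i" if "p \<in> carrier (mpoly_ring n)" "c \<in> koszul_boundaries n Q i" for p c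
      using bsm[OF that] by (simp del: koszul_simps)
  qed
  then show ?thesis using C.module_axioms by (simp add: quotient_module_def quotient_module_axioms_def)
qed

definition hcl :: "nat \<Rightarrow> (nat set, 'k) chains \<Rightarrow> (nat set \<Rightarrow> 'k mpoly set) set" where
  "hcl i k = koszul_class n Q i (Psi k)"

lemma hcl_CM: "hcl i k = koszul_boundaries n Q i +>\<^bsub>CM i\<^esub> Psi k"
  by (simp add: hcl_def koszul_class_def a_r_coset_def' del: koszul_simps)

lemma homol_simps: "homol n I i = restrict_scalars const_poly (quot_module (CM i) (koszul_boundaries n Q i))"
  by (simp add: homol_def koszul_homology_def CM_def Q_def)

text \<open>The cover is over K: normal forms are preserved by constants but not by variables, and
  constants commute with \<open>dK\<close>.\<close>

lemma hcl_cover: "module_cover field_ring (Zc i) (\<lambda>\<kappa>. act (const_poly \<kappa>)) (hcl i) (homol n I i)"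
proof -
  interpret C: quotient_module "mpoly_ring n" "CM i" "koszul_boundaries n Q i" by (rule CM_quotient)
  have Zk: "k \<in> Kch i" if "k \<in> Zc i" for k using that by (simp add: Zc_def)
  have Pc: "Psi k \<in> carrier (CM i)" if "k \<in> Zc i" for k using that by (simp add: cycles_eq)
  have cp: "const_poly \<kappa> \<in> carrier (mpoly_ring n :: ('k mpoly, 'k mpoly) module)" for \<kappa> by (simp add: const_poly_def)
  have dc: "dK (act (const_poly \<kappa>) k) = act (const_poly \<kappa>) (dK k)" for \<kappa> and k :: "(nat set, 'k) chains"
  proof (rule ccoef_inj)
    fix s
    have 1: "ccoef (act (const_poly \<kappa>) c) s = \<kappa> * ccoef c s" for c :: "(nat set, 'k) chains" and s
      by (simp add: ccoef_def const_poly_def lookup_single_mult mdvd_iff)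
    show "ccoef (dK (act (const_poly \<kappa>) k)) s = ccoef (act (const_poly \<kappa>) (dK k)) s"
      by (cases s) (auto simp: ccoef_dK 1 sum_distrib_left intro!: sum.cong)
  qed
  show ?thesis
  proof (rule module_cover.intro[OF field_ring_cring], unfold_locales)
    show "0 \<in> Zc i" by (simp add: Zc_def Kch_iff dK_0)
    show "\<And>x y. x \<in> Zc i \<Longrightarrow> y \<in> Zc i \<Longrightarrow> x + y \<in> Zc i"
      by (auto simp: Zc_def Kch_chain Km.chain_add Km.d_add)
    show "- x \<in> Zc i" if "x \<in> Zc i" for x
      using Km.chain_minus[of 0 i x] Km.d_minus[of 0 x] that by (simp add: Zc_def Kch_chain)
    show "act (const_poly r) x \<in> Zc i" if "x \<in> Zc i" for r x
    proof -
      have "ccoef (act (const_poly r) x) s = r * ccoef x s" for s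
        by (simp add: ccoef_def const_poly_def lookup_single_mult mdvd_iff)
      then show ?thesis using that by (auto simp: Zc_def dc Kch_def)
    qed
    show "act (const_poly r) (x + y) = act (const_poly r) x + act (const_poly r) y" for r and x y :: "(nat set, 'k) chains"
      by (rule act_add)
    show "act (const_poly (r \<oplus>\<^bsub>field_ring\<^esub> r')) x = act (const_poly r) x + act (const_poly r') x" for r r' and x :: "(nat set, 'k) chains"
      by (simp add: const_poly_def single_add act_add_left)
    show "act (const_poly (r \<otimes>\<^bsub>field_ring\<^esub> r')) x = act (const_poly r) (act (const_poly r') x)" for r r' and x :: "(nat set, 'k) chains"
      by (simp add: const_poly_def act_act mult_single)
    show "act (const_poly \<one>\<^bsub>field_ring\<^esub>) x = x" for x :: "(nat set, 'k) chains"
      by (simp add: const_poly_def)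
    have "hcl i ` Zc i = (\<lambda>x. koszul_boundaries n Q i +>\<^bsub>CM i\<^esub> x) ` carrier (CM i)"
      by (simp add: cycles_eq image_image hcl_CM)
    then show "hcl i ` Zc i = carrier (homol n I i)"
      using C.quot_image by (simp add: homol_simps restrict_scalars_def)
    show "hcl i 0 = \<zero>\<^bsub>homol n I i\<^esub>"
      using C.quot_zero by (simp add: hcl_CM homol_simps restrict_scalars_def Psi_0[of i] del: koszul_simps)
    show "hcl i (x + y) = hcl i x \<oplus>\<^bsub>homol n I i\<^esub> hcl i y" if "x \<in> Zc i" "y \<in> Zc i" for x y
      using C.quot_add[OF Pc Pc, OF that] Psi_add[OF Zk Zk, OF that]
      by (simp add: hcl_CM homol_simps restrict_scalars_def del: koszul_simps)
    show "hcl i (act (const_poly r) x) = r \<odot>\<^bsub>homol n I i\<^esub> hcl i x" if "x \<in> Zc i" for r x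
      using C.quot_smult[OF cp Pc, OF that] Psi_const[OF Zk, OF that]
      by (simp add: hcl_CM homol_simps restrict_scalars_def del: koszul_simps)
  qed
qed

lemma hcl_eq_0_iff:
  assumes "k \<in> Zc i"
  shows "hcl i k = \<zero>\<^bsub>homol n I i\<^esub> \<longleftrightarrow> k \<in> dK ` Kch (i + 1)"
proof -
  interpret C: quotient_module "mpoly_ring n" "CM i" "koszul_boundaries n Q i" by (rule CM_quotient)
  have Pc: "Psi k \<in> carrier (CM i)" using assms by (simp add: cycles_eq)
  have "hcl i k = \<zero>\<^bsub>homol n I i\<^esub> \<longleftrightarrow> koszul_boundaries n Q i +>\<^bsub>CM i\<^esub> Psi k = koszul_boundaries n Q i +>\<^bsub>CM i\<^esub> \<zero>\<^bsub>CM i\<^esub>"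
    using C.quot_zero by (simp add: hcl_CM homol_simps restrict_scalars_def)
  also have "\<dots> \<longleftrightarrow> Psi k \<in> koszul_boundaries n Q i"
    using C.coset_eq_iff[OF Pc C.M.zero_closed] C.M.minus_equality[of "\<zero>\<^bsub>CM i\<^esub>" "\<zero>\<^bsub>CM i\<^esub>"]
    by (simp add: a_minus_def C.M.r_zero[OF Pc] del: CM_simps)
  also have "\<dots> \<longleftrightarrow> k \<in> dK ` Kch (i + 1)"
  proof
    assume "Psi k \<in> koszul_boundaries n Q i"
    then obtain b where b: "b \<in> Kch (i + 1)" "Psi k = Psi (dK b)" by (auto simp: boundaries_eq)
    have "dK b \<in> Kch i" using Km.chain_d[of b i] b by (simp add: Kch_chain)
    then have "k = dK b" using Psi_inj[of k i "dK b"] b assms by (simp add: Zc_def)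
    then show "k \<in> dK ` Kch (i + 1)" using b by blast
  qed (auto simp: boundaries_eq)
  finally show ?thesis .
qed

end

lemma Fres_0_simps [simp]:
  "carrier (Fres n I 0) = Inl ` carrier (mpoly_ring n)" "\<zero>\<^bsub>Fres n I 0\<^esub> = Inl 0"
  "x \<oplus>\<^bsub>Fres n I 0\<^esub> y = Inl (projl x + projl y)" "p \<odot>\<^bsub>Fres n I 0\<^esub> x = Inl (p * projl x)"
  by (simp_all add: Fres_def copy_module_def)

lemma Fres_simps:
  assumes "i \<noteq> 0"
  shows "carrier (Fres n I i) = Inr ` carrier (ext_scalars n (homol n I i))" "\<zero>\<^bsub>Fres n I i\<^esub> = Inr (\<lambda>m. \<zero>\<^bsub>homol n I i\<^esub>)"
    "x \<oplus>\<^bsub>Fres n I i\<^esub> y = Inr (\<lambda>m. projr x m \<oplus>\<^bsub>homol n I i\<^esub> projr y m)"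
    "p \<odot>\<^bsub>Fres n I i\<^esub> x = Inr (\<lambda>m. \<Oplus>\<^bsub>homol n I i\<^esub>a\<in>{a \<in> keys p. mdvd a m}. lookup p a \<odot>\<^bsub>homol n I i\<^esub> projr x (m - a))"
  using assms by (simp_all add: Fres_def copy_module_def ext_scalars_def)

lemma ext_scalars_carrier: "x \<in> carrier (ext_scalars n V) \<longleftrightarrow>
    (\<forall>m. x m \<in> carrier V) \<and> finite {m. x m \<noteq> \<zero>\<^bsub>V\<^esub>} \<and> {m. x m \<noteq> \<zero>\<^bsub>V\<^esub>} \<subseteq> mons n"
  by (simp add: ext_scalars_def)

section \<open>Bases of the homology and coordinates for the modules F_i\<close>

context spread_resolution
begin

definition zsym :: "mon \<times> nat set \<Rightarrow> mon \<times> nat set" where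
  "zsym b = (fst b - xvar (maxv (fst b)), insert (maxv (fst b)) (snd b))"

definition zc :: "nat \<Rightarrow> (mon \<times> nat set \<Rightarrow> 'k) \<Rightarrow> (nat set, 'k) chains" where
  "zc i f = (\<Sum>b\<in>Bas i. celt (f b) (zsym b))"

lemma zsym_alt: "zsym = (\<lambda>(u, \<sigma>). (u - xvar (maxv u), insert (maxv u) \<sigma>))"
  by (auto simp: zsym_def)

lemma celt_add: "celt (x + y) s = celt x s + (celt y s :: ('b, 'k) chains)"
  by (simp add: celt_def single_add)

lemma celt_0 [simp]: "celt 0 s = (0 :: ('b, 'k) chains)"
  by (simp add: celt_def)

lemma act_celt: "act (const_poly \<kappa>) (celt x s) = (celt (\<kappa> * x) s :: ('b, 'k) chains)"
  by (simp add: celt_def const_poly_def mult_single)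

lemma zc_cong: "(\<And>b. b \<in> Bas i \<Longrightarrow> f b = g b) \<Longrightarrow> zc i f = zc i g"
  unfolding zc_def by (intro sum.cong refl) simp

lemma zc_add: "zc i (\<lambda>b. f b + g b) = zc i f + zc i g"
  by (simp add: zc_def celt_add sum.distrib)

lemma zc_0 [simp]: "zc i (\<lambda>b. 0) = 0"
  by (simp add: zc_def)

lemma zc_sum: "finite B \<Longrightarrow> zc i (\<lambda>b. \<Sum>x\<in>B. f x b) = (\<Sum>x\<in>B. zc i (f x))"
  by (induction B rule: finite_induct) (simp_all add: zc_add)

lemma act_zc: "act (const_poly \<kappa>) (zc i f) = zc i (\<lambda>b. \<kappa> * f b)"
  by (simp add: zc_def act_sum act_celt)

lemma ccoef_zc: "i \<noteq> 0 \<Longrightarrow> b \<in> Bas i \<Longrightarrow> ccoef (zc i f) (zsym b) = f b"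
proof -
  assume i: "i \<noteq> 0" and b: "b \<in> Bas i"
  then obtain j where j: "i = Suc j" by (cases i) auto
  have "ccoef (zc i f) (zsym b) = (\<Sum>b'\<in>Bas i. ccoef (celt (f b') (zsym b')) (zsym b))"
    unfolding zc_def by (rule Km.coef_sum)
  also have "\<dots> = (\<Sum>b'\<in>Bas i. if b' = b then f b' else 0)"
    using inj_zsym[of j] b unfolding zsym_alt[symmetric] j[symmetric]
    by (intro sum.cong refl) (auto simp: ccoef_celt inj_on_eq_iff)
  finally show ?thesis using b finite_Bas by simp
qed

lemma zsym_critical: "i \<noteq> 0 \<Longrightarrow> b \<in> Bas i \<Longrightarrow> zsym b \<in> KC \<and> zsym b \<in> KCell i"
  using KC_cell[of "i - 1"] by (auto simp: zsym_alt)

lemma ccoef_zc_out: "i \<noteq> 0 \<Longrightarrow> s \<notin> zsym ` Bas i \<Longrightarrow> ccoef (zc i f) s = 0"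
  unfolding zc_def by (subst Km.coef_sum, rule sum.neutral) (auto simp: ccoef_celt)

lemma zc_in_Zc: "i \<noteq> 0 \<Longrightarrow> zc i f \<in> Zc i"
proof -
  assume i: "i \<noteq> 0"
  have "dK (celt x (zsym b)) = (0 :: (nat set, 'k) chains)" if "b \<in> Bas i" for b x
  proof (rule ccoef_inj)
    show "ccoef (dK (celt x (zsym b))) s = ccoef 0 s" for s
      using Km.d_elt[of x "zsym b" s] Km.critical[of "zsym b" i] zsym_critical[OF i that] by simp
  qed
  moreover have "celt x (zsym b) \<in> Kch i" if "b \<in> Bas i" for b x
    using zsym_critical[OF i that] by (simp add: Kch_chain Km.chain_elt)
  ultimately show ?thesis unfolding Zc_def zc_def by (simp add: Kch_chain Km.chain_sum Km.d_sum)
qed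

text \<open>By \<open>cycle_critical\<close> a cycle is, up to a boundary, a combination of critical
  cells, and in positive degree these are the z(u;\<sigma>).\<close>

lemma hcl_zc_surj:
  assumes i: "i \<noteq> 0" and v: "v \<in> carrier (homol n I i)"
  obtains f where "v = hcl i (zc i f)"
proof -
  interpret H: module_cover field_ring "Zc i" "\<lambda>\<kappa>. act (const_poly \<kappa>)" "hcl i" "homol n I i" by (rule hcl_cover)
  interpret V: module field_ring "homol n I i" by (rule H.cover_module)
  obtain k where k: "k \<in> Zc i" "v = hcl i k" using v H.q_surj by blast
  obtain b where b: "b \<in> Km.chain (Suc i)" "\<And>s. ccoef (k - dK b) s \<noteq> 0 \<Longrightarrow> s \<in> KC \<inter> KCell i"
    using Km.cycle_critical[of k i] k by (auto simp: Zc_def Kch_chain)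
  define f where "f = (\<lambda>b'. ccoef (k - dK b) (zsym b'))"
  have zi: "KC \<inter> KCell i = zsym ` Bas i" using KC_cell[of "i - 1"] i by (simp add: zsym_alt)
  have "k - dK b = zc i f"
  proof (rule ccoef_inj)
    fix s
    show "ccoef (k - dK b) s = ccoef (zc i f) s"
    proof (cases "s \<in> zsym ` Bas i")
      case True
      then show ?thesis using ccoef_zc[OF i] by (auto simp: f_def)
    next
      case False
      then show ?thesis using b(2)[of s] ccoef_zc_out[OF i False] zi by auto
    qed
  qed
  then have k': "k = zc i f + dK b" by (simp add: algebra_simps)
  have dbZ: "dK b \<in> Zc i" using Km.chain_d[OF b(1)] dK_dK by (simp add: Zc_def Kch_chain)
  have "hcl i (dK b) = \<zero>\<^bsub>homol n I i\<^esub>" using hcl_eq_0_iff[OF dbZ] b(1) by (auto simp: Kch_chain)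
  then have "v = hcl i (zc i f)"
    using k H.q_add[OF zc_in_Zc[OF i] dbZ] k' H.q_closed[OF zc_in_Zc[OF i]] by simp
  then show thesis by (rule that)
qed

text \<open>The difference of the two combinations is a boundary supported on critical cells, hence
  zero by \<open>boundary_critical\<close>.\<close>

lemma hcl_zc_inj:
  assumes i: "i \<noteq> 0" and eq: "hcl i (zc i f) = hcl i (zc i g)" and b: "b \<in> Bas i"
  shows "f b = g b"
proof -
  interpret H: module_cover field_ring "Zc i" "\<lambda>\<kappa>. act (const_poly \<kappa>)" "hcl i" "homol n I i" by (rule hcl_cover)
  interpret V: module field_ring "homol n I i" by (rule H.cover_module)
  define h where "h = (\<lambda>b. f b - g b)"
  have "zc i f = zc i h + zc i g" using zc_add[of i h g] by (simp add: h_def)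
  then have "hcl i (zc i h) \<oplus>\<^bsub>homol n I i\<^esub> hcl i (zc i g) = hcl i (zc i g)"
    using H.q_add[OF zc_in_Zc[OF i] zc_in_Zc[OF i], of h g] eq by simp
  then have "hcl i (zc i h) = \<zero>\<^bsub>homol n I i\<^esub>"
    using V.M.add.r_cancel_one'[OF H.q_closed[OF zc_in_Zc[OF i]] H.q_closed[OF zc_in_Zc[OF i]]] by metis
  then obtain c where c: "c \<in> Kch (i + 1)" "zc i h = dK c" using hcl_eq_0_iff[OF zc_in_Zc[OF i]] by blast
  have "dK c = 0"
  proof (rule Km.boundary_critical)
    show "c \<in> Km.chain (Suc i)" using c by (simp add: Kch_chain)
    show "s \<in> KC" if "ccoef (dK c) s \<noteq> 0" for s
    proof -
      have "s \<in> zsym ` Bas i" using that ccoef_zc_out[OF i, of s h] c(2) by metis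
      then show ?thesis using zsym_critical[OF i] by blast
    qed
  qed
  then show ?thesis using ccoef_zc[OF i b, of h] c(2) by (simp add: h_def ccoef_def)
qed

text \<open>The sign from the definition of f(u;\<sigma>) is built in, so that the unit chain at
  (u,\<sigma>) goes to f(u;\<sigma>) itself. For \<open>i > 0\<close> the value at \<open>m\<close>
  is the homology class formed from the cells with monomial \<open>m\<close>.\<close>

definition Phi :: "nat \<Rightarrow> (mon \<times> nat set, 'k) chains \<Rightarrow> 'k fres" where
  "Phi i c = (if i = 0 then Inl (lookup c (0, {}))
     else Inr (\<lambda>m. hcl i (zc i (\<lambda>b. (-1) ^ sgn_exp i * ccoef c (m, b)))))"

definition Ech :: "nat \<Rightarrow> (mon \<times> nat set, 'k) chains set" where "Ech i = Em.chain i"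

lemma Ech_iff: "c \<in> Ech i \<longleftrightarrow> keys c \<subseteq> Bas i \<and> (\<forall>b. keys (lookup c b) \<subseteq> mons n)"
proof
  assume c: "c \<in> Ech i"
  have *: "m \<in> mons n \<and> b \<in> Bas i" if "m \<in> keys (lookup c b)" for m b
  proof -
    have "ccoef c (m, b) \<noteq> 0" using that by (simp add: ccoef_def in_keys_iff)
    then have "(m, b) \<in> mons n \<times> Bas i" using c unfolding Ech_def Em.chain_def by blast
    then show ?thesis by simp
  qed
  have "b \<in> Bas i" if "b \<in> keys c" for b
  proof -
    have "lookup c b \<noteq> 0" using that by (simp add: in_keys_iff)
    then obtain m where "m \<in> keys (lookup c b)" by (metis equals0I keys_eq_empty)
    then show ?thesis using * by blast
  qed
  then show "keys c \<subseteq> Bas i \<and> (\<forall>b. keys (lookup c b) \<subseteq> mons n)" using * by blast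
next
  assume c: "keys c \<subseteq> Bas i \<and> (\<forall>b. keys (lookup c b) \<subseteq> mons n)"
  show "c \<in> Ech i" unfolding Ech_def Em.chain_def mem_Collect_eq
  proof (intro allI impI)
    fix s assume "ccoef c s \<noteq> 0"
    then have "fst s \<in> keys (lookup c (snd s))" "snd s \<in> keys c" by (auto simp: ccoef_def in_keys_iff)
    then have "fst s \<in> mons n" "snd s \<in> Bas i" using c by blast+
    then show "s \<in> mons n \<times> Bas i" by (cases s) simp
  qed
qed

lemma ccoef_act: "ccoef (act p c) (m, b) = (\<Sum>x\<in>{x \<in> keys p. mdvd x m}. lookup p x * ccoef c (m - x, b))"
  by (simp add: ccoef_def lookup_mult_sum)

text \<open>Scalar multiplication on S \<otimes> H is the same convolution as the product of
  polynomials, so \<open>act\<close> corresponds to it.\<close>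

lemma Phi_cover: "module_cover (mpoly_ring n) (Ech i) act (Phi i) (Fres n I i)"
proof (rule module_cover.intro[OF mpoly_cring], unfold_locales)
  show "0 \<in> Ech i" by (simp add: Ech_def)
  show "x + y \<in> Ech i" if "x \<in> Ech i" "y \<in> Ech i" for x y using that by (simp add: Ech_def Em.chain_add)
  show "- x \<in> Ech i" if "x \<in> Ech i" for x using Em.chain_minus[of 0 i x] that by (simp add: Ech_def)
  show act_closed: "act r x \<in> Ech i" if "r \<in> carrier (mpoly_ring n)" "x \<in> Ech i" for r x
  proof -
    have "keys (act r x) \<subseteq> keys x" by (auto simp: in_keys_iff)
    moreover have "keys (lookup (act r x) b) \<subseteq> mons n" for b
    proof -
      have "keys (lookup x b) \<subseteq> mons n" using that(2) unfolding Ech_iff by blast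
      then show ?thesis using that(1) keys_mult_mons by simp
    qed
    ultimately show ?thesis using that(2) unfolding Ech_iff by blast
  qed
  show "act r (x + y) = act r x + act r y" for r and x y :: "(mon \<times> nat set, 'k) chains" by (rule act_add)
  show "act (r \<oplus>\<^bsub>mpoly_ring n\<^esub> r') x = act r x + act r' x" for r r' and x :: "(mon \<times> nat set, 'k) chains"
    by (simp add: act_add_left)
  show "act (r \<otimes>\<^bsub>mpoly_ring n\<^esub> r') x = act r (act r' x)" for r r' and x :: "(mon \<times> nat set, 'k) chains"
    by (simp add: act_act)
  show "act \<one>\<^bsub>mpoly_ring n\<^esub> x = x" for x :: "(mon \<times> nat set, 'k) chains" by simp
  let ?V = "homol n I i"
  interpret H: module_cover field_ring "Zc i" "\<lambda>\<kappa>. act (const_poly \<kappa>)" "hcl i" ?V by (rule hcl_cover)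
  interpret V: module field_ring ?V by (rule H.cover_module)
  show "Phi i ` Ech i = carrier (Fres n I i)"
  proof (cases "i = 0")
    case True
    have "Phi 0 ` Ech 0 \<subseteq> carrier (Fres n I 0)" by (auto simp: Phi_def Ech_iff)
    moreover have "x \<in> Phi 0 ` Ech 0" if "x \<in> carrier (Fres n I 0)" for x
    proof -
      obtain p where "x = Inl p" "keys p \<subseteq> mons n" using \<open>x \<in> carrier (Fres n I 0)\<close> by auto
      then show ?thesis
        by (intro image_eqI[of _ _ "single (0, {}) p"]) (auto simp: Phi_def Ech_iff Bas_def lookup_single when_def)
    qed
    ultimately show ?thesis using True by blast
  next
    case i: False
    have "Phi i c \<in> carrier (Fres n I i)" if c: "c \<in> Ech i" for c
    proof -
      define x where "x = (\<lambda>m. hcl i (zc i (\<lambda>b. (-1) ^ sgn_exp i * ccoef c (m, b))))"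
      have x0: "x m = \<zero>\<^bsub>?V\<^esub>" if "m \<notin> fst ` {s. ccoef c s \<noteq> 0}" for m
      proof -
        have "ccoef c (m, b) = 0" for b using that by force
        then show ?thesis by (simp add: x_def H.q_0)
      qed
      have "{m. x m \<noteq> \<zero>\<^bsub>?V\<^esub>} \<subseteq> fst ` {s. ccoef c s \<noteq> 0}" using x0 by blast
      moreover have "fst ` {s. ccoef c s \<noteq> 0} \<subseteq> mons n" using c by (auto simp: Ech_def Em.chain_def)
      moreover have "x m \<in> carrier ?V" for m unfolding x_def by (rule H.q_closed[OF zc_in_Zc[OF i]])
      ultimately have "x \<in> carrier (ext_scalars n ?V)"
        unfolding ext_scalars_carrier using finite_subset[OF _ finite_imageI[OF finite_ccoef]] by blast
      then show ?thesis using i by (simp add: Fres_simps[OF i] Phi_def x_def)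
    qed
    moreover have "y \<in> Phi i ` Ech i" if y: "y \<in> carrier (Fres n I i)" for y
    proof -
      obtain x where x: "y = Inr x" "x \<in> carrier (ext_scalars n ?V)" using y by (auto simp: Fres_simps[OF i])
      define T where "T = {m. x m \<noteq> \<zero>\<^bsub>?V\<^esub>}"
      have T: "finite T" "T \<subseteq> mons n" and xc: "\<And>m. x m \<in> carrier ?V" using x(2) by (auto simp: ext_scalars_carrier T_def)
      have "\<exists>f. x m = hcl i (zc i f)" for m by (rule hcl_zc_surj[OF i xc[of m]]) blast
      then have "\<exists>f. \<forall>m. x m = hcl i (zc i (f m))" by (intro choice allI)
      then obtain f where f: "\<And>m. x m = hcl i (zc i (f m))" by blast
      \<comment> \<open>The sign is inserted once more to cancel that of \<open>Phi\<close>, as its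
        square is 1.\<close>
      define c where "c = (\<Sum>m\<in>T. \<Sum>b\<in>Bas i. celt ((-1) ^ sgn_exp i * f m b) (m, b))"
      have "ccoef c (m, b) = (\<Sum>m'\<in>T. \<Sum>b'\<in>Bas i. if m' = m \<and> b' = b then (-1) ^ sgn_exp i * f m' b' else 0)" for m b
        unfolding c_def Em.coef_sum by (intro sum.cong refl) (auto simp: ccoef_celt)
      also have "\<dots> m b = (\<Sum>m'\<in>T. if m' = m then (\<Sum>b'\<in>Bas i. if b' = b then (-1) ^ sgn_exp i * f m' b' else 0) else 0)" for m b
        by (intro sum.cong refl) (auto intro!: sum.cong sum.neutral)
      finally have cc: "ccoef c (m, b) = (if m \<in> T \<and> b \<in> Bas i then (-1) ^ sgn_exp i * f m b else 0)" for m b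
        using T finite_Bas by simp
      have "c \<in> Ech i" using T by (auto simp: Ech_def Em.chain_def cc split: if_splits)
      moreover have "hcl i (zc i (\<lambda>b. (-1) ^ sgn_exp i * ccoef c (m, b))) = x m" for m
      proof (cases "m \<in> T")
        case True
        have "zc i (\<lambda>b. (-1) ^ sgn_exp i * ccoef c (m, b)) = zc i (f m)"
          by (rule zc_cong) (simp add: cc True power_mult_distrib[symmetric] mult.assoc[symmetric])
        then show ?thesis using f by simp
      next
        case False
        then show ?thesis by (simp add: cc H.q_0) (simp add: T_def)
      qed
      ultimately show ?thesis using x(1) i by (intro image_eqI[of _ _ c]) (auto simp: Phi_def)
    qed
    ultimately show ?thesis by blast
  qed
  show "Phi i 0 = \<zero>\<^bsub>Fres n I i\<^esub>"
    by (cases "i = 0") (simp_all add: Phi_def Fres_simps ccoef_def H.q_0)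
  show "Phi i (x + y) = Phi i x \<oplus>\<^bsub>Fres n I i\<^esub> Phi i y" for x y
  proof (cases "i = 0")
    case False
    have "zc i (\<lambda>b. (-1) ^ sgn_exp i * ccoef (x + y) (m, b)) =
      zc i (\<lambda>b. (-1) ^ sgn_exp i * ccoef x (m, b)) + zc i (\<lambda>b. (-1) ^ sgn_exp i * ccoef y (m, b))" for m
      by (simp add: ccoef_add distrib_left zc_add)
    then show ?thesis using False by (simp add: Phi_def Fres_simps H.q_add[OF zc_in_Zc zc_in_Zc])
  qed (simp add: Phi_def lookup_add)
  show "Phi i (act r x) = r \<odot>\<^bsub>Fres n I i\<^esub> Phi i x" for r x
  proof (cases "i = 0")
    case i: False
    have "hcl i (zc i (\<lambda>b. (-1) ^ sgn_exp i * ccoef (act r x) (m, b))) =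
      (\<Oplus>\<^bsub>?V\<^esub>a\<in>{a \<in> keys r. mdvd a m}. lookup r a \<odot>\<^bsub>?V\<^esub> hcl i (zc i (\<lambda>b. (-1) ^ sgn_exp i * ccoef x (m - a, b))))" for m
    proof -
      let ?z = "\<lambda>a. zc i (\<lambda>b. (-1) ^ sgn_exp i * ccoef x (m - a, b))"
      have fin: "finite {a \<in> keys r. mdvd a m}" by simp
      have "zc i (\<lambda>b. (-1) ^ sgn_exp i * ccoef (act r x) (m, b)) =
          zc i (\<lambda>b. \<Sum>a\<in>{a \<in> keys r. mdvd a m}. lookup r a * ((-1) ^ sgn_exp i * ccoef x (m - a, b)))"
        by (simp add: ccoef_act sum_distrib_left mult.left_commute)
      also have "\<dots> = (\<Sum>a\<in>{a \<in> keys r. mdvd a m}. act (const_poly (lookup r a)) (?z a))"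
        unfolding zc_sum[OF fin] act_zc ..
      finally have "hcl i (zc i (\<lambda>b. (-1) ^ sgn_exp i * ccoef (act r x) (m, b))) =
          (\<Oplus>\<^bsub>?V\<^esub>a\<in>{a \<in> keys r. mdvd a m}. hcl i (act (const_poly (lookup r a)) (?z a)))"
        using H.q_sum[OF fin, of "\<lambda>a. act (const_poly (lookup r a)) (?z a)"]
        by (simp add: act_zc zc_in_Zc[OF i])
      also have "\<dots> = (\<Oplus>\<^bsub>?V\<^esub>a\<in>{a \<in> keys r. mdvd a m}. lookup r a \<odot>\<^bsub>?V\<^esub> hcl i (?z a))"
        by (rule V.finsum_cong') (auto simp: H.q_smult zc_in_Zc[OF i] H.q_closed)
      finally show ?thesis .
    qed
    then show ?thesis using i by (simp add: Phi_def Fres_simps)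
  qed (simp add: Phi_def)
qed

lemma Phi_inj:
  assumes "c \<in> Ech i" "c' \<in> Ech i" "Phi i c = Phi i c'"
  shows "c = c'"
proof (rule ccoef_inj)
  fix s :: "mon \<times> mon \<times> nat set"
  obtain m b where s: "s = (m, b)" by (cases s)
  show "ccoef c s = ccoef c' s"
  proof (cases "b \<in> Bas i")
    case b: True
    show ?thesis
    proof (cases "i = 0")
      case True
      then show ?thesis using assms(3) b by (simp add: s Phi_def Bas_def ccoef_def)
    next
      case i: False
      then have *: "hcl i (zc i (\<lambda>b. (-1) ^ sgn_exp i * ccoef c (m, b))) = hcl i (zc i (\<lambda>b. (-1) ^ sgn_exp i * ccoef c' (m, b)))"
        using assms(3) by (simp add: Phi_def fun_eq_iff)
      then show ?thesis using hcl_zc_inj[OF i * b] by (simp add: s)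
    qed
  next
    case False
    have "ccoef x (m, b) = 0" if "x \<in> Ech i" for x
    proof (rule ccontr)
      assume "ccoef x (m, b) \<noteq> 0"
      then have "(m, b) \<in> mons n \<times> Bas i" using that unfolding Ech_def Em.chain_def by blast
      then show False using False by simp
    qed
    then show ?thesis using assms by (simp add: s)
  qed
qed

lemma zcyc_Psi: "zcyc n I u \<sigma> = Psi (celt 1 (zsym (u, \<sigma>)))"
proof
  fix \<rho>
  show "zcyc n I u \<sigma> \<rho> = Psi (celt 1 (zsym (u, \<sigma>))) \<rho>"
  proof (cases "\<rho> = insert (maxv u) \<sigma>")
    case True
    then show ?thesis by (simp add: zcyc_def tensor_e_def Psi_def celt_def zsym_def cs_def mono_poly_def)
  next
    case False
    then have "Psi (celt 1 (zsym (u, \<sigma>))) \<rho> = cs 0" by (simp add: Psi_def celt_def zsym_def lookup_single)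
    then show ?thesis using False unfolding cs_0 by (simp add: zcyc_def tensor_e_def Q_def)
  qed
qed

lemma fbas_Phi:
  assumes u: "u \<in> G" and i: "i = card \<sigma> + 1"
  shows "fbas n t I u \<sigma> = Phi i (fh u \<sigma>)"
proof (cases "\<sigma> \<subseteq> adm a u")
  case False
  interpret P: module_cover "mpoly_ring n" "Ech i" act "Phi i" "Fres n I i" by (rule Phi_cover)
  show ?thesis using False u unfolding fbas_def Let_def i[symmetric] by (simp add: fh_def admissible_adm P.q_0)
next
  case True
  interpret P: module_cover "mpoly_ring n" "Ech i" act "Phi i" "Fres n I i" by (rule Phi_cover)
  interpret H: module_cover field_ring "Zc i" "\<lambda>\<kappa>. act (const_poly \<kappa>)" "hcl i" "homol n I i" by (rule hcl_cover)
  interpret V: module field_ring "homol n I i" by (rule H.cover_module)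
  have i0: "i \<noteq> 0" using i by simp
  have b: "(u, \<sigma>) \<in> Bas i" using u True i by (simp add: Bas_def)
  define e :: "'k mpoly" where "e = (-1) ^ sgn_exp i"
  have e1: "e = single 0 ((-1) ^ sgn_exp i)"
  proof -
    have "(-1 :: 'k mpoly) = single 0 (-1)" by (simp add: single_uminus)
    moreover have "single 0 x ^ j = (single 0 (x ^ j) :: 'k mpoly)" for x j
      by (induction j) (simp_all add: mult_single)
    ultimately show ?thesis by (simp add: e_def)
  qed
  \<comment> \<open>The coefficient \<open>e\<close> cancels the sign in \<open>Phi\<close>, so
    \<open>Phi i c\<close> is the unsigned tensor; scaling by \<open>e\<close> then produces the
    sign of \<open>fbas\<close>.\<close>
  define c where "c = (single (u, \<sigma>) e :: (mon \<times> nat set, 'k) chains)"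
  have cE: "c \<in> Ech i" using b by (auto simp: c_def Ech_iff e1 lookup_single when_def split: if_splits)
  have eS: "e \<in> carrier (mpoly_ring n)" by (simp add: e1)
  have one: "zc i (\<lambda>b. if b = (u, \<sigma>) then 1 else 0) = celt 1 (zsym (u, \<sigma>))"
  proof -
    have "zc i (\<lambda>b. if b = (u, \<sigma>) then 1 else 0) = (\<Sum>b'\<in>Bas i. if b' = (u, \<sigma>) then celt 1 (zsym (u, \<sigma>)) else 0)"
      unfolding zc_def by (intro sum.cong refl) auto
    then show ?thesis using b finite_Bas by simp
  qed
  have zZ: "celt 1 (zsym (u, \<sigma>)) \<in> Zc i" using zc_in_Zc[OF i0, of "\<lambda>b. if b = (u, \<sigma>) then 1 else 0"] one by simp
  have "Phi i c = Inr (pure_tensor (homol n I i) 1 (hcl i (celt 1 (zsym (u, \<sigma>)))))"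
  proof -
    have "hcl i (zc i (\<lambda>b. (-1) ^ sgn_exp i * ccoef c (m, b))) =
        lookup 1 m \<odot>\<^bsub>homol n I i\<^esub> hcl i (celt 1 (zsym (u, \<sigma>)))" for m
    proof (cases "m = 0")
      case True
      have "zc i (\<lambda>b. (-1) ^ sgn_exp i * ccoef c (m, b)) = celt 1 (zsym (u, \<sigma>))"
        unfolding one[symmetric]
        by (rule zc_cong) (simp add: True c_def e1 ccoef_def lookup_single when_def mult.assoc[symmetric] power_mult_distrib[symmetric])
      then show ?thesis using True V.smult_one[OF H.q_closed[OF zZ]] by (simp add: lookup_one)
    next
      case False
      have "zc i (\<lambda>b. (-1) ^ sgn_exp i * ccoef c (m, b)) = zc i (\<lambda>b. 0)"
        by (rule zc_cong) (use False in \<open>simp add: c_def e1 ccoef_def lookup_single when_def\<close>)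
      then show ?thesis using False V.smult_l_null[OF H.q_closed[OF zZ]] by (simp add: lookup_one H.q_0)
    qed
    then show ?thesis using i0 by (simp add: Phi_def pure_tensor_def)
  qed
  then have "fbas n t I u \<sigma> = e \<odot>\<^bsub>Fres n I i\<^esub> Phi i c"
    using True u unfolding fbas_def Let_def i[symmetric] by (simp add: admissible_adm e_def zcyc_Psi hcl_def Q_def)
  also have "\<dots> = Phi i (act e c)" by (rule P.q_smult[OF eS cE, symmetric])
  also have "act e c = fh u \<sigma>"
    using True by (simp add: c_def fh_def e_def power_mult_distrib[symmetric])
  finally show ?thesis .
qed

end

section \<open>The Koszul lifting in coordinates\<close>

lemma alpha_split: "finite \<sigma> \<Longrightarrow> \<tau> \<subseteq> \<sigma> \<Longrightarrow> alpha \<sigma> k = alpha \<tau> k + alpha (\<sigma> - \<tau>) k"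
proof -
  assume *: "finite \<sigma>" "\<tau> \<subseteq> \<sigma>"
  have "{s \<in> \<sigma>. s < k} = {s \<in> \<tau>. s < k} \<union> {s \<in> \<sigma> - \<tau>. s < k}" using * by auto
  then show ?thesis unfolding alpha_def using * finite_subset by (subst card_Un_disjoint[symmetric]) auto
qed

lemma gam_diff: "finite \<sigma> \<Longrightarrow> \<tau> \<subseteq> \<sigma> \<Longrightarrow> k \<in> \<tau> \<Longrightarrow> gam \<sigma> (\<tau> - {k}) = gam \<sigma> \<tau> + alpha \<sigma> k"
proof -
  assume *: "finite \<sigma>" "\<tau> \<subseteq> \<sigma>" "k \<in> \<tau>"
  then have "\<sigma> - (\<tau> - {k}) = insert k (\<sigma> - \<tau>)" by auto
  then show ?thesis using * by (simp add: gam_def)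
qed

lemma gam_self [simp]: "gam \<sigma> \<sigma> = 0" by (simp add: gam_def)

text \<open>Origin of the exponent (i-1)(i-2)/2: for empty \<tau> the number \<gamma> adds up the
  positions 0, 1, ..., i-2 of all elements of \<sigma>.\<close>

lemma gam_empty: "finite \<sigma> \<Longrightarrow> gam \<sigma> {} = sgn_exp (card \<sigma> + 1)"
proof (induction \<sigma> rule: finite_linorder_max_induct)
  case (insert b A)
  have "b \<notin> A" using insert by auto
  have "alpha (insert b A) k = alpha A k" if "k \<in> A" for k
    using insert.hyps(2) that \<open>b \<notin> A\<close> by (auto simp: alpha_insert)
  moreover have "alpha (insert b A) b = card A"
    unfolding alpha_def by (rule arg_cong[where f=card]) (use insert.hyps(2) in auto)
  ultimately have "gam (insert b A) {} = card A + gam A {}"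
    using insert.hyps(1) \<open>b \<notin> A\<close> by (simp add: gam_def)
  also have "\<dots> = card A + card A * (card A - 1) div 2" using insert.IH by (simp add: sgn_exp_def)
  also have "\<dots> = (card A + 1) * card A div 2" by (cases "card A") (auto simp: field_simps)
  finally show ?case using insert.hyps(1) \<open>b \<notin> A\<close> by (simp add: sgn_exp_def)
qed (simp add: gam_def sgn_exp_def)

lemma act_mono_cancel: "act (mono_poly w) c = 0 \<Longrightarrow> c = (0 :: ('b, 'k::field) chains)"
proof (rule poly_mapping_eqI)
  fix b assume "act (mono_poly w) c = 0"
  then have "mono_poly w * lookup c b = 0" by (metis lookup_act lookup_zero)
  moreover have "mono_poly w \<noteq> (0 :: 'k mpoly)" by (simp add: mono_poly_def flip: keys_eq_empty)
  ultimately show "lookup c b = lookup 0 b" by simp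
qed

context spread_ideal
begin

text \<open>The value u' at the empty set, an element of F_0, is a convention that makes g_0 the
  case j = 0 of the second sum in g_j.\<close>

definition sh :: "mon \<Rightarrow> nat set \<Rightarrow> (mon \<times> nat set, 'k::field) chains" where
  "sh u \<tau> = (if \<tau> = {} then single (0, {}) (mono_poly (u - xvar (maxv u)))
     else \<Sum>k\<in>\<tau>. act ((-1) ^ alpha \<tau> k * mono_poly (vv u k - xvar (maxv u))) (fh (uu u k) (\<tau> - {k})))"

text \<open>Up to sign the part of d(f(u;\<tau>)) that keeps the generator.\<close>

definition Xh :: "mon \<Rightarrow> nat set \<Rightarrow> (mon \<times> nat set, 'k::field) chains" where
  "Xh u \<tau> = (\<Sum>k\<in>\<tau>. act ((-1) ^ alpha \<tau> k * mono_poly (xvar k)) (fh u (\<tau> - {k})))"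

lemma mono_poly_maxv: "k \<in> keys w \<Longrightarrow> mono_poly (xvar k) * mono_poly (w - xvar k) = mono_poly w"
  by (simp add: mono_poly_mult xvar_add_diff)

text \<open>Every \<open>v\<^sub>k\<close> is divisible by the last variable of \<open>u\<close>,
  which can thus be taken out of the sum; for empty \<tau> this is the factorization of
  \<open>u\<close> into its last variable and u'.\<close>

lemma lin_dbas_fh_split:
  assumes "u \<in> G" "\<tau> \<subseteq> adm a u"
  shows "lin dbas (fh u \<tau>) = act (mono_poly (xvar (maxv u))) (sh u \<tau>) - (Xh u \<tau> :: (_, 'k::field) chains)"
proof (cases "\<tau> = {}")
  case True
  then show ?thesis using G_nz[OF assms(1)] maxv_in_keys
    by (simp add: fh_def dbas_def sh_def Xh_def mono_poly_maxv)
next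
  case False
  have "lin dbas (fh u \<tau>) = (\<Sum>k\<in>\<tau>. dterm u \<tau> k :: (_, 'k) chains)"
    by (rule lin_dbas_fh[OF assms False])
  also have "\<dots> = (\<Sum>k\<in>\<tau>. act (mono_poly (xvar (maxv u)))
       (act ((-1) ^ alpha \<tau> k * mono_poly (vv u k - xvar (maxv u))) (fh (uu u k) (\<tau> - {k})))
      - act ((-1) ^ alpha \<tau> k * mono_poly (xvar k)) (fh u (\<tau> - {k})))"
  proof (rule sum.cong[OF refl])
    fix k assume "k \<in> \<tau>"
    then have "mono_poly (xvar (maxv u)) * mono_poly (vv u k - xvar (maxv u)) = (mono_poly (vv u k) :: 'k mpoly)"
      using maxv_keys_vv[OF assms(1)] assms(2) by (intro mono_poly_maxv) auto
    then have *: "mono_poly (xvar (maxv u)) * ((-1) ^ alpha \<tau> k * mono_poly (vv u k - xvar (maxv u))) =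
        ((-1) ^ alpha \<tau> k * mono_poly (vv u k) :: 'k mpoly)" by (simp add: mult.left_commute)
    show "dterm u \<tau> k = act (mono_poly (xvar (maxv u)))
       (act ((-1) ^ alpha \<tau> k * mono_poly (vv u k - xvar (maxv u))) (fh (uu u k) (\<tau> - {k})))
      - (act ((-1) ^ alpha \<tau> k * mono_poly (xvar k)) (fh u (\<tau> - {k})) :: (_, 'k) chains)"
      unfolding dterm_def act_act * by (simp add: act_add act_minus act_act act_uminus_left act_uminus)
  qed
  also have "\<dots> = act (mono_poly (xvar (maxv u))) (sh u \<tau>) - Xh u \<tau>"
    using False by (simp add: sum_subtractf sh_def Xh_def act_sum)
  finally show ?thesis .
qed

text \<open>With the generator fixed, this is the vanishing of the squared Koszul
  differential.\<close>

lemma Xh_Xh: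
  assumes "finite \<tau>"
  shows "(\<Sum>k\<in>\<tau>. act ((-1) ^ alpha \<tau> k * mono_poly (xvar k)) (Xh u (\<tau> - {k}))) = (0 :: (_, 'k::field) chains)"
proof -
  let ?h = "\<lambda>k j. act ((-1) ^ alpha \<tau> k * (-1) ^ alpha (\<tau> - {k}) j) (act (mono_poly (xvar k + xvar j)) (fh u (\<tau> - {k} - {j}))) :: (_, 'k) chains"
  have "(\<Sum>k\<in>\<tau>. act ((-1) ^ alpha \<tau> k * mono_poly (xvar k)) (Xh u (\<tau> - {k}))) = (\<Sum>k\<in>\<tau>. \<Sum>j\<in>\<tau> - {k}. ?h k j)"
    unfolding Xh_def act_sum by (intro sum.cong refl) (simp add: act_act mono_poly_mult[symmetric] mult_ac)
  also have "\<dots> = 0"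
  proof (rule sum_antisymmetric[OF assms])
    fix j k assume jk: "j \<in> \<tau>" "k \<in> \<tau>" "j \<noteq> k"
    have "\<tau> - {j} - {k} = \<tau> - {k} - {j}" by auto
    then show "?h j k = - ?h k j"
      using sign_swap[OF assms jk(1,2), where 'a="'k mpoly"] jk(3) by (simp add: act_uminus_left add.commute)
  qed
  finally show ?thesis .
qed

lemma lin_dbas_lin_dbas_fh: "u \<in> G \<Longrightarrow> lin dbas (lin dbas (fh u \<tau>)) = (0 :: (_, 'k::field) chains)"
proof (cases "\<tau> \<subseteq> adm a u")
  case True
  assume "u \<in> G"
  then have "(u, \<tau>) \<in> Bas (card \<tau> + 1)" using True by (simp add: Bas_def)
  then show ?thesis using True lin_dbas_dbas[of "(u, \<tau>)"] by (simp add: fh_def)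
qed (simp add: fh_def)

text \<open>Both sides agree after multiplication by \<open>x\<^bsub>max(u)\<^esub>\<close>, by \<open>d\<^sup>2 = 0\<close>.\<close>

lemma lin_dbas_sh:
  assumes "u \<in> G" "\<tau> \<subseteq> adm a u" "\<tau> \<noteq> {}"
  shows "lin dbas (sh u \<tau>) = (\<Sum>k\<in>\<tau>. act ((-1) ^ alpha \<tau> k * mono_poly (xvar k)) (sh u (\<tau> - {k})) :: (_, 'k::field) chains)"
    (is "?l = ?r")
proof -
  let ?N = "mono_poly (xvar (maxv u)) :: 'k mpoly"
  have fin: "finite \<tau>" by (rule finite_subset_adm[OF assms(2)])
  have lm: "lin dbas (c - c') = lin dbas c - (lin dbas c' :: (_, 'k) chains)" for c c'
    using lin_add[of dbas "c - c'" c'] by (simp add: algebra_simps)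
  have "0 = lin dbas (lin dbas (fh u \<tau>) :: (_, 'k) chains)" using lin_dbas_lin_dbas_fh[OF assms(1)] by simp
  also have "\<dots> = act ?N ?l - lin dbas (Xh u \<tau>)"
    unfolding lin_dbas_fh_split[OF assms(1,2)] lm lin_act ..
  also have "lin dbas (Xh u \<tau>) = (\<Sum>k\<in>\<tau>. act ((-1) ^ alpha \<tau> k * mono_poly (xvar k))
      (act ?N (sh u (\<tau> - {k})) - Xh u (\<tau> - {k})))"
    unfolding Xh_def[of u \<tau>] lin_sum lin_act
  proof (rule sum.cong[OF refl])
    fix k
    have "\<tau> - {k} \<subseteq> adm a u" using assms(2) by auto
    then show "act ((-1) ^ alpha \<tau> k * mono_poly (xvar k)) (lin dbas (fh u (\<tau> - {k}))) =
        act ((-1) ^ alpha \<tau> k * mono_poly (xvar k)) (act ?N (sh u (\<tau> - {k})) - Xh u (\<tau> - {k}))"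
      by (simp only: lin_dbas_fh_split[OF assms(1)])
  qed
  also have "\<dots> = act ?N ?r"
    unfolding act_minus sum_subtractf Xh_Xh[OF fin] act_sum by (simp add: act_act mult_ac)
  finally have "act ?N (?l - ?r) = 0" by (simp add: act_minus)
  then have "?l - ?r = 0" by (rule act_mono_cancel)
  then show ?thesis by simp
qed

text \<open>\<open>gh u \<sigma> j \<rho>\<close> is the coefficient of \<open>e\<^sub>\<rho>\<close> in \<open>g\<^sub>j\<close>; the two sums of \<open>g\<^sub>j\<close> contribute for
  \<open>max(u) \<notin> \<rho>\<close> and \<open>max(u) \<in> \<rho>\<close> respectively, the value \<open>j = 0\<close> included.\<close>

definition Ah :: "mon \<Rightarrow> nat set \<Rightarrow> nat \<Rightarrow> nat set \<Rightarrow> (mon \<times> nat set, 'k::field) chains" where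
  "Ah u \<sigma> j \<rho> = (if \<rho> \<subseteq> \<sigma> \<and> card \<rho> + j = card \<sigma> + 1
     then act ((-1) ^ card \<rho> * (-1) ^ gam \<sigma> (\<sigma> - \<rho>)) (fh u (\<sigma> - \<rho>)) else 0)"

definition Bh :: "mon \<Rightarrow> nat set \<Rightarrow> nat \<Rightarrow> nat set \<Rightarrow> (mon \<times> nat set, 'k::field) chains" where
  "Bh u \<sigma> j \<rho> = (if \<rho> \<subseteq> \<sigma> \<and> card \<rho> + j = card \<sigma>
     then act ((-1) ^ gam \<sigma> (\<sigma> - \<rho>)) (sh u (\<sigma> - \<rho>)) else 0)"

definition gh :: "mon \<Rightarrow> nat set \<Rightarrow> nat \<Rightarrow> nat set \<Rightarrow> (mon \<times> nat set, 'k::field) chains" where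
  "gh u \<sigma> j \<rho> = (if maxv u \<in> \<rho> then Bh u \<sigma> j (\<rho> - {maxv u}) else Ah u \<sigma> j \<rho>)"

text \<open>As \<alpha>(\<sigma>;k) splits into the contributions of \<rho> and of its complement,
  \<alpha>(\<rho>;k) occurs twice and drops out.\<close>

lemma gam_sign:
  assumes "finite \<sigma>" "\<rho> \<subseteq> \<sigma>" "k \<in> \<sigma> - \<rho>"
  shows "(-1) ^ alpha \<rho> k * (-1) ^ gam \<sigma> (\<sigma> - insert k \<rho>) = ((-1) ^ gam \<sigma> (\<sigma> - \<rho>) * (-1) ^ alpha (\<sigma> - \<rho>) k :: 'a::comm_ring_1)"
proof -
  have "\<sigma> - insert k \<rho> = \<sigma> - \<rho> - {k}" by auto
  then have "gam \<sigma> (\<sigma> - insert k \<rho>) = gam \<sigma> (\<sigma> - \<rho>) + alpha \<sigma> k"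
    using gam_diff[OF assms(1), of "\<sigma> - \<rho>" k] assms by auto
  moreover have "alpha \<sigma> k = alpha \<rho> k + alpha (\<sigma> - \<rho>) k" using alpha_split assms by auto
  ultimately show ?thesis by (simp add: minus_one_power_iff)
qed

lemma card_insert_sub: "finite \<sigma> \<Longrightarrow> insert k \<rho> \<subseteq> \<sigma> \<Longrightarrow> k \<notin> \<rho> \<Longrightarrow> card (insert k \<rho>) = Suc (card \<rho>)"
  by (meson card_insert_disjoint finite_insert finite_subset)

text \<open>Compares the coefficients at \<rho> in d(g_{j+1}) and in the boundary of g_j. If max(u)
  is in \<rho>, only the second sums contribute and the claim is \<open>lin_dbas_sh\<close>;
  otherwise one term from the second sum of g_j joins the first sum, and the claim is
  \<open>lin_dbas_fh_split\<close>. There is no bound on \<open>j\<close>: for j = |\<sigma>| and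
  empty \<rho> the boundary of g_{i-1} is identified with d(f(u;\<sigma>)).\<close>

lemma lin_dbas_gh:
  assumes u: "u \<in> G" "\<sigma> \<subseteq> adm a u"
  shows "lin dbas (gh u \<sigma> (j + 1) \<rho>) =
    (\<Sum>k\<in>{1..n} - \<rho>. act ((-1) ^ alpha (insert k \<rho>) k * mono_poly (xvar k)) (gh u \<sigma> j (insert k \<rho>)) :: (_, 'k::field) chains)"
proof -
  define N where "N = maxv u"
  have fin: "finite \<sigma>" by (rule finite_subset_adm[OF u(2)])
  have s1: "\<sigma> \<subseteq> {1..n}" "\<sigma> \<subseteq> {..<N}" using adm_le_n[OF u(1)] u(2) by (auto simp: N_def)
  have N: "N \<in> {1..n}" "N \<notin> \<sigma>" using maxv_le_n[OF u(1)] s1 by (auto simp: N_def)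
  show ?thesis
  proof (cases "N \<in> \<rho>")
    case True
    define \<rho>' where "\<rho>' = \<rho> - {N}"
    have \<rho>: "\<rho> = insert N \<rho>'" "N \<notin> \<rho>'" using True by (auto simp: \<rho>'_def)
    have gk: "gh u \<sigma> j (insert k \<rho>) = (Bh u \<sigma> j (insert k \<rho>') :: (_, 'k) chains)" if "k \<in> {1..n} - \<rho>" for k
    proof -
      have "insert k \<rho> - {N} = insert k \<rho>'" using that True by (auto simp: \<rho>'_def)
      then show ?thesis using True by (simp add: gh_def N_def)
    qed
    show ?thesis
    proof (cases "\<rho>' \<subseteq> \<sigma> \<and> card \<rho>' + (j + 1) = card \<sigma>")
      case ok: True
      define \<tau> where "\<tau> = \<sigma> - \<rho>'"
      have \<tau>: "\<tau> \<subseteq> adm a u" "\<tau> \<noteq> {}" using u(2) ok by (auto simp: \<tau>_def)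
      have "lin dbas (gh u \<sigma> (j + 1) \<rho>) = act ((-1) ^ gam \<sigma> \<tau>) (lin dbas (sh u \<tau>) :: (_, 'k) chains)"
        using True ok by (simp add: gh_def N_def[symmetric] Bh_def \<rho>'_def[symmetric] \<tau>_def lin_act)
      also have "\<dots> = (\<Sum>k\<in>\<tau>. act ((-1) ^ gam \<sigma> \<tau> * (-1) ^ alpha \<tau> k * mono_poly (xvar k)) (sh u (\<tau> - {k})))"
        unfolding lin_dbas_sh[OF u(1) \<tau>] act_sum act_act by (simp add: mult.assoc)
      also have "\<dots> = (\<Sum>k\<in>{1..n} - \<rho>. act ((-1) ^ alpha (insert k \<rho>) k * mono_poly (xvar k)) (gh u \<sigma> j (insert k \<rho>)))"
      proof (rule sum.mono_neutral_cong_left)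
        show "\<tau> \<subseteq> {1..n} - \<rho>" using s1 N by (auto simp: \<tau>_def \<rho>)
        show "\<forall>k\<in>{1..n} - \<rho> - \<tau>. act ((-1) ^ alpha (insert k \<rho>) k * mono_poly (xvar k)) (gh u \<sigma> j (insert k \<rho>)) = (0 :: (_, 'k) chains)"
        proof
          fix k assume k: "k \<in> {1..n} - \<rho> - \<tau>"
          then have "\<not> insert k \<rho>' \<subseteq> \<sigma>" by (auto simp: \<tau>_def \<rho>)
          then have "gh u \<sigma> j (insert k \<rho>) = (0 :: (_, 'k) chains)" using k gk[of k] unfolding Bh_def by auto
          then show "act ((-1) ^ alpha (insert k \<rho>) k * mono_poly (xvar k)) (gh u \<sigma> j (insert k \<rho>)) = (0 :: (_, 'k) chains)"
            by simp
        qed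
        fix k assume k: "k \<in> \<tau>"
        then have k': "k \<in> {1..n} - \<rho>" "k \<in> \<sigma> - \<rho>'" "k < N" using s1 N by (auto simp: \<tau>_def \<rho>)
        have "insert k \<rho>' \<subseteq> \<sigma>" "card (insert k \<rho>') + j = card \<sigma>"
          using ok k' card_insert_sub[OF fin, of k \<rho>'] by auto
        then have "gh u \<sigma> j (insert k \<rho>) = act ((-1) ^ gam \<sigma> (\<sigma> - insert k \<rho>')) (sh u (\<sigma> - insert k \<rho>') :: (_, 'k) chains)"
          by (simp add: gk[OF k'(1)] Bh_def)
        moreover have "\<sigma> - insert k \<rho>' = \<tau> - {k}" by (auto simp: \<tau>_def)
        \<comment> \<open>max(u) lies in \<rho> but exceeds \<open>k\<close>, so it is not
          counted.\<close>
        moreover have "alpha (insert k \<rho>) k = alpha \<rho>' k"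
          unfolding alpha_def using k' by (intro arg_cong[where f=card]) (auto simp: \<rho>)
        moreover have "(-1) ^ alpha \<rho>' k * (-1) ^ gam \<sigma> (\<tau> - {k}) = ((-1) ^ gam \<sigma> \<tau> * (-1) ^ alpha \<tau> k :: 'k mpoly)"
          using gam_sign[OF fin _ k'(2), where 'a="'k mpoly"] ok calculation(2) by (simp add: \<tau>_def)
        ultimately show "act ((-1) ^ gam \<sigma> \<tau> * (-1) ^ alpha \<tau> k * mono_poly (xvar k)) (sh u (\<tau> - {k})) =
            act ((-1) ^ alpha (insert k \<rho>) k * mono_poly (xvar k)) (gh u \<sigma> j (insert k \<rho>) :: (_, 'k) chains)"
          by (simp add: act_act mult_ac)
      qed simp
      finally show ?thesis .
    next
      case no: False
      have "Bh u \<sigma> j (insert k \<rho>') = (0 :: (_, 'k) chains)" if "k \<in> {1..n} - \<rho>" for k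
        using no that card_insert_sub[OF fin, of k \<rho>'] by (auto simp: Bh_def \<rho>)
      then have "(\<Sum>k\<in>{1..n} - \<rho>. act ((-1) ^ alpha (insert k \<rho>) k * mono_poly (xvar k)) (gh u \<sigma> j (insert k \<rho>)) :: (_, 'k) chains) = 0"
        by (intro sum.neutral) (simp add: gk)
      moreover have "gh u \<sigma> (j + 1) \<rho> = (0 :: (_, 'k) chains)"
        using True no by (auto simp: gh_def N_def[symmetric] Bh_def \<rho>'_def[symmetric])
      ultimately show ?thesis by simp
    qed
  next
    case False
    have split: "(\<Sum>k\<in>{1..n} - \<rho>. act ((-1) ^ alpha (insert k \<rho>) k * mono_poly (xvar k)) (gh u \<sigma> j (insert k \<rho>)) :: (_, 'k) chains)
      = act ((-1) ^ alpha (insert N \<rho>) N * mono_poly (xvar N)) (Bh u \<sigma> j \<rho>)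
       + (\<Sum>k\<in>{1..n} - \<rho> - {N}. act ((-1) ^ alpha (insert k \<rho>) k * mono_poly (xvar k)) (Ah u \<sigma> j (insert k \<rho>)))"
    proof -
      have "insert N \<rho> - {N} = \<rho>" using False by auto
      then have "gh u \<sigma> j (insert N \<rho>) = (Bh u \<sigma> j \<rho> :: (_, 'k) chains)" by (simp add: gh_def N_def)
      moreover have "gh u \<sigma> j (insert k \<rho>) = (Ah u \<sigma> j (insert k \<rho>) :: (_, 'k) chains)" if "k \<in> {1..n} - \<rho> - {N}" for k
        using that False by (auto simp: gh_def N_def)
      moreover have "N \<in> {1..n} - \<rho>" using N False by simp
      ultimately show ?thesis by (subst sum.remove[of _ N]) (auto intro!: sum.cong)
    qed
    show ?thesis
    proof (cases "\<rho> \<subseteq> \<sigma> \<and> card \<rho> + (j + 1) = card \<sigma> + 1")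
      case ok: True
      define \<tau> where "\<tau> = \<sigma> - \<rho>"
      have \<tau>: "\<tau> \<subseteq> adm a u" using u(2) by (auto simp: \<tau>_def)
      \<comment> \<open>All of \<rho> lies below max(u), so removing max(u) has the sign
        (-1)^|\<rho>|, which is the factor (-1)^{i-j-1} of the first sum in g_{j+1}.\<close>
      have aN: "alpha (insert N \<rho>) N = card \<rho>"
        unfolding alpha_def by (rule arg_cong[where f=card]) (use ok s1 in auto)
      have B: "Bh u \<sigma> j \<rho> = (act ((-1) ^ gam \<sigma> \<tau>) (sh u \<tau>) :: (_, 'k) chains)" using ok by (simp add: Bh_def \<tau>_def)
      have "(\<Sum>k\<in>{1..n} - \<rho> - {N}. act ((-1) ^ alpha (insert k \<rho>) k * mono_poly (xvar k)) (Ah u \<sigma> j (insert k \<rho>))) =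
        (\<Sum>k\<in>\<tau>. - act ((-1) ^ card \<rho> * (-1) ^ gam \<sigma> \<tau>) (act ((-1) ^ alpha \<tau> k * mono_poly (xvar k)) (fh u (\<tau> - {k}))) :: (_, 'k) chains)"
      proof (rule sum.mono_neutral_cong_right)
        show "\<tau> \<subseteq> {1..n} - \<rho> - {N}" using s1 N by (auto simp: \<tau>_def)
        show "\<forall>k\<in>{1..n} - \<rho> - {N} - \<tau>. act ((-1) ^ alpha (insert k \<rho>) k * mono_poly (xvar k)) (Ah u \<sigma> j (insert k \<rho>)) = (0 :: (_, 'k) chains)"
          by (auto simp: Ah_def \<tau>_def)
        fix k assume k: "k \<in> \<tau>"
        then have k': "k \<in> \<sigma> - \<rho>" by (auto simp: \<tau>_def)
        have c: "card (insert k \<rho>) = Suc (card \<rho>)" using ok k' card_insert_sub[OF fin, of k \<rho>] by auto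
        have "insert k \<rho> \<subseteq> \<sigma>" "card (insert k \<rho>) + j = card \<sigma> + 1" using ok k' c by auto
        then have "Ah u \<sigma> j (insert k \<rho>) = act ((-1) ^ card (insert k \<rho>) * (-1) ^ gam \<sigma> (\<sigma> - insert k \<rho>)) (fh u (\<sigma> - insert k \<rho>) :: (_, 'k) chains)"
          by (simp add: Ah_def)
        moreover have "\<sigma> - insert k \<rho> = \<tau> - {k}" by (auto simp: \<tau>_def)
        moreover have "alpha (insert k \<rho>) k = alpha \<rho> k" using k' by (simp add: alpha_insert)
        moreover have "(-1) ^ alpha \<rho> k * (-1) ^ gam \<sigma> (\<tau> - {k}) = ((-1) ^ gam \<sigma> \<tau> * (-1) ^ alpha \<tau> k :: 'k mpoly)"
          using gam_sign[OF fin _ k', where 'a="'k mpoly"] ok calculation(2) by (simp add: \<tau>_def)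
        ultimately have "act ((-1) ^ alpha (insert k \<rho>) k * mono_poly (xvar k)) (Ah u \<sigma> j (insert k \<rho>)) =
            act (((-1) ^ alpha \<rho> k * (-1) ^ gam \<sigma> (\<tau> - {k})) * (- ((-1) ^ card \<rho>) * mono_poly (xvar k))) (fh u (\<tau> - {k}) :: (_, 'k) chains)"
          by (simp add: act_act c mult_ac)
        also have "\<dots> = - act ((-1) ^ card \<rho> * (-1) ^ gam \<sigma> \<tau>) (act ((-1) ^ alpha \<tau> k * mono_poly (xvar k)) (fh u (\<tau> - {k})))"
          unfolding \<open>(-1) ^ alpha \<rho> k * (-1) ^ gam \<sigma> (\<tau> - {k}) = (-1) ^ gam \<sigma> \<tau> * (-1) ^ alpha \<tau> k\<close>
          by (simp add: act_act mult_ac flip: act_uminus_left)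
        finally show "act ((-1) ^ alpha (insert k \<rho>) k * mono_poly (xvar k)) (Ah u \<sigma> j (insert k \<rho>)) =
            - act ((-1) ^ card \<rho> * (-1) ^ gam \<sigma> \<tau>) (act ((-1) ^ alpha \<tau> k * mono_poly (xvar k)) (fh u (\<tau> - {k}) :: (_, 'k) chains))" .
      qed simp
      also have "\<dots> = - act ((-1) ^ card \<rho> * (-1) ^ gam \<sigma> \<tau>) (Xh u \<tau>)"
        by (simp add: Xh_def act_sum sum_negf)
      finally have A: "(\<Sum>k\<in>{1..n} - \<rho> - {N}. act ((-1) ^ alpha (insert k \<rho>) k * mono_poly (xvar k)) (Ah u \<sigma> j (insert k \<rho>))) =
        - act ((-1) ^ card \<rho> * (-1) ^ gam \<sigma> \<tau>) (Xh u \<tau> :: (_, 'k) chains)" .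
      have "lin dbas (gh u \<sigma> (j + 1) \<rho>) = act ((-1) ^ card \<rho> * (-1) ^ gam \<sigma> \<tau>) (lin dbas (fh u \<tau>) :: (_, 'k) chains)"
        using False ok by (simp add: gh_def N_def[symmetric] Ah_def \<tau>_def lin_act)
      also have "\<dots> = act ((-1) ^ card \<rho> * (-1) ^ gam \<sigma> \<tau>) (act (mono_poly (xvar N)) (sh u \<tau>))
          - act ((-1) ^ card \<rho> * (-1) ^ gam \<sigma> \<tau>) (Xh u \<tau>)"
        unfolding lin_dbas_fh_split[OF u(1) \<tau>] N_def act_minus ..
      finally show ?thesis unfolding split A B aN by (simp add: act_act mult_ac)
    next
      case no: False
      have "Ah u \<sigma> j (insert k \<rho>) = (0 :: (_, 'k) chains)" if "k \<in> {1..n} - \<rho> - {N}" for k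
        using no that card_insert_sub[OF fin, of k \<rho>] by (auto simp: Ah_def)
      then have "(\<Sum>k\<in>{1..n} - \<rho> - {N}. act ((-1) ^ alpha (insert k \<rho>) k * mono_poly (xvar k)) (Ah u \<sigma> j (insert k \<rho>)) :: (_, 'k) chains) = 0"
        by (intro sum.neutral) simp
      moreover have "Bh u \<sigma> j \<rho> = (0 :: (_, 'k) chains)" using no by (auto simp: Bh_def)
      moreover have "gh u \<sigma> (j + 1) \<rho> = (0 :: (_, 'k) chains)" using False no by (auto simp: gh_def N_def[symmetric] Ah_def)
      ultimately show ?thesis unfolding split by simp
    qed
  qed
qed

end

section \<open>The elements g_j and the maps d_i in coordinates\<close>

context spread_resolution
begin

interpretation P: module_cover "mpoly_ring n" "Ech i" act "Phi i" "Fres n I i" for i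
  by (rule Phi_cover)

interpretation Fm: module "mpoly_ring n" "Fres n I i" for i
  by (rule P.cover_module)

lemma sign_carrier: "((-1) ^ k :: 'k mpoly) \<in> carrier (mpoly_ring n)"
  using sign_in_mons[of k "1 :: 'k mpoly" n] by simp

lemma fh_Ech: "u \<in> G \<Longrightarrow> card \<sigma> + 1 = i \<Longrightarrow> fh u \<sigma> \<in> Ech i"
  by (auto simp: fh_def Ech_iff Bas_def lookup_single when_def)

lemma single_Ech: "b \<in> Bas i \<Longrightarrow> keys p \<subseteq> mons n \<Longrightarrow> single b p \<in> Ech i"
  by (auto simp: Ech_iff lookup_single when_def)

lemma mono_carrier: "w \<in> mons n \<Longrightarrow> (-1) ^ k * mono_poly w \<in> carrier (mpoly_ring n :: ('k mpoly, 'k mpoly) module)"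
  by (simp add: sign_in_mons)

lemma sh_Ech:
  assumes u: "u \<in> G" "\<tau> \<subseteq> adm a u" and j: "card \<tau> = j"
  shows "sh u \<tau> \<in> Ech j"
proof (cases "\<tau> = {}")
  case True
  then show ?thesis using j G_mons[OF u(1)] by (auto simp: sh_def Bas_def intro!: single_Ech diff_in_mons)
next
  case False
  have "act ((-1) ^ alpha \<tau> k * mono_poly (vv u k - xvar (maxv u))) (fh (uu u k) (\<tau> - {k})) \<in> Ech j" if k: "k \<in> \<tau>" for k
  proof (rule P.s_closed[OF mono_carrier fh_Ech])
    show "vv u k - xvar (maxv u) \<in> mons n" "uu u k \<in> G" using vv_mons diff_in_mons uu_G u k by auto
    show "card (\<tau> - {k}) + 1 = j" using j k finite_subset_adm[OF u(2)] card_Suc_Diff1 by fastforce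
  qed
  then show ?thesis using False by (simp add: sh_def P.A_sum)
qed

lemma gh_Ech:
  assumes u: "u \<in> G" "\<sigma> \<subseteq> adm a u"
  shows "gh u \<sigma> j \<rho> \<in> Ech j"
proof -
  have fin: "finite \<sigma>" by (rule finite_subset_adm[OF u(2)])
  have cd: "card (\<sigma> - \<rho>) + card \<rho> = card \<sigma>" if "\<rho> \<subseteq> \<sigma>" for \<rho>
    using that fin card_mono[OF fin that] finite_subset[OF that fin] by (simp add: card_Diff_subset)
  have "Ah u \<sigma> j \<rho> \<in> Ech j" for \<rho>
  proof (cases "\<rho> \<subseteq> \<sigma> \<and> card \<rho> + j = card \<sigma> + 1")
    case True
    then have "fh u (\<sigma> - \<rho>) \<in> Ech j" using cd[of \<rho>] by (intro fh_Ech u) auto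
    then have "act ((-1) ^ card \<rho>) (act ((-1) ^ gam \<sigma> (\<sigma> - \<rho>)) (fh u (\<sigma> - \<rho>))) \<in> Ech j"
      by (intro P.s_closed sign_carrier)
    then show ?thesis using True by (simp add: Ah_def act_act)
  qed (auto simp: Ah_def P.A_0)
  moreover have "Bh u \<sigma> j \<rho> \<in> Ech j" for \<rho>
  proof (cases "\<rho> \<subseteq> \<sigma> \<and> card \<rho> + j = card \<sigma>")
    case True
    then have "sh u (\<sigma> - \<rho>) \<in> Ech j" using cd[of \<rho>] u by (intro sh_Ech) auto
    then show ?thesis using True by (simp add: Bh_def P.s_closed sign_carrier del: mpoly_ring_simps)
  qed (auto simp: Bh_def P.A_0)
  ultimately show ?thesis by (simp add: gh_def)
qed

lemma uk_uu: "uk n I u k = uu u k" and vk_vv: "vk n I u k = vv u k"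
  by (simp_all add: uk_def vk_def decomp_def min_gens_G uu_def vv_def gg_def)

text \<open>Nonemptiness matters: \<open>selt\<close> of the empty set is an empty sum, whereas
  \<open>sh u {}\<close> is u'.\<close>

lemma selt_Phi:
  assumes u: "u \<in> G" "\<tau> \<subseteq> adm a u" "\<tau> \<noteq> {}"
  shows "selt n t I u \<tau> = Phi (card \<tau>) (sh u \<tau>)"
proof -
  have fin: "finite \<tau>" by (rule finite_subset_adm[OF u(2)])
  have c: "card (\<tau> - {k}) + 1 = card \<tau>" if "k \<in> \<tau>" for k
    using that fin card_Suc_Diff1 by fastforce
  let ?s = "\<lambda>k. (-1) ^ alpha \<tau> k * mono_poly (vv u k - xvar (maxv u)) :: 'k mpoly"
  have sS: "?s k \<in> carrier (mpoly_ring n)" if "k \<in> \<tau>" for k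
    using vv_mons[OF u(1)] u(2) that by (intro mono_carrier diff_in_mons) auto
  have fE: "fh (uu u k) (\<tau> - {k}) \<in> Ech (card \<tau>)" if "k \<in> \<tau>" for k
    using that u c by (intro fh_Ech uu_G) auto
  have eq: "?s k \<odot>\<^bsub>Fres n I (card \<tau>)\<^esub> fbas n t I (uu u k) (\<tau> - {k}) = Phi (card \<tau>) (act (?s k) (fh (uu u k) (\<tau> - {k})))" if k: "k \<in> \<tau>" for k
  proof -
    have "uu u k \<in> G" using uu_G u k by auto
    then have "fbas n t I (uu u k) (\<tau> - {k}) = Phi (card \<tau>) (fh (uu u k) (\<tau> - {k}))"
      using c[OF k] by (intro fbas_Phi) auto
    then show ?thesis using P.q_smult[OF sS[OF k] fE[OF k]] by simp
  qed
  have "selt n t I u \<tau> = (\<Oplus>\<^bsub>Fres n I (card \<tau>)\<^esub>k\<in>\<tau>. Phi (card \<tau>) (act (?s k) (fh (uu u k) (\<tau> - {k}))))"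
    unfolding selt_def uk_uu vk_vv
    by (rule Fm.finsum_cong') (use eq P.q_closed[OF P.s_closed[OF sS fE]] in auto)
  also have "\<dots> = Phi (card \<tau>) (\<Sum>k\<in>\<tau>. act (?s k) (fh (uu u k) (\<tau> - {k})))"
    by (rule P.q_sum[OF fin P.s_closed[OF sS fE], symmetric])
  finally show ?thesis using u(3) by (simp add: sh_def)
qed

lemma koszul_sum_Phi:
  assumes T: "finite T" "\<And>\<tau>. \<tau> \<in> T \<Longrightarrow> h \<tau> \<in> Ech j" "\<And>\<tau>. \<tau> \<in> T \<Longrightarrow> y \<tau> \<subseteq> {1..n} \<and> card (y \<tau>) = l"
    and s: "\<And>\<tau>. s \<tau> \<in> carrier (mpoly_ring n)"
  shows "(\<Oplus>\<^bsub>koszul n (Fres n I j) l\<^esub>\<tau>\<in>T. s \<tau> \<odot>\<^bsub>koszul n (Fres n I j) l\<^esub> tensor_e (Fres n I j) (Phi j (h \<tau>)) (y \<tau>)) \<rho>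
    = Phi j (\<Sum>\<tau>\<in>T. act (s \<tau>) (if \<rho> = y \<tau> then h \<tau> else 0))"
proof -
  interpret K: module "mpoly_ring n" "koszul n (Fres n I j) l" by (rule koszul_module[OF P.cover_module])
  have hE: "(if \<rho> = y \<tau> then h \<tau> else 0) \<in> Ech j" if "\<tau> \<in> T" for \<tau> \<rho> using T(2)[OF that] P.A_0 by simp
  have te: "tensor_e (Fres n I j) (Phi j (h \<tau>)) (y \<tau>) \<rho> = Phi j (if \<rho> = y \<tau> then h \<tau> else 0)" for \<tau> \<rho>
    by (simp add: tensor_e_def P.q_0)
  have tc: "tensor_e (Fres n I j) (Phi j (h \<tau>)) (y \<tau>) \<in> carrier (koszul n (Fres n I j) l)" if "\<tau> \<in> T" for \<tau>
    using P.q_closed[OF T(2)[OF that]] T(3)[OF that] by (simp add: tensor_e_def)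
  have "(\<Oplus>\<^bsub>koszul n (Fres n I j) l\<^esub>\<tau>\<in>T. s \<tau> \<odot>\<^bsub>koszul n (Fres n I j) l\<^esub> tensor_e (Fres n I j) (Phi j (h \<tau>)) (y \<tau>)) \<rho>
     = (\<Oplus>\<^bsub>Fres n I j\<^esub>\<tau>\<in>T. (s \<tau> \<odot>\<^bsub>koszul n (Fres n I j) l\<^esub> tensor_e (Fres n I j) (Phi j (h \<tau>)) (y \<tau>)) \<rho>)"
    by (subst koszul_finsum[OF P.cover_module T(1) K.smult_closed[OF s tc]]) simp_all
  also have "\<dots> = (\<Oplus>\<^bsub>Fres n I j\<^esub>\<tau>\<in>T. Phi j (act (s \<tau>) (if \<rho> = y \<tau> then h \<tau> else 0)))"
    using P.q_smult[OF s hE] P.q_closed[OF P.s_closed[OF s hE]]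
    by (intro Fm.finsum_cong') (auto simp: te simp del: mpoly_ring_simps)
  also have "\<dots> = Phi j (\<Sum>\<tau>\<in>T. act (s \<tau>) (if \<rho> = y \<tau> then h \<tau> else 0))"
    by (rule P.q_sum[OF T(1) P.s_closed[OF s hE], symmetric])
  finally show ?thesis .
qed

text \<open>Each \<rho> comes from at most one \<tau>, the complement in \<sigma> of \<rho> without
  max(u). For j = 0 the sign is supplied by \<open>gam_empty\<close>.\<close>

lemma gelt_Phi:
  assumes u: "u \<in> G" "\<sigma> \<subseteq> adm a u" and j: "j \<le> card \<sigma>"
  shows "gelt n t I u \<sigma> j \<rho> = Phi j (gh u \<sigma> j \<rho>)"
proof -
  define N where "N = maxv u"
  define i where "i = card \<sigma> + 1"
  have fin: "finite \<sigma>" by (rule finite_subset_adm[OF u(2)])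
  have s1: "\<sigma> \<subseteq> {1..n}" "\<sigma> \<subseteq> {..<N}" using adm_le_n[OF u(1)] u(2) by (auto simp: N_def)
  have N: "N \<in> {1..n}" "N \<notin> \<sigma>" using maxv_le_n[OF u(1)] s1 by (auto simp: N_def)
  have cd: "card (\<sigma> - \<tau>) = card \<sigma> - card \<tau>" "card \<tau> \<le> card \<sigma>" "finite \<tau>" if "\<tau> \<subseteq> \<sigma>" for \<tau>
    using that fin card_mono[OF fin that] finite_subset[OF that fin] by (simp_all add: card_Diff_subset)
  show ?thesis
  proof (cases "j = 0")
    case True
    have eqs: "(\<rho> - {N} \<subseteq> \<sigma> \<and> card (\<rho> - {N}) = card \<sigma>) \<longleftrightarrow> \<rho> = insert N \<sigma>" if "N \<in> \<rho>"
      using that card_subset_eq[OF fin, of "\<rho> - {N}"] N fin by auto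
    have noA: "\<not> (\<rho> \<subseteq> \<sigma> \<and> card \<rho> = card \<sigma> + 1)" using cd(2)[of \<rho>] by auto
    have "lookup (gh u \<sigma> 0 \<rho>) (0, {}) = ((-1) ^ sgn_exp i * (if \<rho> = insert N \<sigma> then mono_poly (u - xvar N) else 0) :: 'k mpoly)"
      using eqs noA N gam_empty[OF fin] by (auto simp: gh_def Ah_def Bh_def N_def[symmetric] sh_def i_def)
    then show ?thesis using True
      unfolding gelt_def Let_def i_def[symmetric] N_def[symmetric] by (simp add: Phi_def tensor_e_def)
  next
    case False
    let ?F = "Fres n I j"
    let ?K = "koszul n ?F (i - j)"
    let ?T1 = "{\<tau>. \<tau> \<subseteq> \<sigma> \<and> card \<tau> = j - 1}"
    let ?T2 = "{\<tau>. \<tau> \<subseteq> \<sigma> \<and> card \<tau> = j}"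
    interpret K: module "mpoly_ring n" ?K by (rule koszul_module[OF P.cover_module])
    have fT: "finite ?T1" "finite ?T2" using fin by auto
    have j': "j \<noteq> 0" "j \<le> card \<sigma>" "i = Suc (card \<sigma>)" using False j by (auto simp: i_def)
    have f1: "fbas n t I u \<tau> = Phi j (fh u \<tau>) \<and> fh u \<tau> \<in> Ech j" if "\<tau> \<in> ?T1" for \<tau>
      using that u(1) j' by (intro conjI fbas_Phi fh_Ech) auto
    have f2: "selt n t I u \<tau> = Phi j (sh u \<tau>) \<and> sh u \<tau> \<in> Ech j" if "\<tau> \<in> ?T2" for \<tau>
    proof -
      have "\<tau> \<subseteq> adm a u" "\<tau> \<noteq> {}" "card \<tau> = j" using that u j' by auto
      then show ?thesis using selt_Phi[OF u(1), of \<tau>] sh_Ech[OF u(1), of \<tau>] by simp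
    qed
    have y1: "\<sigma> - \<tau> \<subseteq> {1..n} \<and> card (\<sigma> - \<tau>) = i - j" if "\<tau> \<in> ?T1" for \<tau>
      using that s1 j' cd(1)[of \<tau>] by auto
    have y2: "insert N (\<sigma> - \<tau>) \<subseteq> {1..n} \<and> card (insert N (\<sigma> - \<tau>)) = i - j" if "\<tau> \<in> ?T2" for \<tau>
      using that s1 j' cd(1)[of \<tau>] N fin by auto
    let ?t1 = "\<lambda>\<tau>. (-1) ^ gam \<sigma> \<tau> \<odot>\<^bsub>?K\<^esub> tensor_e ?F (fbas n t I u \<tau>) (\<sigma> - \<tau>)"
    let ?t2 = "\<lambda>\<tau>. (-1) ^ gam \<sigma> \<tau> \<odot>\<^bsub>?K\<^esub> tensor_e ?F (selt n t I u \<tau>) (insert N (\<sigma> - \<tau>))"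
    let ?t1' = "\<lambda>\<tau>. (-1) ^ gam \<sigma> \<tau> \<odot>\<^bsub>?K\<^esub> tensor_e ?F (Phi j (fh u \<tau>)) (\<sigma> - \<tau>)"
    let ?t2' = "\<lambda>\<tau>. (-1) ^ gam \<sigma> \<tau> \<odot>\<^bsub>?K\<^esub> tensor_e ?F (Phi j (sh u \<tau>)) (insert N (\<sigma> - \<tau>))"
    have tc: "tensor_e ?F (Phi j c) \<upsilon> \<in> carrier ?K" if "c \<in> Ech j" "\<upsilon> \<subseteq> {1..n} \<and> card \<upsilon> = i - j" for c \<upsilon>
      using P.q_closed[OF that(1)] that(2) by (simp add: tensor_e_def)
    have e1: "(\<Oplus>\<^bsub>?K\<^esub>\<tau>\<in>?T1. ?t1 \<tau>) = (\<Oplus>\<^bsub>?K\<^esub>\<tau>\<in>?T1. ?t1' \<tau>)"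
    proof (rule K.finsum_cong'[OF refl Pi_I])
      show "?t1' \<tau> \<in> carrier ?K" if "\<tau> \<in> ?T1" for \<tau>
        by (rule K.smult_closed[OF sign_carrier tc]) (use f1[OF that] y1[OF that] in blast)+
      show "?t1 \<tau> = ?t1' \<tau>" if "\<tau> \<in> ?T1" for \<tau> using f1[OF that] by simp
    qed
    have e2: "(\<Oplus>\<^bsub>?K\<^esub>\<tau>\<in>?T2. ?t2 \<tau>) = (\<Oplus>\<^bsub>?K\<^esub>\<tau>\<in>?T2. ?t2' \<tau>)"
    proof (rule K.finsum_cong'[OF refl Pi_I])
      show "?t2' \<tau> \<in> carrier ?K" if "\<tau> \<in> ?T2" for \<tau>
        by (rule K.smult_closed[OF sign_carrier tc]) (use f2[OF that] y2[OF that] in blast)+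
      show "?t2 \<tau> = ?t2' \<tau>" if "\<tau> \<in> ?T2" for \<tau> using f2[OF that] by simp
    qed
    let ?S1 = "\<Sum>\<tau>\<in>?T1. act ((-1) ^ gam \<sigma> \<tau>) (if \<rho> = \<sigma> - \<tau> then fh u \<tau> else 0) :: (_, 'k) chains"
    let ?S2 = "\<Sum>\<tau>\<in>?T2. act ((-1) ^ gam \<sigma> \<tau>) (if \<rho> = insert N (\<sigma> - \<tau>) then sh u \<tau> else 0) :: (_, 'k) chains"
    have S1E: "?S1 \<in> Ech j" using f1 P.A_0 by (intro P.A_sum P.s_closed sign_carrier) auto
    have S2E: "?S2 \<in> Ech j" using f2 P.A_0 by (intro P.A_sum P.s_closed sign_carrier) auto
    have "gelt n t I u \<sigma> j \<rho> = ((-1) ^ (i - j) \<odot>\<^bsub>?F\<^esub> (\<Oplus>\<^bsub>?K\<^esub>\<tau>\<in>?T1. ?t1' \<tau>) \<rho>) \<oplus>\<^bsub>?F\<^esub> (\<Oplus>\<^bsub>?K\<^esub>\<tau>\<in>?T2. ?t2' \<tau>) \<rho>"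
      using False unfolding gelt_def Let_def i_def[symmetric] N_def[symmetric] e1[symmetric] e2[symmetric] by simp
    also have "(\<Oplus>\<^bsub>?K\<^esub>\<tau>\<in>?T1. ?t1' \<tau>) \<rho> = Phi j ?S1"
      by (rule koszul_sum_Phi[OF fT(1)]) (use f1 y1 sign_carrier in blast)+
    also have "(\<Oplus>\<^bsub>?K\<^esub>\<tau>\<in>?T2. ?t2' \<tau>) \<rho> = Phi j ?S2"
      by (rule koszul_sum_Phi[OF fT(2)]) (use f2 y2 sign_carrier in blast)+
    also have "((-1) ^ (i - j) \<odot>\<^bsub>?F\<^esub> Phi j ?S1) \<oplus>\<^bsub>?F\<^esub> Phi j ?S2 = Phi j (act ((-1) ^ (i - j)) ?S1 + ?S2)"
      using P.q_smult[OF sign_carrier S1E] P.q_add[OF P.s_closed[OF sign_carrier S1E] S2E] by simp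
    also have "act ((-1) ^ (i - j)) ?S1 + ?S2 = gh u \<sigma> j \<rho>"
    proof (cases "N \<in> \<rho>")
      case Np: True
      have "?S1 = 0" using Np N by (intro sum.neutral) auto
      moreover have "?S2 = Bh u \<sigma> j (\<rho> - {N})"
      proof (cases "\<rho> - {N} \<subseteq> \<sigma> \<and> card (\<rho> - {N}) + j = card \<sigma>")
        case ok: True
        have "?S2 = (\<Sum>\<tau>\<in>?T2. if \<tau> = \<sigma> - (\<rho> - {N}) then act ((-1) ^ gam \<sigma> (\<sigma> - (\<rho> - {N}))) (sh u (\<sigma> - (\<rho> - {N}))) else 0)"
        proof (rule sum.cong[OF refl])
          fix \<tau> assume "\<tau> \<in> ?T2"
          then have "\<rho> = insert N (\<sigma> - \<tau>) \<longleftrightarrow> \<tau> = \<sigma> - (\<rho> - {N})" using ok Np N by auto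
          then show "act ((-1) ^ gam \<sigma> \<tau>) (if \<rho> = insert N (\<sigma> - \<tau>) then sh u \<tau> else 0) =
            (if \<tau> = \<sigma> - (\<rho> - {N}) then act ((-1) ^ gam \<sigma> (\<sigma> - (\<rho> - {N}))) (sh u (\<sigma> - (\<rho> - {N}))) else (0 :: (_, 'k) chains))"
            by simp
        qed
        moreover have "\<sigma> - (\<rho> - {N}) \<in> ?T2" using ok cd(1)[of "\<rho> - {N}"] by auto
        ultimately show ?thesis using ok fT(2) by (simp add: Bh_def)
      next
        case no: False
        have "?S2 = 0"
        proof (rule sum.neutral, rule ballI)
          fix \<tau> assume "\<tau> \<in> ?T2"
          then have "\<rho> \<noteq> insert N (\<sigma> - \<tau>)" using no N cd(1,2)[of \<tau>] by auto
          then show "act ((-1) ^ gam \<sigma> \<tau>) (if \<rho> = insert N (\<sigma> - \<tau>) then sh u \<tau> else 0) = (0 :: (_, 'k) chains)" by simp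
        qed
        then show ?thesis using no by (auto simp: Bh_def)
      qed
      ultimately show ?thesis using Np by (simp add: gh_def N_def)
    next
      case Nn: False
      have "?S2 = 0" using Nn by (intro sum.neutral) auto
      moreover have "act ((-1) ^ (i - j)) ?S1 = Ah u \<sigma> j \<rho>"
      proof (cases "\<rho> \<subseteq> \<sigma> \<and> card \<rho> + j = card \<sigma> + 1")
        case ok: True
        have "?S1 = (\<Sum>\<tau>\<in>?T1. if \<tau> = \<sigma> - \<rho> then act ((-1) ^ gam \<sigma> (\<sigma> - \<rho>)) (fh u (\<sigma> - \<rho>)) else 0)"
        proof (rule sum.cong[OF refl])
          fix \<tau> assume "\<tau> \<in> ?T1"
          then have "\<rho> = \<sigma> - \<tau> \<longleftrightarrow> \<tau> = \<sigma> - \<rho>" using ok by auto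
          then show "act ((-1) ^ gam \<sigma> \<tau>) (if \<rho> = \<sigma> - \<tau> then fh u \<tau> else 0) =
            (if \<tau> = \<sigma> - \<rho> then act ((-1) ^ gam \<sigma> (\<sigma> - \<rho>)) (fh u (\<sigma> - \<rho>)) else (0 :: (_, 'k) chains))"
            by simp
        qed
        also have "\<dots> = act ((-1) ^ gam \<sigma> (\<sigma> - \<rho>)) (fh u (\<sigma> - \<rho>))"
        proof -
          have "\<sigma> - \<rho> \<in> ?T1" using ok cd(1)[of \<rho>] by auto
          then show ?thesis unfolding sum.delta'[OF fT(1)] sum.delta[OF fT(1)] by (rule if_P)
        qed
        finally have S1: "?S1 = act ((-1) ^ gam \<sigma> (\<sigma> - \<rho>)) (fh u (\<sigma> - \<rho>))" .
        have ij: "i - j = card \<rho>" unfolding i_def using ok by linarith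
        show ?thesis unfolding S1 ij Ah_def if_P[OF ok] act_act ..
      next
        case no: False
        have "?S1 = 0"
        proof (rule sum.neutral, rule ballI)
          fix \<tau> assume "\<tau> \<in> ?T1"
          then have \<tau>: "\<tau> \<subseteq> \<sigma>" "card \<tau> = j - 1" by simp_all
          have "card (\<sigma> - \<tau>) + j = card \<sigma> + 1"
            using cd(1,2)[OF \<tau>(1)] \<tau>(2) j'(1,2) by linarith
          then have "\<rho> \<noteq> \<sigma> - \<tau>" using no by blast
          then show "act ((-1) ^ gam \<sigma> \<tau>) (if \<rho> = \<sigma> - \<tau> then fh u \<tau> else 0) = (0 :: (_, 'k) chains)" by simp
        qed
        then show ?thesis using no by (auto simp: Ah_def)
      qed
      ultimately show ?thesis using Nn by (simp add: gh_def N_def)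
    qed
    finally show ?thesis .
  qed
qed

lemma koszul_d_gelt:
  assumes u: "u \<in> G" "\<sigma> \<subseteq> adm a u" and j: "j \<le> card \<sigma>"
  shows "koszul_d n (Fres n I j) (gelt n t I u \<sigma> j) \<rho> = Phi j (lin dbas (gh u \<sigma> (j + 1) \<rho>))"
proof -
  have s: "(-1) ^ alpha (insert k \<rho>) k * mono_poly (xvar k) \<in> carrier (mpoly_ring n :: ('k mpoly, 'k mpoly) module)"
    if "k \<in> {1..n} - \<rho>" for k using that by (intro mono_carrier) simp
  have "koszul_d n (Fres n I j) (gelt n t I u \<sigma> j) \<rho> =
    (\<Oplus>\<^bsub>Fres n I j\<^esub>k\<in>{1..n} - \<rho>. Phi j (act ((-1) ^ alpha (insert k \<rho>) k * mono_poly (xvar k)) (gh u \<sigma> j (insert k \<rho>))))"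
    unfolding koszul_d_def gelt_Phi[OF assms]
    by (rule Fm.finsum_cong') (use P.q_smult[OF s gh_Ech[OF u]] P.q_closed[OF P.s_closed[OF s gh_Ech[OF u]]] in auto)
  also have "\<dots> = Phi j (\<Sum>k\<in>{1..n} - \<rho>. act ((-1) ^ alpha (insert k \<rho>) k * mono_poly (xvar k)) (gh u \<sigma> j (insert k \<rho>)))"
    by (rule P.q_sum[OF _ P.s_closed[OF s gh_Ech[OF u]], symmetric]) simp_all
  finally show ?thesis unfolding lin_dbas_gh[OF u] .
qed

lemma basis_index_Bas: "i \<ge> 1 \<Longrightarrow> basis_index n t I i = Bas i"
  using admissible_adm by (auto simp: basis_index_def Bas_def min_gens_G)

text \<open>Extended to the index i, the family \<open>gh\<close> has f(u;\<sigma>) as its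
  coefficient at the empty set. The lifting equation for that index shows that the definition of d_i
  through g_{i-1} agrees with the explicit formula.\<close>

lemma koszul_d_gelt_top:
  assumes "(u, \<sigma>) \<in> Bas i" "i \<ge> 1"
  shows "koszul_d n (Fres n I (i - 1)) (gelt n t I u \<sigma> (i - 1)) {} = Phi (i - 1) (dbas (u, \<sigma>))"
proof -
  have u: "u \<in> G" "\<sigma> \<subseteq> adm a u" "card \<sigma> = i - 1" using assms by (auto simp: Bas_def)
  have "gh u \<sigma> (card \<sigma> + 1) {} = (fh u \<sigma> :: (_, 'k) chains)" by (simp add: gh_def Ah_def)
  then have "lin dbas (gh u \<sigma> (card \<sigma> + 1) {}) = (dbas (u, \<sigma>) :: (_, 'k) chains)" using u(2) by (simp add: fh_def)
  then show ?thesis using koszul_d_gelt[OF u(1,2) order_refl, of "{}"] u(3) by simp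
qed

lemma fbas_single: "(u, \<sigma>) \<in> Bas i \<Longrightarrow> i \<ge> 1 \<Longrightarrow> fbas n t I u \<sigma> = Phi i (single (u, \<sigma>) 1)"
  using fbas_Phi[of u i \<sigma>] by (auto simp: Bas_def fh_def)

lemma lin_dbas_Ech: "c \<in> Ech i \<Longrightarrow> i \<ge> 1 \<Longrightarrow> lin dbas c \<in> Ech (i - 1)"
  using Em.chain_d[of c "i - 1"] by (simp add: Ech_def)

lemma res_maps_iff:
  "res_maps n t I D \<longleftrightarrow> (\<forall>i\<ge>1. D i \<in> mod_hom (mpoly_ring n) (Fres n I i) (Fres n I (i - 1)) \<and>
     (\<forall>b\<in>Bas i. D i (Phi i (single b 1)) = Phi (i - 1) (dbas b)))"
proof -
  have "(case b of (u, \<sigma>) \<Rightarrow> D i (fbas n t I u \<sigma>) = koszul_d n (Fres n I (i - 1)) (gelt n t I u \<sigma> (i - 1)) {}) \<longleftrightarrow>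
      D i (Phi i (single b 1)) = Phi (i - 1) (dbas b)" if "b \<in> Bas i" "i \<ge> 1" for b i
    using that by (cases b) (simp add: fbas_single koszul_d_gelt_top del: One_nat_def)
  then show ?thesis unfolding res_maps_def using basis_index_Bas by auto
qed

text \<open>Linearity leaves no freedom: any \<open>D\<close> as in \<open>res_maps\<close> is
  \<open>lin dbas\<close> in coordinates, and its properties are deduced from this.\<close>

lemma res_maps_Phi:
  assumes D: "res_maps n t I D" and c: "c \<in> Ech i" and i: "i \<ge> 1"
  shows "D i (Phi i c) = Phi (i - 1) (lin dbas c)"
proof -
  have hom: "D i \<in> mod_hom (mpoly_ring n) (Fres n I i) (Fres n I (i - 1))"
    and bas: "\<And>b. b \<in> Bas i \<Longrightarrow> D i (Phi i (single b 1)) = Phi (i - 1) (dbas b)"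
    using D i by (auto simp: res_maps_iff)
  have D_add: "D i (Phi i (x + y)) = D i (Phi i x) \<oplus>\<^bsub>Fres n I (i - 1)\<^esub> D i (Phi i y)" if "x \<in> Ech i" "y \<in> Ech i" for x y
    using hom P.q_closed that P.q_add[OF that] by (simp add: mod_hom_def)
  have D_smult: "D i (Phi i (act p x)) = p \<odot>\<^bsub>Fres n I (i - 1)\<^esub> D i (Phi i x)"
    if "p \<in> carrier (mpoly_ring n)" "x \<in> Ech i" for p x
    using hom P.q_closed that P.q_smult[OF that] by (simp add: mod_hom_def del: mpoly_ring_simps)
  have D_0: "D i (Phi i 0) = Phi (i - 1) 0"
  proof -
    have "D i (Phi i 0) \<in> carrier (Fres n I (i - 1))" using hom P.q_closed[OF P.A_0] by (auto simp: mod_hom_def)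
    then show ?thesis using D_smult[OF mpoly.zero_closed P.A_0] Fm.smult_l_null P.q_0 by simp
  qed
  have cB: "keys c \<subseteq> Bas i" "\<And>b. keys (lookup c b) \<subseteq> mons n" using c by (auto simp: Ech_iff)
  have dE: "dbas b \<in> Ech (i - 1)" if "b \<in> Bas i" for b
    using lin_dbas_Ech[OF single_Ech[OF that, of 1] i] by simp
  have "D i (Phi i (\<Sum>b\<in>B. single b (lookup c b))) = Phi (i - 1) (\<Sum>b\<in>B. act (lookup c b) (dbas b))"
    if "B \<subseteq> keys c" for B
    using finite_subset[OF that finite_keys] that
  proof (induction B rule: finite_induct)
    case empty then show ?case by (simp add: D_0)
  next
    case (insert b B)
    have b: "b \<in> Bas i" using insert cB by auto
    have cS: "lookup c b \<in> carrier (mpoly_ring n)" for b using cB(2) by simp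
    have B: "b' \<in> Bas i" if "b' \<in> B" for b' using insert.prems cB(1) that by blast
    have E: "single b (lookup c b) \<in> Ech i" "(\<Sum>b\<in>B. single b (lookup c b)) \<in> Ech i"
      by (rule single_Ech[OF b cB(2)]) (rule P.A_sum, rule single_Ech[OF B cB(2)])
    have E': "act (lookup c b) (dbas b) \<in> Ech (i - 1)" "(\<Sum>b\<in>B. act (lookup c b) (dbas b)) \<in> Ech (i - 1)"
      by (rule P.s_closed[OF cS dE[OF b]]) (rule P.A_sum, rule P.s_closed[OF cS dE[OF B]])
    have "D i (Phi i (single b (lookup c b))) = D i (Phi i (act (lookup c b) (single b 1)))" by simp
    also have "\<dots> = lookup c b \<odot>\<^bsub>Fres n I (i - 1)\<^esub> Phi (i - 1) (dbas b)"
      using D_smult[of "lookup c b" "single b 1"] single_Ech[OF b, of 1] cB(2) bas[OF b] by simp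
    also have "\<dots> = Phi (i - 1) (act (lookup c b) (dbas b))"
      using P.q_smult[of "lookup c b" "dbas b" "i - 1"] cB(2) dE[OF b] by simp
    finally show ?case using insert D_add[OF E] P.q_add[OF E'] by simp
  qed
  from this[OF order_refl] show ?thesis
    unfolding lin_def by (metis chains_expand)
qed

lemma Phi_cases:
  assumes "x \<in> carrier (Fres n I i)"
  obtains c where "c \<in> Ech i" "x = Phi i c"
  using assms P.q_surj by blast

lemma res_maps_exists: "\<exists>D. res_maps n t I D"
proof -
  \<comment> \<open>The coordinate differential, transported along the bijections
    \<open>Phi\<close>.\<close>
  define D where "D = (\<lambda>i x. Phi (i - 1) (lin dbas (inv_into (Ech i) (Phi i) x)))"
  have inv: "inv_into (Ech i) (Phi i) (Phi i c) = c" if "c \<in> Ech i" for i c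
    using Phi_inj that by (intro inv_into_f_f inj_onI) auto
  have D: "D i (Phi i c) = Phi (i - 1) (lin dbas c)" if "c \<in> Ech i" for i c
    by (simp add: D_def inv[OF that])
  have "res_maps n t I D" unfolding res_maps_iff
  proof (intro allI impI conjI ballI)
    fix i :: nat assume i: "1 \<le> i"
    show "D i \<in> mod_hom (mpoly_ring n) (Fres n I i) (Fres n I (i - 1))" unfolding mod_hom_def
    proof (intro CollectI conjI ballI Pi_I)
      fix x assume "x \<in> carrier (Fres n I i)"
      then obtain c where c: "c \<in> Ech i" "x = Phi i c" by (rule Phi_cases)
      then show "D i x \<in> carrier (Fres n I (i - 1))" by (simp add: D P.q_closed lin_dbas_Ech i del: One_nat_def)
      fix y assume "y \<in> carrier (Fres n I i)"
      then obtain c' where c': "c' \<in> Ech i" "y = Phi i c'" by (rule Phi_cases)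
      show "D i (x \<oplus>\<^bsub>Fres n I i\<^esub> y) = D i x \<oplus>\<^bsub>Fres n I (i - 1)\<^esub> D i y"
        using c c' lin_dbas_Ech[OF _ i]
        by (simp add: P.q_add[symmetric] D P.A_add lin_add del: One_nat_def)
    next
      fix p x assume p: "p \<in> carrier (mpoly_ring n :: ('k mpoly, 'k mpoly) module)" and "x \<in> carrier (Fres n I i)"
      then obtain c where c: "c \<in> Ech i" "x = Phi i c" using Phi_cases by blast
      show "D i (p \<odot>\<^bsub>Fres n I i\<^esub> x) = p \<odot>\<^bsub>Fres n I (i - 1)\<^esub> D i x"
        using c p lin_dbas_Ech[OF _ i]
        by (simp add: P.q_smult[symmetric] D P.s_closed lin_act del: mpoly_ring_simps One_nat_def)
    qed
    fix b assume "b \<in> Bas i"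
    then show "D i (Phi i (single b 1)) = Phi (i - 1) (dbas b)" using D[OF single_Ech[of b i 1]] by simp
  qed
  then show ?thesis by blast
qed

end

section \<open>Freeness, grading, minimality and exactness\<close>

context spread_resolution
begin

interpretation P: module_cover "mpoly_ring n" "Ech i" act "Phi i" "Fres n I i" for i
  by (rule Phi_cover)

interpretation Fm: module "mpoly_ring n" "Fres n I i" for i
  by (rule P.cover_module)

definition bas :: "nat \<Rightarrow> mon \<times> nat set \<Rightarrow> 'k fres" where "bas i b = Phi i (single b 1)"

lemma bas_closed: "b \<in> Bas i \<Longrightarrow> bas i b \<in> carrier (Fres n I i)"
  unfolding bas_def by (rule P.q_closed[OF single_Ech]) simp_all

lemma inj_bas: "inj_on (bas i) (Bas i)"
proof (rule inj_onI)
  fix b b' assume b: "b \<in> Bas i" "b' \<in> Bas i" "bas i b = bas i b'"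
  have "single b 1 = (single b' 1 :: (_, 'k) chains)"
    using Phi_inj[OF single_Ech[OF b(1)] single_Ech[OF b(2)], of 1 1] b(3) by (simp add: bas_def)
  then have "lookup (single b 1) b = (lookup (single b' 1) b :: 'k mpoly)" by simp
  then show "b = b'" by (simp add: lookup_single when_def split: if_splits)
qed

lemma finsum_bas:
  assumes f: "\<And>b. b \<in> Bas i \<Longrightarrow> f (bas i b) \<in> carrier (mpoly_ring n)"
  shows "(\<Oplus>\<^bsub>Fres n I i\<^esub>y\<in>bas i ` Bas i. f y \<odot>\<^bsub>Fres n I i\<^esub> y) = Phi i (\<Sum>b\<in>Bas i. single b (f (bas i b)))"
proof -
  have E: "single b (f (bas i b)) \<in> Ech i" if "b \<in> Bas i" for b using f[OF that] that by (intro single_Ech) auto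
  have eq: "f (bas i b) \<odot>\<^bsub>Fres n I i\<^esub> bas i b = Phi i (single b (f (bas i b)))" if "b \<in> Bas i" for b
    using P.q_smult[OF f[OF that] single_Ech[OF that, of 1]] by (simp add: bas_def)
  have "(\<Oplus>\<^bsub>Fres n I i\<^esub>y\<in>bas i ` Bas i. f y \<odot>\<^bsub>Fres n I i\<^esub> y) = (\<Oplus>\<^bsub>Fres n I i\<^esub>b\<in>Bas i. f (bas i b) \<odot>\<^bsub>Fres n I i\<^esub> bas i b)"
    by (rule Fm.add.finprod_reindex[OF _ inj_bas]) (use Fm.smult_closed[OF f bas_closed] in auto)
  also have "\<dots> = (\<Oplus>\<^bsub>Fres n I i\<^esub>b\<in>Bas i. Phi i (single b (f (bas i b))))"
    by (rule Fm.finsum_cong') (use eq P.q_closed[OF E] in auto)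
  also have "\<dots> = Phi i (\<Sum>b\<in>Bas i. single b (f (bas i b)))"
    by (rule P.q_sum[OF finite_Bas E, symmetric])
  finally show ?thesis .
qed

lemma Ech_lookup: "c \<in> Ech i \<Longrightarrow> keys (lookup c b) \<subseteq> mons n"
  unfolding Ech_iff by blast

lemma Ech_expand: "c \<in> Ech i \<Longrightarrow> (\<Sum>b\<in>Bas i. single b (lookup c b)) = c"
proof -
  assume "c \<in> Ech i"
  then have "keys c \<subseteq> Bas i" by (simp add: Ech_iff)
  then have "(\<Sum>b\<in>keys c. single b (lookup c b)) = (\<Sum>b\<in>Bas i. single b (lookup c b))"
    using finite_Bas by (intro sum.mono_neutral_left) (auto simp: in_keys_iff)
  then show ?thesis using chains_expand[of c] by simp
qed

definition coord :: "nat \<Rightarrow> (mon \<times> nat set, 'k) chains \<Rightarrow> 'k fres \<Rightarrow> 'k mpoly" where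
  "coord i c y = lookup c (inv_into (Bas i) (bas i) y)"

lemma coord_bas: "b \<in> Bas i \<Longrightarrow> coord i c (bas i b) = lookup c b"
  by (simp add: coord_def inv_into_f_f[OF inj_bas])

lemma Phi_coord:
  assumes "c \<in> Ech i"
  shows "Phi i c = (\<Oplus>\<^bsub>Fres n I i\<^esub>y\<in>bas i ` Bas i. coord i c y \<odot>\<^bsub>Fres n I i\<^esub> y)"
proof -
  have "coord i c (bas i b) \<in> carrier (mpoly_ring n)" if "b \<in> Bas i" for b
    using Ech_lookup[OF assms] by (simp add: coord_bas[OF that])
  then have "(\<Oplus>\<^bsub>Fres n I i\<^esub>y\<in>bas i ` Bas i. coord i c y \<odot>\<^bsub>Fres n I i\<^esub> y) = Phi i (\<Sum>b\<in>Bas i. single b (coord i c (bas i b)))"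
    by (rule finsum_bas)
  also have "(\<Sum>b\<in>Bas i. single b (coord i c (bas i b))) = (\<Sum>b\<in>Bas i. single b (lookup c b))"
    by (rule sum.cong) (simp_all add: coord_bas)
  finally show ?thesis by (simp add: Ech_expand[OF assms])
qed

lemma Fres_finite_basis: "finite_basis (mpoly_ring n) (Fres n I i) (bas i ` Bas i)"
  unfolding finite_basis_def
proof (intro conjI ballI)
  show "finite (bas i ` Bas i)" using finite_Bas by simp
  show "bas i ` Bas i \<subseteq> carrier (Fres n I i)" using bas_closed by auto
  fix x assume "x \<in> carrier (Fres n I i)"
  then obtain c where c: "c \<in> Ech i" "x = Phi i c" by (rule Phi_cases)
  let ?f = "restrict (coord i c) (bas i ` Bas i)"
  show "\<exists>!f. f \<in> bas i ` Bas i \<rightarrow>\<^sub>E carrier (mpoly_ring n) \<and> x = (\<Oplus>\<^bsub>Fres n I i\<^esub>b\<in>bas i ` Bas i. f b \<odot>\<^bsub>Fres n I i\<^esub> b)"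
  proof (rule ex1I[of _ ?f], intro conjI)
    show "?f \<in> bas i ` Bas i \<rightarrow>\<^sub>E carrier (mpoly_ring n)"
      using Ech_lookup[OF c(1)] by (auto simp: coord_bas subset_iff)
    have fc: "?f (bas i b) \<in> carrier (mpoly_ring n)" if "b \<in> Bas i" for b
      using that Ech_lookup[OF c(1)] by (simp add: coord_bas)
    have "(\<Sum>b\<in>Bas i. single b (?f (bas i b))) = (\<Sum>b\<in>Bas i. single b (lookup c b))"
      by (rule sum.cong) (simp_all add: coord_bas)
    then show "x = (\<Oplus>\<^bsub>Fres n I i\<^esub>b\<in>bas i ` Bas i. ?f b \<odot>\<^bsub>Fres n I i\<^esub> b)"
      using finsum_bas[of i ?f, OF fc] by (simp only: c(2) Ech_expand[OF c(1)])
    fix f assume f: "f \<in> bas i ` Bas i \<rightarrow>\<^sub>E carrier (mpoly_ring n) \<and> x = (\<Oplus>\<^bsub>Fres n I i\<^esub>b\<in>bas i ` Bas i. f b \<odot>\<^bsub>Fres n I i\<^esub> b)"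
    then have fS: "f (bas i b) \<in> carrier (mpoly_ring n)" if "b \<in> Bas i" for b using that by (meson PiE_mem imageI)
    have E: "(\<Sum>b\<in>Bas i. single b (f (bas i b))) \<in> Ech i"
      by (intro P.A_sum single_Ech) (use fS in auto)
    have "Phi i c = Phi i (\<Sum>b\<in>Bas i. single b (f (bas i b)))" using f finsum_bas[of i f, OF fS] c by simp
    then have ceq: "c = (\<Sum>b\<in>Bas i. single b (f (bas i b)))" by (rule Phi_inj[OF c(1) E])
    have "lookup c b = f (bas i b)" if "b \<in> Bas i" for b
      using that finite_Bas[of i] by (subst ceq) (simp add: lookup_sum lookup_single when_def)
    then show "f = ?f" using f by (intro extensionalityI[of f "bas i ` Bas i" ?f]) (auto simp: coord_bas PiE_def)
  qed
qed

text \<open>The total degree of u times the variables of \<sigma>, which is the multidegree of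
  z(u;\<sigma>).\<close>

definition deg :: "mon \<times> nat set \<Rightarrow> nat" where "deg b = mdeg (fst b) + card (snd b)"

lemma dbas_homogeneous:
  assumes b: "b \<in> Bas i" "i \<ge> 1" and m: "m \<in> keys (lookup (dbas b :: (_, 'k) chains) b')"
  shows "mdeg m + deg b' = deg b"
proof -
  obtain u \<sigma> where bu: "b = (u, \<sigma>)" by (cases b)
  have u: "u \<in> G" "\<sigma> \<subseteq> adm a u" "u \<noteq> 0" using b G_nz by (auto simp: Bas_def bu)
  have fin: "finite \<sigma>" by (rule finite_subset_adm[OF u(2)])
  show ?thesis
  proof (cases "\<sigma> = {}")
    case True
    then have "lookup (single (0, {}) (mono_poly u) :: (_, 'k) chains) b' \<noteq> 0" "m \<in> keys (lookup (single (0, {}) (mono_poly u) :: (_, 'k) chains) b')"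
      using m u by (auto simp: dbas_def bu)
    then have "b' = (0, {})" "m = u" by (auto simp: lookup_single when_def split: if_splits)
    then show ?thesis using True by (simp add: deg_def bu)
  next
    case False
    \<comment> \<open>Multiplication by the monomial 1 brings the coefficient into the form required
      by \<open>toggle_dterm_cases\<close>.\<close>
    have nz: "ccoef (act (single 0 1) (dbas (u, \<sigma>)) :: (_, 'k) chains) (m, b') \<noteq> 0"
      using m by (simp add: ccoef_def in_keys_iff bu)
    have c: "Suc (card (\<sigma> - {k})) = card \<sigma>" if "k \<in> \<sigma>" for k using card_Suc_Diff1[OF fin that] .
    show ?thesis
    proof (cases rule: toggle_dterm_cases[OF u(1,2) False nz])
      case (1 k)
      then show ?thesis using c[of k] by (simp add: deg_def bu mdeg_add)
    next
      case (2 k)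
      then have "mdeg (vv u k + uu u k) = mdeg (xvar k + u)" using uu_add_vv[of u k] u by auto
      then show ?thesis using 2 c[of k] by (simp add: deg_def bu mdeg_add)
    qed
  qed
qed

lemma aug_Phi: "aug n I (Phi 0 c) = cs (lookup c (0, {}))"
  by (simp add: aug_def Phi_def cs_def)

lemma irrelevant_mono: "w \<in> mons n \<Longrightarrow> w \<noteq> 0 \<Longrightarrow> (mono_poly w :: 'k mpoly) \<in> irrelevant_ideal n"
proof -
  assume w: "w \<in> mons n" "w \<noteq> 0"
  have sub: "((\<lambda>k. mono_poly (xvar k)) ` {1..n} :: 'k mpoly set) \<subseteq> carrier (mpoly_ring n)" by auto
  interpret J: ideal "irrelevant_ideal n :: 'k mpoly set" "mpoly_ring n"
    unfolding irrelevant_ideal_def by (rule mpoly.genideal_ideal[OF sub])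
  have k: "maxv w \<in> keys w" by (rule maxv_in_keys[OF w(2)])
  then have "maxv w \<in> {1..n}" using w by (auto simp: mons_def)
  then have "(mono_poly (xvar (maxv w)) :: 'k mpoly) \<in> irrelevant_ideal n"
    unfolding irrelevant_ideal_def using mpoly.genideal_self[OF sub] by blast
  then have "mono_poly (w - xvar (maxv w)) * mono_poly (xvar (maxv w)) \<in> (irrelevant_ideal n :: 'k mpoly set)"
    using J.I_l_closed[of "mono_poly (xvar (maxv w))" "mono_poly (w - xvar (maxv w))"] w by (simp add: diff_in_mons)
  then show ?thesis using k by (simp add: mono_poly_mult xvar_add_diff add.commute)
qed

context
  fixes D :: "nat \<Rightarrow> 'k fres \<Rightarrow> 'k fres"
  assumes D: "res_maps n t I D"
begin

text \<open>All coefficients of \<open>dbas\<close> are, up to sign, nonconstant monomials: x_k, the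
  monomial \<open>v\<^sub>k\<close>, which contains the last variable of u, and in degree 1 the
  generator u itself.\<close>

lemma D_image_minimal:
  assumes i: "i \<ge> 1"
  shows "D i ` carrier (Fres n I i) \<subseteq> ideal_module (mpoly_ring n) (irrelevant_ideal n) (Fres n I (i - 1))"
  unfolding ideal_module_def
proof (intro image_subsetI InterI, elim CollectE conjE)
  fix x N assume x: "x \<in> carrier (Fres n I i)" and N: "submodule N (mpoly_ring n) (Fres n I (i - 1))"
    and NI: "\<forall>a\<in>irrelevant_ideal n. \<forall>x\<in>carrier (Fres n I (i - 1)). a \<odot>\<^bsub>Fres n I (i - 1)\<^esub> x \<in> N"
  \<comment> \<open>\<open>ideal_module\<close> is an intersection, so an arbitrary submodule
    \<open>N\<close> containing the products is tested, through its preimage in coordinates.\<close>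
  define PN where "PN = {c \<in> Ech (i - 1). Phi (i - 1) c \<in> N}"
  have PN_0: "0 \<in> PN" using submodule.axioms(1)[OF N] subgroup.one_closed P.A_0 P.q_0 by (fastforce simp: PN_def)
  have PN_add: "c + c' \<in> PN" if "c \<in> PN" "c' \<in> PN" for c c'
    using that Fm.submoduleE(5)[OF N] by (simp add: PN_def P.A_add P.q_add)
  have PN_act: "act p c \<in> PN" if "p \<in> carrier (mpoly_ring n)" "c \<in> PN" for p c
    using that Fm.submoduleE(4)[OF N] by (simp add: PN_def P.s_closed P.q_smult del: mpoly_ring_simps)
  have PN_irr: "act (mono_poly w) c \<in> PN" if "w \<in> mons n" "w \<noteq> 0" "c \<in> Ech (i - 1)" for w c
  proof -
    have w: "mono_poly w \<in> carrier (mpoly_ring n :: ('k mpoly, 'k mpoly) module)" using that(1) by simp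
    show ?thesis using NI irrelevant_mono[OF that(1,2)] P.q_closed[OF that(3)] P.q_smult[OF w that(3)] P.s_closed[OF w that(3)]
      by (simp add: PN_def)
  qed
  have PN_sum: "sum f B \<in> PN" if "\<And>b. b \<in> B \<Longrightarrow> f b \<in> PN" for f and B :: "nat set"
    using that by (induction B rule: infinite_finite_induct) (simp_all add: PN_0 PN_add)
  have PN_sum': "sum f B \<in> PN" if "\<And>b. b \<in> B \<Longrightarrow> f b \<in> PN" for f and B :: "(mon \<times> nat set) set"
    using that by (induction B rule: infinite_finite_induct) (simp_all add: PN_0 PN_add)
  have dPN: "dbas b \<in> PN" if b: "b \<in> Bas i" for b
  proof -
    obtain u \<sigma> where bu: "b = (u, \<sigma>)" by (cases b)
    have u: "u \<in> G" "\<sigma> \<subseteq> adm a u" "u \<noteq> 0" "card \<sigma> = i - 1" using b i G_nz by (auto simp: Bas_def bu)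
    show ?thesis
    proof (cases "\<sigma> = {}")
      case True
      have "act (mono_poly u) (single (0, {}) 1) \<in> PN"
        using u True by (intro PN_irr G_mons single_Ech) (auto simp: Bas_def)
      then show ?thesis using True u by (simp add: bu dbas_def)
    next
      case False
      have "dterm u \<sigma> k \<in> PN" if k: "k \<in> \<sigma>" for k
      proof -
        have ka: "k \<in> adm a u" using k u by auto
        have kn: "1 \<le> k" "k \<le> n" using adm_le_n[OF u(1) ka] by auto
        have cd: "card (\<sigma> - {k}) + 1 = i - 1"
          using card_Suc_Diff1[OF finite_subset_adm[OF u(2)] k] u(4) by simp
        have x0: "xvar k \<noteq> 0" by (metis keys_xvar keys_zero insert_not_empty)
        have v0: "vv u k \<noteq> 0" using maxv_keys_vv[OF u(1) ka] by auto
        have "act (mono_poly (xvar k)) (fh u (\<sigma> - {k})) \<in> PN"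
          by (rule PN_irr[OF _ x0 fh_Ech[OF u(1) cd]]) (use kn in simp)
        then have "act (- 1) (act (mono_poly (xvar k)) (fh u (\<sigma> - {k}))) \<in> PN"
          by (rule PN_act[rotated]) simp
        moreover have "act (mono_poly (vv u k)) (fh (uu u k) (\<sigma> - {k})) \<in> PN"
          by (rule PN_irr[OF vv_mons[OF u(1) ka] v0 fh_Ech[OF uu_G[OF u(1) ka] cd]])
        ultimately show ?thesis unfolding dterm_def
          by (intro PN_act[OF sign_carrier] PN_add) (simp_all add: act_act)
      qed
      then show ?thesis using False u by (simp add: bu dbas_def PN_sum)
    qed
  qed
  obtain c where c: "c \<in> Ech i" "x = Phi i c" using x by (rule Phi_cases)
  have "lin dbas c \<in> PN" unfolding lin_def
  proof (intro PN_sum' PN_act)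
    fix b assume "b \<in> keys c"
    then show "dbas b \<in> PN" using c(1) by (intro dPN) (auto simp: Ech_iff)
  qed (use Ech_lookup[OF c(1)] in simp)
  then show "D i x \<in> N" using res_maps_Phi[OF D c(1) i] by (simp add: c(2) PN_def)
qed

lemma Phi_eq_0_iff: "c \<in> Ech i \<Longrightarrow> Phi i c = \<zero>\<^bsub>Fres n I i\<^esub> \<longleftrightarrow> c = 0"
  using Phi_inj[of c i 0] P.A_0 P.q_0 by auto

text \<open>No critical cell has positive degree, so \<open>cycle_critical\<close> turns every cycle
  into a boundary.\<close>

lemma D_kernel:
  assumes i: "i \<ge> 1"
  shows "a_kernel (Fres n I i) (Fres n I (i - 1)) (D i) = D (i + 1) ` carrier (Fres n I (i + 1))"
proof (intro equalityI subsetI)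
  fix x assume "x \<in> a_kernel (Fres n I i) (Fres n I (i - 1)) (D i)"
  then have x: "x \<in> carrier (Fres n I i)" "D i x = \<zero>\<^bsub>Fres n I (i - 1)\<^esub>" by (auto simp: a_kernel_def')
  obtain c where c: "c \<in> Ech i" "x = Phi i c" using x(1) by (rule Phi_cases)
  have "lin dbas c = 0"
    using x(2) res_maps_Phi[OF D c(1) i] Phi_eq_0_iff[OF lin_dbas_Ech[OF c(1) i]] by (simp add: c(2))
  then obtain b where b: "b \<in> Ech (i + 1)" "\<And>s. ccoef (c - lin dbas b) s \<noteq> 0 \<Longrightarrow> s \<in> EC \<inter> (mons n \<times> Bas i)"
    using Em.cycle_critical[of c i] c(1) by (auto simp: Ech_def)
  have "EC \<inter> (mons n \<times> Bas i) = {}" using i G_nz by (auto simp: EC_def Bas_def)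
  then have "ccoef (c - lin dbas b) s = ccoef 0 s" for s using b(2)[of s] by (auto simp: ccoef_def)
  then have "c - lin dbas b = 0" by (rule ccoef_inj)
  then have "x = D (i + 1) (Phi (i + 1) b)" using res_maps_Phi[OF D b(1)] c(2) by simp
  then show "x \<in> D (i + 1) ` carrier (Fres n I (i + 1))" using P.q_closed[OF b(1)] by blast
next
  fix x assume "x \<in> D (i + 1) ` carrier (Fres n I (i + 1))"
  then obtain y where y: "y \<in> carrier (Fres n I (i + 1))" "x = D (i + 1) y" by blast
  obtain b where b: "b \<in> Ech (i + 1)" "y = Phi (i + 1) b" using y(1) by (rule Phi_cases)
  have x: "x = Phi i (lin dbas b)" using res_maps_Phi[OF D b(1)] b y by simp
  have dE: "lin dbas b \<in> Ech i" using lin_dbas_Ech[OF b(1)] by simp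
  have "lin dbas (lin dbas b) = 0" using Em.d_d[of b "i + 1"] b(1) unfolding Ech_def Em.chain_def by blast
  then have "D i x = \<zero>\<^bsub>Fres n I (i - 1)\<^esub>" using res_maps_Phi[OF D dE i] P.q_0 by (simp add: x)
  then show "x \<in> a_kernel (Fres n I i) (Fres n I (i - 1)) (D i)"
    using P.q_closed[OF dE] by (simp add: a_kernel_def' x)
qed

text \<open>In degree 0 exactness comes from \<open>reduction\<close> alone: a chain over the ideal
  and every boundary are supported on \<open>EL\<close>, where the reduced chain vanishes.\<close>

lemma aug_kernel: "a_kernel (Fres n I 0) Q (aug n I) = D 1 ` carrier (Fres n I 1)"
proof (intro equalityI subsetI)
  fix x assume "x \<in> a_kernel (Fres n I 0) Q (aug n I)"
  then have x: "x \<in> carrier (Fres n I 0)" "aug n I x = \<zero>\<^bsub>Q\<^esub>" by (auto simp: a_kernel_def' simp del: Fres_0_simps)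
  obtain c where c: "c \<in> Ech 0" "x = Phi 0 c" using x(1) by (rule Phi_cases)
  have "keys (lookup c (0, {}) - 0) \<subseteq> M"
    using x(2) c cs_eq_iff[of "lookup c (0, {})" 0] cs_0 by (simp add: aug_Phi Ech_iff)
  then have cM: "s \<in> EL" if "ccoef c s \<noteq> 0" for s
  proof -
    have "s \<in> mons n \<times> Bas 0" using that c(1) unfolding Ech_def Em.chain_def by blast
    then have s: "s = (fst s, 0, {})" by (auto simp: Bas_def)
    then have "fst s \<in> keys (lookup c (0, {}))" using that by (metis ccoef_def fst_conv snd_conv in_keys_iff)
    then show ?thesis using \<open>keys _ \<subseteq> M\<close> by (subst s) (auto simp: EL_def)
  qed
  obtain b where b: "b \<in> Ech 1" "\<forall>y\<in>EL. ccoef (c - lin dbas b) y = 0"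
    using Em.reduction[of c 0] c(1) by (auto simp: Ech_def)
  have "c - lin dbas b = 0"
  proof (rule ccoef_inj)
    fix s
    show "ccoef (c - lin dbas b) s = ccoef 0 s"
    proof (cases "s \<in> EL")
      case True
      then show ?thesis using b(2) by (simp add: ccoef_def)
    next
      case False
      then have "ccoef c s = 0" using cM by blast
      moreover have "ccoef (lin dbas b) s = 0"
      proof (subst Em.coef_d, rule sum.neutral, rule ballI)
        fix s' assume "s' \<in> {s. ccoef b s \<noteq> 0}"
        then have "s' \<in> mons n \<times> Bas 1" using b(1) unfolding Ech_def Em.chain_def by blast
        then obtain m u where s': "s' = (m, u, {})" "m \<in> mons n" "u \<in> G" using finite_subset_adm
          by (auto simp: Bas_def)
        have "lin dbas (celt (1 :: 'k) s') = single (0, {}) (single (m + u) 1)"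
          using G_nz[OF s'(3)] by (simp add: s' celt_def dbas_def mono_poly_def mult_single)
        moreover have "m + u \<in> M" using M_add s' G_sub by (metis add.commute subsetD)
        then have "s \<noteq> (m + u, 0, {})" using False by (auto simp: EL_def)
        ultimately have "ccoef (lin dbas (celt (1 :: 'k) s')) s = 0"
          by (cases s) (auto simp: ccoef_def lookup_single when_def)
        then show "ccoef b s' * ccoef (lin dbas (celt 1 s')) s = 0" by simp
      qed
      ultimately show ?thesis by (simp add: ccoef_minus)
    qed
  qed
  then have "x = D 1 (Phi 1 b)" using res_maps_Phi[OF D b(1)] c(2) by simp
  then show "x \<in> D 1 ` carrier (Fres n I 1)" using P.q_closed[OF b(1)] by blast
next
  fix x assume "x \<in> D 1 ` carrier (Fres n I 1)"
  then obtain y where y: "y \<in> carrier (Fres n I 1)" "x = D 1 y" by blast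
  obtain b where b: "b \<in> Ech 1" "y = Phi 1 b" using y(1) by (rule Phi_cases)
  have x: "x = Phi 0 (lin dbas b)" using res_maps_Phi[OF D b(1)] b y by simp
  have dE: "lin dbas b \<in> Ech 0" using lin_dbas_Ech[OF b(1)] by simp
  have "keys (lookup (lin dbas b) (0, {})) \<subseteq> M" unfolding lin_def lookup_sum
  proof (rule keys_sum_mons)
    fix b' assume b': "b' \<in> keys b"
    then have "b' \<in> Bas 1" using b(1) by (auto simp: Ech_iff)
    then obtain u where u: "b' = (u, {})" "u \<in> G" using finite_subset_adm by (auto simp: Bas_def)
    have "keys (lookup b b' * mono_poly u) \<subseteq> {x + y |x y. x \<in> keys (lookup b b') \<and> y \<in> keys (mono_poly u :: 'k mpoly)}"
      by (rule keys_mult)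
    also have "\<dots> \<subseteq> M"     proof safe
      fix x y assume "x \<in> keys (lookup b b')" "y \<in> keys (mono_poly u :: 'k mpoly)"
      then have "x \<in> mons n" "y = u" using Ech_lookup[OF b(1), of b'] by (auto simp: mono_poly_def)
      then show "x + y \<in> M" using M_add[of u x] u(2) G_sub by (simp add: add.commute subset_iff)
    qed
    finally show "keys (lookup (act (lookup b b') (dbas b')) (0, {})) \<subseteq> M"
      using G_nz[OF u(2)] by (simp add: u dbas_def)
  qed
  then have "cs (lookup (lin dbas b) (0, {})) = cs 0"
    using dE by (subst cs_eq_iff) (simp_all add: Ech_iff)
  then show "x \<in> a_kernel (Fres n I 0) Q (aug n I)"
    using P.q_closed[OF dE] by (simp add: a_kernel_def' x aug_Phi cs_0 del: Fres_0_simps)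
qed

lemma minimal_resolution: "minimal_free_resolution n (Fres n I) D (aug n I) Q (quot_component n I)"
  unfolding minimal_free_resolution_def
proof (intro conjI allI impI)
  show "module (mpoly_ring n) Q" by (rule Q_module)
  show "module (mpoly_ring n) (Fres n I i)" for i by (rule P.cover_module)
  show "aug n I \<in> mod_hom (mpoly_ring n) (Fres n I 0) Q"
    by (auto simp: mod_hom_def aug_def cs_def[symmetric] cs_closed cs_add cs_mult)
  show "D i \<in> mod_hom (mpoly_ring n) (Fres n I i) (Fres n I (i - 1))" if "1 \<le> i" for i
    using D that by (simp add: res_maps_def)
  define \<delta> where "\<delta> = (\<lambda>i y. deg (inv_into (Bas i) (bas i) y))"
  have \<delta>: "\<delta> i (bas i b) = deg b" if "b \<in> Bas i" for i b
    by (simp add: \<delta>_def inv_into_f_f[OF inj_bas that])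
  show "\<exists>B \<delta>. (\<forall>i. finite_basis (mpoly_ring n) (Fres n I i) (B i)) \<and>
        (\<forall>b\<in>B 0. aug n I b \<in> quot_component n I (\<delta> 0 b)) \<and>
        (\<forall>i\<ge>1. \<forall>b\<in>B i. D i b \<in> free_component n (Fres n I (i - 1)) (B (i - 1)) (\<delta> (i - 1)) (\<delta> i b))"
  proof (intro exI[of _ "\<lambda>i. bas i ` Bas i"] exI[of _ \<delta>] conjI allI ballI impI)
    show "finite_basis (mpoly_ring n) (Fres n I i) (bas i ` Bas i)" for i by (rule Fres_finite_basis)
    fix y assume "y \<in> bas 0 ` Bas 0"
    then have y: "y = bas 0 (0, {})" by (auto simp: Bas_def)
    have "\<delta> 0 y = 0" using \<delta>[of "(0, {})" 0] by (simp add: y Bas_def deg_def)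
    moreover have "aug n I y = I +>\<^bsub>mpoly_ring n\<^esub> 1" by (simp add: y bas_def aug_Phi cs_def)
    ultimately show "aug n I y \<in> quot_component n I (\<delta> 0 y)"
      unfolding quot_component_def by (auto intro!: exI[of _ 1])
  next
    fix i :: nat and y assume i: "1 \<le> i" and "y \<in> bas i ` Bas i"
    then obtain b where b: "b \<in> Bas i" "y = bas i b" by blast
    have dE: "dbas b \<in> Ech (i - 1)" using lin_dbas_Ech[OF single_Ech[OF b(1), of 1] i] by simp
    have "D i y = Phi (i - 1) (dbas b)" using res_maps_Phi[OF D single_Ech[OF b(1), of 1] i] by (simp add: b bas_def)
    then have "D i y = (\<Oplus>\<^bsub>Fres n I (i - 1)\<^esub>z\<in>bas (i - 1) ` Bas (i - 1). coord (i - 1) (dbas b) z \<odot>\<^bsub>Fres n I (i - 1)\<^esub> z)"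
      using Phi_coord[OF dE] by simp
    moreover have "coord (i - 1) (dbas b) z \<in> carrier (mpoly_ring n) \<and>
        (\<forall>m\<in>keys (coord (i - 1) (dbas b) z). mdeg m + \<delta> (i - 1) z = \<delta> i y)" if z: "z \<in> bas (i - 1) ` Bas (i - 1)" for z
    proof -
      obtain b' where b': "b' \<in> Bas (i - 1)" "z = bas (i - 1) b'" using z by blast
      have "mdeg m + deg b' = deg b" if "m \<in> keys (lookup (dbas b :: (_, 'k) chains) b')" for m
        by (rule dbas_homogeneous[OF b(1) i that])
      then show ?thesis using Ech_lookup[OF dE] by (simp add: b' coord_bas \<delta> b del: One_nat_def)
    qed
    ultimately show "D i y \<in> free_component n (Fres n I (i - 1)) (bas (i - 1) ` Bas (i - 1)) (\<delta> (i - 1)) (\<delta> i y)"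
      unfolding free_component_def by blast
  qed
  show "aug n I ` carrier (Fres n I 0) = carrier Q"
  proof -
    have "aug n I ` Inl ` {p. keys p \<subseteq> mons n} = cs ` {p. keys p \<subseteq> mons n}"
      unfolding image_image by (rule image_cong) (simp_all add: aug_def cs_def)
    then show ?thesis unfolding cs_image by (simp add: mpoly_ring_def)
  qed
  show "a_kernel (Fres n I 0) Q (aug n I) = D 1 ` carrier (Fres n I 1)" by (rule aug_kernel)
  show "a_kernel (Fres n I i) (Fres n I (i - 1)) (D i) = D (i + 1) ` carrier (Fres n I (i + 1))" if "1 \<le> i" for i
    by (rule D_kernel[OF that])
  show "D i ` carrier (Fres n I i) \<subseteq> ideal_module (mpoly_ring n) (irrelevant_ideal n) (Fres n I (i - 1))" if "1 \<le> i" for i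
    by (rule D_image_minimal[OF that])
qed

lemma aug_gelt:
  assumes "(u, \<sigma>) \<in> Bas i" "i \<ge> 1"
  shows "(\<lambda>\<rho>. aug n I (gelt n t I u \<sigma> 0 \<rho>)) = (-1) ^ sgn_exp i \<odot>\<^bsub>koszul n Q i\<^esub> zcyc n I u \<sigma>"
proof
  fix \<rho>
  have u: "u \<in> G" "card \<sigma> + 1 = i" using assms by (auto simp: Bas_def)
  have s: "keys ((-1) ^ sgn_exp i :: 'k mpoly) \<subseteq> mons n" using sign_carrier by simp
  have p: "keys (if \<rho> = insert (maxv u) \<sigma> then mono_poly (u - xvar (maxv u)) else 0 :: 'k mpoly) \<subseteq> mons n"
    using diff_in_mons[OF G_mons[OF u(1)]] by simp
  have "aug n I (gelt n t I u \<sigma> 0 \<rho>) = cs ((-1) ^ sgn_exp i * (if \<rho> = insert (maxv u) \<sigma> then mono_poly (u - xvar (maxv u)) else 0))"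
    unfolding gelt_def Let_def u(2) by (simp add: aug_def cs_def tensor_e_def)
  also have "\<dots> = (-1) ^ sgn_exp i \<odot>\<^bsub>Q\<^esub> cs (if \<rho> = insert (maxv u) \<sigma> then mono_poly (u - xvar (maxv u)) else 0)"
    by (rule cs_mult[OF s p])
  also have "cs (if \<rho> = insert (maxv u) \<sigma> then mono_poly (u - xvar (maxv u)) else 0) = zcyc n I u \<sigma> \<rho>"
    using cs_0 by (auto simp: zcyc_def tensor_e_def cs_def[symmetric] Q_def[symmetric])
  finally show "aug n I (gelt n t I u \<sigma> 0 \<rho>) = ((-1) ^ sgn_exp i \<odot>\<^bsub>koszul n Q i\<^esub> zcyc n I u \<sigma>) \<rho>" by simp
qed

lemma D_gelt:
  assumes "(u, \<sigma>) \<in> Bas i" "j + 2 \<le> i"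
  shows "(\<lambda>\<rho>. D (j + 1) (gelt n t I u \<sigma> (j + 1) \<rho>)) = koszul_d n (Fres n I j) (gelt n t I u \<sigma> j)"
proof
  fix \<rho>
  have u: "u \<in> G" "\<sigma> \<subseteq> adm a u" "j + 1 \<le> card \<sigma>" "j \<le> card \<sigma>" using assms by (auto simp: Bas_def split: if_splits)
  have "D (j + 1) (gelt n t I u \<sigma> (j + 1) \<rho>) = Phi j (lin dbas (gh u \<sigma> (j + 1) \<rho>))"
    unfolding gelt_Phi[OF u(1,2,3)] using res_maps_Phi[OF D gh_Ech[OF u(1,2)], of "j + 1"] by simp
  then show "D (j + 1) (gelt n t I u \<sigma> (j + 1) \<rho>) = koszul_d n (Fres n I j) (gelt n t I u \<sigma> j) \<rho>"
    unfolding koszul_d_gelt[OF u(1,2,4)] .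
qed

lemma D_fbas:
  assumes "(u, \<sigma>) \<in> Bas i" "i \<ge> 2"
  shows "D i (fbas n t I u \<sigma>) =
    (\<Oplus>\<^bsub>Fres n I (i - 1)\<^esub>k\<in>\<sigma>. (-1) ^ alpha \<sigma> k \<odot>\<^bsub>Fres n I (i - 1)\<^esub>
            ((- mono_poly (xvar k)) \<odot>\<^bsub>Fres n I (i - 1)\<^esub> fbas n t I u (\<sigma> - {k})
             \<oplus>\<^bsub>Fres n I (i - 1)\<^esub>
             mono_poly (vk n I u k) \<odot>\<^bsub>Fres n I (i - 1)\<^esub> fbas n t I (uk n I u k) (\<sigma> - {k})))"
proof -
  have i1: "i \<ge> 1" using assms(2) by simp
  have u: "u \<in> G" "\<sigma> \<subseteq> adm a u" "card \<sigma> = i - 1" "u \<noteq> 0" using assms G_nz by (auto simp: Bas_def)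
  have fin: "finite \<sigma>" by (rule finite_subset_adm[OF u(2)])
  have ne: "\<sigma> \<noteq> {}" using u(3) assms(2) by auto
  let ?F = "Fres n I (i - 1)"
  have tk: "(-1) ^ alpha \<sigma> k \<odot>\<^bsub>?F\<^esub> ((- mono_poly (xvar k)) \<odot>\<^bsub>?F\<^esub> fbas n t I u (\<sigma> - {k}) \<oplus>\<^bsub>?F\<^esub>
      mono_poly (vk n I u k) \<odot>\<^bsub>?F\<^esub> fbas n t I (uk n I u k) (\<sigma> - {k})) = Phi (i - 1) (dterm u \<sigma> k) \<and>
      dterm u \<sigma> k \<in> Ech (i - 1)"
    if k: "k \<in> \<sigma>" for k
  proof -
    have ka: "k \<in> adm a u" using k u by auto
    have cd: "i - 1 = card (\<sigma> - {k}) + 1" using card_Suc_Diff1[OF fin k] u(3) by simp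
    have x: "- mono_poly (xvar k) \<in> carrier (mpoly_ring n :: ('k mpoly, 'k mpoly) module)"
      using adm_le_n[OF u(1) ka] by simp
    have v: "mono_poly (vv u k) \<in> carrier (mpoly_ring n :: ('k mpoly, 'k mpoly) module)"
      using vv_mons[OF u(1) ka] by simp
    have f1: "fbas n t I u (\<sigma> - {k}) = Phi (i - 1) (fh u (\<sigma> - {k}))" "fh u (\<sigma> - {k}) \<in> Ech (i - 1)"
      by (rule fbas_Phi[OF u(1) cd], rule fh_Ech[OF u(1) cd[symmetric]])
    have f2: "fbas n t I (uu u k) (\<sigma> - {k}) = Phi (i - 1) (fh (uu u k) (\<sigma> - {k}))" "fh (uu u k) (\<sigma> - {k}) \<in> Ech (i - 1)"
      by (rule fbas_Phi[OF uu_G[OF u(1) ka] cd], rule fh_Ech[OF uu_G[OF u(1) ka] cd[symmetric]])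
    note E1 = P.s_closed[OF x f1(2)] and E2 = P.s_closed[OF v f2(2)]
    show ?thesis unfolding uk_uu vk_vv f1(1) f2(1) dterm_def
      P.q_smult[OF x f1(2), symmetric] P.q_smult[OF v f2(2), symmetric] P.q_add[OF E1 E2, symmetric]
      P.q_smult[OF sign_carrier P.A_add[OF E1 E2], symmetric]
      using P.s_closed[OF sign_carrier P.A_add[OF E1 E2]] by simp
  qed
  have "D i (fbas n t I u \<sigma>) = Phi (i - 1) (dbas (u, \<sigma>))"
    using res_maps_Phi[OF D single_Ech[OF assms(1), of 1] i1] fbas_single[OF assms(1) i1] by simp
  also have "\<dots> = Phi (i - 1) (\<Sum>k\<in>\<sigma>. dterm u \<sigma> k)" using ne u(4) by (simp add: dbas_def)
  also have "\<dots> = (\<Oplus>\<^bsub>?F\<^esub>k\<in>\<sigma>. Phi (i - 1) (dterm u \<sigma> k))"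
    by (rule P.q_sum[OF fin]) (use tk in blast)
  also have "\<dots> = (\<Oplus>\<^bsub>?F\<^esub>k\<in>\<sigma>. (-1) ^ alpha \<sigma> k \<odot>\<^bsub>?F\<^esub> ((- mono_poly (xvar k)) \<odot>\<^bsub>?F\<^esub> fbas n t I u (\<sigma> - {k}) \<oplus>\<^bsub>?F\<^esub>
      mono_poly (vk n I u k) \<odot>\<^bsub>?F\<^esub> fbas n t I (uk n I u k) (\<sigma> - {k})))"
  proof (rule Fm.finsum_cong'[OF refl Pi_I])
    show "(-1) ^ alpha \<sigma> k \<odot>\<^bsub>?F\<^esub> ((- mono_poly (xvar k)) \<odot>\<^bsub>?F\<^esub> fbas n t I u (\<sigma> - {k}) \<oplus>\<^bsub>?F\<^esub>
      mono_poly (vk n I u k) \<odot>\<^bsub>?F\<^esub> fbas n t I (uk n I u k) (\<sigma> - {k})) \<in> carrier ?F" if "k \<in> \<sigma>" for k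
      using tk[OF that] P.q_closed[of "dterm u \<sigma> k" "i - 1"] by metis
  qed (use tk in metis)
  finally show ?thesis .
qed

lemma D_1_fbas: "u \<in> G \<Longrightarrow> D 1 (fbas n t I u {}) = Inl (mono_poly u)"
proof -
  assume u: "u \<in> G"
  have b: "(u, {}) \<in> Bas 1" using u by (simp add: Bas_def)
  have "D 1 (fbas n t I u {}) = Phi 0 (dbas (u, {}))"
    using res_maps_Phi[OF D single_Ech[OF b, of 1]] fbas_single[OF b] by simp
  then show ?thesis using G_nz[OF u] by (simp add: dbas_def Phi_def)
qed

end

end

text \<open>The d_i are prescribed by their values on basis elements, whence the form of the
  statement: such linear maps exist, and every choice of them has the properties.\<close>

theorem theorem4p2:
  fixes I :: "'k::field mpoly set" and n d a b :: nat and t :: "nat list"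
  assumes "d \<ge> 2"
    and "t = replicate a 1 @ replicate b 0" and "length t = d - 1"
    and "spread_strongly_stable n t I"
    and "I \<noteq> carrier (mpoly_ring n)"
  shows "(\<exists>D. res_maps n t I D) \<and>
    (\<forall>D. res_maps n t I D \<longrightarrow>
      (\<forall>i\<ge>1. \<forall>(u, \<sigma>)\<in>basis_index n t I i.
        (\<lambda>\<rho>. aug n I (gelt n t I u \<sigma> 0 \<rho>)) =
          (-1) ^ sgn_exp i \<odot>\<^bsub>koszul n (quot n I) i\<^esub> zcyc n I u \<sigma> \<and>
        (\<forall>j. j + 2 \<le> i \<longrightarrow>
          (\<lambda>\<rho>. D (j + 1) (gelt n t I u \<sigma> (j + 1) \<rho>)) =
          koszul_d n (Fres n I j) (gelt n t I u \<sigma> j))) \<and>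
      minimal_free_resolution n (Fres n I) D (aug n I) (quot n I) (quot_component n I) \<and>
      (\<forall>i\<ge>2. \<forall>(u, \<sigma>)\<in>basis_index n t I i.
        D i (fbas n t I u \<sigma>) =
          (\<Oplus>\<^bsub>Fres n I (i - 1)\<^esub>k\<in>\<sigma>. (-1) ^ alpha \<sigma> k \<odot>\<^bsub>Fres n I (i - 1)\<^esub>
            ((- mono_poly (xvar k)) \<odot>\<^bsub>Fres n I (i - 1)\<^esub> fbas n t I u (\<sigma> - {k})
             \<oplus>\<^bsub>Fres n I (i - 1)\<^esub>
             mono_poly (vk n I u k) \<odot>\<^bsub>Fres n I (i - 1)\<^esub> fbas n t I (uk n I u k) (\<sigma> - {k})))) \<and>
      (\<forall>u\<in>min_gens n I. D 1 (fbas n t I u {}) = Inl (mono_poly u)))"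
proof -
  let ?M = "ideal_mons n I"
  have mi: "monomial_ideal n I" using assms(4) by (simp add: spread_strongly_stable_def)
  interpret S: spread_ideal n a "a + b + 1" ?M
    by (rule spread_ideal_ideal_mons[OF assms(2,4,5)])
  have mg: "min_gens n I = S.G" unfolding min_gens_eq[OF mi] S.G_def ..
  interpret R: spread_resolution n a "a + b + 1" ?M I t
  proof
    show "I = {p. keys p \<subseteq> ?M}" by (rule monomial_ideal_char(1)[OF mi])
    show "min_gens n I = S.G" by (rule mg)
    show "admissible t u = adm a u" if "u \<in> S.G" for u
      using admissible_eq_adm[OF assms(2)] assms(4) that by (simp add: spread_strongly_stable_def mg)
  qed
  show ?thesis
  proof (intro conjI allI impI)
    show "\<exists>D. res_maps n t I D" by (rule R.res_maps_exists)
    fix D assume D: "res_maps n t I D"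
    show "\<forall>(u, \<sigma>)\<in>basis_index n t I i. (\<lambda>\<rho>. aug n I (gelt n t I u \<sigma> 0 \<rho>)) =
          (-1) ^ sgn_exp i \<odot>\<^bsub>koszul n (quot n I) i\<^esub> zcyc n I u \<sigma> \<and>
        (\<forall>j. j + 2 \<le> i \<longrightarrow> (\<lambda>\<rho>. D (j + 1) (gelt n t I u \<sigma> (j + 1) \<rho>)) = koszul_d n (Fres n I j) (gelt n t I u \<sigma> j))"
      if "1 \<le> i" for i
      unfolding R.basis_index_Bas[OF that]
      using R.aug_gelt[OF D _ that] R.D_gelt[OF D] unfolding R.Q_def by blast
    show "minimal_free_resolution n (Fres n I) D (aug n I) (quot n I) (quot_component n I)"
      using R.minimal_resolution[OF D] by (simp add: R.Q_def)
    show "\<forall>(u, \<sigma>)\<in>basis_index n t I i.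
        D i (fbas n t I u \<sigma>) =
          (\<Oplus>\<^bsub>Fres n I (i - 1)\<^esub>k\<in>\<sigma>. (-1) ^ alpha \<sigma> k \<odot>\<^bsub>Fres n I (i - 1)\<^esub>
            ((- mono_poly (xvar k)) \<odot>\<^bsub>Fres n I (i - 1)\<^esub> fbas n t I u (\<sigma> - {k})
             \<oplus>\<^bsub>Fres n I (i - 1)\<^esub>
             mono_poly (vk n I u k) \<odot>\<^bsub>Fres n I (i - 1)\<^esub> fbas n t I (uk n I u k) (\<sigma> - {k})))"
      if "2 \<le> i" for i
    proof -
      have "1 \<le> i" using that by simp
      then show ?thesis unfolding R.basis_index_Bas[OF \<open>1 \<le> i\<close>] using R.D_fbas[OF D _ that] by blast
    qed
    show "\<forall>u\<in>min_gens n I. D 1 (fbas n t I u {}) = Inl (mono_poly u)"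
      unfolding mg using R.D_1_fbas[OF D] by blast
  qed
qed

end
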